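(* Let $\boldsymbol\eta$ be an optimal incompressible flow in $\mathbb T^d$ between $\eta$ and $\gamma$, where $\eta,\gamma\in\Gamma(\mathbb T^d)$, and let $p$ be the associated pressure field. Then $$\langle p,\rho^{\boldsymbol\nu}-1\rangle\le\mathscr A_1(\boldsymbol\nu)-\mathscr A_1(\boldsymbol\eta)$$ for any generalized flow with bounded compression $\boldsymbol\nu$ between $\eta$ and $\gamma$ such that $$\rho^{\boldsymbol\nu}(t,\cdot)=1\quad\text{for $t$ sufficiently close to $0$, $1$.}\qquad(\ast)$$ If $p\in L^1([0,1]\times\mathbb T^d)$, the condition $(\ast)$ is not required for the validity of the inequality.
   Context: $\mathbb T^d=\mathbb R^d/\mathbb Z^d$ is the flat torus and $\mu_{\mathbb T}$ its canonical (probability) measure. $\Gamma(\mathbb T^d)$ is the set of Borel probability measures on $\mathbb T^d\times\mathbb T^d$ with both marginals $\mu_{\mathbb T}$; each $\eta\in\Gamma(\mathbb T^d)$ is disintegrated as $\eta=\eta_a\otimes\mu_{\mathbb T}$, meaning $\int f\,d\eta=\int\int f(a,x)\,d\eta_a(x)\,d\mu_{\mathbb T}(a)$. $\Omega(\mathbb T^d)=C([0,1];\mathbb T^d)$, $e_t(\omega)=\omega(t)$, $\tilde\Omega(\mathbb T^d)=\Omega(\mathbb T^d)\times\mathbb T^d$ with elements $(\omega,a)$; $e_t$ is also regarded as a map on $\tilde\Omega(\mathbb T^d)$. A generalized flow between $\eta$ and $\gamma$ is a Borel probability measure $\boldsymbol\nu=\boldsymbol\nu_a\otimes\mu_{\mathbb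 T}$ on $\tilde\Omega(\mathbb T^d)$ with marginal $\mu_{\mathbb T}$ on the second factor such that $(e_0)_\#\boldsymbol\nu_a=\eta_a$, $(e_1)_\#\boldsymbol\nu_a=\gamma_a$ for $\mu_{\mathbb T}$-a.e. $a$. Its action is $\mathscr A_1(\boldsymbol\nu)=\int\mathscr A_1(\omega)\,d\boldsymbol\nu(\omega,a)$, with $\mathscr A_1(\omega)=\int_0^1\frac12|\dot\omega|^2dt$ if $\omega$ is absolutely continuous and $+\infty$ otherwise. When $(e_t)_\#\boldsymbol\nu\ll\mu_{\mathbb T}$, $\rho^{\boldsymbol\nu}(t,\cdot)$ is the density: $\rho^{\boldsymbol\nu}(t,\cdot)\mu_{\mathbb T}=(e_t)_\#\boldsymbol\nu$. The flow is incompressible if $(e_t)_\#\boldsymbol\nu=\mu_{\mathbb T}$ for all $t$, and has bounded compression if $\rho^{\boldsymbol\nu}\in L^\infty((0,1)\times\mathbb T^d)$. An incompressible flow between $\eta$ and $\gamma$ is optimal if it minimizes $\mathscr A_1$ among all incompressible flows between $\eta$ and $\gamma$. Pressure field: given an optimal $\boldsymbol\eta$, $p$ is the distribution on $(0,1)\times\mathbb T^d$, unique up to additive distributions depending on $t$ only (and depending only on $\eta,\gamma$), such that $$\int_{\tilde\Omega(\mathbb T^d)}\int_0^1\dot\omega(t)\cdot\frac{d}{dt}\boldsymbol w(t,\omega(t))\,dt\,d\boldsymbol\eta(\omega,a)+\langle p,\mathrm{div}\,\boldsymbol w\rangle=0$$ for all smooth vector fields $\boldsymbol w(t,x)$ vanishing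 for $t$ close to $0$ and $1$. It is known (Ambrosio–Figalli) that, after normalizing $\int p(t,\cdot)\,d\mu_{\mathbb T}=0$ for a.e. $t$, one has $p\in L^2_{\rm loc}((0,1);L^{d/(d-1)}(\mathbb T^d))$, and $p$ is taken with this normalization. $\langle p,\rho^{\boldsymbol\nu}-1\rangle=\int_0^1\int_{\mathbb T^d}p\,(\rho^{\boldsymbol\nu}-1)\,d\mu_{\mathbb T}\,dt$. *)

theory Defs
  imports "HOL-Probability.Probability"
begin

section \<open>The flat torus\<close>

text \<open>
  The dimension \<open>d\<close> is \<open>CARD('n)\<close>. Below, \<open>abs_torus\<close> is the projection from the Euclidean
  space onto the torus and \<open>rep_torus\<close> an arbitrary choice of representatives.
\<close>

definition lattice_rel :: "real ^ 'n \<Rightarrow> real ^ 'n \<Rightarrow> bool" where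
  "lattice_rel x y \<longleftrightarrow> (\<forall>i. x $ i - y $ i \<in> \<int>)"

lemma equivp_lattice_rel: "equivp lattice_rel"
proof (rule equivpI)
  show "reflp lattice_rel" by (simp add: reflp_def lattice_rel_def)
  show "symp lattice_rel"
    unfolding symp_def lattice_rel_def by (metis Ints_minus minus_diff_eq)
  show "transp lattice_rel"
    unfolding transp_def lattice_rel_def
  proof (intro allI impI)
    fix x y z :: "real ^ 'n" and i
    assume "\<forall>i. x $ i - y $ i \<in> \<int>" "\<forall>i. y $ i - z $ i \<in> \<int>"
    then have "(x $ i - y $ i) + (y $ i - z $ i) \<in> \<int>" by (blast intro: Ints_add)
    then show "x $ i - z $ i \<in> \<int>" by simp
  qed
qed

quotient_type 'n torus = "real ^ ('n::finite)" / lattice_rel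
  by (rule equivp_lattice_rel)

lemma abs_torus_eq_iff: "abs_torus x = abs_torus y \<longleftrightarrow> lattice_rel x y"
  by (rule torus.abs_eq_iff)

lemma abs_rep_torus [simp]: "abs_torus (rep_torus X) = X"
  by (rule Quotient_abs_rep[OF Quotient_torus])

abbreviation torus_fibre :: "'n::finite torus \<Rightarrow> (real ^ 'n) set" where
  "torus_fibre X \<equiv> {x. abs_torus x = X}"

lemma torus_fibre_translate:
  assumes "abs_torus x = abs_torus x'" "abs_torus y = Y"
  shows "abs_torus (y - x + x') = Y"
proof -
  have "(y - x + x') $ i - y $ i \<in> \<int>" for i
    using equivp_symp[OF equivp_lattice_rel] assms(1)
    by (auto simp: abs_torus_eq_iff lattice_rel_def algebra_simps)
  then have "lattice_rel (y - x + x') y" by (simp add: lattice_rel_def)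
  then show ?thesis using assms(2) by (metis abs_torus_eq_iff)
qed

lemma closed_torus_fibre: "closed (torus_fibre (X :: 'n::finite torus))"
proof -
  have "torus_fibre X = (\<Inter>i. (\<lambda>x. x $ i - rep_torus X $ i) -` \<int>)"
    using abs_torus_eq_iff[of _ "rep_torus X"] by (auto simp: lattice_rel_def)
  also have "closed \<dots>"
    by (intro closed_INT ballI closed_vimage closed_Ints continuous_intros)
  finally show ?thesis .
qed

lemma setdist_torus_fibre:
  assumes "abs_torus x = (X :: 'n::finite torus)"
  shows "setdist (torus_fibre X) (torus_fibre Y) = setdist {x} (torus_fibre Y)"
proof (rule antisym)
  show "setdist (torus_fibre X) (torus_fibre Y) \<le> setdist {x} (torus_fibre Y)"
    using assms by (intro setdist_subset_left) auto
  have ne: "torus_fibre X \<noteq> {}" "torus_fibre Y \<noteq> {}"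
    using abs_rep_torus by blast+
  show "setdist {x} (torus_fibre Y) \<le> setdist (torus_fibre X) (torus_fibre Y)"
  proof (rule le_setdistI[OF ne])
    fix x' y assume "x' \<in> torus_fibre X" "y \<in> torus_fibre Y"
    then have "abs_torus (y - x' + x) = Y"
      using assms by (intro torus_fibre_translate) auto
    then have "setdist {x} (torus_fibre Y) \<le> dist x (y - x' + x)"
      by (intro setdist_le_dist) auto
    also have "\<dots> = dist x' y" by (simp add: dist_norm norm_minus_commute)
    finally show "setdist {x} (torus_fibre Y) \<le> dist x' y" .
  qed
qed

instantiation torus :: (finite) metric_space
begin

definition dist_torus :: "'a torus \<Rightarrow> 'a torus \<Rightarrow> real" where
  "dist_torus X Y = setdist (torus_fibre X) (torus_fibre Y)"

definition uniformity_torus :: "('a torus \<times> 'a torus) filter" where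
  "uniformity_torus = (INF e\<in>{0<..}. principal {(x, y). dist x y < e})"

definition open_torus :: "'a torus set \<Rightarrow> bool" where
  "open_torus U \<longleftrightarrow> (\<forall>x\<in>U. eventually (\<lambda>(x', y). x' = x \<longrightarrow> y \<in> U) uniformity)"

instance
proof
  fix X Y Z :: "'a torus"
  show "dist X Y = 0 \<longleftrightarrow> X = Y"
  proof
    assume "dist X Y = 0"
    then have "infdist (rep_torus X) (torus_fibre Y) = 0"
      by (simp add: dist_torus_def setdist_torus_fibre[OF abs_rep_torus] infdist_eq_setdist)
    moreover have "torus_fibre Y \<noteq> {}" using abs_rep_torus by blast
    ultimately have "rep_torus X \<in> torus_fibre Y"
      using in_closed_iff_infdist_zero[OF closed_torus_fibre] by blast
    then show "X = Y" by simp
  qed (simp add: dist_torus_def setdist_refl)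
  show "dist X Y \<le> dist X Z + dist Y Z"
    using setdist_triangle[of "torus_fibre X" "torus_fibre Y" "rep_torus Z"]
    unfolding dist_torus_def setdist_sym[of "torus_fibre X" "torus_fibre Z"]
      setdist_sym[of "torus_fibre Y" "torus_fibre Z"] setdist_torus_fibre[OF abs_rep_torus[of Z]]
      setdist_sym[of "torus_fibre X" "{rep_torus Z}"] .
qed (simp_all add: uniformity_torus_def open_torus_def)

end

lemma dist_abs_torus_le: "dist (abs_torus x) (abs_torus y) \<le> dist x y"
  by (auto simp: dist_torus_def intro: setdist_le_dist)

lemma continuous_on_abs_torus: "continuous_on S abs_torus"
  unfolding continuous_on_iff by (meson dist_abs_torus_le le_less_trans)

definition torus_measure :: "'n::finite torus measure" where
  "torus_measure =
     distr (restrict_space lborel {x. \<forall>i. 0 \<le> x $ i \<and> x $ i < 1}) borel abs_torus"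


section \<open>Measure-preserving plans and disintegration\<close>

definition borel_of :: "'a topology \<Rightarrow> 'a measure" where
  "borel_of X = sigma (topspace X) {U. openin X U}"

definition torus_plans :: "('n::finite torus \<times> 'n torus) measure set" where
  "torus_plans = {\<eta>. prob_space \<eta> \<and> sets \<eta> = sets borel \<and>
     distr \<eta> borel fst = torus_measure \<and> distr \<eta> borel snd = torus_measure}"

text \<open>The disintegrated coordinate \<open>a\<close> is the first one in a plan, but the second one in a flow.\<close>

definition plan_disintegration ::
  "('n::finite torus \<times> 'n torus) measure \<Rightarrow> ('n torus \<Rightarrow> 'n torus measure) \<Rightarrow> bool" where
  "plan_disintegration \<eta> \<kappa> \<longleftrightarrow> \<kappa> \<in> torus_measure \<rightarrow>\<^sub>M prob_algebra borel \<and>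
     (\<forall>f :: _ \<Rightarrow> ennreal. f \<in> borel_measurable \<eta> \<longrightarrow>
        (\<integral>\<^sup>+z. f z \<partial>\<eta>) = (\<integral>\<^sup>+a. (\<integral>\<^sup>+x. f (a, x) \<partial>\<kappa> a) \<partial>torus_measure))"


section \<open>Paths\<close>

text \<open>
  A path is a function on the reals, continuous on \<open>{0..1}\<close> and equal to \<open>undefined\<close> outside it.
  The boundedness required by \<open>cfunspace\<close> is automatic; the distance is the uniform one.
\<close>

definition path_topology :: "(real \<Rightarrow> 'n::finite torus) topology" where
  "path_topology = mtopology_of (cfunspace (top_of_set {0..1}) euclidean_metric)"

definition absolutely_continuous_curve :: "(real \<Rightarrow> 'a::metric_space) \<Rightarrow> bool" where
  "absolutely_continuous_curve \<omega> \<longleftrightarrow> (\<forall>\<epsilon>>0. \<exists>\<delta>>0. \<forall>I :: (real \<times> real) set.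
     finite I \<and> (\<forall>(a, b)\<in>I. 0 \<le> a \<and> a \<le> b \<and> b \<le> 1) \<and>
     disjoint_family_on (\<lambda>(a, b). {a<..<b}) I \<and> (\<Sum>(a, b)\<in>I. b - a) < \<delta> \<longrightarrow>
     (\<Sum>(a, b)\<in>I. dist (\<omega> a) (\<omega> b)) < \<epsilon>)"

text \<open>
  The velocity at \<open>t\<close> is the derivative at \<open>t\<close> of any lift that is differentiable there. The lift
  need not be continuous elsewhere; since two lifts differ by lattice vectors, those that are
  differentiable at \<open>t\<close> have the same derivative.
\<close>

definition has_velocity :: "(real \<Rightarrow> 'n::finite torus) \<Rightarrow> real ^ 'n \<Rightarrow> real \<Rightarrow> bool" where
  "has_velocity \<omega> v t \<longleftrightarrow> (\<exists>L. (\<forall>s\<in>{0..1}. abs_torus (L s) = \<omega> s) \<and>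
     (L has_vector_derivative v) (at t within {0..1}))"

definition velocity :: "(real \<Rightarrow> 'n::finite torus) \<Rightarrow> real \<Rightarrow> real ^ 'n" where
  "velocity \<omega> t = (if \<exists>v. has_velocity \<omega> v t then THE v. has_velocity \<omega> v t else 0)"

definition curve_action :: "(real \<Rightarrow> 'n::finite torus) \<Rightarrow> ennreal" where
  "curve_action \<omega> =
     (if absolutely_continuous_curve \<omega>
      then \<integral>\<^sup>+t\<in>{0..1}. ennreal (1 / 2 * (norm (velocity \<omega> t))\<^sup>2) \<partial>lborel
      else \<infinity>)"


section \<open>Generalized flows\<close>

type_synonym 'n flow = "((real \<Rightarrow> 'n torus) \<times> 'n torus) measure"

definition flow_disintegration ::
  "'n::finite flow \<Rightarrow> ('n torus \<Rightarrow> (real \<Rightarrow> 'n torus) measure) \<Rightarrow> bool" where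
  "flow_disintegration \<nu> \<kappa> \<longleftrightarrow> \<kappa> \<in> torus_measure \<rightarrow>\<^sub>M prob_algebra (borel_of path_topology) \<and>
     (\<forall>f :: _ \<Rightarrow> ennreal. f \<in> borel_measurable \<nu> \<longrightarrow>
        (\<integral>\<^sup>+z. f z \<partial>\<nu>) = (\<integral>\<^sup>+a. (\<integral>\<^sup>+\<omega>. f (\<omega>, a) \<partial>\<kappa> a) \<partial>torus_measure))"

definition generalized_flow ::
  "('n::finite torus \<times> 'n torus) measure \<Rightarrow> ('n torus \<times> 'n torus) measure \<Rightarrow> 'n flow \<Rightarrow> bool" where
  "generalized_flow \<eta> \<gamma> \<nu> \<longleftrightarrow>
     prob_space \<nu> \<and> sets \<nu> = sets (borel_of (prod_topology path_topology euclidean)) \<and>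
     distr \<nu> borel snd = torus_measure \<and>
     (\<exists>\<nu>\<^sub>a \<eta>\<^sub>a \<gamma>\<^sub>a. flow_disintegration \<nu> \<nu>\<^sub>a \<and> plan_disintegration \<eta> \<eta>\<^sub>a \<and> plan_disintegration \<gamma> \<gamma>\<^sub>a \<and>
        (AE a in torus_measure. distr (\<nu>\<^sub>a a) borel (\<lambda>\<omega>. \<omega> 0) = \<eta>\<^sub>a a \<and>
                                distr (\<nu>\<^sub>a a) borel (\<lambda>\<omega>. \<omega> 1) = \<gamma>\<^sub>a a))"

definition flow_action :: "'n::finite flow \<Rightarrow> ennreal" where
  "flow_action \<nu> = (\<integral>\<^sup>+(\<omega>, a). curve_action \<omega> \<partial>\<nu>)"

definition flow_at :: "'n::finite flow \<Rightarrow> real \<Rightarrow> 'n torus measure" where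
  "flow_at \<nu> t = distr \<nu> borel (\<lambda>(\<omega>, a). \<omega> t)"

definition incompressible :: "'n::finite flow \<Rightarrow> bool" where
  "incompressible \<nu> \<longleftrightarrow> (\<forall>t\<in>{0..1}. flow_at \<nu> t = torus_measure)"

definition optimal_incompressible_flow ::
  "('n::finite torus \<times> 'n torus) measure \<Rightarrow> ('n torus \<times> 'n torus) measure \<Rightarrow> 'n flow \<Rightarrow> bool" where
  "optimal_incompressible_flow \<eta> \<gamma> \<nu> \<longleftrightarrow> generalized_flow \<eta> \<gamma> \<nu> \<and> incompressible \<nu> \<and>
     (\<forall>\<nu>'. generalized_flow \<eta> \<gamma> \<nu>' \<and> incompressible \<nu>' \<longrightarrow> flow_action \<nu> \<le> flow_action \<nu>')"


section \<open>Lebesgue norms and densities\<close>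

definition Lp_norm :: "ennreal \<Rightarrow> 'a measure \<Rightarrow> ('a \<Rightarrow> real) \<Rightarrow> ennreal" where
  "Lp_norm q M f =
     (if q = \<infinity> then esssup M (\<lambda>x. ennreal \<bar>f x\<bar>)
      else let J = \<integral>\<^sup>+x. ennreal (\<bar>f x\<bar> powr enn2real q) \<partial>M
           in if J = \<infinity> then \<infinity> else ennreal (enn2real J powr (1 / enn2real q)))"

definition spacetime :: "(real \<times> 'n::finite torus) measure" where
  "spacetime = restrict_space lborel {0<..<1} \<Otimes>\<^sub>M torus_measure"

text \<open>
  \<open>\<rho>\<close> is a Borel representative of the density of \<open>\<nu>\<close>. Nonnegativity is needed because
  \<open>ennreal\<close> truncates negative values.
\<close>

definition flow_density :: "'n::finite flow \<Rightarrow> (real \<times> 'n torus \<Rightarrow> real) \<Rightarrow> bool" where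
  "flow_density \<nu> \<rho> \<longleftrightarrow> \<rho> \<in> borel_measurable spacetime \<and>
     (\<forall>t\<in>{0<..<1}. (AE x in torus_measure. 0 \<le> \<rho> (t, x)) \<and>
        flow_at \<nu> t = density torus_measure (\<lambda>x. ennreal (\<rho> (t, x))))"

definition bounded_compression_density :: "'n::finite flow \<Rightarrow> (real \<times> 'n torus \<Rightarrow> real) \<Rightarrow> bool" where
  "bounded_compression_density \<nu> \<rho> \<longleftrightarrow> flow_density \<nu> \<rho> \<and> Lp_norm \<infinity> spacetime \<rho> < \<infinity>"


section \<open>The pressure field\<close>

primrec Ck_on :: "'a::real_normed_vector set \<Rightarrow> nat \<Rightarrow> ('a \<Rightarrow> 'b::real_normed_vector) \<Rightarrow> bool" where
  "Ck_on S 0 f \<longleftrightarrow> continuous_on S f"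
| "Ck_on S (Suc k) f \<longleftrightarrow> (\<forall>x\<in>S. f differentiable (at x)) \<and>
     (\<forall>v. Ck_on S k (\<lambda>x. frechet_derivative f (at x) v))"

definition test_field :: "(real \<Rightarrow> 'n::finite torus \<Rightarrow> real ^ 'n) \<Rightarrow> bool" where
  "test_field w \<longleftrightarrow>
     (\<forall>k. Ck_on ({0<..<1} \<times> UNIV) k (\<lambda>(t, x). w t (abs_torus x))) \<and>
     (\<exists>\<delta>>0. \<forall>t\<in>{0<..<1}. t < \<delta> \<or> 1 - \<delta> < t \<longrightarrow> (\<forall>x. w t x = 0))"

text \<open>The lift of \<open>u\<close> is periodic, so the choice of representative is irrelevant.\<close>

definition divergence :: "('n::finite torus \<Rightarrow> real ^ 'n) \<Rightarrow> 'n torus \<Rightarrow> real" where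
  "divergence u x =
     (\<Sum>i\<in>UNIV. frechet_derivative (\<lambda>y. u (abs_torus y)) (at (rep_torus x)) (axis i 1) $ i)"

definition L2_loc :: "ennreal \<Rightarrow> (real \<times> 'n::finite torus \<Rightarrow> real) \<Rightarrow> bool" where
  "L2_loc q f \<longleftrightarrow> f \<in> borel_measurable spacetime \<and>
     (\<forall>a b. 0 < a \<and> a < b \<and> b < 1 \<longrightarrow>
        (\<integral>\<^sup>+t\<in>{a..b}. (Lp_norm q torus_measure (\<lambda>x. f (t, x)))\<^sup>2 \<partial>lborel) < \<infinity>)"

text \<open>
  The pressure is given as a function, normalized to have zero spatial mean, which induces the
  pressure distribution. The exponent \<open>d / (d - 1)\<close> is taken in \<open>ennreal\<close>, hence it is \<open>\<infinity>\<close> for \<open>d = 1\<close>.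
\<close>

definition pressure_field :: "'n::finite flow \<Rightarrow> (real \<times> 'n torus \<Rightarrow> real) \<Rightarrow> bool" where
  "pressure_field \<nu> p \<longleftrightarrow>
     L2_loc (of_nat CARD('n) / of_nat (CARD('n) - 1)) p \<and>
     (AE t in lborel. t \<in> {0<..<1} \<longrightarrow> (\<integral>x. p (t, x) \<partial>torus_measure) = 0) \<and>
     (\<forall>w. test_field w \<longrightarrow>
        (\<integral>(\<omega>, a). (LINT t:{0<..<1}|lborel.
             velocity \<omega> t \<bullet> vector_derivative (\<lambda>s. w s (\<omega> s)) (at t)) \<partial>\<nu>)
        + (\<integral>(t, x). p (t, x) * divergence (w t) x \<partial>spacetime) = 0)"

definition pressure_pairing ::
  "(real \<times> 'n::finite torus \<Rightarrow> real) \<Rightarrow> (real \<times> 'n torus \<Rightarrow> real) \<Rightarrow> real" where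
  "pressure_pairing p f = (LINT t:{0<..<1}|lborel. (\<integral>x. p (t, x) * f (t, x) \<partial>torus_measure))"

definition unit_density_near_endpoints :: "(real \<times> 'n::finite torus \<Rightarrow> real) \<Rightarrow> bool" where
  "unit_density_near_endpoints \<rho> \<longleftrightarrow> (\<exists>\<delta>>0. \<forall>t\<in>{0<..<1}. t < \<delta> \<or> 1 - \<delta> < t \<longrightarrow>
     (AE x in torus_measure. \<rho> (t, x) = 1))"

end

theory Submission
 imports Defs
begin

text \<open>
 The inequality is the first-order condition for optimality. Suppose first that the density of \<open>\<nu>\<close> is
 \<open>1 + s\<close>, where \<open>s\<close> is a trigonometric polynomial in space whose coefficients are smooth functions of time
 that vanish near the end points. The mixture of \<open>1 - e\<close> parts of the optimal flow \<open>\<eta>\<eta>\<close> and \<open>e\<close> parts of \<open>\<nu>\<close> has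
 density \<open>1 + e s\<close>. An explicit triangular map of the torus transports this density to the uniform one, and
 it is the displacement by \<open>e W + O(e\<^sup>2)\<close> for a smooth field \<open>W\<close> with divergence \<open>s\<close>. Moving all paths by
 this map gives an incompressible competitor for \<open>\<eta>\<eta>\<close>. Comparing actions and dividing by \<open>e\<close> shows that
 the action of \<open>\<eta>\<eta>\<close> is at most that of \<open>\<nu>\<close> plus the first variation of the action of \<open>\<eta>\<eta>\<close> along \<open>W\<close>, which
 is \<open>- \<langle>p, s\<rangle>\<close> by the defining equation of the pressure. This is \<open>smooth_density_inequality\<close>.

 A general \<open>\<nu>\<close> is approximated by flows of this kind. Each path is run through a random affine change of
 time, waits at its end points, and is displaced in space by a small random vector that is switched off near
 the times 0 and 1. Independent smooth delays make the density smooth in time, and displacements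
 distributed according to a nonnegative trigonometric kernel make it a trigonometric polynomial in space;
 during the switching the position is uniform anyway because the marginals of the plans are. The action
 grows by a factor close to 1 and a small additive constant (\<open>curve_action_mollify_le\<close>), the densities obey
 the same bound as that of \<open>\<nu>\<close>, and they converge weakly at almost every time. A bound and weak
 convergence suffice for testing against integrable functions, so the pairing with \<open>p\<close> converges where \<open>p\<close> is
 integrable. If \<open>p\<close> is only locally integrable in time, the approximating densities are exactly 1
 near the end points, where that of \<open>\<nu>\<close> is 1, and the problematic times drop out.

 Finiteness of the minimal action comes from an explicit incompressible flow through an independent
 uniformly distributed midpoint (\<open>ex_incompressible_flow_finite_action\<close>).
\<close>

section \<open>Translations of the flat torus\<close>

definition torus_shift :: "'n::finite torus => real ^ 'n => 'n torus" (infixl "\<oplus>" 65) where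
 "X \<oplus> v = abs_torus (rep_torus X + v)"

lemma lattice_relI: "(!!i. x $ i - y $ i \<in> \<int>) ==> lattice_rel x y"
 by (simp add: lattice_rel_def)

lemma lattice_rel_add_right: "lattice_rel x y ==> lattice_rel (x + v) (y + v)"
 by (simp add: lattice_rel_def)

lemma lattice_rel_rep_abs: "lattice_rel (rep_torus (abs_torus x)) x"
 using abs_torus_eq_iff abs_rep_torus by blast

lemma abs_torus_shift [simp]: "abs_torus x \<oplus> v = abs_torus (x + v)"
 unfolding torus_shift_def abs_torus_eq_iff
 by (intro lattice_rel_add_right lattice_rel_rep_abs)

lemma torus_shift_assoc: "X \<oplus> v \<oplus> w = X \<oplus> (v + w)"
 by (metis abs_rep_torus abs_torus_shift add.assoc)

lemma torus_shift_zero [simp]: "X \<oplus> 0 = X"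
 by (simp add: torus_shift_def)

lemma abs_torus_add_lattice: "(!!i. m $ i \<in> \<int>) ==> abs_torus (x + m) = abs_torus x"
 unfolding abs_torus_eq_iff lattice_rel_def by simp

definition centre :: "real ^ 'n => real ^ 'n" where
 "centre x = (\<chi> i. x $ i - of_int \<lfloor>x $ i + 1/2\<rfloor>)"

lemma centre_bounds: "- 1/2 <= centre x $ i" "centre x $ i < 1/2"
 unfolding centre_def by (simp_all, linarith+)

lemma abs_centre_le: "\<bar>centre x $ i\<bar> <= 1/2"
 using centre_bounds[of x i] by linarith

lemma abs_torus_centre [simp]: "abs_torus (centre x) = abs_torus x"
 unfolding abs_torus_eq_iff lattice_rel_def centre_def by simp

lemma centre_cong: assumes "lattice_rel x y" shows "centre x = centre y"
proof -
 have "centre x $ i = centre y $ i" for i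
 proof -
  obtain m where "x $ i - y $ i = of_int m"
   using assms by (auto simp: lattice_rel_def elim: Ints_cases)
  then have "x $ i = y $ i + of_int m" by simp
  then have "x $ i + 1/2 = (y $ i + 1/2) + of_int m" by simp
  then have "\<lfloor>x $ i + 1/2\<rfloor> = \<lfloor>y $ i + 1/2\<rfloor> + m" by (simp only: floor_add_int)
  then show ?thesis using \<open>x $ i = y $ i + of_int m\<close> by (simp add: centre_def)
 qed
 then show ?thesis by (simp add: vec_eq_iff)
qed

lemma centre_eq: assumes "!!i. - 1/2 <= x $ i" "!!i. x $ i < 1/2" shows "centre x = x"
proof -
 have "\<lfloor>x $ i + 1/2\<rfloor> = 0" for i using assms[of i] by (simp add: floor_eq_iff)
 then show ?thesis by (simp add: centre_def vec_eq_iff)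
qed

lemma norm_centre_le: assumes "lattice_rel x y" shows "norm (centre x) <= norm y"
proof -
 have "\<bar>centre x $ i\<bar> <= \<bar>y $ i\<bar>" for i
 proof -
  have "lattice_rel (centre x) y" using assms by (metis abs_torus_centre abs_torus_eq_iff)
  then obtain m where m: "centre x $ i - y $ i = of_int m"
   by (auto simp: lattice_rel_def elim: Ints_cases)
  show ?thesis
  proof (cases "m = 0")
   case False
   then have "\<bar>real_of_int m\<bar> >= 1" by linarith
   then show ?thesis using m abs_centre_le[of x i] by linarith
  qed (use m in simp)
 qed
 then show ?thesis by (intro norm_le_componentwise_cart) simp
qed

text \<open>The representative with coordinates in \<open>[-1/2, 1/2)\<close>: unlike an arbitrary choice it is Borel measurable.\<close>

definition rep :: "'n::finite torus => real ^ 'n" where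
 "rep X = centre (rep_torus X)"

lemma abs_torus_rep [simp]: "abs_torus (rep X) = X"
 by (simp add: rep_def)

lemma torus_rep_abs [simp]: "rep (abs_torus x) = centre x"
 unfolding rep_def by (rule centre_cong[OF lattice_rel_rep_abs])

lemma torus_shift_rep: "X \<oplus> v = abs_torus (rep X + v)"
 by (metis abs_torus_rep abs_torus_shift)

definition torus_diff :: "'n::finite torus => 'n torus => real ^ 'n" where
 "torus_diff Y X = centre (rep Y - rep X)"

lemma torus_shift_diff [simp]: "X \<oplus> torus_diff Y X = Y"
proof -
 have "lattice_rel (rep X + torus_diff Y X) (rep Y)"
  by (rule lattice_relI) (simp add: torus_diff_def centre_def)
 then show ?thesis by (metis abs_torus_eq_iff abs_torus_rep torus_shift_rep)
qed

lemma torus_diff_abs: "torus_diff (abs_torus y) (abs_torus x) = centre (y - x)"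
proof -
 have "lattice_rel (centre y - centre x) (y - x)"
  unfolding lattice_rel_def centre_def
 proof
  fix i
  have "((\<chi> i. y $ i - of_int \<lfloor>y $ i + 1/2\<rfloor>) - (\<chi> i. x $ i - of_int \<lfloor>x $ i + 1/2\<rfloor>)) $ i - (y - x) $ i
   = of_int (\<lfloor>x $ i + 1/2\<rfloor> - \<lfloor>y $ i + 1/2\<rfloor>)" by simp
  then show "((\<chi> i. y $ i - of_int \<lfloor>y $ i + 1/2\<rfloor>) - (\<chi> i. x $ i - of_int \<lfloor>x $ i + 1/2\<rfloor>)) $ i - (y - x) $ i \<in> \<int>"
   by (metis Ints_of_int)
 qed
 then show ?thesis unfolding torus_diff_def by (simp add: centre_cong)
qed

lemma torus_diff_shift: "torus_diff (X \<oplus> v) (X \<oplus> w) = centre (v - w)"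
 by (simp add: torus_shift_rep torus_diff_abs)

lemma centre_small:
 assumes "norm v < 1/2" shows "centre v = v"
proof (rule centre_eq)
 fix i
 have "\<bar>v $ i\<bar> < 1/2" using component_le_norm_cart[of v i] assms by linarith
 then show "- 1/2 <= v $ i" "v $ i < 1/2" by linarith+
qed

lemma torus_diff_shift_small:
 assumes "norm v < 1/2" shows "torus_diff (X \<oplus> v) X = v"
 using torus_diff_shift[of X v 0] centre_small[OF assms] by simp

lemma dist_torus_eq: "dist X Y = norm (torus_diff X Y)"
proof (rule antisym)
 have "dist (Y \<oplus> torus_diff X Y) (Y \<oplus> 0) <= dist (rep Y + torus_diff X Y) (rep Y + 0)"
  unfolding torus_shift_rep by (rule dist_abs_torus_le)
 then show "dist X Y <= norm (torus_diff X Y)"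
  by (simp add: dist_norm)
 have ne: "torus_fibre X ~= {}" "torus_fibre Y ~= {}"
  using abs_rep_torus by blast+
 show "norm (torus_diff X Y) <= dist X Y"
  unfolding dist_torus_def
 proof (rule le_setdistI[OF ne])
  fix x y assume "x \<in> torus_fibre X" "y \<in> torus_fibre Y"
  then have "torus_diff X Y = centre (x - y)" using torus_diff_abs by blast
  moreover have "lattice_rel (x - y) (x - y)" by (simp add: lattice_rel_def)
  ultimately show "norm (torus_diff X Y) <= dist x y"
   by (simp add: dist_norm norm_centre_le)
 qed
qed

lemma dist_torus_shift_le: "dist (X \<oplus> v) (X \<oplus> w) <= norm (v - w)"
 using dist_abs_torus_le[of "rep X + v" "rep X + w"]
 by (simp add: torus_shift_rep dist_norm)

lemma dist_torus_shift_same [simp]: "dist (X \<oplus> v) (Y \<oplus> v) = dist X Y"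
proof -
 have "torus_diff (X \<oplus> v) (Y \<oplus> v) = centre (rep X - rep Y)"
  unfolding torus_shift_rep torus_diff_abs by simp
 then show ?thesis by (simp add: dist_torus_eq torus_diff_def)
qed

lemma dist_torus_shift_le2: "dist (X \<oplus> v) (Y \<oplus> w) <= dist X Y + norm (v - w)"
 using dist_triangle[of "X \<oplus> v" "Y \<oplus> w" "Y \<oplus> v"] dist_torus_shift_le[of Y v w] by simp

lemma dist_torus_bounded: "dist X (Y :: 'n::finite torus) <= real CARD('n)"
proof -
 have "norm (torus_diff X Y) <= (\<Sum>i\<in>UNIV. \<bar>torus_diff X Y $ i\<bar>)" by (rule norm_le_l1_cart)
 also have "... <= (\<Sum>i\<in>(UNIV::'n set). 1)"
  by (intro sum_mono, unfold torus_diff_def) (rule order_trans[OF abs_centre_le], simp)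
 finally show ?thesis by (simp add: dist_torus_eq)
qed

lemma continuous_on_torus_shift [continuous_intros]:
 fixes f :: "'a::metric_space => 'n::finite torus"
 assumes "continuous_on S f" "continuous_on S g"
 shows "continuous_on S (%x. f x \<oplus> g x)"
 unfolding continuous_on_iff
proof (intro ballI allI impI)
 fix x and e :: real assume "x \<in> S" "e > 0"
 then obtain d1 d2 where d: "d1 > 0" "!!x'. x' \<in> S ==> dist x' x < d1 ==> dist (f x') (f x) < e/2"
  "d2 > 0" "!!x'. x' \<in> S ==> dist x' x < d2 ==> dist (g x') (g x) < e/2"
  using assms unfolding continuous_on_iff by (metis half_gt_zero)
 show "\<exists>d>0. \<forall>x'\<in>S. dist x' x < d --> dist (f x' \<oplus> g x') (f x \<oplus> g x) < e"
 proof (intro exI[of _ "min d1 d2"] conjI ballI impI)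
  fix x' assume "x' \<in> S" "dist x' x < min d1 d2"
  then have "dist (f x') (f x) < e/2" "norm (g x' - g x) < e/2"
   using d(2)[of x'] d(4)[of x'] by (auto simp: dist_norm)
  then show "dist (f x' \<oplus> g x') (f x \<oplus> g x) < e"
   using dist_torus_shift_le2[of "f x'" "g x'" "f x" "g x"] by linarith
 qed (use d in auto)
qed

lemma open_torus_iff: "open E \<longleftrightarrow> open (abs_torus -` E)" for E :: "'n::finite torus set"
proof
 show "open E ==> open (abs_torus -` E)"
  by (rule open_vimage) (auto intro: continuous_on_abs_torus)
 assume op: "open (abs_torus -` E)"
 show "open E"
  unfolding open_dist
 proof
  fix X assume "X \<in> E"
  then have "rep X \<in> abs_torus -` E" by simp
  then obtain e where e: "e > 0" "!!y. dist y (rep X) < e ==> abs_torus y \<in> E"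
   using op unfolding open_dist by (metis vimageE)
  show "\<exists>e>0. \<forall>y. dist y X < e --> y \<in> E"
  proof (intro exI conjI allI impI)
   fix Y assume "dist Y X < e"
   then have "dist (rep X + torus_diff Y X) (rep X) < e"
    by (simp add: dist_torus_eq dist_norm)
   from e(2)[OF this] show "Y \<in> E" by (metis torus_shift_diff torus_shift_rep)
  qed (rule e)
 qed
qed

lemma open_abs_torus_image: assumes "open U" shows "open (abs_torus ` U)"
proof -
 have "abs_torus -` abs_torus ` U = (\<Union>m\<in>{m. \<forall>i. m $ i \<in> \<int>}. (%x. x + m) -` U)" (is "?L = ?R")
 proof
  show "?L \<subseteq> ?R"
  proof
   fix x assume "x \<in> ?L"
   then obtain y where y: "y \<in> U" "abs_torus x = abs_torus y" by auto
   then have "lattice_rel y x" by (metis abs_torus_eq_iff)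
   then have "y - x \<in> {m. \<forall>i. m $ i \<in> \<int>}" "x \<in> (%z. z + (y - x)) -` U"
    using y by (auto simp: lattice_rel_def)
   then show "x \<in> ?R" by blast
  qed
  show "?R \<subseteq> ?L"
   by auto (metis abs_torus_add_lattice imageI)
 qed
 also have "open ..."
  by (intro open_UN ballI open_vimage assms continuous_intros)
 finally show ?thesis by (simp add: open_torus_iff)
qed

instance torus :: (finite) second_countable_topology
proof
 obtain B :: "(real ^ 'a) set set" where B: "countable B" "topological_basis B"
  using ex_countable_basis by blast
 have "topological_basis ((`) abs_torus ` B)"
 proof (rule topological_basisI)
  fix B' assume "B' \<in> (`) abs_torus ` B"
  then show "open B'" using B(2) by (auto intro!: open_abs_torus_image dest: topological_basis_open)
 next
  fix O' :: "'a torus set" and X assume *: "open O'" "X \<in> O'"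
  then have "open (abs_torus -` O')" "rep X \<in> abs_torus -` O'"
   by (simp_all flip: open_torus_iff)
  then obtain b where "b \<in> B" "rep X \<in> b" "b \<subseteq> abs_torus -` O'"
   using topological_basisE[OF B(2)] by metis
  then show "\<exists>B'\<in>(`) abs_torus ` B. X \<in> B' & B' \<subseteq> O'"
   by (intro bexI[of _ "abs_torus ` b"]) (auto intro: image_eqI[of _ _ "rep X"])
 qed
 then show "\<exists>B :: 'a torus set set. countable B & open = generate_topology B"
  using B(1) by (intro exI[of _ "(`) abs_torus ` B"] conjI topological_basis_imp_subbasis) auto
qed

lemma measurable_abs_torus [measurable]: "abs_torus : borel_measurable borel"
 by (intro borel_measurable_continuous_onI continuous_on_abs_torus)

lemma measurable_torus_shift [measurable (raw)]:
 assumes [measurable]: "f : borel_measurable M" "g : borel_measurable M"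
 shows "(%x. f x \<oplus> g x) : borel_measurable M"
proof -
 have "(%z. fst z \<oplus> snd z) : borel_measurable (borel \<Otimes>\<^sub>M (borel :: (real^'b) measure))"
  unfolding borel_prod by (intro borel_measurable_continuous_onI continuous_intros)
 then have "(%z. fst z \<oplus> snd z) \<circ> (%x. (f x, g x)) : borel_measurable M"
  by (rule measurable_comp[rotated]) simp
 then show ?thesis by (simp add: comp_def)
qed

lemma open_centre_greater:
 assumes "- 1/2 <= a" shows "open {x :: real ^ 'n. a < centre x $ i}"
proof -
 have "{x :: real ^ 'n. a < centre x $ i} = (\<Union>m::int. {x. of_int m + a < x $ i} \<inter> {x. x $ i < of_int m + 1/2})"
  (is "?L = ?R")
 proof
  show "?L \<subseteq> ?R"
  proof
   fix x assume "x \<in> ?L"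
   then have "x \<in> {x. of_int \<lfloor>x $ i + 1/2\<rfloor> + a < x $ i} \<inter> {x. x $ i < of_int \<lfloor>x $ i + 1/2\<rfloor> + 1/2}"
    using centre_bounds[of x i] by (simp add: centre_def)
   moreover have "\<lfloor>x $ i + 1/2\<rfloor> \<in> UNIV" by simp
   ultimately show "x \<in> ?R" by (simp only: UN_iff Int_iff mem_Collect_eq) blast
  qed
  show "?R \<subseteq> ?L"
  proof
   fix x assume "x \<in> ?R"
   then obtain m :: int where m: "of_int m + a < x $ i" "x $ i < of_int m + 1/2" by auto
   then have "\<lfloor>x $ i + 1/2\<rfloor> = m" using assms by (intro floor_unique) linarith+
   then show "x \<in> ?L" using m by (simp add: centre_def)
  qed
 qed
 also have "open ..."
  by (intro open_UN ballI open_Int open_Collect_less continuous_intros)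
 finally show ?thesis .
qed

lemma measurable_torus_rep [measurable]: "(rep :: 'n::finite torus => real ^ 'n) : borel_measurable borel"
proof -
 have "(%X :: 'n torus. rep X $ i) : borel_measurable borel" for i
  unfolding borel_measurable_iff_le
 proof
  fix a
  show "{w \<in> space borel. rep (w :: 'n torus) $ i <= a} \<in> sets borel"
  proof (cases "a < - 1/2")
   case True
   have "\<not> rep X $ i <= a" for X :: "'n torus"
    using centre_bounds(1)[of "rep_torus X" i] True unfolding rep_def by linarith
   then show ?thesis by simp
  next
   case False
   have "open {X :: 'n torus. a < rep X $ i}"
    unfolding open_torus_iff using open_centre_greater[of a i] False by (simp add: vimage_def)
   moreover have "{w \<in> space borel. rep w $ i <= a} = - {X :: 'n torus. a < rep X $ i}"
    by auto
   ultimately show ?thesis by simp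
  qed
 qed
 then show ?thesis
  by (subst borel_measurable_euclidean_space) (auto simp: Basis_vec_def inner_axis)
qed

lemma measurable_centre [measurable]: "centre : borel_measurable borel"
 using measurable_compose[OF measurable_abs_torus measurable_torus_rep] by simp

lemma measurable_torus_diff [measurable (raw)]:
 assumes [measurable]: "f : borel_measurable M" "g : borel_measurable M"
 shows "(%x. torus_diff (f x) (g x)) : borel_measurable M"
 unfolding torus_diff_def by measurable

definition unit_cube :: "(real ^ 'n) set" where
 "unit_cube = {x. \<forall>i. 0 <= x $ i & x $ i < 1}"

lemma sets_unit_cube [measurable]: "unit_cube \<in> sets borel"
proof -
 have "unit_cube = (\<Inter>i\<in>UNIV. {x :: real ^ 'n. 0 <= x $ i} \<inter> {x. x $ i < 1})"
  by (auto simp: unit_cube_def)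
 also have "... \<in> sets borel"
  by (intro sets.finite_INT sets.Int borel_closed borel_open closed_Collect_le open_Collect_less continuous_intros) auto
 finally show ?thesis .
qed

lemma emeasure_unit_cube [simp]: "emeasure lborel (unit_cube :: (real ^ 'n) set) = 1"
proof -
 have *: "(1 :: real ^ 'n) \<bullet> b = 1" if "b \<in> Basis" for b
  using that by (auto simp: Basis_vec_def inner_axis)
 have "emeasure lborel (unit_cube :: (real ^ 'n) set) <= emeasure lborel (cbox 0 (1 :: real ^ 'n))"
  by (intro emeasure_mono) (auto simp: unit_cube_def mem_box_cart less_imp_le)
 also have "... = 1" by (subst emeasure_lborel_cbox) (simp_all add: *)
 finally have 1: "emeasure lborel (unit_cube :: (real ^ 'n) set) <= 1" .
 have "1 = emeasure lborel (box 0 (1 :: real ^ 'n))"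
  by (subst emeasure_lborel_box) (simp_all add: *)
 also have "... <= emeasure lborel (unit_cube :: (real ^ 'n) set)"
  by (intro emeasure_mono) (auto simp: unit_cube_def mem_box_cart less_imp_le)
 finally show ?thesis using 1 by simp
qed

lemma torus_measure_alt:
 "torus_measure = distr (restrict_space lborel unit_cube) borel abs_torus"
 by (simp add: torus_measure_def unit_cube_def)

lemma sets_torus_measure [simp, measurable_cong]: "sets torus_measure = sets borel"
 by (simp add: torus_measure_def)

lemma space_torus_measure [simp]: "space torus_measure = UNIV"
 by (simp add: torus_measure_def)

abbreviation TM :: "'n::finite torus measure" where "TM \<equiv> torus_measure"

lemma nn_integral_torus:
 assumes [measurable]: "f : borel_measurable borel"
 shows "(\<integral>\<^sup>+X. f X \<partial>TM) = (\<integral>\<^sup>+x. f (abs_torus x) * indicator unit_cube x \<partial>lborel)"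
 unfolding torus_measure_alt
 by (subst nn_integral_distr)
  (auto simp: nn_integral_restrict_space intro!: measurable_restrict_space1)

lemma prob_space_torus_measure: "prob_space (TM :: 'n::finite torus measure)"
proof
 have "emeasure TM (UNIV :: 'n torus set) = (\<integral>\<^sup>+X. 1 \<partial>(TM :: 'n torus measure))"
  by simp
 also have "... = 1" by (subst nn_integral_torus) simp_all
 finally show "emeasure TM (space (TM :: 'n torus measure)) = 1" by simp
qed

interpretation torus: prob_space "TM :: 'n::finite torus measure"
 by (rule prob_space_torus_measure)

definition lattice :: "(real ^ 'n) set" where "lattice = {m. \<forall>i. m $ i \<in> \<int>}"

lemma countable_lattice: "countable (lattice :: (real ^ 'n) set)"
proof -
 have "countable (PiE (UNIV :: 'n set) (%_. \<int> :: real set))"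
  by (intro countable_PiE) (auto simp: Ints_def)
 moreover have "lattice \<subseteq> vec_lambda ` PiE (UNIV :: 'n set) (%_. \<int> :: real set)"
 proof
  fix m :: "real ^ 'n" assume "m \<in> lattice"
  then show "m \<in> vec_lambda ` PiE (UNIV :: 'n set) (%_. \<int> :: real set)"
   by (intro image_eqI[of _ _ "%i. m $ i"]) (auto simp: lattice_def)
 qed
 ultimately show ?thesis by (meson countable_image countable_subset)
qed

lemma nn_integral_lattice_unit_cube:
 "(\<integral>\<^sup>+m. indicator unit_cube (x + m) \<partial>count_space lattice) = 1"
proof -
 define m0 where "m0 = (\<chi> i. - real_of_int \<lfloor>x $ i\<rfloor>)"
 have m0: "m0 \<in> lattice" by (simp add: m0_def lattice_def)
 have "x + m \<in> unit_cube \<longleftrightarrow> m = m0" if "m \<in> lattice" for m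
 proof
  assume *: "x + m \<in> unit_cube"
  have "m $ i = m0 $ i" for i
  proof -
   obtain z where z: "m $ i = of_int z" using \<open>m \<in> lattice\<close> by (auto simp: lattice_def elim: Ints_cases)
   have "\<lfloor>x $ i\<rfloor> = - z" using * z by (intro floor_unique) (auto simp: unit_cube_def dest: spec[of _ i])
   then show ?thesis using z by (simp add: m0_def)
  qed
  then show "m = m0" by (simp add: vec_eq_iff)
 next
  assume "m = m0"
  moreover have "x $ i - real_of_int \<lfloor>x $ i\<rfloor> < 1" for i by linarith
  ultimately show "x + m \<in> unit_cube" by (auto simp: unit_cube_def m0_def)
 qed
 then have "(\<integral>\<^sup>+m. indicator unit_cube (x + m) \<partial>count_space lattice) = (\<integral>\<^sup>+m. indicator {m0} m \<partial>count_space lattice)"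
  by (intro nn_integral_cong) (auto split: split_indicator)
 also have "... = 1" using m0 by simp
 finally show ?thesis .
qed

lemma nn_integral_lborel_shift:
 fixes f :: "real ^ 'n => ennreal"
 assumes [measurable]: "f : borel_measurable borel"
 shows "(\<integral>\<^sup>+x. f (x + m) \<partial>lborel) = (\<integral>\<^sup>+x. f x \<partial>lborel)"
proof -
 have "(\<integral>\<^sup>+x. f x \<partial>lborel) = (\<integral>\<^sup>+x. f x \<partial>distr lborel borel ((+) m))" by (simp add: lborel_distr_plus)
 also have "... = (\<integral>\<^sup>+x. f (m + x) \<partial>lborel)" by (subst nn_integral_distr) auto
 finally show ?thesis by (simp add: add.commute)
qed

text \<open>The translated unit cube is cut by the lattice into pieces that reassemble to the unit cube.\<close>

lemma nn_integral_torus_shift: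
 fixes f :: "'n::finite torus => ennreal"
 assumes [measurable]: "f : borel_measurable borel"
 shows "(\<integral>\<^sup>+X. f (X \<oplus> v) \<partial>TM) = (\<integral>\<^sup>+X. f X \<partial>TM)"
proof -
 define g where "g x = f (abs_torus x)" for x
 have [measurable]: "g : borel_measurable borel" unfolding g_def by measurable
 have per: "g (x + m) = g x" if "m \<in> lattice" for x m
  using that unfolding g_def lattice_def by (simp add: abs_torus_add_lattice)
 have neg: "- m \<in> lattice \<longleftrightarrow> m \<in> lattice" for m :: "real ^ 'n"
  by (auto simp: lattice_def)
 have one: "(\<integral>\<^sup>+m. indicator unit_cube (x - m) \<partial>count_space lattice) = (1 :: ennreal)" for x :: "real ^ 'n"
 proof -
  have "bij_betw uminus lattice (lattice :: (real ^ 'n) set)"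
   by (rule bij_betwI[of _ _ _ uminus]) (auto simp: neg)
  from nn_integral_bij_count_space[OF this, of "%m. indicator unit_cube (x + m)"]
  show ?thesis by (simp add: nn_integral_lattice_unit_cube)
 qed
 have "(\<integral>\<^sup>+X. f (X \<oplus> v) \<partial>TM) = (\<integral>\<^sup>+x. g (x + v) * indicator unit_cube (x + v - v) \<partial>lborel)"
  by (subst nn_integral_torus) (simp_all add: g_def)
 also have "... = (\<integral>\<^sup>+x. g x * indicator unit_cube (x - v) \<partial>lborel)"
  by (rule nn_integral_lborel_shift) measurable
 also have "... = (\<integral>\<^sup>+x. \<integral>\<^sup>+m. g x * indicator unit_cube (x - v) * indicator unit_cube (x - m) \<partial>count_space lattice \<partial>lborel)"
  by (simp add: nn_integral_cmult one)
 also have "... = (\<integral>\<^sup>+m. \<integral>\<^sup>+x. g x * indicator unit_cube (x - v) * indicator unit_cube (x - m) \<partial>lborel \<partial>count_space lattice)"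
  by (rule nn_integral_count_space_nn_integral) (auto intro: countable_lattice)
 also have "... = (\<integral>\<^sup>+m. \<integral>\<^sup>+x. g x * indicator unit_cube x * indicator unit_cube (x - v + m) \<partial>lborel \<partial>count_space lattice)"
 proof (rule nn_integral_cong)
  fix m :: "real ^ 'n" assume "m \<in> space (count_space lattice)"
  then have "m \<in> lattice" by simp
  have "(\<integral>\<^sup>+x. g x * indicator unit_cube (x - v) * indicator unit_cube (x - m) \<partial>lborel)
   = (\<integral>\<^sup>+x. g (x + m) * indicator unit_cube (x + m - v) * indicator unit_cube (x + m - m) \<partial>lborel)"
   by (rule nn_integral_lborel_shift[symmetric]) measurable
  also have "... = (\<integral>\<^sup>+x. g x * indicator unit_cube x * indicator unit_cube (x - v + m) \<partial>lborel)"
   by (intro nn_integral_cong) (simp add: per \<open>m \<in> lattice\<close> algebra_simps)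
  finally show "(\<integral>\<^sup>+x. g x * indicator unit_cube (x - v) * indicator unit_cube (x - m) \<partial>lborel)
   = (\<integral>\<^sup>+x. g x * indicator unit_cube x * indicator unit_cube (x - v + m) \<partial>lborel)" .
 qed
 also have "... = (\<integral>\<^sup>+x. \<integral>\<^sup>+m. g x * indicator unit_cube x * indicator unit_cube (x - v + m) \<partial>count_space lattice \<partial>lborel)"
  by (rule nn_integral_count_space_nn_integral[symmetric]) (auto intro: countable_lattice)
 also have "... = (\<integral>\<^sup>+x. g x * indicator unit_cube x \<partial>lborel)"
  by (simp add: nn_integral_cmult nn_integral_lattice_unit_cube)
 also have "... = (\<integral>\<^sup>+X. f X \<partial>TM)" by (simp add: nn_integral_torus g_def)
 finally show ?thesis .
qed

lemma distr_torus_shift: "distr TM borel (%X. X \<oplus> v) = (TM :: 'n::finite torus measure)"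
proof (rule measure_eqI)
 fix A :: "'n torus set" assume "A \<in> sets (distr TM borel (%X. X \<oplus> v))"
 then have [measurable]: "A \<in> sets borel" by simp
 have "emeasure (distr TM borel (%X. X \<oplus> v)) A = (\<integral>\<^sup>+X. indicator A (X \<oplus> v) \<partial>TM)"
  using nn_integral_distr[of "%X. X \<oplus> v" TM borel "indicator A"] by simp
 also have "... = emeasure TM A" by (subst nn_integral_torus_shift) simp_all
 finally show "emeasure (distr TM borel (%X. X \<oplus> v)) A = emeasure TM A" .
qed simp

section \<open>The Borel structure of the path space\<close>

definition paths :: "(real => 'n::finite torus) set" where
 "paths = {om. om \<in> extensional {0..1} & continuous_on {0..1} om}"

abbreviation path_borel :: "(real => 'n::finite torus) measure" where
 "path_borel \<equiv> borel_of path_topology"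

definition paths_close :: "real => (real => 'n::finite torus) => (real => 'n torus) => bool" where
 "paths_close e om om' \<longleftrightarrow> (\<forall>t\<in>{0..1}. dist (om t) (om' t) < e)"

lemma mspace_paths: "mspace (cfunspace (top_of_set {0..1::real}) euclidean_metric) = (paths :: (real => 'n::finite torus) set)"
proof -
 have "Met_TC.mbounded (om ` {0..1})" for om :: "real => 'n torus"
  unfolding Met_TC.mbounded_alt using dist_torus_bounded by blast
 then show ?thesis by (auto simp: paths_def continuous_map_in_subtopology)
qed

lemma topspace_path_topology [simp]: "topspace path_topology = paths"
 by (simp only: path_topology_def topspace_mtopology_of mspace_paths)

lemma openin_path_topology_iff:
 fixes U :: "(real => 'n::finite torus) set"
 shows "openin path_topology U \<longleftrightarrow>
  U \<subseteq> paths & (\<forall>om\<in>U. \<exists>e>0. \<forall>om'\<in>paths. paths_close e om om' --> om' \<in> U)"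
proof -
 let ?m = "cfunspace (top_of_set {0..1::real}) euclidean_metric :: (real => 'n torus) metric"
 interpret M: Metric_space "mspace ?m" "mdist ?m" by (rule Metric_space_mspace_mdist)
 have le: "mdist ?m om om' <= a \<longleftrightarrow> (\<forall>t\<in>{0..1}. dist (om t) (om' t) <= a)"
  if "om \<in> paths" "om' \<in> paths" for om om' a
  using cfunspace_mdist_le[of om "top_of_set {0..1::real}" euclidean_metric om' a] that
  unfolding mspace_paths by simp
 have ball: "M.mball om r \<subseteq> U \<longleftrightarrow> (\<forall>om'\<in>paths. mdist ?m om om' < r --> om' \<in> U)" if "om \<in> paths" for om r
  using that unfolding subset_iff M.in_mball unfolding mspace_paths by blast
 have "openin path_topology U \<longleftrightarrow> U \<subseteq> paths &
   (\<forall>om\<in>U. \<exists>r>0. \<forall>om'\<in>paths. mdist ?m om om' < r --> om' \<in> U)"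
 proof -
  have "openin path_topology U \<longleftrightarrow> U \<subseteq> paths & (\<forall>om. om \<in> U --> (\<exists>r>0. M.mball om r \<subseteq> U))"
   unfolding path_topology_def mtopology_of_def M.openin_mtopology
   by (simp only: mspace_paths)
  also have "... \<longleftrightarrow> U \<subseteq> paths & (\<forall>om\<in>U. \<exists>r>0. \<forall>om'\<in>paths. mdist ?m om om' < r --> om' \<in> U)"
   unfolding Ball_def[of U] by (intro conj_cong refl all_cong ex_cong) ((rule ball, blast)+)
  finally show ?thesis .
 qed
 also have "... \<longleftrightarrow> U \<subseteq> paths & (\<forall>om\<in>U. \<exists>e>0. \<forall>om'\<in>paths. paths_close e om om' --> om' \<in> U)"
 proof (intro conj_cong refl ball_cong iffI)
  fix om assume U: "U \<subseteq> paths" and "om \<in> U" and "\<exists>r>0. \<forall>om'\<in>paths. mdist ?m om om' < r --> om' \<in> U"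
  then obtain r where r: "r > 0" "!!om'. om' \<in> paths ==> mdist ?m om om' < r ==> om' \<in> U" by blast
  show "\<exists>e>0. \<forall>om'\<in>paths. paths_close e om om' --> om' \<in> U"
  proof (intro exI conjI ballI impI)
   show "r / 2 > 0" using r by simp
   fix om' :: "real => 'n torus" assume "om' \<in> paths" "paths_close (r/2) om om'"
   then have "mdist ?m om om' <= r/2"
    using \<open>om \<in> U\<close> U by (subst le) (auto simp: paths_close_def less_imp_le)
   then show "om' \<in> U" using r \<open>om' \<in> paths\<close> by simp
  qed
 next
  fix om assume U: "U \<subseteq> paths" and "om \<in> U" and "\<exists>e>0. \<forall>om'\<in>paths. paths_close e om om' --> om' \<in> U"
  then obtain e where e: "e > 0" "!!om'. om' \<in> paths ==> paths_close e om om' ==> om' \<in> U" by blast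
  have "om \<in> paths" using U \<open>om \<in> U\<close> by blast
  show "\<exists>r>0. \<forall>om'\<in>paths. mdist ?m om om' < r --> om' \<in> U"
  proof (intro exI conjI ballI impI)
   fix om' :: "real => 'n torus" assume *: "om' \<in> paths" "mdist ?m om om' < e"
   have "dist (om t) (om' t) < e" if "t \<in> {0..1}" for t
   proof -
    have "dist (om t) (om' t) <= mdist ?m om om'" using le[OF \<open>om \<in> paths\<close> *(1), of "mdist ?m om om'"] that by auto
    then show ?thesis using *(2) by linarith
   qed
   then show "om' \<in> U" using e(2) * by (auto simp: paths_close_def)
  qed (rule e)
 qed
 finally show ?thesis .
qed

lemma openin_path_subset: "openin path_topology U ==> U \<subseteq> paths"
 by (simp add: openin_path_topology_iff)

lemma space_borel_of [simp]: "space (borel_of X) = topspace X"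
 unfolding borel_of_def by (rule space_measure_of) (auto dest: openin_subset)

lemma measurable_borel_of:
 assumes "!!x. x \<in> space M ==> f x \<in> topspace X"
  and "!!U. openin X U ==> f -` U \<inter> space M \<in> sets M"
 shows "f \<in> M \<rightarrow>\<^sub>M borel_of X"
 unfolding borel_of_def by (rule measurable_measure_of) (use assms in "auto dest: openin_subset")

lemma space_path_borel: "space path_borel = paths"
 by simp

lemma sets_borel_of: "sets (borel_of X) = sigma_sets (topspace X) {U. openin X U}"
 unfolding borel_of_def by (rule sets_measure_of) (auto dest: openin_subset)

lemma open_in_path_product:
 fixes W :: "((real => 'n::finite torus) \<times> 'b::{metric_space, second_countable_topology}) set"
 assumes sub: "W \<subseteq> paths \<times> UNIV"
  and op: "!!om th. (om, th) \<in> W ==> \<exists>e>0. \<forall>om'\<in>paths. \<forall>th'.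
       paths_close e om om' & dist th th' < e --> (om', th') \<in> W"
 shows "W \<in> sets (path_borel \<Otimes>\<^sub>M borel)"
proof -
 obtain B :: "'b set set" where B: "countable B" "topological_basis B" using ex_countable_basis by blast
 define V where "V b = \<Union>{V. openin path_topology V & V \<times> b \<subseteq> W}" for b
 have V: "openin path_topology (V b)" for b unfolding V_def by auto
 have "W = (\<Union>b\<in>B. V b \<times> b)"
 proof (rule antisym)
  show "(\<Union>b\<in>B. V b \<times> b) \<subseteq> W" by (auto simp: V_def)
  show "W \<subseteq> (\<Union>b\<in>B. V b \<times> b)"
  proof (clarify)
   fix om th assume "(om, th) \<in> W"
   then obtain e where e: "e > 0" "!!om' th'. om' \<in> paths ==> paths_close e om om' ==> dist th th' < e ==> (om', th') \<in> W"
    using op by blast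
   have "om \<in> paths" using sub \<open>(om, th) \<in> W\<close> by auto
   obtain b where b: "b \<in> B" "th \<in> b" "b \<subseteq> ball th e"
    using topological_basisE[OF B(2), of "ball th e" th] e(1) by auto
   define U where "U = {om'\<in>paths. \<exists>d<e. \<forall>t\<in>{0..1}. dist (om t) (om' t) <= d}"
   have "openin path_topology U"
    unfolding openin_path_topology_iff
   proof (intro conjI ballI)
    fix om_1 assume "om_1 \<in> U"
    then obtain d where d: "d < e" "!!t. t \<in> {0..1} ==> dist (om t) (om_1 t) <= d" by (auto simp: U_def)
    show "\<exists>e>0. \<forall>om'\<in>paths. paths_close e om_1 om' --> om' \<in> U"
    proof (intro exI conjI ballI impI)
     show "(e - d)/2 > 0" using d by simp
     fix om' :: "real => 'n torus" assume w: "om' \<in> paths" "paths_close ((e - d)/2) om_1 om'"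
     have "dist (om t) (om' t) <= d + (e - d)/2" if "t \<in> {0..1}" for t
     proof -
      have "dist (om_1 t) (om' t) < (e - d)/2" using w(2) that by (simp add: paths_close_def)
      then show ?thesis
       using d(2)[OF that] dist_triangle[of "om t" "om' t" "om_1 t"] by linarith
     qed
     moreover have "d + (e - d)/2 < e" using d(1) by (simp add: field_simps)
     ultimately show "om' \<in> U" using w(1) unfolding U_def
      by (intro CollectI conjI exI[of _ "d + (e - d)/2"]) auto
    qed
   qed (auto simp: U_def)
   moreover have "U \<times> b \<subseteq> W"
   proof (clarify)
    fix om' th' assume "om' \<in> U" "th' \<in> b"
    then show "(om', th') \<in> W" using b(3) by (intro e(2)) (auto simp: U_def paths_close_def)
   qed
   moreover have "om \<in> U" using e(1) \<open>om \<in> paths\<close> by (auto simp: U_def intro!: exI[of _ 0])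
   ultimately show "(om, th) \<in> (\<Union>b\<in>B. V b \<times> b)" using b unfolding V_def by blast
  qed
 qed
 moreover have "V b \<times> b \<in> sets (path_borel \<Otimes>\<^sub>M borel)" if "b \<in> B" for b
 proof (rule pair_measureI)
  show "V b \<in> sets path_borel" using V[of b] by (auto simp: sets_borel_of)
  show "b \<in> sets borel" using that B(2) by (auto dest: topological_basis_open)
 qed
 ultimately show ?thesis using B(1) by (auto intro!: sets.countable_UN')
qed

lemma measurable_into_paths:
 fixes \<Phi> :: "(real => 'n::finite torus) => 'b::{metric_space, second_countable_topology} => real => 'm::finite torus"
 assumes mem: "!!om th. om \<in> paths ==> \<Phi> om th \<in> paths"
  and cont: "!!om th e. om \<in> paths ==> e > 0 ==> \<exists>d>0. \<forall>om'\<in>paths. \<forall>th'.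
       paths_close d om om' & dist th th' < d --> paths_close e (\<Phi> om th) (\<Phi> om' th')"
 shows "(%(om, th). \<Phi> om th) \<in> path_borel \<Otimes>\<^sub>M borel \<rightarrow>\<^sub>M path_borel"
proof (rule measurable_borel_of)
 show "x \<in> space (path_borel \<Otimes>\<^sub>M borel) ==> (%(om, th). \<Phi> om th) x \<in> topspace path_topology" for x
  using mem by (auto simp: space_pair_measure)
 fix U :: "(real => 'm torus) set" assume "openin path_topology U"
 then have U: "!!om. om \<in> U ==> \<exists>e>0. \<forall>om'\<in>paths. paths_close e om om' --> om' \<in> U"
  by (auto simp: openin_path_topology_iff)
 show "(%(om, th). \<Phi> om th) -` U \<inter> space (path_borel \<Otimes>\<^sub>M borel) \<in> sets (path_borel \<Otimes>\<^sub>M borel)"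
 proof (rule open_in_path_product)
  fix om th assume *: "(om, th) \<in> (%(om, th). \<Phi> om th) -` U \<inter> space (path_borel \<Otimes>\<^sub>M borel)"
  then have "om \<in> paths" "\<Phi> om th \<in> U" by (auto simp: space_pair_measure)
  from U[OF this(2)] obtain e where e: "e > 0" "!!om'. om' \<in> paths ==> paths_close e (\<Phi> om th) om' ==> om' \<in> U" by blast
  from cont[OF \<open>om \<in> paths\<close> e(1), of th] show "\<exists>d>0. \<forall>om'\<in>paths. \<forall>th'.
    paths_close d om om' & dist th th' < d --> (om', th') \<in> (%(om, th). \<Phi> om th) -` U \<inter> space (path_borel \<Otimes>\<^sub>M borel)"
   using e(2) mem by (fastforce simp: space_pair_measure)
 qed (auto simp: space_pair_measure)
qed

definition clamp01 :: "real => real" where "clamp01 t = max 0 (min 1 t)"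

lemma clamp01_mem [simp]: "clamp01 t \<in> {0..1}" by (auto simp: clamp01_def)
lemma clamp01_bounds [simp]: "0 <= clamp01 t" "clamp01 t <= 1" by (auto simp: clamp01_def)
lemma clamp01_id: "t \<in> {0..1} ==> clamp01 t = t" by (auto simp: clamp01_def)
lemma clamp01_lipschitz: "\<bar>clamp01 s - clamp01 t\<bar> <= \<bar>s - t\<bar>" by (auto simp: clamp01_def)
lemma clamp01_mono: "s <= t ==> clamp01 s <= clamp01 t" by (auto simp: clamp01_def)

lemma path_uniformly_continuous:
 assumes "om \<in> paths" "e > 0"
 obtains d where "d > 0" "!!s t. s \<in> {0..1} ==> t \<in> {0..1} ==> \<bar>s - t\<bar> < d ==> dist (om s) (om t) < e"
proof -
 have "uniformly_continuous_on {0..1} om"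
  using assms(1) by (intro compact_uniformly_continuous) (auto simp: paths_def)
 then obtain d where "d > 0" "!!x x'. x \<in> {0..1} ==> x' \<in> {0..1} ==> dist x' x < d ==> dist (om x') (om x) < e"
  using assms(2) unfolding uniformly_continuous_on_def by metis
 then show ?thesis by (intro that[of d]) (auto simp: dist_real_def)
qed

text \<open>Extending a path by its end values makes evaluation total and jointly continuous.\<close>

definition path_at :: "(real => 'n::finite torus) => real => 'n torus" where
 "path_at om t = om (clamp01 t)"

lemma path_at_eq: "t \<in> {0..1} ==> path_at om t = om t"
 by (simp add: path_at_def clamp01_id)

lemma continuous_path_at: assumes "om \<in> paths" shows "continuous_on UNIV (path_at om)"
proof -
 have "continuous_on UNIV (om \<circ> clamp01)"
  using assms unfolding paths_def
  by (intro continuous_on_compose) (auto simp: clamp01_def[abs_def] intro!: continuous_intros elim: continuous_on_subset)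
 then show ?thesis by (simp add: comp_def path_at_def[abs_def])
qed

lemma measurable_path_at_pair:
 "(%(om :: real => 'n::finite torus, t). path_at om t) \<in> path_borel \<Otimes>\<^sub>M borel \<rightarrow>\<^sub>M borel"
proof (rule borel_measurableI)
 fix S :: "'n torus set" assume "open S"
 show "(%(om, t). path_at om t) -` S \<inter> space (path_borel \<Otimes>\<^sub>M borel) \<in> sets (path_borel \<Otimes>\<^sub>M borel)"
 proof (rule open_in_path_product)
  fix om t assume *: "(om, t) \<in> (%(om, t). path_at om t) -` S \<inter> space (path_borel \<Otimes>\<^sub>M borel)"
  then have w: "om \<in> paths" "path_at om t \<in> S" by (auto simp: space_pair_measure)
  then obtain e where e: "e > 0" "!!Y. dist Y (path_at om t) < e ==> Y \<in> S"
   using \<open>open S\<close> unfolding open_dist by metis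
  obtain d where d: "d > 0" "!!s t. s \<in> {0..1} ==> t \<in> {0..1} ==> \<bar>s - t\<bar> < d ==> dist (om s) (om t) < e/2"
   using path_uniformly_continuous[OF w(1), of "e/2"] e(1) by auto
  show "\<exists>e>0. \<forall>om'\<in>paths. \<forall>th'. paths_close e om om' & dist t th' < e -->
    (om', th') \<in> (%(om, t). path_at om t) -` S \<inter> space (path_borel \<Otimes>\<^sub>M borel)"
  proof (intro exI[of _ "min (e/2) d"] conjI ballI allI impI)
   fix om' :: "real => 'n torus" and t' :: real
   assume w': "om' \<in> paths" "paths_close (min (e/2) d) om om' & dist t t' < min (e/2) d"
   then have "dist (om (clamp01 t')) (om' (clamp01 t')) < e/2" by (auto simp: paths_close_def)
   moreover have "dist (om (clamp01 t')) (om (clamp01 t)) < e/2"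
    using w'(2) clamp01_lipschitz[of t' t] by (intro d(2)) (auto simp: dist_real_def abs_minus_commute)
   ultimately have "path_at om' t' \<in> S"
    using dist_triangle[of "om' (clamp01 t')" "om (clamp01 t)" "om (clamp01 t')"]
    by (intro e(2)) (simp add: path_at_def dist_commute)
   then show "(om', t') \<in> (%(om, t). path_at om t) -` S \<inter> space (path_borel \<Otimes>\<^sub>M borel)"
    using w'(1) by (simp add: space_pair_measure)
  qed (use e d in auto)
 qed (auto simp: space_pair_measure)
qed

lemma measurable_path_at [measurable (raw)]:
 assumes [measurable]: "f \<in> M \<rightarrow>\<^sub>M path_borel" "g : borel_measurable M"
 shows "(%x. path_at (f x) (g x)) : borel_measurable M"
 using measurable_compose[OF measurable_Pair[OF assms] measurable_path_at_pair] by simp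

lemma measurable_path_eval:
 assumes [measurable]: "f \<in> M \<rightarrow>\<^sub>M path_borel" and t: "t \<in> {0..1}"
 shows "(%x. f x t) : borel_measurable M"
proof -
 have "(%x. path_at (f x) t) : borel_measurable M" by measurable
 then show ?thesis by (simp add: path_at_eq[OF t])
qed

lemma sets_flow_space:
 "sets (borel_of (prod_topology path_topology euclidean))
 = sets ((path_borel :: (real => 'n::finite torus) measure) \<Otimes>\<^sub>M (borel :: 'm::finite torus measure))"
proof (rule antisym)
 let ?X = "prod_topology (path_topology :: (real => 'n torus) topology) (euclidean :: 'm torus topology)"
 show "sets (borel_of ?X) \<subseteq> sets (path_borel \<Otimes>\<^sub>M borel)"
  unfolding sets_borel_of
 proof -
  have "openin ?X W ==> W \<in> sets (path_borel \<Otimes>\<^sub>M borel)" for W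
  proof (rule open_in_path_product)
   assume W: "openin ?X W"
   then show "W \<subseteq> paths \<times> UNIV" using openin_subset[OF W] by simp
   fix om X assume "(om, X) \<in> W"
   then obtain U V where UV: "openin path_topology U" "open V" "om \<in> U" "X \<in> V" "U \<times> V \<subseteq> W"
    using W unfolding openin_prod_topology_alt by (metis open_openin)
   obtain e1 where e1: "e1 > 0" "!!om'. om'\<in>paths ==> paths_close e1 om om' ==> om' \<in> U"
    using UV(1,3) unfolding openin_path_topology_iff by blast
   obtain e2 where e2: "e2 > 0" "!!Y. dist Y X < e2 ==> Y \<in> V" using UV(2,4) unfolding open_dist by metis
   show "\<exists>e>0. \<forall>om'\<in>paths. \<forall>th'. paths_close e om om' & dist X th' < e --> (om', th') \<in> W"
    using e1 e2 UV(5) by (intro exI[of _ "min e1 e2"]) (auto simp: paths_close_def dist_commute)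
  qed
  moreover have "topspace ?X = space (path_borel \<Otimes>\<^sub>M borel)" by (simp add: space_pair_measure)
  ultimately show "sigma_sets (topspace ?X) {U. openin ?X U} \<subseteq> sets (path_borel \<Otimes>\<^sub>M borel)"
   by (metis (no_types, lifting) mem_Collect_eq sets.sigma_sets_subset subsetI)
 qed
 have sp: "space (borel_of ?X) = paths \<times> UNIV" by simp
 have o: "A \<in> sets (borel_of ?X)" if "openin ?X A" for A
  using that by (auto simp: sets_borel_of)
 have "fst \<in> borel_of ?X \<rightarrow>\<^sub>M path_borel"
 proof (rule measurable_borel_of)
  fix U :: "(real => 'n torus) set" assume "openin path_topology U"
  then have "U \<subseteq> paths" "openin ?X (U \<times> UNIV)" by (auto simp: openin_prod_Times_iff dest!: openin_path_subset)
  moreover have "fst -` U \<inter> space (borel_of ?X) = U \<times> UNIV" using \<open>U \<subseteq> paths\<close> by (auto simp: sp)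
  ultimately show "fst -` U \<inter> space (borel_of ?X) \<in> sets (borel_of ?X)" using o by simp
 qed (auto simp: sp dest!: openin_path_subset)
 moreover have "snd \<in> borel_of ?X \<rightarrow>\<^sub>M borel"
 proof (rule borel_measurableI)
  fix S :: "'m torus set" assume "open S"
  then have "openin ?X (paths \<times> S)"
   unfolding openin_prod_Times_iff using openin_topspace[of path_topology] by auto
  moreover have "snd -` S \<inter> space (borel_of ?X) = paths \<times> S" by (auto simp: sp)
  ultimately show "snd -` S \<inter> space (borel_of ?X) \<in> sets (borel_of ?X)" using o by simp
 qed
 ultimately have "(%z. (fst z, snd z)) \<in> borel_of ?X \<rightarrow>\<^sub>M path_borel \<Otimes>\<^sub>M borel"
  by (rule measurable_Pair)
 then have *: "(%z. z) \<in> borel_of ?X \<rightarrow>\<^sub>M path_borel \<Otimes>\<^sub>M borel" by simp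
 show "sets (path_borel \<Otimes>\<^sub>M borel) \<subseteq> sets (borel_of ?X)"
 proof
  fix A :: "((real => 'n torus) \<times> 'm torus) set" assume A: "A \<in> sets (path_borel \<Otimes>\<^sub>M borel)"
  from measurable_sets[OF * A] sets.sets_into_space[OF A] show "A \<in> sets (borel_of ?X)"
   by (simp add: sp space_pair_measure Int_absorb2 Int_absorb1)
 qed
qed

lemma has_vector_derivative_iff_quotient:
 fixes f :: "real => 'b::real_normed_vector"
 shows "(f has_vector_derivative v) (at x within S) \<longleftrightarrow>
  ((%y. (f y - f x) /\<^sub>R (y - x)) \<longlongrightarrow> v) (at x within S)"
proof -
 have "(f has_vector_derivative v) (at x within S) \<longleftrightarrow>
  ((%y. norm ((1 / norm (y - x)) *\<^sub>R (f y - (f x + (y - x) *\<^sub>R v)))) \<longlongrightarrow> 0) (at x within S)"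
  unfolding has_vector_derivative_def has_derivative_within tendsto_norm_zero_iff
  by (simp add: bounded_linear_scaleR_left)
 also have "... \<longleftrightarrow> ((%y. norm ((f y - f x) /\<^sub>R (y - x) - v)) \<longlongrightarrow> 0) (at x within S)"
 proof (rule tendsto_cong)
  have "norm ((1 / norm (y - x)) *\<^sub>R (f y - (f x + (y - x) *\<^sub>R v))) = norm ((f y - f x) /\<^sub>R (y - x) - v)"
   if "y ~= x" for y
  proof -
   have "(f y - f x) /\<^sub>R (y - x) - v = (1 / (y - x)) *\<^sub>R (f y - (f x + (y - x) *\<^sub>R v))"
   proof -
    have "(1 / (y - x)) *\<^sub>R ((y - x) *\<^sub>R v) = v" using that by simp
    then show ?thesis
     by (simp add: scaleR_right_diff_distrib scaleR_right_distrib inverse_eq_divide del: scaleR_scaleR)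
   qed
   then show ?thesis by simp
  qed
  then show "eventually (%y. norm ((1 / norm (y - x)) *\<^sub>R (f y - (f x + (y - x) *\<^sub>R v)))
   = norm ((f y - f x) /\<^sub>R (y - x) - v)) (at x within S)"
   by (simp add: eventually_at_filter)
 qed
 finally show ?thesis unfolding tendsto_norm_zero_iff by (simp add: LIM_zero_iff)
qed

lemma has_velocity_iff:
 assumes "t \<in> {0..1}"
 shows "has_velocity om v t \<longleftrightarrow>
  ((%s. torus_diff (om s) (om t) /\<^sub>R (s - t)) \<longlongrightarrow> v) (at t within {0..1})"
proof
 assume "has_velocity om v t"
 then obtain L where L: "!!s. s \<in> {0..1} ==> abs_torus (L s) = om s"
  and d: "(L has_vector_derivative v) (at t within {0..1})" unfolding has_velocity_def by blast
 have "(L \<longlongrightarrow> L t) (at t within {0..1})"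
  using has_vector_derivative_continuous[OF d] by (simp add: continuous_within)
 then have "eventually (%s. dist (L s) (L t) < 1/2) (at t within {0..1})"
  by (rule tendstoD) simp
 then have "eventually (%s. (L s - L t) /\<^sub>R (s - t) = torus_diff (om s) (om t) /\<^sub>R (s - t)) (at t within {0..1})"
  unfolding eventually_at_filter
 proof eventually_elim
  case (elim s)
  show ?case
  proof (intro impI)
   assume "s ~= t" "s \<in> {0..1}"
   then have "norm (L s - L t) < 1/2" using elim by (simp add: dist_norm)
   then have "torus_diff (om s) (om t) = L s - L t"
    using L[OF \<open>s \<in> {0..1}\<close>] L[OF assms] by (metis centre_small torus_diff_abs)
   then show "(L s - L t) /\<^sub>R (s - t) = torus_diff (om s) (om t) /\<^sub>R (s - t)" by simp
  qed
 qed
 then show "((%s. torus_diff (om s) (om t) /\<^sub>R (s - t)) \<longlongrightarrow> v) (at t within {0..1})"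
  using d unfolding has_vector_derivative_iff_quotient by (rule Lim_transform_eventually[rotated])
next
 assume *: "((%s. torus_diff (om s) (om t) /\<^sub>R (s - t)) \<longlongrightarrow> v) (at t within {0..1})"
 define L where "L s = rep (om t) + torus_diff (om s) (om t)" for s
 have "abs_torus (L s) = om s" for s unfolding L_def by (metis torus_shift_diff torus_shift_rep)
 moreover have "torus_diff X X = 0" for X :: "'a torus"
  using torus_diff_shift_small[of 0 X] by simp
 then have "(L has_vector_derivative v) (at t within {0..1})"
  unfolding has_vector_derivative_iff_quotient using * by (simp add: L_def)
 ultimately show "has_velocity om v t" unfolding has_velocity_def by blast
qed

lemma has_velocity_iff_interior:
 assumes "t \<in> {0<..<1}"
 shows "has_velocity om v t \<longleftrightarrow> ((%s. torus_diff (om s) (om t) /\<^sub>R (s - t)) \<longlongrightarrow> v) (at t)"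
proof -
 have "at t within {0..1} = at t" using assms by (intro at_within_interior) simp
 then show ?thesis using has_velocity_iff[of t om v] assms by simp
qed

lemma has_velocity_cong:
 assumes t: "t \<in> {0<..<1}" and ev: "eventually (%s. om s = om' s) (nhds t)"
 shows "has_velocity om v t \<longleftrightarrow> has_velocity om' v t"
proof -
 have "om t = om' t" using ev by (rule eventually_nhds_x_imp_x)
 moreover have "eventually (%s. om s = om' s) (at t)"
  using ev by (auto simp: eventually_at_filter elim: eventually_mono)
 ultimately show ?thesis unfolding has_velocity_iff_interior[OF t]
  by (intro tendsto_cong) (auto elim: eventually_mono)
qed

lemma has_velocity_unique:
 assumes "t \<in> {0<..<1}" "has_velocity om v t" "has_velocity om v' t" shows "v = v'"
 using assms tendsto_unique[of "at t"] by (auto simp: has_velocity_iff_interior)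

lemma velocity_eq:
 assumes "t \<in> {0<..<1}" "has_velocity om v t" shows "velocity om t = v"
proof -
 have "(THE v. has_velocity om v t) = v"
  using assms by (intro the_equality) (auto intro: has_velocity_unique)
 then show ?thesis using assms(2) by (auto simp: velocity_def)
qed

lemma velocity_eq_0: "(!!v. \<not> has_velocity om v t) ==> velocity om t = 0"
 by (simp add: velocity_def)

lemma tendsto_torus_diff:
 assumes "(f \<longlongrightarrow> Y) F" "norm (torus_diff Y X) < 1/2"
 shows "((%s. torus_diff (f s) X) \<longlongrightarrow> torus_diff Y X) F"
proof -
 define e where "e s = torus_diff (f s) Y" for s
 have e: "(e \<longlongrightarrow> 0) F"
  using assms(1) unfolding tendsto_dist_iff[of f] dist_torus_eq e_def tendsto_norm_zero_iff .
 have "((%s. torus_diff Y X + e s) \<longlongrightarrow> torus_diff Y X + 0) F"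
  by (intro tendsto_intros e)
 then have lim: "((%s. torus_diff Y X + e s) \<longlongrightarrow> torus_diff Y X) F" by simp
 have "eventually (%s. norm (torus_diff Y X + e s) < 1/2) F"
  using order_tendstoD(2)[OF tendsto_norm[OF lim] assms(2)] .
 then have "eventually (%s. torus_diff Y X + e s = torus_diff (f s) X) F"
 proof eventually_elim
  case (elim s)
  have "f s = X \<oplus> (torus_diff Y X + e s)" by (simp add: e_def flip: torus_shift_assoc)
  then show ?case using torus_diff_shift_small[OF elim] by simp
 qed
 with lim show ?thesis by (rule Lim_transform_eventually)
qed

definition diff_quotient :: "(real => 'n::finite torus) => real => real => real ^ 'n" where
 "diff_quotient om t h = torus_diff (path_at om (t + h)) (path_at om t) /\<^sub>R h"

lemma has_velocity_iff_difference:
 assumes t: "t \<in> {0<..<1}"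
 shows "has_velocity om v t \<longleftrightarrow> (diff_quotient om t \<longlongrightarrow> v) (at 0)"
proof -
 have "eventually (%s. s \<in> {0<..<1}) (nhds t)"
  using t by (intro eventually_nhds_in_open) auto
 then have "eventually (%s. om s = path_at om s) (nhds t)"
  by eventually_elim (simp add: path_at_eq)
 then have "has_velocity om v t \<longleftrightarrow> ((%s. torus_diff (path_at om s) (path_at om t) /\<^sub>R (s - t)) \<longlongrightarrow> v) (at t)"
  using has_velocity_cong[OF t] has_velocity_iff_interior[OF t, of "path_at om" v] by blast
 also have "... \<longleftrightarrow> (diff_quotient om t \<longlongrightarrow> v) (at 0)"
  unfolding diff_quotient_def
  using LIM_offset_zero[of "%s. torus_diff (path_at om s) (path_at om t) /\<^sub>R (s - t)" v t]
   LIM_offset_zero_cancel[of "%s. torus_diff (path_at om s) (path_at om t) /\<^sub>R (s - t)" t v]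
  by auto
 finally show ?thesis .
qed

text \<open>Since only the values of \<open>om\<close> enter through a continuous expression, it is enough to test the
 Cauchy criterion for the difference quotients on rational increments.\<close>

lemma isCont_quotient:
 assumes w: "om \<in> paths" and h: "h ~= 0" "dist (path_at om (t + h)) (path_at om t) < 1/2"
 shows "isCont (diff_quotient om t) h"
proof -
 have "isCont (path_at om) (t + h)"
  using continuous_path_at[OF w] by (simp add: continuous_on_eq_continuous_at)
 then have "isCont (%h. path_at om (t + h)) h"
  by (intro isCont_o2[where g = "path_at om" and f = "%h. t + h"]) auto
 then have "((%h. path_at om (t + h)) \<longlongrightarrow> path_at om (t + h)) (at h)" by (simp add: isCont_def)
 then have "((%h. torus_diff (path_at om (t + h)) (path_at om t)) \<longlongrightarrow> torus_diff (path_at om (t + h)) (path_at om t)) (at h)"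
  using h(2) by (intro tendsto_torus_diff) (auto simp: dist_torus_eq)
 then show ?thesis unfolding isCont_def diff_quotient_def by (intro tendsto_intros h(1))
qed

lemma ex_rational_near:
 fixes f :: "real => 'a::metric_space"
 assumes "isCont f h" "e > 0" "h \<in> J" "open J"
 shows "\<exists>r\<in>\<rat>. r \<in> J & dist (f r) (f h) < e"
proof -
 have "eventually (%r. r \<in> J & dist (f r) (f h) < e) (nhds h)"
  using assms by (intro eventually_conj eventually_nhds_in_open tendstoD)
   (auto simp: isCont_def tendsto_at_iff_tendsto_nhds)
 then obtain d where d: "d > 0" "!!r. dist r h < d ==> r \<in> J & dist (f r) (f h) < e"
  by (auto simp: eventually_nhds_metric)
 obtain r where "r \<in> \<rat>" "h < r" "r < h + d" using Rats_dense_in_real[of h "h + d"] d(1) by auto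
 then show ?thesis using d(2)[of r] by (intro bexI[of _ r]) (auto simp: dist_real_def)
qed

definition rational_cauchy :: "(real => 'n::finite torus) => real => bool" where
 "rational_cauchy om t \<longleftrightarrow> (\<forall>k::nat. \<exists>m::nat. \<forall>h\<in>\<rat>. \<forall>h'\<in>\<rat>.
  h ~= 0 & \<bar>h\<bar> < 1 / Suc m & h' ~= 0 & \<bar>h'\<bar> < 1 / Suc m -->
   dist (diff_quotient om t h) (diff_quotient om t h') <= 1 / Suc k)"

lemma has_velocity_imp_rational_cauchy:
 assumes t: "t \<in> {0<..<1}" and v: "has_velocity om v t"
 shows "rational_cauchy om t"
 unfolding rational_cauchy_def
proof
 fix k :: nat
 have lim: "(diff_quotient om t \<longlongrightarrow> v) (at 0)" using v by (simp add: has_velocity_iff_difference[OF t])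
 have "eventually (%h. dist (diff_quotient om t h) v < 1 / Suc k / 2) (at 0)"
  using lim by (rule tendstoD) simp
 then obtain d where d: "d > 0" "!!h. h ~= 0 ==> \<bar>h\<bar> < d ==> dist (diff_quotient om t h) v < 1 / Suc k / 2"
  by (auto simp: eventually_at dist_real_def)
 obtain m where m: "1 / Suc m < d" using nat_approx_posE[OF d(1)] by blast
 show "\<exists>m::nat. \<forall>h\<in>\<rat>. \<forall>h'\<in>\<rat>. h ~= 0 & \<bar>h\<bar> < 1 / Suc m & h' ~= 0 & \<bar>h'\<bar> < 1 / Suc m -->
   dist (diff_quotient om t h) (diff_quotient om t h') <= 1 / Suc k"
 proof (intro exI[of _ m] ballI impI)
  fix h h' assume "h ~= 0 & \<bar>h\<bar> < 1 / Suc m & h' ~= 0 & \<bar>h'\<bar> < 1 / Suc m"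
  then have "h ~= 0" "\<bar>h\<bar> < d" "h' ~= 0" "\<bar>h'\<bar> < d" using m by auto
  then have "dist (diff_quotient om t h) v < 1 / Suc k / 2" "dist (diff_quotient om t h') v < 1 / Suc k / 2"
   using d(2) by blast+
  then show "dist (diff_quotient om t h) (diff_quotient om t h') <= 1 / Suc k"
   using dist_triangle2[of "diff_quotient om t h" "diff_quotient om t h'" v] by linarith
 qed
qed

lemma rational_cauchy_imp_has_velocity:
 assumes w: "om \<in> paths" and t: "t \<in> {0<..<1}" and c: "rational_cauchy om t"
 shows "\<exists>v. has_velocity om v t & (%n. diff_quotient om t (1 / Suc n)) \<longlonglongrightarrow> v"
proof -
 have "isCont (path_at om) t"
  using continuous_path_at[OF w] by (simp add: continuous_on_eq_continuous_at)
 then obtain d where d: "d > 0" "!!s. dist s t < d ==> dist (path_at om s) (path_at om t) < 1/2"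
  unfolding continuous_at_eps_delta by (metis half_gt_zero_iff zero_less_one)
 have all: "\<exists>e>0. \<forall>h h'. h ~= 0 & \<bar>h\<bar> < e & h' ~= 0 & \<bar>h'\<bar> < e -->
   dist (diff_quotient om t h) (diff_quotient om t h') <= 1 / Suc k" for k
 proof -
  obtain m :: nat where m: "!!h h'. h \<in> \<rat> ==> h' \<in> \<rat> ==> h ~= 0 & \<bar>h\<bar> < 1 / Suc m & h' ~= 0 & \<bar>h'\<bar> < 1 / Suc m ==>
   dist (diff_quotient om t h) (diff_quotient om t h') <= 1 / Suc k"
   using c unfolding rational_cauchy_def by meson
  define e where "e = min d (1 / Suc m)"
  define J where "J = {-e<..<e} - {0}"
  have J: "open J" unfolding J_def by auto
  have "dist (diff_quotient om t h) (diff_quotient om t h') <= 1 / Suc k" if h: "h \<in> J" "h' \<in> J" for h h'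
  proof (rule field_le_epsilon)
   fix ep :: real assume "ep > 0"
   have "isCont (diff_quotient om t) h" "isCont (diff_quotient om t) h'"
    using h by (auto intro!: isCont_quotient[OF w] d(2) simp: J_def e_def dist_real_def)
   then obtain r r' where r: "r \<in> \<rat>" "r \<in> J" "dist (diff_quotient om t r) (diff_quotient om t h) < ep/2"
    "r' \<in> \<rat>" "r' \<in> J" "dist (diff_quotient om t r') (diff_quotient om t h') < ep/2"
    using ex_rational_near[where f = "diff_quotient om t" and h = h and e = "ep/2" and J = J]
     ex_rational_near[where f = "diff_quotient om t" and h = h' and e = "ep/2" and J = J] h J \<open>ep > 0\<close>
    by (meson half_gt_zero)
   have "dist (diff_quotient om t r) (diff_quotient om t r') <= 1 / Suc k"
    using r by (intro m) (auto simp: J_def e_def)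
   then show "dist (diff_quotient om t h) (diff_quotient om t h') <= 1 / Suc k + ep"
    using r(3,6) dist_triangle[of "diff_quotient om t h" "diff_quotient om t h'" "diff_quotient om t r"]
     dist_triangle[of "diff_quotient om t r" "diff_quotient om t h'" "diff_quotient om t r'"]
     dist_commute[of "diff_quotient om t h" "diff_quotient om t r"] by linarith
  qed
  then show ?thesis
  proof -
   have "h \<in> J" if "h ~= 0" "\<bar>h\<bar> < e" for h using that by (auto simp: J_def)
   moreover have "e > 0" using d(1) by (simp add: e_def)
   ultimately show ?thesis using \<open>!!h h'. h \<in> J ==> h' \<in> J ==> dist (diff_quotient om t h) (diff_quotient om t h') <= 1 / Suc k\<close>
    by blast
  qed
 qed
 have small: "eventually (%n. 1 / real (Suc n) < e) sequentially" if "e > 0" for e :: real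
 proof -
  have "(%n. 1 / real (Suc n)) \<longlonglongrightarrow> 0" by (rule LIMSEQ_Suc[OF lim_inverse_n', unfolded])
  then show ?thesis using that by (rule order_tendstoD)
 qed
 have "Cauchy (%n. diff_quotient om t (1 / Suc n))"
 proof (rule metric_CauchyI)
  fix ep :: real assume "ep > 0"
  obtain k where k: "1 / Suc k < ep" using nat_approx_posE[OF \<open>ep > 0\<close>] by blast
  obtain e where e: "e > 0" "!!h h'. h ~= 0 & \<bar>h\<bar> < e & h' ~= 0 & \<bar>h'\<bar> < e ==>
   dist (diff_quotient om t h) (diff_quotient om t h') <= 1 / Suc k" using all[of k] by blast
  obtain N where N: "!!n. n >= N ==> 1 / real (Suc n) < e" using small[OF e(1)] by (auto simp: eventually_sequentially)
  have "dist (diff_quotient om t (1 / Suc n)) (diff_quotient om t (1 / Suc n')) < ep" if "n >= N" "n' >= N" for n n'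
   using e(2)[of "1 / Suc n" "1 / Suc n'"] N[OF that(1)] N[OF that(2)] k by simp
  then show "\<exists>M. \<forall>m\<ge>M. \<forall>n\<ge>M. dist (diff_quotient om t (1 / Suc m)) (diff_quotient om t (1 / Suc n)) < ep" by blast
 qed
 then obtain v where v: "(%n. diff_quotient om t (1 / Suc n)) \<longlonglongrightarrow> v"
  using Cauchy_convergent_iff convergent_def by blast
 have "(diff_quotient om t \<longlongrightarrow> v) (at 0)"
 proof (rule tendstoI)
  fix ep :: real assume "ep > 0"
  obtain k where k: "1 / Suc k < ep" using nat_approx_posE[OF \<open>ep > 0\<close>] by blast
  obtain e where e: "e > 0" "!!h h'. h ~= 0 & \<bar>h\<bar> < e & h' ~= 0 & \<bar>h'\<bar> < e ==>
   dist (diff_quotient om t h) (diff_quotient om t h') <= 1 / Suc k" using all[of k] by blast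
  have "dist (diff_quotient om t h) v < ep" if "h ~= 0" "\<bar>h\<bar> < e" for h
  proof -
   have "eventually (%n. dist (diff_quotient om t h) (diff_quotient om t (1 / Suc n)) <= 1 / Suc k) sequentially"
    using small[OF e(1)] by eventually_elim (rule e(2), use that in auto)
   moreover have "(%n. dist (diff_quotient om t h) (diff_quotient om t (1 / Suc n))) \<longlonglongrightarrow> dist (diff_quotient om t h) v"
    by (intro tendsto_intros v)
   ultimately have "dist (diff_quotient om t h) v <= 1 / Suc k"
    by (intro tendsto_upperbound) auto
   then show ?thesis using k by linarith
  qed
  then show "eventually (%h. dist (diff_quotient om t h) v < ep) (at 0)"
   unfolding eventually_at using e(1) by (intro exI[of _ e]) (auto simp: dist_real_def)
 qed
 then show ?thesis using v has_velocity_iff_difference[OF t] by blast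
qed

lemma velocity_eq_lim:
 assumes w: "om \<in> paths" and t: "t \<in> {0<..<1}"
 shows "velocity om t = (if rational_cauchy om t then lim (%n. diff_quotient om t (1 / Suc n)) else 0)"
proof (cases "rational_cauchy om t")
 case True
 then obtain v where "has_velocity om v t" "(%n. diff_quotient om t (1 / Suc n)) \<longlonglongrightarrow> v"
  using rational_cauchy_imp_has_velocity[OF w t] by blast
 then show ?thesis using True velocity_eq[OF t] limI by metis
next
 case False
 then show ?thesis using has_velocity_imp_rational_cauchy[OF t] by (auto intro: velocity_eq_0)
qed

lemma measurable_quotient_pair [measurable]:
 "(%z :: (real => 'n::finite torus) \<times> real. diff_quotient (fst z) (snd z) h) : borel_measurable (path_borel \<Otimes>\<^sub>M borel)"
 unfolding diff_quotient_def by measurable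

definition velocity01 :: "(real => 'n::finite torus) => real => real ^ 'n" where
 "velocity01 om t = (if t \<in> {0<..<1} then velocity om t else 0)"

lemma pred_countable_Ball:
 assumes "countable S" "!!i. i \<in> S ==> Measurable.pred M (P i)"
 shows "Measurable.pred M (%x. \<forall>i\<in>S. P i x)"
proof (cases "S = {}")
 case False
 have "{x \<in> space M. \<forall>i\<in>S. P i x} = (\<Inter>i\<in>S. {x \<in> space M. P i x})" using False by auto
 also have "... \<in> sets M"
  using assms False by (intro sets.countable_INT') (auto simp: pred_def)
 finally show ?thesis by (simp add: pred_def)
qed simp

text \<open>Having a velocity is a Cauchy condition on rational increments, hence a countable combination of measurable conditions.\<close>

lemma measurable_velocity01_pair:
 "(%z :: (real => 'n::finite torus) \<times> real. velocity01 (fst z) (snd z)) : borel_measurable (path_borel \<Otimes>\<^sub>M borel)"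
proof -
 have [measurable]: "Measurable.pred (path_borel \<Otimes>\<^sub>M borel) (%z :: (real => 'n torus) \<times> real. rational_cauchy (fst z) (snd z))"
  unfolding rational_cauchy_def
  by (intro pred_intros_countable pred_countable_Ball countable_rat) measurable
 have "(%z :: (real => 'n torus) \<times> real. if snd z \<in> {0<..<1} then
   if rational_cauchy (fst z) (snd z) then lim (%n. diff_quotient (fst z) (snd z) (1 / Suc n)) else 0 else 0)
  : borel_measurable (path_borel \<Otimes>\<^sub>M borel)"
  by measurable
 then show ?thesis
  by (rule measurable_cong[THEN iffD1, rotated])
   (auto simp: velocity01_def velocity_eq_lim space_pair_measure)
qed

lemma measurable_velocity01 [measurable (raw)]:
 assumes [measurable]: "f \<in> M \<rightarrow>\<^sub>M path_borel" "g : borel_measurable M"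
 shows "(%x. velocity01 (f x) (g x)) : borel_measurable M"
 using measurable_compose[OF measurable_Pair[OF assms] measurable_velocity01_pair] by simp

section \<open>Absolute continuity\<close>

definition interval_family :: "(real \<times> real) set => real => bool" where
 "interval_family I dl \<longleftrightarrow> finite I & (\<forall>(a, b)\<in>I. 0 <= a & a <= b & b <= 1) &
  disjoint_family_on (%(a, b). {a<..<b}) I & (\<Sum>(a, b)\<in>I. b - a) < dl"

text \<open>The definition in terms of \<open>interval_family\<close>; with rational end points there are countably many families to test.\<close>

lemma absolutely_continuous_curve_alt:
 "absolutely_continuous_curve om \<longleftrightarrow> (\<forall>ep>0. \<exists>dl>0. \<forall>I. interval_family I dl --> (\<Sum>(a, b)\<in>I. dist (om a) (om b)) < ep)"
 by (simp add: absolutely_continuous_curve_def interval_family_def)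

text \<open>Moving the endpoints of the nondegenerate intervals of a family inwards to rational points.\<close>

lemma rational_interval_family:
 assumes w: "om \<in> paths" and I: "interval_family I dl" and e: "e > 0"
 obtains J where "J \<subseteq> \<rat> \<times> \<rat>" "interval_family J dl"
  "(\<Sum>(a, b)\<in>I. dist (om a) (om b)) <= (\<Sum>(a, b)\<in>J. dist (om a) (om b)) + e"
proof -
 have fin: "finite I" using I by (simp add: interval_family_def)
 define I' where "I' = {x\<in>I. fst x < snd x}"
 have fin': "finite I'" using fin by (simp add: I'_def)
 define \<eta> where "\<eta> = e / (2 * (card I' + 1))"
 have "\<eta> > 0" using e by (simp add: \<eta>_def)
 have "\<exists>y. fst y \<in> \<rat> & snd y \<in> \<rat> & fst x < fst y & fst y < snd y & snd y < snd x &
   dist (om (fst x)) (om (fst y)) < \<eta> & dist (om (snd x)) (om (snd y)) < \<eta>" if "x \<in> I'" for x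
 proof -
  obtain a b where x: "x = (a, b)" by fastforce
  have ab: "0 <= a" "a < b" "b <= 1" using that I x by (auto simp: I'_def interval_family_def)
  obtain d where d: "d > 0" "!!s t. s \<in> {0..1} ==> t \<in> {0..1} ==> \<bar>s - t\<bar> < d ==> dist (om s) (om t) < \<eta>"
   using path_uniformly_continuous[OF w \<open>\<eta> > 0\<close>] by blast
  obtain a' where a': "a' \<in> \<rat>" "a < a'" "a' < min (a + d) ((a + b)/2)"
   using Rats_dense_in_real[of a "min (a + d) ((a + b)/2)"] ab d by auto
  obtain b' where b': "b' \<in> \<rat>" "max (b - d) ((a + b)/2) < b'" "b' < b"
   using Rats_dense_in_real[of "max (b - d) ((a + b)/2)" b] ab d by auto
  have "a' < b'" "b' < b" using a' b' by linarith+
  then show ?thesis using a' b' ab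
   by (intro exI[of _ "(a', b')"]) (auto simp: x intro!: d(2))
 qed
 then obtain r where r: "!!x. x \<in> I' ==> fst (r x) \<in> \<rat> & snd (r x) \<in> \<rat> & fst x < fst (r x) &
   fst (r x) < snd (r x) & snd (r x) < snd x &
   dist (om (fst x)) (om (fst (r x))) < \<eta> & dist (om (snd x)) (om (snd (r x))) < \<eta>"
  by metis
 have sub: "I' \<subseteq> I" by (auto simp: I'_def)
 have disj: "{fst x<..<snd x} \<inter> {fst y<..<snd y} = {}" if "x \<in> I'" "y \<in> I'" "x ~= y" for x y
  using I that sub unfolding interval_family_def disjoint_family_on_def
  by (metis (no_types, lifting) case_prod_beta subsetD)
 have inj: "inj_on r I'"
 proof (rule inj_onI, rule ccontr)
  fix x y assume xy: "x \<in> I'" "y \<in> I'" "r x = r y" "x ~= y"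
  have "fst (r x) \<in> {fst x<..<snd x} \<inter> {fst y<..<snd y}"
   using r[OF xy(1)] r[OF xy(2)] xy(3) by auto
  then show False using disj xy by blast
 qed
 show ?thesis
 proof (rule that)
  show "r ` I' \<subseteq> \<rat> \<times> \<rat>" using r by (intro image_subsetI) (simp add: mem_Times_iff)
  have "(\<Sum>(a, b)\<in>r ` I'. b - a) = (\<Sum>x\<in>I'. snd (r x) - fst (r x))"
   by (simp add: sum.reindex[OF inj] case_prod_beta)
  also have "... <= (\<Sum>x\<in>I'. snd x - fst x)" using r by (intro sum_mono) fastforce
  also have "... <= (\<Sum>x\<in>I. snd x - fst x)"
   using sub fin I by (intro sum_mono2) (auto simp: interval_family_def)
  also have "... < dl" using I by (simp add: interval_family_def case_prod_beta)
  finally have len: "(\<Sum>(a, b)\<in>r ` I'. b - a) < dl" .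
  have "disjoint_family_on (%(a, b). {a<..<b}) (r ` I')"
   unfolding disjoint_family_on_def
  proof (intro ballI impI)
   fix u v assume "u \<in> r ` I'" "v \<in> r ` I'" "u ~= v"
   then obtain x y where xy: "x \<in> I'" "y \<in> I'" "u = r x" "v = r y" "x ~= y" by auto
   have "{fst (r x)<..<snd (r x)} \<subseteq> {fst x<..<snd x}" "{fst (r y)<..<snd (r y)} \<subseteq> {fst y<..<snd y}"
    using r[OF xy(1)] r[OF xy(2)] by auto
   then show "(case u of (a, b) => {a<..<b}) \<inter> (case v of (a, b) => {a<..<b}) = {}"
    using disj[OF xy(1,2,5)] unfolding xy(3,4) case_prod_beta by blast
  qed
  moreover have "\<forall>(a, b)\<in>r ` I'. 0 <= a & a <= b & b <= 1"
  proof -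
   have "0 <= fst (r x) & fst (r x) <= snd (r x) & snd (r x) <= 1" if "x \<in> I'" for x
   proof -
    have "0 <= fst x" "snd x <= 1" using that sub I by (auto simp: interval_family_def dest!: bspec[of I _ x])
    then show ?thesis using r[OF that] by auto
   qed
   then show ?thesis by (auto simp: case_prod_beta)
  qed
  ultimately show "interval_family (r ` I') dl"
   using fin' len by (simp add: interval_family_def)
  have "(\<Sum>(a, b)\<in>I. dist (om a) (om b)) = (\<Sum>x\<in>I'. dist (om (fst x)) (om (snd x)))"
   unfolding case_prod_beta
  proof (rule sum.mono_neutral_right[OF fin sub])
   show "\<forall>i\<in>I - I'. dist (om (fst i)) (om (snd i)) = 0"
    using I by (force simp: I'_def interval_family_def)
  qed
  also have "... <= (\<Sum>x\<in>I'. dist (om (fst (r x))) (om (snd (r x))) + 2 * \<eta>)"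
  proof (rule sum_mono)
   fix x assume "x \<in> I'"
   show "dist (om (fst x)) (om (snd x)) <= dist (om (fst (r x))) (om (snd (r x))) + 2 * \<eta>"
    using r[OF \<open>x \<in> I'\<close>] dist_triangle[of "om (fst x)" "om (snd x)" "om (fst (r x))"]
     dist_triangle2[of "om (fst (r x))" "om (snd x)" "om (snd (r x))"]
    by linarith
  qed
  also have "... = (\<Sum>(a, b)\<in>r ` I'. dist (om a) (om b)) + card I' * (2 * \<eta>)"
   by (simp add: sum.reindex[OF inj] case_prod_beta sum.distrib)
  also have "card I' * (2 * \<eta>) <= e" using e by (simp add: \<eta>_def field_simps)
  finally show "(\<Sum>(a, b)\<in>I. dist (om a) (om b)) <= (\<Sum>(a, b)\<in>r ` I'. dist (om a) (om b)) + e" by simp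
 qed
qed

lemma absolutely_continuous_curve_rational:
 assumes w: "om \<in> paths"
 shows "absolutely_continuous_curve om \<longleftrightarrow>
  (\<forall>k::nat. \<exists>m::nat. \<forall>I\<in>{I. I \<subseteq> \<rat> \<times> \<rat> & interval_family I (1 / Suc m)}. (\<Sum>(a, b)\<in>I. dist (path_at om a) (path_at om b)) <= 1 / Suc k)"
  (is "_ \<longleftrightarrow> ?R")
proof -
 have pa: "(\<Sum>(a, b)\<in>I. dist (path_at om a) (path_at om b)) = (\<Sum>(a, b)\<in>I. dist (om a) (om b))"
  if "interval_family I dl" for I dl
  using that by (intro sum.cong) (auto simp: interval_family_def path_at_eq)
 show ?thesis
 proof
  assume ac: "absolutely_continuous_curve om"
  show ?R
  proof
   fix k :: nat
   obtain dl where dl: "dl > 0" "!!I. interval_family I dl ==> (\<Sum>(a, b)\<in>I. dist (om a) (om b)) < 1 / Suc k"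
    using ac unfolding absolutely_continuous_curve_alt by (metis of_nat_0_less_iff zero_less_Suc zero_less_divide_1_iff)
   obtain m where m: "1 / Suc m < dl" using nat_approx_posE[OF dl(1)] by blast
   show "\<exists>m::nat. \<forall>I\<in>{I. I \<subseteq> \<rat> \<times> \<rat> & interval_family I (1 / Suc m)}. (\<Sum>(a, b)\<in>I. dist (path_at om a) (path_at om b)) <= 1 / Suc k"
   proof (intro exI[of _ m] ballI)
    fix I assume "I \<in> {I. I \<subseteq> \<rat> \<times> \<rat> & interval_family I (1 / Suc m)}"
    then have i: "interval_family I (1 / Suc m)" by simp
    then have "interval_family I dl" using m by (auto simp: interval_family_def)
    from dl(2)[OF this] show "(\<Sum>(a, b)\<in>I. dist (path_at om a) (path_at om b)) <= 1 / Suc k"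
     by (simp add: pa[OF i])
   qed
  qed
 next
  assume R: ?R
  show "absolutely_continuous_curve om"
   unfolding absolutely_continuous_curve_alt
  proof (intro allI impI)
   fix ep :: real assume "ep > 0"
   obtain k where k: "1 / Suc k < ep / 2" using nat_approx_posE[of "ep/2"] \<open>ep > 0\<close> by auto
   obtain m :: nat where m: "!!I. I \<subseteq> \<rat> \<times> \<rat> ==> interval_family I (1 / Suc m) ==>
     (\<Sum>(a, b)\<in>I. dist (path_at om a) (path_at om b)) <= 1 / Suc k"
    using R by blast
   show "\<exists>dl>0. \<forall>I. interval_family I dl --> (\<Sum>(a, b)\<in>I. dist (om a) (om b)) < ep"
   proof (intro exI[of _ "1 / Suc m"] conjI allI impI)
    fix I assume I: "interval_family I (1 / Suc m)"
    have "ep / 4 > 0" using \<open>ep > 0\<close> by simp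
    from rational_interval_family[OF w I this] obtain J where J: "J \<subseteq> \<rat> \<times> \<rat>" "interval_family J (1 / Suc m)"
     "(\<Sum>(a, b)\<in>I. dist (om a) (om b)) <= (\<Sum>(a, b)\<in>J. dist (om a) (om b)) + ep / 4" by blast
    then show "(\<Sum>(a, b)\<in>I. dist (om a) (om b)) < ep"
     using m[OF J(1,2)] pa[OF J(2)] k \<open>ep > 0\<close> by linarith
   qed simp
  qed
 qed
qed

lemma pred_absolutely_continuous_curve [measurable]:
 "Measurable.pred path_borel (absolutely_continuous_curve :: (real => 'n::finite torus) => bool)"
proof -
 have c: "countable {I. I \<subseteq> \<rat> \<times> \<rat> & interval_family I dl}" for dl
  by (rule countable_subset[OF _ countable_Collect_finite_subset[of "\<rat> \<times> \<rat>"]])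
   (auto simp: interval_family_def countable_rat)
 have "Measurable.pred path_borel (%om :: real => 'n torus. \<forall>k::nat. \<exists>m::nat. \<forall>I\<in>{I. I \<subseteq> \<rat> \<times> \<rat> & interval_family I (1 / Suc m)}. (\<Sum>(a, b)\<in>I. dist (path_at om a) (path_at om b)) <= 1 / Suc k)"
  unfolding case_prod_beta
  by (intro pred_intros_countable pred_countable_Ball c) measurable
 then show ?thesis
  by (rule measurable_cong[THEN iffD1, rotated]) (simp add: absolutely_continuous_curve_rational)
qed

definition kinetic :: "(real => 'n::finite torus) => ennreal" where
 "kinetic om = (\<integral>\<^sup>+t. ennreal (1 / 2 * (norm (velocity01 om t))\<^sup>2) \<partial>lborel)"

lemma curve_action_alt: "curve_action om = (if absolutely_continuous_curve om then kinetic om else \<infinity>)"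
proof -
 have "(\<integral>\<^sup>+t\<in>{0..1}. ennreal (1 / 2 * (norm (velocity om t))\<^sup>2) \<partial>lborel) = kinetic om"
  unfolding kinetic_def
 proof (rule nn_integral_cong_AE)
  have "AE t in lborel. t \<notin> {0, 1::real}"
   by (rule AE_not_in, rule countable_imp_null_set_lborel) auto
  then show "AE t in lborel. ennreal (1 / 2 * (norm (velocity om t))\<^sup>2) * indicator {0..1} t
   = ennreal (1 / 2 * (norm (velocity01 om t))\<^sup>2)"
   by eventually_elim (auto simp: velocity01_def split: split_indicator)
 qed
 then show ?thesis by (simp add: curve_action_def)
qed

lemma measurable_kinetic [measurable]: "kinetic : borel_measurable path_borel"
 unfolding kinetic_def by measurable

lemma measurable_curve_action [measurable]: "curve_action : borel_measurable path_borel"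
 unfolding curve_action_alt by measurable

section \<open>Paths under changes of time and displacements\<close>

lemma absolutely_continuous_curve_transform:
 assumes ac: "absolutely_continuous_curve om" and C: "C > 0"
  and mono: "!!a b. 0 <= a ==> a <= b ==> b <= 1 ==> 0 <= \<tau> a & \<tau> a <= \<tau> b & \<tau> b <= 1"
  and lip: "!!a b. 0 <= a ==> a <= b ==> b <= 1 ==> \<tau> b - \<tau> a <= C * (b - a)"
  and d: "!!a b. 0 <= a ==> a <= b ==> b <= 1 ==> dist (om' a) (om' b) <= C * (dist (om (\<tau> a)) (om (\<tau> b)) + (b - a))"
 shows "absolutely_continuous_curve om'"
 unfolding absolutely_continuous_curve_alt
proof (intro allI impI)
 fix ep :: real assume "ep > 0"
 then have "ep / (2 * C) > 0" using C by simp
 then obtain dl where dl: "dl > 0" "!!I. interval_family I dl ==> (\<Sum>(a, b)\<in>I. dist (om a) (om b)) < ep / (2 * C)"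
  using ac unfolding absolutely_continuous_curve_alt by blast
 define dl' where "dl' = min (dl / C) (ep / (2 * C))"
 have "(\<Sum>(a, b)\<in>I. dist (om' a) (om' b)) < ep" if I: "interval_family I dl'" for I
 proof -
  have fin: "finite I" and len: "(\<Sum>x\<in>I. snd x - fst x) < dl'"
   and bd: "!!x. x \<in> I ==> 0 <= fst x & fst x <= snd x & snd x <= 1"
   using I by (auto simp: interval_family_def case_prod_beta)
  have disj: "{fst x<..<snd x} \<inter> {fst y<..<snd y} = {}" if "x \<in> I" "y \<in> I" "x ~= y" for x y
   using I that unfolding interval_family_def disjoint_family_on_def case_prod_beta by blast
  define I' where "I' = {x\<in>I. \<tau> (fst x) < \<tau> (snd x)}"
  define r where "r x = (\<tau> (fst x), \<tau> (snd x))" for x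
  have sub: "I' \<subseteq> I" and fin': "finite I'" using fin by (auto simp: I'_def)
  have lt: "fst x < snd x" if "x \<in> I'" for x
   using that bd[of x] by (cases "fst x = snd x") (auto simp: I'_def)
  have ord: "\<tau> (snd x) <= \<tau> (fst y) \<or> \<tau> (snd y) <= \<tau> (fst x)" if "x \<in> I'" "y \<in> I'" "x ~= y" for x y
  proof -
   have "{fst x<..<snd x} \<inter> {fst y<..<snd y} = {}" using disj that sub by blast
   then have "snd x <= fst y \<or> snd y <= fst x"
    using lt[OF that(1)] lt[OF that(2)] by (auto simp: min_def max_def split: if_splits)
   moreover have "0 <= snd x" "0 <= snd y" "fst x <= 1" "fst y <= 1"
    using bd[of x] bd[of y] that sub by auto
   ultimately show ?thesis using mono by blast
  qed
  have inj: "inj_on r I'"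
  proof (rule inj_onI, rule ccontr)
   fix x y assume xy: "x \<in> I'" "y \<in> I'" "r x = r y" "x ~= y"
   have "\<tau> (fst x) < \<tau> (snd x)" "\<tau> (fst y) < \<tau> (snd y)" using xy by (auto simp: I'_def)
   then show False using ord[OF xy(1,2,4)] xy(3) by (auto simp: r_def)
  qed
  have "interval_family (r ` I') dl"
   unfolding interval_family_def
  proof (intro conjI)
   show "finite (r ` I')" using fin' by simp
   have "!!x. x \<in> I' ==> 0 <= \<tau> (fst x) & \<tau> (fst x) <= \<tau> (snd x) & \<tau> (snd x) <= 1"
    using mono bd sub by blast
   then show "\<forall>(a, b)\<in>r ` I'. 0 <= a & a <= b & b <= 1" by (auto simp: r_def)
   show "disjoint_family_on (%(a, b). {a<..<b}) (r ` I')"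
    unfolding disjoint_family_on_def
   proof (intro ballI impI)
    fix u v assume "u \<in> r ` I'" "v \<in> r ` I'" "u ~= v"
    then obtain x y where xy: "x \<in> I'" "y \<in> I'" "u = r x" "v = r y" "x ~= y" by auto
    then show "(case u of (a, b) => {a<..<b}) \<inter> (case v of (a, b) => {a<..<b}) = {}"
     using ord[OF xy(1,2,5)] by (auto simp: r_def)
   qed
   have "(\<Sum>(a, b)\<in>r ` I'. b - a) = (\<Sum>x\<in>I'. \<tau> (snd x) - \<tau> (fst x))"
    by (subst sum.reindex[OF inj]) (simp add: r_def)
   also have "... <= (\<Sum>x\<in>I'. C * (snd x - fst x))" using lip bd sub by (intro sum_mono) blast
   also have "... <= (\<Sum>x\<in>I. C * (snd x - fst x))"
    using sub fin bd C by (intro sum_mono2) auto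
   also have "... = C * (\<Sum>x\<in>I. snd x - fst x)" by (simp add: sum_distrib_left)
   also have "... < C * dl'" using len C by simp
   also have "... <= dl" using C by (simp add: dl'_def min_def field_simps)
   finally show "(\<Sum>(a, b)\<in>r ` I'. b - a) < dl" .
  qed
  from dl(2)[OF this] have J: "(\<Sum>x\<in>I'. dist (om (\<tau> (fst x))) (om (\<tau> (snd x)))) < ep / (2 * C)"
   by (subst (asm) sum.reindex[OF inj]) (simp add: r_def)
  have "(\<Sum>(a, b)\<in>I. dist (om' a) (om' b)) <= (\<Sum>x\<in>I. C * (dist (om (\<tau> (fst x))) (om (\<tau> (snd x))) + (snd x - fst x)))"
   unfolding case_prod_beta using d bd by (intro sum_mono) blast
  also have "... = C * ((\<Sum>x\<in>I. dist (om (\<tau> (fst x))) (om (\<tau> (snd x)))) + (\<Sum>x\<in>I. snd x - fst x))"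
   by (simp only: sum_distrib_left sum.distrib distrib_left)
  also have "(\<Sum>x\<in>I. dist (om (\<tau> (fst x))) (om (\<tau> (snd x)))) = (\<Sum>x\<in>I'. dist (om (\<tau> (fst x))) (om (\<tau> (snd x))))"
  proof (rule sum.mono_neutral_right[OF fin sub], rule ballI)
   fix x assume "x \<in> I - I'"
   then have "\<tau> (fst x) = \<tau> (snd x)" using mono[of "fst x" "snd x"] bd[of x] by (auto simp: I'_def)
   then show "dist (om (\<tau> (fst x))) (om (\<tau> (snd x))) = 0" by simp
  qed
  also have "C * (... + (\<Sum>x\<in>I. snd x - fst x)) < C * (ep / (2 * C) + ep / (2 * C))"
   using J len C by (intro mult_strict_left_mono add_strict_mono) (auto simp: dl'_def)
  also have "... = ep" using C by (simp add: field_simps)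
  finally show ?thesis .
 qed
 moreover have "dl' > 0" using dl(1) C \<open>ep > 0\<close> by (simp add: dl'_def)
 ultimately show "\<exists>dl>0. \<forall>I. interval_family I dl --> (\<Sum>(a, b)\<in>I. dist (om' a) (om' b)) < ep" by blast
qed

lemma torus_diff_shift_same [simp]: "torus_diff (X \<oplus> v) (Y \<oplus> v) = torus_diff X Y"
 by (simp add: torus_shift_rep torus_diff_abs) (simp add: torus_diff_def)

lemma torus_shift_minus [simp]: "X \<oplus> v \<oplus> (- v) = X"
 by (simp add: torus_shift_assoc)

lemma has_velocity_affine:
 assumes t: "t \<in> {0<..<1}" "m * (t - c) \<in> {0<..<1}" "m > 0"
  and eq: "eventually (%s. om' s = om (m * (s - c)) \<oplus> y) (nhds t)"
  and v: "has_velocity om v (m * (t - c))"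
 shows "has_velocity om' (m *\<^sub>R v) t"
proof -
 have "((%s. torus_diff (om s) (om (m * (t - c))) /\<^sub>R (s - m * (t - c))) \<longlongrightarrow> v) (at (m * (t - c)))"
  using v has_velocity_iff_interior[OF t(2)] by blast
 moreover have "filterlim (%s. m * (s - c)) (at (m * (t - c))) (at t)"
  using t(3) by (intro filterlim_atI tendsto_intros) (auto simp: eventually_at_filter)
 ultimately have "((%s. torus_diff (om (m * (s - c))) (om (m * (t - c))) /\<^sub>R (m * (s - c) - m * (t - c))) \<longlongrightarrow> v) (at t)"
  by (rule filterlim_compose)
 then have "((%s. m *\<^sub>R (torus_diff (om (m * (s - c))) (om (m * (t - c))) /\<^sub>R (m * (s - c) - m * (t - c)))) \<longlongrightarrow> m *\<^sub>R v) (at t)"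
  by (intro tendsto_intros)
 moreover have "m *\<^sub>R (torus_diff (om (m * (s - c))) (om (m * (t - c))) /\<^sub>R (m * (s - c) - m * (t - c)))
  = torus_diff (om (m * (s - c)) \<oplus> y) (om (m * (t - c)) \<oplus> y) /\<^sub>R (s - t)" for s
 proof -
  have "m * (s - c) - m * (t - c) = m * (s - t)" by (simp add: algebra_simps)
  then show ?thesis using t(3) by simp
 qed
 ultimately have "has_velocity (%s. om (m * (s - c)) \<oplus> y) (m *\<^sub>R v) t"
  unfolding has_velocity_iff_interior[OF t(1)] by (simp only:)
 then show ?thesis using has_velocity_cong[OF t(1) eq] by simp
qed

text \<open>The chain rule for an affine change of time, with a constant displacement in space. It also covers paths without a velocity, where both sides are 0.\<close>

lemma velocity_affine:
 assumes t: "t \<in> {0<..<1}" "m * (t - c) \<in> {0<..<1}" "m > 0"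
  and eq: "eventually (%s. om' s = om (m * (s - c)) \<oplus> y) (nhds t)"
 shows "velocity om' t = m *\<^sub>R velocity om (m * (t - c))"
proof (cases "\<exists>v. has_velocity om v (m * (t - c))")
 case True
 then obtain v where v: "has_velocity om v (m * (t - c))" by blast
 from has_velocity_affine[OF t eq v] have "has_velocity om' (m *\<^sub>R v) t" .
 then show ?thesis using velocity_eq[OF t(2) v] velocity_eq[OF t(1)] by simp
next
 case False
 define t' where "t' = m * (t - c)"
 have inv: "(1 / m) * (t' - (- (m * c))) = t" using t(3) by (simp add: t'_def field_simps)
 have "filterlim (%s. (1 / m) * (s - (- (m * c)))) (nhds t) (nhds t')"
 proof -
  have "((%s. (1 / m) * (s - (- (m * c)))) \<longlongrightarrow> (1 / m) * (t' - (- (m * c)))) (nhds t')"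
   by (intro tendsto_intros filterlim_ident)
  then show ?thesis unfolding inv .
 qed
 from eventually_compose_filterlim[OF eq this]
 have "eventually (%s. om s = om' ((1 / m) * (s - (- (m * c)))) \<oplus> (- y)) (nhds t')"
  by eventually_elim (use t(3) in "simp add: field_simps")
 then have "has_velocity om ((1 / m) *\<^sub>R v) t'" if "has_velocity om' v t" for v
  using t that inv by (intro has_velocity_affine[where om = om' and c = "- (m * c)" and y = "- y" and m = "1 / m"])
   (auto simp: t'_def)
 then have "\<not> has_velocity om' v t" for v using False by (auto simp: t'_def)
 then show ?thesis using False by (simp add: velocity_eq_0)
qed

lemma velocity_shift_curve:
 assumes t: "t \<in> {0<..<1}" and eq: "eventually (%s. om' s = X \<oplus> \<beta> s) (nhds t)"
  and d: "(\<beta> has_vector_derivative v) (at t)"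
 shows "velocity om' t = v"
proof -
 have "has_velocity (%s. X \<oplus> \<beta> s) v t"
  unfolding has_velocity_def
 proof (intro exI conjI ballI)
  show "abs_torus (rep X + \<beta> s) = X \<oplus> \<beta> s" for s by (simp add: torus_shift_rep)
  have "((%s. rep X + \<beta> s) has_vector_derivative 0 + v) (at t within {0..1})"
   using has_vector_derivative_at_within[OF d] by (intro has_vector_derivative_add has_vector_derivative_const)
  then show "((%s. rep X + \<beta> s) has_vector_derivative v) (at t within {0..1})" by simp
 qed
 then have "has_velocity om' v t" using has_velocity_cong[OF t eq] by simp
 then show ?thesis by (rule velocity_eq[OF t])
qed

lemma has_vector_derivative_eventually_eq:
 assumes "(f has_vector_derivative v) (at t)" "eventually (%s. f s = g s) (nhds t)"
 shows "(g has_vector_derivative v) (at t)"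
proof -
 have "eventually (%s. s \<in> UNIV --> f s = g s) (nhds t)" using assms(2) by simp
 from has_vector_derivative_cong_ev[OF this eventually_nhds_x_imp_x[OF assms(2)]] assms(1)
 show ?thesis by blast
qed

section \<open>Periodic functions of time and space\<close>

text \<open>Periodicity in space makes \<open>U\<close> well defined on the torus, whatever representatives are chosen.\<close>

definition periodic_C1 :: "(real \<times> (real ^ 'n) => 'b::real_normed_vector) => (real \<times> (real ^ 'n) => real \<times> (real ^ 'n) => 'b) => real => bool" where
 "periodic_C1 U U' K \<longleftrightarrow> (\<forall>z. (U has_derivative U' z) (at z)) &
  (\<forall>t x y. lattice_rel x y --> U (t, x) = U (t, y)) &
  (\<forall>z. norm (U z) <= K) & (\<forall>z h. norm (U' z h) <= K * norm h)"

lemma periodic_C1D: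
 assumes "periodic_C1 U U' K"
 shows "(U has_derivative U' z) (at z)" "lattice_rel x y ==> U (t, x) = U (t, y)"
  "norm (U z) <= K" "norm (U' z h) <= K * norm h" "bounded_linear (U' z)" "K >= 0"
proof -
 show d: "(U has_derivative U' z) (at z)" and "lattice_rel x y ==> U (t, x) = U (t, y)"
  and n: "norm (U z) <= K" and "norm (U' z h) <= K * norm h"
  using assms unfolding periodic_C1_def by blast+
 show "bounded_linear (U' z)" using d by (rule has_derivative_bounded_linear)
 show "K >= 0" using n norm_ge_zero[of "U z"] by linarith
qed

lemma periodic_C1_lipschitz:
 assumes "periodic_C1 U U' K" shows "norm (U z - U z') <= K * norm (z - z')"
proof (rule differentiable_bound[where S = UNIV and f' = U'])
 show "onorm (U' x) <= K" for x by (rule onorm_le) (rule periodic_C1D(4)[OF assms])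
qed (simp_all add: periodic_C1D(1)[OF assms])

lemma periodic_C1_lipschitz_torus:
 assumes "periodic_C1 U U' K"
 shows "norm (U (s, rep X) - U (s', rep Y)) <= K * (\<bar>s - s'\<bar> + dist X Y)"
proof -
 define y where "y = rep X + torus_diff Y X"
 have "abs_torus y = Y" unfolding y_def by (metis torus_shift_diff torus_shift_rep)
 then have "lattice_rel (rep Y) y" by (metis abs_torus_eq_iff abs_torus_rep)
 then have "U (s', rep Y) = U (s', y)" using periodic_C1D(2)[OF assms] by blast
 moreover have "norm ((s, rep X) - (s', y)) <= \<bar>s - s'\<bar> + dist X Y"
 proof -
  have "dist X Y = norm (torus_diff Y X)" by (metis dist_commute dist_torus_eq)
  then show ?thesis using norm_Pair_le[of "s - s'" "rep X - y"] by (simp add: y_def)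
 qed
 ultimately show ?thesis
  using order_trans[OF periodic_C1_lipschitz[OF assms, of "(s, rep X)" "(s', y)"]
    mult_left_mono[OF _ periodic_C1D(6)[OF assms]]] by simp
qed

definition move_path :: "(real \<times> (real ^ 'n) => real ^ 'n) => (real => 'n::finite torus) => real => 'n torus" where
 "move_path U om = (\<lambda>t\<in>{0..1}. om t \<oplus> U (t, rep (om t)))"

lemma has_velocity_lift_at:
 assumes "has_velocity om v t" "t \<in> {0<..<1}"
 obtains L where "!!s. s \<in> {0..1} ==> abs_torus (L s) = om s" "(L has_vector_derivative v) (at t)" "L t = rep (om t)"
proof -
 obtain L where L: "\<forall>s\<in>{0..1}. abs_torus (L s) = om s" "(L has_vector_derivative v) (at t within {0..1})"
  using assms(1) unfolding has_velocity_def by blast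
 have at: "at t within {0..1} = at t" using assms(2) by (intro at_within_interior) simp
 have rel: "lattice_rel (rep (om t)) (L t)"
  using L(1) assms(2) by (subst abs_torus_eq_iff[symmetric]) simp
 show ?thesis
 proof (rule that[of "%s. L s + (rep (om t) - L t)"])
  show "abs_torus (L s + (rep (om t) - L t)) = om s" if "s \<in> {0..1}" for s
   using rel L(1) that by (subst abs_torus_add_lattice) (auto simp: lattice_rel_def)
  show "((%s. L s + (rep (om t) - L t)) has_vector_derivative v) (at t)"
   using L(2) unfolding at by (intro derivative_eq_intros | simp)+
 qed simp
qed

lemma has_vector_derivative_along:
 assumes U: "(U has_derivative U') (at (t, L t))" and L: "(L has_vector_derivative v) (at t)"
 shows "((%s. U (s, L s)) has_vector_derivative U' (1, v)) (at t)"
proof -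
 have "((%s. (s, L s)) has_derivative (%h. (h, h *\<^sub>R v))) (at t)"
  using L unfolding has_vector_derivative_def by (intro has_derivative_Pair has_derivative_ident)
 from has_derivative_compose[OF this, of U U'] U
 have "((%s. U (s, L s)) has_derivative (%h. U' (h, h *\<^sub>R v))) (at t)" by simp
 moreover have "U' (h, h *\<^sub>R v) = h *\<^sub>R U' (1, v)" for h
  using linear_cmul[OF has_derivative_linear[OF U], of h "(1, v)"] by simp
 ultimately show ?thesis by (simp add: has_vector_derivative_def)
qed

lemma has_velocity_move_path:
 assumes U: "periodic_C1 U U' K" and t: "t \<in> {0<..<1}" and v: "has_velocity om v t"
 shows "has_velocity (move_path U om) (v + U' (t, rep (om t)) (1, v)) t"
proof -
 obtain L where L: "!!s. s \<in> {0..1} ==> abs_torus (L s) = om s" "(L has_vector_derivative v) (at t)" "L t = rep (om t)"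
  using has_velocity_lift_at[OF v t] by blast
 show ?thesis
  unfolding has_velocity_def
 proof (intro exI[of _ "%s. L s + U (s, L s)"] conjI ballI)
  fix s :: real assume s: "s \<in> {0..1}"
  have "lattice_rel (L s) (rep (om s))"
   using L(1)[OF s] by (subst abs_torus_eq_iff[symmetric]) simp
  then have "U (s, L s) = U (s, rep (om s))" using periodic_C1D(2)[OF U] by blast
  then show "abs_torus (L s + U (s, L s)) = move_path U om s"
   using s L(1)[OF s] by (simp add: move_path_def flip: abs_torus_shift)
 next
  have "((%s. L s + U (s, L s)) has_vector_derivative v + U' (t, L t) (1, v)) (at t)"
   by (intro has_vector_derivative_add L(2) has_vector_derivative_along periodic_C1D(1)[OF U])
  then show "((%s. L s + U (s, L s)) has_vector_derivative (v + U' (t, rep (om t)) (1, v))) (at t within {0..1})"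
   unfolding L(3) by (rule has_vector_derivative_at_within)
 qed
qed

lemma ex_velocity_move_path_imp:
 assumes U: "periodic_C1 U U' (1/2)" and t: "t \<in> {0<..<1}" and v: "has_velocity (move_path U om) v t"
 shows "\<exists>v. has_velocity om v t"
proof -
 define H where "H z = (fst z, snd z + U z)" for z
 define H' where "H' z h = (fst h, snd h + U' z h)" for z h
 have dH: "(H has_derivative H' z) (at z)" for z
  unfolding H_def[abs_def] H'_def[abs_def]
  by (intro has_derivative_Pair has_derivative_add has_derivative_fst has_derivative_snd has_derivative_ident periodic_C1D(1)[OF U])
 have inj: "inj H"
 proof (rule injI)
  fix z z' assume eq: "H z = H z'"
  then have f: "fst z = fst z'" and "snd z + U z = snd z' + U z'" by (auto simp: H_def)
  then have "snd z - snd z' = U z' - U z" by (simp add: algebra_simps)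
  then have "norm (snd z - snd z') = norm (U z - U z')" by (simp add: norm_minus_commute)
  moreover have "norm (z - z') = norm (snd z - snd z')" using f
   by (simp add: norm_prod_def)
  ultimately have "norm (snd z - snd z') <= 1/2 * norm (snd z - snd z')"
   using periodic_C1_lipschitz[OF U, of z z'] by simp
  then have "snd z = snd z'" by simp
  with f show "z = z'" by (simp add: prod_eq_iff)
 qed
 have linH: "linear (H' z)" for z using has_derivative_linear[OF dH] .
 have injH': "inj (H' z)" for z
 proof (subst linear_injective_0[OF linH], intro allI impI)
  fix h assume "H' z h = 0"
  then have h: "fst h = 0" "snd h = - U' z h" by (auto simp: H'_def zero_prod_def eq_neg_iff_add_eq_0)
  then have "norm (snd h) <= 1/2 * norm (snd h)"
   using periodic_C1D(4)[OF U, of z h] by (simp add: norm_prod_def)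
  then show "h = 0" using h(1) by (simp add: prod_eq_iff)
 qed
 obtain L' where L': "!!s. s \<in> {0..1} ==> abs_torus (L' s) = move_path U om s" "(L' has_vector_derivative v) (at t)"
  using has_velocity_lift_at[OF v t] by metis
 have "\<exists>x. abs_torus x = om s & H (s, x) = (s, L' s)" if s: "s \<in> {0..1}" for s
 proof -
  define x0 where "x0 = rep (om s)"
  define m where "m = x0 + U (s, x0) - L' s"
  have "abs_torus (x0 + U (s, x0)) = abs_torus (L' s)"
   using L'(1)[OF s] s by (simp add: move_path_def x0_def torus_shift_rep)
  then have m: "m $ i \<in> \<int>" for i unfolding m_def by (auto simp: abs_torus_eq_iff lattice_rel_def)
  have "abs_torus (x0 + - m) = abs_torus x0" using m by (intro abs_torus_add_lattice) auto
  then have a: "abs_torus (x0 - m) = om s" by (simp add: x0_def)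
  have "U (s, x0 - m) = U (s, x0)" using m by (intro periodic_C1D(2)[OF U]) (simp add: lattice_rel_def)
  then have "H (s, x0 - m) = (s, L' s)" by (simp add: H_def m_def)
  with a show ?thesis by blast
 qed
 then obtain L where L: "!!s. s \<in> {0..1} ==> abs_torus (L s) = om s & H (s, L s) = (s, L' s)" by metis
 define g where "g = inv H"
 have g: "g (H z) = z" for z by (simp add: g_def inj)
 obtain g' where g': "H' (t, L t) \<circ> g' = id"
  using linear_surjective_right_inverse[OF linH linear_injective_imp_surjective[OF linH injH']] by blast
 have "continuous_on UNIV H" using dH by (intro has_derivative_continuous_on) auto
 then have dg: "(g has_derivative g') (at (t, L' t))"
  using has_derivative_inverse_strong[of UNIV "(t, L t)" H g "H' (t, L t)" g'] g dH g' L[of t] t by auto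
 have "((%s. g (s, L' s)) has_vector_derivative g' (1, v)) (at t)"
  by (rule has_vector_derivative_along[OF dg L'(2)])
 then have "((%s. snd (g (s, L' s))) has_vector_derivative snd (g' (1, v))) (at t)"
  unfolding has_vector_derivative_def by (auto intro!: derivative_eq_intros)
 moreover have "eventually (%s. snd (g (s, L' s)) = L s) (nhds t)"
 proof -
  have "eventually (%s. s \<in> {0<..<1}) (nhds t)" using t by (intro eventually_nhds_in_open) auto
  then show ?thesis
  proof eventually_elim
   case (elim s)
   then have "H (s, L s) = (s, L' s)" using L[of s] by simp
   then have "g (s, L' s) = (s, L s)" using g[of "(s, L s)"] by simp
   then show ?case by simp
  qed
 qed
 ultimately have "(L has_vector_derivative snd (g' (1, v))) (at t)"
  by (rule has_vector_derivative_eventually_eq)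
 then show ?thesis
  unfolding has_velocity_def using L by (blast intro: has_vector_derivative_at_within)
qed

lemma velocity_move_path:
 assumes U: "periodic_C1 U U' (1/2)" and t: "t \<in> {0<..<1}"
 shows "velocity (move_path U om) t =
  (if \<exists>v. has_velocity om v t then velocity om t + U' (t, rep (om t)) (1, velocity om t) else 0)"
proof (cases "\<exists>v. has_velocity om v t")
 case True
 then obtain v where v: "has_velocity om v t" by blast
 show ?thesis using True velocity_eq[OF t v] velocity_eq[OF t has_velocity_move_path[OF U t v]] by simp
next
 case False
 then have "\<not> has_velocity (move_path U om) v t" for v using ex_velocity_move_path_imp[OF U t] by blast
 then show ?thesis using False by (simp add: velocity_eq_0)
qed

lemma vector_derivative_along_path:
 assumes W: "periodic_C1 W W' K" and t: "t \<in> {0<..<1}" and v: "has_velocity om v t"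
 shows "vector_derivative (%s. W (s, rep (om s))) (at t) = W' (t, rep (om t)) (1, v)"
proof -
 obtain L where L: "!!s. s \<in> {0..1} ==> abs_torus (L s) = om s" "(L has_vector_derivative v) (at t)" "L t = rep (om t)"
  using has_velocity_lift_at[OF v t] by blast
 have *: "((%s. W (s, L s)) has_vector_derivative W' (t, L t) (1, v)) (at t)"
  by (intro has_vector_derivative_along periodic_C1D(1)[OF W] L(2))
 have "eventually (%s. s \<in> {0<..<1}) (nhds t)" using t by (intro eventually_nhds_in_open) auto
 then have "eventually (%s. W (s, L s) = W (s, rep (om s))) (nhds t)"
 proof eventually_elim
  case (elim s)
  then have "lattice_rel (L s) (rep (om s))"
   using L(1)[of s] by (subst abs_torus_eq_iff[symmetric]) simp
  then show ?case using periodic_C1D(2)[OF W] by blast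
 qed
 with * have "((%s. W (s, rep (om s))) has_vector_derivative W' (t, L t) (1, v)) (at t)"
  by (rule has_vector_derivative_eventually_eq)
 then show ?thesis by (simp add: vector_derivative_at L(3))
qed

lemma dist_move_path_le:
 assumes U: "periodic_C1 U U' K"
 shows "dist (X \<oplus> U (s, rep X)) (Y \<oplus> U (s', rep Y)) <= (1 + K) * (dist X Y + \<bar>s - s'\<bar>)"
proof -
 have "dist (X \<oplus> U (s, rep X)) (Y \<oplus> U (s', rep Y)) <= dist X Y + norm (U (s, rep X) - U (s', rep Y))"
  by (rule dist_torus_shift_le2)
 also have "... <= dist X Y + K * (\<bar>s - s'\<bar> + dist X Y)"
  using periodic_C1_lipschitz_torus[OF U] by simp
 also have "... <= (1 + K) * (dist X Y + \<bar>s - s'\<bar>)" by (simp add: algebra_simps)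
 finally show ?thesis .
qed

lemma move_path_in_paths:
 assumes U: "periodic_C1 U U' K" and w: "om \<in> paths"
 shows "move_path U om \<in> paths"
proof -
 have "continuous_on {0..1::real} (%t. om t \<oplus> U (t, rep (om t)))"
  unfolding continuous_on_iff
 proof (intro ballI allI impI)
  fix t e :: real assume t: "t \<in> {0..1}" and "e > 0"
  define e' where "e' = e / (2 * (1 + K))"
  have K: "K >= 0" and "e' > 0" using periodic_C1D(6)[OF U] \<open>e > 0\<close> by (auto simp: e'_def)
  obtain d where d: "d > 0" "!!s t. s \<in> {0..1} ==> t \<in> {0..1} ==> \<bar>s - t\<bar> < d ==> dist (om s) (om t) < e'"
   using path_uniformly_continuous[OF w \<open>e' > 0\<close>] by blast
  show "\<exists>d>0. \<forall>x'\<in>{0..1}. dist x' t < d -->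
   dist (om x' \<oplus> U (x', rep (om x'))) (om t \<oplus> U (t, rep (om t))) < e"
  proof (intro exI[of _ "min d e'"] conjI ballI impI)
   fix s assume s: "s \<in> {0..1}" "dist s t < min d e'"
   then have "dist (om s) (om t) + \<bar>s - t\<bar> < 2 * e'" using d(2)[of s t] t by (auto simp: dist_real_def)
   then have "(1 + K) * (dist (om s) (om t) + \<bar>s - t\<bar>) < (1 + K) * (2 * e')" using K by simp
   also have "... = e" using K by (simp add: e'_def field_simps)
   finally show "dist (om s \<oplus> U (s, rep (om s))) (om t \<oplus> U (t, rep (om t))) < e"
    using dist_move_path_le[OF U, of "om s" s "om t" t] by linarith
  qed (use d \<open>e' > 0\<close> in auto)
 qed
 then have "continuous_on {0..1} (move_path U om)"
  by (rule continuous_on_eq) (simp add: move_path_def)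
 then show ?thesis by (simp add: paths_def move_path_def)
qed

lemma measurable_move_path:
 assumes U: "periodic_C1 U U' K"
 shows "move_path U \<in> path_borel \<rightarrow>\<^sub>M path_borel"
proof -
 have K: "K >= 0" using periodic_C1D(6)[OF U] .
 have "(%(om, th :: real). move_path U om) \<in> path_borel \<Otimes>\<^sub>M borel \<rightarrow>\<^sub>M path_borel"
 proof (rule measurable_into_paths)
  fix om and th e :: real assume "e > 0"
  show "\<exists>d>0. \<forall>om'\<in>paths. \<forall>th'. paths_close d om om' & dist th th' < d --> paths_close e (move_path U om) (move_path U om')"
  proof (intro exI[of _ "e / (1 + K)"] conjI ballI allI impI)
   show "e / (1 + K) > 0" using K \<open>e > 0\<close> by simp
   fix om' :: "real => 'a torus" and th' :: real assume *: "paths_close (e / (1 + K)) om om' & dist th th' < e / (1 + K)"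
   show "paths_close e (move_path U om) (move_path U om')"
    unfolding paths_close_def
   proof
    fix t :: real assume t: "t \<in> {0..1}"
    then have "dist (om t) (om' t) < e / (1 + K)" using * by (simp add: paths_close_def)
    then have "(1 + K) * (dist (om t) (om' t) + \<bar>t - t\<bar>) < e" using K by (simp add: field_simps)
    then show "dist (move_path U om t) (move_path U om' t) < e"
     using dist_move_path_le[OF U, of "om t" t "om' t" t] t by (simp add: move_path_def)
   qed
  qed
 qed (rule move_path_in_paths[OF U])
 from measurable_compose[OF measurable_Pair[OF measurable_ident measurable_const[of 0]] this]
 show ?thesis by simp
qed

lemma absolutely_continuous_move_path:
 assumes U: "periodic_C1 U U' K" and ac: "absolutely_continuous_curve om"
 shows "absolutely_continuous_curve (move_path U om)"
proof (rule absolutely_continuous_curve_transform[OF ac, where \<tau> = "%t. t" and C = "1 + K"])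
 show "1 + K > 0" using periodic_C1D(6)[OF U] by simp
 show "b - a <= (1 + K) * (b - a)" if "a <= b" for a b
  using periodic_C1D(6)[OF U] that by (simp add: algebra_simps mult_left_mono)
 show "dist (move_path U om a) (move_path U om b) <= (1 + K) * (dist (om a) (om b) + (b - a))"
  if "0 <= a" "a <= b" "b <= 1" for a b
  using dist_move_path_le[OF U, of "om a" a "om b" b] that by (simp add: move_path_def abs_minus_commute)
qed auto

abbreviation flow_borel :: "((real => 'n::finite torus) \<times> 'n torus) measure" where
 "flow_borel \<equiv> path_borel \<Otimes>\<^sub>M borel"

section \<open>Flows and kernels of paths\<close>

text \<open>The law of a path given its label; that a flow runs between two plans is a condition on the joint laws of label and end points.\<close>

definition flow_kernel ::
 "('n::finite torus \<times> 'n torus) measure => ('n torus \<times> 'n torus) measure => ('n torus => (real => 'n torus) measure) => bool" where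
 "flow_kernel \<eta> gm ka \<longleftrightarrow> ka \<in> TM \<rightarrow>\<^sub>M prob_algebra path_borel &
  (\<forall>f :: _ => ennreal. f : borel_measurable borel -->
   (\<integral>\<^sup>+a. \<integral>\<^sup>+om. f (a, om 0) \<partial>ka a \<partial>TM) = (\<integral>\<^sup>+z. f z \<partial>\<eta>)) &
  (\<forall>f :: _ => ennreal. f : borel_measurable borel -->
   (\<integral>\<^sup>+a. \<integral>\<^sup>+om. f (a, om 1) \<partial>ka a \<partial>TM) = (\<integral>\<^sup>+z. f z \<partial>gm))"

definition flow_of :: "('n::finite torus => (real => 'n torus) measure) => 'n flow" where
 "flow_of ka = TM \<bind> (%a. distr (ka a) flow_borel (%om. (om, a)))"

definition path_law :: "'n::finite flow => (real => 'n torus) measure" where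
 "path_law \<nu> = distr \<nu> path_borel fst"

lemma torus_kernel:
 assumes "ka \<in> TM \<rightarrow>\<^sub>M prob_algebra N"
 shows "sets (ka a) = sets N" "space (ka a) = space N" "prob_space (ka a)"
proof -
 have "ka a \<in> space (prob_algebra N)" using measurable_space[OF assms, of a] by simp
 then show "sets (ka a) = sets N" "prob_space (ka a)" by (auto simp: space_prob_algebra)
 then show "space (ka a) = space N" by (intro sets_eq_imp_space_eq)
qed

lemma measurable_section_kernel:
 "(%a. distr (ka a) flow_borel (%om. (om, a))) \<in> TM \<rightarrow>\<^sub>M prob_algebra flow_borel"
 if [measurable]: "ka \<in> TM \<rightarrow>\<^sub>M prob_algebra path_borel"
 by measurable

lemma nn_integral_flow_of:
 fixes f :: "_ => ennreal"
 assumes ka: "ka \<in> TM \<rightarrow>\<^sub>M prob_algebra path_borel" and f: "f : borel_measurable flow_borel"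
 shows "(\<integral>\<^sup>+z. f z \<partial>flow_of ka) = (\<integral>\<^sup>+a. \<integral>\<^sup>+om. f (om, a) \<partial>ka a \<partial>TM)"
proof -
 have "(\<integral>\<^sup>+z. f z \<partial>flow_of ka) = (\<integral>\<^sup>+a. \<integral>\<^sup>+z. f z \<partial>distr (ka a) flow_borel (%om. (om, a)) \<partial>TM)"
  unfolding flow_of_def
  by (rule nn_integral_bind[OF f measurable_prob_algebraD[OF measurable_section_kernel[OF ka]]])
 also have "... = (\<integral>\<^sup>+a. \<integral>\<^sup>+om. f (om, a) \<partial>ka a \<partial>TM)"
 proof (rule nn_integral_cong)
  fix a
  have "(%om. (om, a)) \<in> ka a \<rightarrow>\<^sub>M flow_borel"
   unfolding measurable_cong_sets[OF torus_kernel(1)[OF ka] refl] by measurable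
  then show "(\<integral>\<^sup>+z. f z \<partial>distr (ka a) flow_borel (%om. (om, a))) = (\<integral>\<^sup>+om. f (om, a) \<partial>ka a)"
   using f by (intro nn_integral_distr) auto
 qed
 finally show ?thesis .
qed

lemma sets_flow_of:
 assumes ka: "ka \<in> TM \<rightarrow>\<^sub>M prob_algebra path_borel"
 shows "sets (flow_of ka) = sets flow_borel"
 unfolding flow_of_def
 by (rule sets_bind) (use subprob_measurableD(2)[OF measurable_prob_algebraD[OF measurable_section_kernel[OF ka]]] in auto)

lemma prob_space_flow_of:
 assumes ka: "ka \<in> TM \<rightarrow>\<^sub>M prob_algebra path_borel"
 shows "prob_space (flow_of ka)"
proof
 have sp: "space (flow_of ka) = space flow_borel" using sets_flow_of[OF ka] by (rule sets_eq_imp_space_eq)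
 have "emeasure (flow_of ka) (space (flow_of ka)) = (\<integral>\<^sup>+z. 1 \<partial>flow_of ka)" by simp
 also have "... = (\<integral>\<^sup>+a. \<integral>\<^sup>+om. 1 \<partial>ka a \<partial>TM)" by (rule nn_integral_flow_of[OF ka]) simp
 also have "... = 1" using torus_kernel(3)[OF ka]
  by (simp add: prob_space.emeasure_space_1 torus.emeasure_space_1[simplified])
 finally show "emeasure (flow_of ka) (space (flow_of ka)) = 1" .
qed

lemma flow_borel_measurableI:
 assumes "sets \<nu> = sets flow_borel" "f \<in> flow_borel \<rightarrow>\<^sub>M N" shows "f \<in> \<nu> \<rightarrow>\<^sub>M N"
 using assms measurable_cong_sets by blast

lemma torus_plansD:
 assumes "\<eta> \<in> torus_plans" shows "sets \<eta> = sets borel" "prob_space \<eta>" "distr \<eta> borel snd = TM"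
 using assms by (auto simp: torus_plans_def)

lemma flow_kernel_imp_plan_disintegration:
 assumes \<eta>: "sets \<eta> = sets borel" and ka[measurable]: "ka \<in> TM \<rightarrow>\<^sub>M prob_algebra path_borel"
  and t: "t \<in> {0..1}"
  and law: "!!f :: _ => ennreal. f : borel_measurable borel ==>
   (\<integral>\<^sup>+a. \<integral>\<^sup>+om. f (a, om t) \<partial>ka a \<partial>TM) = (\<integral>\<^sup>+z. f z \<partial>\<eta>)"
 shows "plan_disintegration \<eta> (%a. distr (ka a) borel (%om. om t))"
 unfolding plan_disintegration_def
proof (intro conjI allI impI)
 have [measurable]: "(%om :: real => 'a torus. om t) \<in> path_borel \<rightarrow>\<^sub>M borel"
  by (rule measurable_path_eval[OF measurable_ident_sets[OF refl] t])
 show "(%a. distr (ka a) borel (%om. om t)) \<in> TM \<rightarrow>\<^sub>M prob_algebra borel" by measurable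
 fix f :: "_ => ennreal" assume "f : borel_measurable \<eta>"
 then have f: "f : borel_measurable borel" using measurable_cong_sets[OF \<eta> refl] by blast
 then have fp: "f : borel_measurable (borel \<Otimes>\<^sub>M borel)" by (simp add: borel_prod)
 have "(\<integral>\<^sup>+z. f z \<partial>\<eta>) = (\<integral>\<^sup>+a. \<integral>\<^sup>+om. f (a, om t) \<partial>ka a \<partial>TM)" using law[OF f] by simp
 also have "... = (\<integral>\<^sup>+a. \<integral>\<^sup>+x. f (a, x) \<partial>distr (ka a) borel (%om. om t) \<partial>TM)"
 proof (rule nn_integral_cong)
  fix a
  have "(%om. om t) \<in> ka a \<rightarrow>\<^sub>M borel"
   unfolding measurable_cong_sets[OF torus_kernel(1)[OF ka] refl] by measurable
  moreover have "(%x. f (a, x)) : borel_measurable borel"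
   using measurable_Pair2[OF fp, of a] by simp
  ultimately show "(\<integral>\<^sup>+om. f (a, om t) \<partial>ka a) = (\<integral>\<^sup>+x. f (a, x) \<partial>distr (ka a) borel (%om. om t))"
   by (subst nn_integral_distr) auto
 qed
 finally show "(\<integral>\<^sup>+z. f z \<partial>\<eta>) = (\<integral>\<^sup>+a. \<integral>\<^sup>+x. f (a, x) \<partial>distr (ka a) borel (%om. om t) \<partial>TM)" .
qed

lemma generalized_flow_flow_of:
 assumes \<eta>: "\<eta> \<in> torus_plans" and gm: "gm \<in> torus_plans" and k: "flow_kernel \<eta> gm ka"
 shows "generalized_flow \<eta> gm (flow_of ka)"
proof -
 have ka[measurable]: "ka \<in> TM \<rightarrow>\<^sub>M prob_algebra path_borel" using k by (simp add: flow_kernel_def)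
 have s: "sets (flow_of ka) = sets flow_borel" by (rule sets_flow_of[OF ka])
 have "distr (flow_of ka) borel snd = TM"
 proof (rule measure_eqI)
  fix A :: "'a torus set" assume "A \<in> sets (distr (flow_of ka) borel snd)"
  then have [measurable]: "A \<in> sets borel" by simp
  have snd: "snd \<in> flow_of ka \<rightarrow>\<^sub>M borel" by (rule flow_borel_measurableI[OF s]) measurable
  have "emeasure (distr (flow_of ka) borel snd) A = (\<integral>\<^sup>+z. indicator A (snd z) \<partial>flow_of ka)"
   using nn_integral_distr[OF snd, of "indicator A"] by simp
  also have "... = (\<integral>\<^sup>+a. \<integral>\<^sup>+om. indicator A a \<partial>ka a \<partial>TM)"
   by (subst nn_integral_flow_of[OF ka]) simp_all
  also have "... = emeasure TM A"
   using torus_kernel(3)[OF ka] by (simp add: prob_space.emeasure_space_1)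
  finally show "emeasure (distr (flow_of ka) borel snd) A = emeasure TM A" .
 qed simp
 moreover have "flow_disintegration (flow_of ka) ka"
  unfolding flow_disintegration_def using ka nn_integral_flow_of[OF ka] measurable_cong_sets[OF s refl] by blast
 moreover have "plan_disintegration \<eta> (%a. distr (ka a) borel (%om. om 0))"
  using k by (intro flow_kernel_imp_plan_disintegration torus_plansD[OF \<eta>] ka) (auto simp: flow_kernel_def)
 moreover have "plan_disintegration gm (%a. distr (ka a) borel (%om. om 1))"
  using k by (intro flow_kernel_imp_plan_disintegration torus_plansD[OF gm] ka) (auto simp: flow_kernel_def)
 ultimately show ?thesis
  unfolding generalized_flow_def using prob_space_flow_of[OF ka] s sets_flow_space by blast
qed

lemma plan_disintegration_endpoint:
 fixes f :: "_ => ennreal"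
 assumes \<eta>: "sets \<eta> = sets borel" and d: "plan_disintegration \<eta> \<eta>a" and t: "t \<in> {0..1}"
  and ka: "ka \<in> TM \<rightarrow>\<^sub>M prob_algebra path_borel"
  and ae: "AE a in TM. distr (ka a) borel (%om. om t) = \<eta>a a"
  and f: "f : borel_measurable borel"
 shows "(\<integral>\<^sup>+a. \<integral>\<^sup>+om. f (a, om t) \<partial>ka a \<partial>TM) = (\<integral>\<^sup>+z. f z \<partial>\<eta>)"
proof -
 have fp: "f : borel_measurable (borel \<Otimes>\<^sub>M borel)" using f by (simp add: borel_prod)
 have "f : borel_measurable \<eta>" using f measurable_cong_sets[OF \<eta> refl] by blast
 then have "(\<integral>\<^sup>+z. f z \<partial>\<eta>) = (\<integral>\<^sup>+a. \<integral>\<^sup>+x. f (a, x) \<partial>\<eta>a a \<partial>TM)"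
  using d by (simp add: plan_disintegration_def)
 also have "... = (\<integral>\<^sup>+a. \<integral>\<^sup>+om. f (a, om t) \<partial>ka a \<partial>TM)"
 proof (rule nn_integral_cong_AE, use ae in eventually_elim)
  case (elim a)
  have "(%om. om t) \<in> ka a \<rightarrow>\<^sub>M borel"
   unfolding measurable_cong_sets[OF torus_kernel(1)[OF ka] refl]
   by (rule measurable_path_eval[OF measurable_ident_sets[OF refl] t])
  moreover have "(%x. f (a, x)) : borel_measurable borel" using measurable_Pair2[OF fp, of a] by simp
  ultimately show ?case unfolding elim[symmetric] by (subst nn_integral_distr) auto
 qed
 finally show ?thesis by simp
qed

lemma generalized_flow_imp_kernel:
 assumes \<eta>: "\<eta> \<in> torus_plans" and gm: "gm \<in> torus_plans" and \<nu>: "generalized_flow \<eta> gm \<nu>"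
 obtains ka where "flow_kernel \<eta> gm ka" "\<nu> = flow_of ka"
proof -
 obtain ka \<eta>a gma where k: "flow_disintegration \<nu> ka" "plan_disintegration \<eta> \<eta>a" "plan_disintegration gm gma"
  "AE a in TM. distr (ka a) borel (%om. om 0) = \<eta>a a & distr (ka a) borel (%om. om 1) = gma a"
  using \<nu> unfolding generalized_flow_def by blast
 have ka: "ka \<in> TM \<rightarrow>\<^sub>M prob_algebra path_borel" using k(1) by (simp add: flow_disintegration_def)
 have s: "sets \<nu> = sets flow_borel" using \<nu> sets_flow_space unfolding generalized_flow_def by blast
 have "flow_kernel \<eta> gm ka"
  unfolding flow_kernel_def
 proof (intro conjI allI impI ka)
  fix f :: "'a torus \<times> 'a torus => ennreal" assume f: "f : borel_measurable borel"
  show "(\<integral>\<^sup>+a. \<integral>\<^sup>+om. f (a, om 0) \<partial>ka a \<partial>TM) = (\<integral>\<^sup>+z. f z \<partial>\<eta>)"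
   by (rule plan_disintegration_endpoint[OF torus_plansD(1)[OF \<eta>] k(2) _ ka _ f]) (use k(4) in auto)
  show "(\<integral>\<^sup>+a. \<integral>\<^sup>+om. f (a, om 1) \<partial>ka a \<partial>TM) = (\<integral>\<^sup>+z. f z \<partial>gm)"
   by (rule plan_disintegration_endpoint[OF torus_plansD(1)[OF gm] k(3) _ ka _ f]) (use k(4) in auto)
 qed
 moreover have "\<nu> = flow_of ka"
 proof (rule measure_eqI)
  show "sets \<nu> = sets (flow_of ka)" using s sets_flow_of[OF ka] by simp
  fix A assume A: "A \<in> sets \<nu>"
  then have A': "A \<in> sets flow_borel" "A \<in> sets (flow_of ka)" using s sets_flow_of[OF ka] by auto
  have "emeasure \<nu> A = (\<integral>\<^sup>+z. indicator A z \<partial>\<nu>)" using A by simp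
  also have "... = (\<integral>\<^sup>+a. \<integral>\<^sup>+om. indicator A (om, a) \<partial>ka a \<partial>TM)"
  proof -
   have "indicator A : borel_measurable \<nu>" using A by simp
   with k(1) show ?thesis unfolding flow_disintegration_def by blast
  qed
  also have "... = (\<integral>\<^sup>+z. indicator A z \<partial>flow_of ka)"
   by (rule nn_integral_flow_of[OF ka, symmetric]) (use A' in simp)
  also have "... = emeasure (flow_of ka) A" using A' by simp
  finally show "emeasure \<nu> A = emeasure (flow_of ka) A" .
 qed
 ultimately show ?thesis using that by blast
qed

lemma generalized_flow_sets:
 assumes "generalized_flow \<eta> gm \<nu>" shows "sets \<nu> = sets flow_borel"
 using assms sets_flow_space unfolding generalized_flow_def by blast

lemma measurable_fst_flow:
 assumes "generalized_flow \<eta> gm \<nu>" shows "fst \<in> \<nu> \<rightarrow>\<^sub>M path_borel"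
 by (rule flow_borel_measurableI[OF generalized_flow_sets[OF assms]]) measurable

lemma sets_path_law [simp, measurable_cong]: "sets (path_law \<nu>) = sets path_borel"
 by (simp add: path_law_def)

lemma space_path_law [simp]: "space (path_law \<nu>) = paths"
 by (simp add: path_law_def)

lemma prob_space_path_law:
 assumes "generalized_flow \<eta> gm \<nu>" shows "prob_space (path_law \<nu>)"
 unfolding path_law_def using assms measurable_fst_flow[OF assms]
 by (intro prob_space.prob_space_distr) (auto simp: generalized_flow_def)

lemma nn_integral_path_law:
 assumes "generalized_flow \<eta> gm \<nu>" "F : borel_measurable path_borel"
 shows "(\<integral>\<^sup>+om. F om \<partial>path_law \<nu>) = (\<integral>\<^sup>+z. F (fst z) \<partial>\<nu>)"
 unfolding path_law_def using assms measurable_fst_flow[OF assms(1)] by (subst nn_integral_distr) auto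

lemma flow_action_eq:
 assumes "generalized_flow \<eta> gm \<nu>" shows "flow_action \<nu> = (\<integral>\<^sup>+om. curve_action om \<partial>path_law \<nu>)"
 by (subst nn_integral_path_law[OF assms measurable_curve_action]) (simp add: flow_action_def case_prod_unfold)

lemma flow_at_eq:
 assumes "generalized_flow \<eta> gm \<nu>" "t \<in> {0..1}"
 shows "flow_at \<nu> t = distr (path_law \<nu>) borel (%om. om t)"
proof -
 have "(%om. om t) \<in> path_borel \<rightarrow>\<^sub>M borel" by (rule measurable_path_eval[OF measurable_ident_sets[OF refl] assms(2)])
 then show ?thesis unfolding path_law_def flow_at_def
  using measurable_fst_flow[OF assms(1)] by (subst distr_distr) (auto simp: comp_def case_prod_unfold)
qed

lemma nn_integral_flow_at:
 assumes "generalized_flow \<eta> gm \<nu>" "t \<in> {0..1}" and f: "f : borel_measurable borel"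
 shows "(\<integral>\<^sup>+x. f x \<partial>flow_at \<nu> t) = (\<integral>\<^sup>+om. f (om t) \<partial>path_law \<nu>)"
proof -
 have "(%om. om t) \<in> path_borel \<rightarrow>\<^sub>M borel" by (rule measurable_path_eval[OF measurable_ident_sets[OF refl] assms(2)])
 then show ?thesis unfolding flow_at_eq[OF assms(1,2)] using f
  by (subst nn_integral_distr) (auto cong: measurable_cong_sets)
qed

lemma nn_integral_path_law_flow_of:
 fixes F :: "(real => 'n::finite torus) => ennreal"
 assumes g: "generalized_flow \<eta> gm (flow_of ka)" and ka: "ka \<in> TM \<rightarrow>\<^sub>M prob_algebra path_borel"
  and F: "F : borel_measurable path_borel"
 shows "(\<integral>\<^sup>+om. F om \<partial>path_law (flow_of ka)) = (\<integral>\<^sup>+a. \<integral>\<^sup>+om. F om \<partial>ka a \<partial>TM)"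
proof -
 have "(%z. F (fst z)) : borel_measurable flow_borel" using F by measurable
 then show ?thesis
  by (simp add: nn_integral_path_law[OF g F] nn_integral_flow_of[OF ka])
qed

text \<open>Moving each path by a random map that fixes its end points does not change the joint law of label and end points.\<close>

lemma transport_flow:
 fixes \<Phi> :: "(real => 'n::finite torus) => 'b::{metric_space, second_countable_topology} => real => 'n torus"
 assumes \<eta>: "\<eta> \<in> torus_plans" and gm: "gm \<in> torus_plans" and \<nu>: "generalized_flow \<eta> gm \<nu>"
  and Q: "prob_space Q" "sets Q = sets borel"
  and \<Phi>: "(%(om, th). \<Phi> om th) \<in> path_borel \<Otimes>\<^sub>M borel \<rightarrow>\<^sub>M path_borel"
  and ends: "!!om th. om \<in> paths ==> \<Phi> om th 0 = om 0" "!!om th. om \<in> paths ==> \<Phi> om th 1 = om 1"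
 obtains \<nu>' where "generalized_flow \<eta> gm \<nu>'"
  "!!F :: _ => ennreal. F : borel_measurable path_borel ==>
   (\<integral>\<^sup>+om. F om \<partial>path_law \<nu>') = (\<integral>\<^sup>+om. \<integral>\<^sup>+th. F (\<Phi> om th) \<partial>Q \<partial>path_law \<nu>)"
proof -
 obtain ka where k: "flow_kernel \<eta> gm ka" and \<nu>eq: "\<nu> = flow_of ka"
  using generalized_flow_imp_kernel[OF \<eta> gm \<nu>] by blast
 have ka[measurable]: "ka \<in> TM \<rightarrow>\<^sub>M prob_algebra path_borel" using k by (simp add: flow_kernel_def)
 have Qp: "Q \<in> space (prob_algebra borel)" using Q by (simp add: space_prob_algebra)
 have [measurable]: "(%a. Q) \<in> TM \<rightarrow>\<^sub>M prob_algebra borel" using Qp by simp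
 interpret Q: prob_space Q by fact
 define ka' where "ka' a = distr (ka a \<Otimes>\<^sub>M Q) path_borel (%z. \<Phi> (fst z) (snd z))" for a
 have \<Phi>': "(%z. \<Phi> (fst z) (snd z)) \<in> path_borel \<Otimes>\<^sub>M borel \<rightarrow>\<^sub>M path_borel" using \<Phi> by (simp add: case_prod_beta)
 have ka': "ka' \<in> TM \<rightarrow>\<^sub>M prob_algebra path_borel"
  unfolding ka'_def by (rule measurable_compose[OF _ measurable_distr_prob_space[OF \<Phi>']]) measurable
 have int: "(\<integral>\<^sup>+om. F om \<partial>ka' a) = (\<integral>\<^sup>+om. \<integral>\<^sup>+th. F (\<Phi> om th) \<partial>Q \<partial>ka a)" if F: "F : borel_measurable path_borel" for F :: "_ => ennreal" and a
 proof -
  have s: "sets (ka a \<Otimes>\<^sub>M Q) = sets (path_borel \<Otimes>\<^sub>M borel)"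
   by (rule sets_pair_measure_cong[OF torus_kernel(1)[OF ka] Q(2)])
  have m: "(%z. \<Phi> (fst z) (snd z)) \<in> ka a \<Otimes>\<^sub>M Q \<rightarrow>\<^sub>M path_borel"
   unfolding measurable_cong_sets[OF s refl] by (rule \<Phi>')
  have "(\<integral>\<^sup>+om. F om \<partial>ka' a) = (\<integral>\<^sup>+z. F (\<Phi> (fst z) (snd z)) \<partial>(ka a \<Otimes>\<^sub>M Q))"
   unfolding ka'_def using F by (intro nn_integral_distr m) auto
  also have "... = (\<integral>\<^sup>+om. \<integral>\<^sup>+th. F (\<Phi> om th) \<partial>Q \<partial>ka a)"
   using Q.nn_integral_fst[OF measurable_compose[OF m F]] by simp
  finally show ?thesis .
 qed
 have sp: "space (ka a) = paths" for a using torus_kernel(2)[OF ka] by simp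
 have law: "(\<integral>\<^sup>+a. \<integral>\<^sup>+om. f (a, om t) \<partial>ka' a \<partial>TM) = (\<integral>\<^sup>+a. \<integral>\<^sup>+om. f (a, om t) \<partial>ka a \<partial>TM)"
  if f: "f : borel_measurable borel" and t: "t \<in> {0..1}" and fixt: "!!om th. om \<in> paths ==> \<Phi> om th t = om t"
  for f :: "_ => ennreal" and t
 proof (rule nn_integral_cong)
  fix a
  have fp: "f : borel_measurable (borel \<Otimes>\<^sub>M borel)" using f by (simp add: borel_prod)
  have "(%x. f (a, x)) : borel_measurable borel" using measurable_Pair2[OF fp, of a] by simp
  then have "(%om. f (a, om t)) : borel_measurable path_borel"
   by (rule measurable_compose[OF measurable_path_eval[OF measurable_ident_sets[OF refl] t]])
  from int[OF this, of a] have "(\<integral>\<^sup>+om. f (a, om t) \<partial>ka' a) = (\<integral>\<^sup>+om. \<integral>\<^sup>+th. f (a, \<Phi> om th t) \<partial>Q \<partial>ka a)" .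
  also have "... = (\<integral>\<^sup>+om. f (a, om t) \<partial>ka a)"
   by (rule nn_integral_cong) (simp add: fixt sp Q.emeasure_space_1)
  finally show "(\<integral>\<^sup>+om. f (a, om t) \<partial>ka' a) = (\<integral>\<^sup>+om. f (a, om t) \<partial>ka a)" .
 qed
 have "flow_kernel \<eta> gm ka'"
  unfolding flow_kernel_def
 proof (intro conjI allI impI ka')
  fix f :: "'n torus \<times> 'n torus => ennreal" assume f: "f : borel_measurable borel"
  show "(\<integral>\<^sup>+a. \<integral>\<^sup>+om. f (a, om 0) \<partial>ka' a \<partial>TM) = (\<integral>\<^sup>+z. f z \<partial>\<eta>)"
   using law[OF f _ ends(1)] k f by (simp add: flow_kernel_def)
  show "(\<integral>\<^sup>+a. \<integral>\<^sup>+om. f (a, om 1) \<partial>ka' a \<partial>TM) = (\<integral>\<^sup>+z. f z \<partial>gm)"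
   using law[OF f _ ends(2)] k f by (simp add: flow_kernel_def)
 qed
 then have g: "generalized_flow \<eta> gm (flow_of ka')" by (rule generalized_flow_flow_of[OF \<eta> gm])
 show ?thesis
 proof (rule that[OF g])
  fix F :: "(real => 'n torus) => ennreal" assume F: "F : borel_measurable path_borel"
  have "(%z. F (\<Phi> (fst z) (snd z))) : borel_measurable (path_borel \<Otimes>\<^sub>M Q)"
   using measurable_compose[OF \<Phi>' F] measurable_cong_sets[OF sets_pair_measure_cong[OF refl Q(2)] refl] by blast
  from Q.borel_measurable_nn_integral_fst[OF this]
  have m: "(%om. \<integral>\<^sup>+th. F (\<Phi> om th) \<partial>Q) : borel_measurable path_borel" by simp
  show "(\<integral>\<^sup>+om. F om \<partial>path_law (flow_of ka')) = (\<integral>\<^sup>+om. \<integral>\<^sup>+th. F (\<Phi> om th) \<partial>Q \<partial>path_law \<nu>)"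
   using \<nu> unfolding \<nu>eq
   by (simp add: nn_integral_path_law_flow_of[OF g ka' F] nn_integral_path_law_flow_of[OF _ ka m] int[OF F])
 qed
qed

lemma mix_flows:
 assumes \<eta>: "\<eta> \<in> torus_plans" and gm: "gm \<in> torus_plans"
  and \<nu>1: "generalized_flow \<eta> gm \<nu>1" and \<nu>2: "generalized_flow \<eta> gm \<nu>2" and e: "0 <= e" "e <= (1::real)"
 obtains \<nu>' where "generalized_flow \<eta> gm \<nu>'"
  "!!F :: _ => ennreal. F : borel_measurable path_borel ==>
   (\<integral>\<^sup>+om. F om \<partial>path_law \<nu>') = (\<integral>\<^sup>+om. F om \<partial>path_law \<nu>1) * ennreal (1 - e) + (\<integral>\<^sup>+om. F om \<partial>path_law \<nu>2) * ennreal e"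
proof -
 obtain ka_1 where k1: "flow_kernel \<eta> gm ka_1" and \<nu>1eq: "\<nu>1 = flow_of ka_1"
  using generalized_flow_imp_kernel[OF \<eta> gm \<nu>1] by blast
 obtain ka_2 where k2: "flow_kernel \<eta> gm ka_2" and \<nu>2eq: "\<nu>2 = flow_of ka_2"
  using generalized_flow_imp_kernel[OF \<eta> gm \<nu>2] by blast
 have ka_1[measurable]: "ka_1 \<in> TM \<rightarrow>\<^sub>M prob_algebra path_borel" using k1 by (simp add: flow_kernel_def)
 have ka_2[measurable]: "ka_2 \<in> TM \<rightarrow>\<^sub>M prob_algebra path_borel" using k2 by (simp add: flow_kernel_def)
 let ?B = "measure_pmf (bernoulli_pmf e)"
 have [measurable]: "(%a. ?B) \<in> TM \<rightarrow>\<^sub>M prob_algebra (count_space UNIV)"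
  by (simp add: space_prob_algebra measure_pmf.prob_space_axioms)
 define ka' where "ka' a = ?B \<bind> (%b. if b then ka_2 a else ka_1 a)" for a
 have ka': "ka' \<in> TM \<rightarrow>\<^sub>M prob_algebra path_borel"
  unfolding ka'_def by measurable
 have int: "(\<integral>\<^sup>+om. F om \<partial>ka' a) = (\<integral>\<^sup>+om. F om \<partial>ka_1 a) * ennreal (1 - e) + (\<integral>\<^sup>+om. F om \<partial>ka_2 a) * ennreal e"
  if F: "F : borel_measurable path_borel" for F :: "_ => ennreal" and a
 proof -
  have "(%b. if b then ka_2 a else ka_1 a) \<in> ?B \<rightarrow>\<^sub>M subprob_algebra path_borel"
   using measurable_space[OF measurable_prob_algebraD[OF ka_1], of a] measurable_space[OF measurable_prob_algebraD[OF ka_2], of a]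
   by (auto simp: measurable_def)
  from nn_integral_bind[OF F this] show ?thesis
   unfolding ka'_def using e by (simp add: ac_simps)
 qed
 have meas: "(%a. \<integral>\<^sup>+om. f (om, a) \<partial>ka a) : borel_measurable TM"
  if "ka \<in> TM \<rightarrow>\<^sub>M prob_algebra path_borel" "f : borel_measurable flow_borel" for ka and f :: "_ => ennreal"
 proof -
  have [measurable]: "ka \<in> TM \<rightarrow>\<^sub>M subprob_algebra path_borel" using that(1) by (rule measurable_prob_algebraD)
  have [measurable]: "f : borel_measurable flow_borel" by fact
  show ?thesis by (rule nn_integral_measurable_subprob_algebra2[where N = path_borel]) measurable
 qed
 have int2: "(\<integral>\<^sup>+a. \<integral>\<^sup>+om. f (om, a) \<partial>ka' a \<partial>TM) =
   (\<integral>\<^sup>+a. \<integral>\<^sup>+om. f (om, a) \<partial>ka_1 a \<partial>TM) * ennreal (1 - e) + (\<integral>\<^sup>+a. \<integral>\<^sup>+om. f (om, a) \<partial>ka_2 a \<partial>TM) * ennreal e"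
  if f: "f : borel_measurable flow_borel" for f :: "_ => ennreal"
 proof -
  have "(%om. f (om, a)) : borel_measurable path_borel" for a using measurable_Pair1[OF f, of a] by simp
  note [simp] = int[OF this]
  show ?thesis
   using meas[OF ka_1 f] meas[OF ka_2 f] by (simp add: nn_integral_add nn_integral_multc)
 qed
 have mix_const: "c * ennreal (1 - e) + c * ennreal e = c" for c
  using e by (simp add: distrib_left[symmetric] ennreal_plus[symmetric] del: ennreal_plus)
 have ev: "(%z :: (real => 'a torus) \<times> 'a torus. f (snd z, fst z t)) : borel_measurable flow_borel"
  if f: "f : borel_measurable borel" and t: "t \<in> {0..1}" for f :: "_ => ennreal" and t
 proof -
  have [measurable]: "f : borel_measurable (borel \<Otimes>\<^sub>M borel)" using f by (simp add: borel_prod)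
  note [measurable] = measurable_path_eval[OF measurable_fst t]
  show ?thesis by measurable
 qed
 have "flow_kernel \<eta> gm ka'"
  unfolding flow_kernel_def
 proof (intro conjI allI impI ka')
  fix f :: "'a torus \<times> 'a torus => ennreal" assume f: "f : borel_measurable borel"
  show "(\<integral>\<^sup>+a. \<integral>\<^sup>+om. f (a, om 0) \<partial>ka' a \<partial>TM) = (\<integral>\<^sup>+z. f z \<partial>\<eta>)"
   using int2[OF ev[OF f], of 0] k1 k2 f mix_const by (simp add: flow_kernel_def)
  show "(\<integral>\<^sup>+a. \<integral>\<^sup>+om. f (a, om 1) \<partial>ka' a \<partial>TM) = (\<integral>\<^sup>+z. f z \<partial>gm)"
   using int2[OF ev[OF f], of 1] k1 k2 f mix_const by (simp add: flow_kernel_def)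
 qed
 then have g: "generalized_flow \<eta> gm (flow_of ka')" by (rule generalized_flow_flow_of[OF \<eta> gm])
 show ?thesis
 proof (rule that[OF g])
  fix F :: "(real => 'a torus) => ennreal" assume F: "F : borel_measurable path_borel"
  have "(%z :: (real => 'a torus) \<times> 'a torus. F (fst z)) : borel_measurable flow_borel" using F by measurable
  from int2[OF this] \<nu>1 \<nu>2 show "(\<integral>\<^sup>+om. F om \<partial>path_law (flow_of ka')) = (\<integral>\<^sup>+om. F om \<partial>path_law \<nu>1) * ennreal (1 - e) + (\<integral>\<^sup>+om. F om \<partial>path_law \<nu>2) * ennreal e"
   unfolding \<nu>1eq \<nu>2eq
   by (simp add: nn_integral_path_law_flow_of[OF g ka' F] nn_integral_path_law_flow_of[OF _ ka_1 F] nn_integral_path_law_flow_of[OF _ ka_2 F])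
 qed
qed

lemma incompressible_iff:
 assumes "generalized_flow \<eta> gm \<nu>"
 shows "incompressible \<nu> \<longleftrightarrow> (\<forall>t\<in>{0..1}. \<forall>f :: _ => ennreal. f : borel_measurable borel -->
  (\<integral>\<^sup>+om. f (om t) \<partial>path_law \<nu>) = (\<integral>\<^sup>+x. f x \<partial>TM))"
proof
 assume "incompressible \<nu>"
 then show "\<forall>t\<in>{0..1}. \<forall>f :: _ => ennreal. f : borel_measurable borel -->
  (\<integral>\<^sup>+om. f (om t) \<partial>path_law \<nu>) = (\<integral>\<^sup>+x. f x \<partial>TM)"
  using nn_integral_flow_at[OF assms] by (auto simp: incompressible_def)
next
 assume *: "\<forall>t\<in>{0..1}. \<forall>f :: _ => ennreal. f : borel_measurable borel -->
  (\<integral>\<^sup>+om. f (om t) \<partial>path_law \<nu>) = (\<integral>\<^sup>+x. f x \<partial>TM)"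
 show "incompressible \<nu>"
  unfolding incompressible_def
 proof
  fix t :: real assume t: "t \<in> {0..1}"
  have s: "sets (flow_at \<nu> t) = sets borel" by (simp add: flow_at_def)
  show "flow_at \<nu> t = TM"
  proof (rule measure_eqI)
   fix A assume "A \<in> sets (flow_at \<nu> t)"
   then have A[measurable]: "A \<in> sets borel" using s by simp
   have "emeasure (flow_at \<nu> t) A = (\<integral>\<^sup>+x. indicator A x \<partial>flow_at \<nu> t)" using s by simp
   also have "... = (\<integral>\<^sup>+om. indicator A (om t) \<partial>path_law \<nu>)"
    by (rule nn_integral_flow_at[OF assms t]) simp
   also have "... = emeasure TM A" using * t by simp
   finally show "emeasure (flow_at \<nu> t) A = emeasure TM A" .
  qed (simp add: s)
 qed
qed

section \<open>An incompressible flow of finite action\<close>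

text \<open>Both marginals of a plan are uniform, so a path starts and ends uniformly distributed, even without incompressibility.\<close>

lemma path_law_endpoint_uniform:
 fixes f :: "'n::finite torus => ennreal"
 assumes \<eta>: "\<eta> \<in> torus_plans" and gm: "gm \<in> torus_plans" and \<nu>: "generalized_flow \<eta> gm \<nu>"
  and f: "f : borel_measurable borel" and t: "t = 0 \<or> t = 1"
 shows "(\<integral>\<^sup>+om. f (om t) \<partial>path_law \<nu>) = (\<integral>\<^sup>+x. f x \<partial>TM)"
proof -
 obtain ka where k: "flow_kernel \<eta> gm ka" and \<nu>eq: "\<nu> = flow_of ka"
  using generalized_flow_imp_kernel[OF \<eta> gm \<nu>] by blast
 have ka: "ka \<in> TM \<rightarrow>\<^sub>M prob_algebra path_borel" using k by (simp add: flow_kernel_def)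
 have law0: "(\<integral>\<^sup>+a. \<integral>\<^sup>+om. h (a, om 0) \<partial>ka a \<partial>TM) = (\<integral>\<^sup>+z. h z \<partial>\<eta>)"
  and law1: "(\<integral>\<^sup>+a. \<integral>\<^sup>+om. h (a, om 1) \<partial>ka a \<partial>TM) = (\<integral>\<^sup>+z. h z \<partial>gm)"
  if "h : borel_measurable borel" for h :: "'n torus \<times> 'n torus => ennreal"
  using k that unfolding flow_kernel_def by simp_all
 have t01: "t \<in> {0..1}" using t by auto
 have F: "(%om. f (om t)) : borel_measurable path_borel"
  by (rule measurable_compose[OF measurable_path_eval[OF measurable_ident_sets[OF refl] t01] f])
 have snd: "(%z. f (snd z)) : borel_measurable (borel :: ('n torus \<times> 'n torus) measure)"
  unfolding borel_prod[symmetric] by (rule measurable_compose[OF measurable_snd f])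
 have marg: "(\<integral>\<^sup>+z. f (snd z) \<partial>\<zeta>) = (\<integral>\<^sup>+x. f x \<partial>TM)" if \<zeta>: "\<zeta> \<in> torus_plans" for \<zeta> :: "('n torus \<times> 'n torus) measure"
 proof -
  have "snd \<in> \<zeta> \<rightarrow>\<^sub>M borel"
   unfolding measurable_cong_sets[OF torus_plansD(1)[OF \<zeta>] refl] unfolding borel_prod[symmetric] by measurable
  from nn_integral_distr[OF this, of f] f show ?thesis
   unfolding torus_plansD(3)[OF \<zeta>] measurable_cong_sets[OF sets_torus_measure refl] by simp
 qed
 have "(\<integral>\<^sup>+om. f (om t) \<partial>path_law \<nu>) = (\<integral>\<^sup>+a. \<integral>\<^sup>+om. f (snd (a, om t)) \<partial>ka a \<partial>TM)"
  using nn_integral_path_law_flow_of[OF \<nu>[unfolded \<nu>eq] ka F] by (simp add: \<nu>eq)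
 also have "... = (\<integral>\<^sup>+x. f x \<partial>TM)"
 proof (cases "t = 0")
  case True
  have "(\<integral>\<^sup>+a. \<integral>\<^sup>+om. f (snd (a, om 0)) \<partial>ka a \<partial>TM) = (\<integral>\<^sup>+z. f (snd z) \<partial>\<eta>)"
   by (rule law0[OF snd])
  then show ?thesis by (simp only: True marg[OF \<eta>])
 next
  case False
  then have "t = 1" using t by simp
  have "(\<integral>\<^sup>+a. \<integral>\<^sup>+om. f (snd (a, om 1)) \<partial>ka a \<partial>TM) = (\<integral>\<^sup>+z. f (snd z) \<partial>gm)"
   by (rule law1[OF snd])
  then show ?thesis by (simp only: \<open>t = 1\<close> marg[OF gm])
 qed
 finally show ?thesis .
qed

text \<open>From \<open>X\<close> along \<open>u\<close> in the first half of the time, then backwards along \<open>v\<close>.\<close>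

definition bridge_path :: "'n::finite torus => real ^ 'n => real ^ 'n => real => 'n torus" where
 "bridge_path X u v = (\<lambda>t\<in>{0..1}. X \<oplus> (min 1 (2 * t) *\<^sub>R u - max 0 (2 * t - 1) *\<^sub>R v))"

lemma bridge_path_in_paths: "bridge_path X u v \<in> paths"
proof -
 have "continuous_on {0..1} (%t::real. X \<oplus> (min 1 (2 * t) *\<^sub>R u - max 0 (2 * t - 1) *\<^sub>R v))"
  by (intro continuous_intros)
 then have "continuous_on {0..1} (bridge_path X u v)"
  by (rule continuous_on_eq) (simp add: bridge_path_def)
 then show ?thesis by (simp add: paths_def bridge_path_def)
qed

lemma measurable_bridge_path [measurable (raw)]:
 fixes f :: "'a => 'n::finite torus"
 assumes [measurable]: "f : borel_measurable M" "g : borel_measurable M" "h : borel_measurable M"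
 shows "(%x. bridge_path (f x) (g x) (h x)) \<in> M \<rightarrow>\<^sub>M path_borel"
proof -
 have *: "(%(om, th). bridge_path (fst th) (fst (snd th)) (snd (snd th))) \<in>
  (path_borel :: (real => 'n torus) measure) \<Otimes>\<^sub>M (borel :: ('n torus \<times> (real ^ 'n) \<times> (real ^ 'n)) measure) \<rightarrow>\<^sub>M path_borel"
 proof (rule measurable_into_paths)
  fix om :: "real => 'n torus" and th :: "'n torus \<times> (real ^ 'n) \<times> (real ^ 'n)" and e :: real assume "e > 0"
  obtain X u v where th: "th = (X, u, v)" by (cases th)
  show "\<exists>d>0. \<forall>om'\<in>paths. \<forall>th'. paths_close d om om' & dist th th' < d -->
   paths_close e (bridge_path (fst th) (fst (snd th)) (snd (snd th))) (bridge_path (fst th') (fst (snd th')) (snd (snd th')))"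
  proof (intro exI[of _ "e / 3"] conjI ballI allI impI)
   fix om' and th' :: "'n torus \<times> (real ^ 'n) \<times> (real ^ 'n)" assume d: "paths_close (e / 3) om om' & dist th th' < e / 3"
   obtain X' u' v' where th': "th' = (X', u', v')" by (cases th')
   have dd: "dist X X' < e/3" "dist u u' < e/3" "dist v v' < e/3"
   proof -
    have "dist th th' < e/3" using d by blast
    moreover have "dist X X' <= dist th th'" using dist_fst_le[of th th'] by (simp add: th th')
    moreover have "dist (u, v) (u', v') <= dist th th'" using dist_snd_le[of th th'] by (simp add: th th')
    moreover have "dist u u' <= dist (u, v) (u', v')" using dist_fst_le[of "(u, v)" "(u', v')"] by simp
    moreover have "dist v v' <= dist (u, v) (u', v')" using dist_snd_le[of "(u, v)" "(u', v')"] by simp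
    ultimately show "dist X X' < e/3" "dist u u' < e/3" "dist v v' < e/3" by linarith+
   qed
   show "paths_close e (bridge_path (fst th) (fst (snd th)) (snd (snd th))) (bridge_path (fst th') (fst (snd th')) (snd (snd th')))"
    unfolding paths_close_def
   proof
    fix t :: real assume t: "t \<in> {0..1}"
    let ?a = "min 1 (2 * t)" and ?b = "max 0 (2 * t - 1)"
    have ab: "\<bar>?a\<bar> <= 1" "\<bar>?b\<bar> <= 1" using t by auto
    have "norm ((?a *\<^sub>R u - ?b *\<^sub>R v) - (?a *\<^sub>R u' - ?b *\<^sub>R v')) = norm (?a *\<^sub>R (u - u') - ?b *\<^sub>R (v - v'))"
     by (simp add: algebra_simps)
    also have "... <= norm (?a *\<^sub>R (u - u')) + norm (?b *\<^sub>R (v - v'))" by (rule norm_triangle_ineq4)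
    also have "... <= dist u u' + dist v v'"
     using mult_right_mono[OF ab(1), of "norm (u - u')"] mult_right_mono[OF ab(2), of "norm (v - v')"]
     by (simp add: dist_norm)
    finally have "dist (X \<oplus> (?a *\<^sub>R u - ?b *\<^sub>R v)) (X' \<oplus> (?a *\<^sub>R u' - ?b *\<^sub>R v')) < e"
     using dist_torus_shift_le2[of X "?a *\<^sub>R u - ?b *\<^sub>R v" X' "?a *\<^sub>R u' - ?b *\<^sub>R v'"] dd by linarith
    then show "dist (bridge_path (fst th) (fst (snd th)) (snd (snd th)) t) (bridge_path (fst th') (fst (snd th')) (snd (snd th')) t) < e"
     using t by (simp add: bridge_path_def th th')
   qed
  qed (use \<open>e > 0\<close> in auto)
 qed (rule bridge_path_in_paths)
 define om_0 where "om_0 = bridge_path (abs_torus 0 :: 'n torus) 0 0"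
 have "om_0 \<in> space path_borel" unfolding space_path_borel om_0_def by (rule bridge_path_in_paths)
 then have "(%x. (om_0, (f x, (g x, h x)))) \<in> M \<rightarrow>\<^sub>M path_borel \<Otimes>\<^sub>M borel"
  unfolding borel_prod[symmetric] by measurable
 from measurable_compose[OF this *] show ?thesis by simp
qed

lemma absolutely_continuous_bridge_path: "absolutely_continuous_curve (bridge_path X u v)"
proof -
 define K where "K = 1 + 2 * norm u + 2 * norm v"
 have const: "absolutely_continuous_curve (%_. X)"
  unfolding absolutely_continuous_curve_def
 proof (intro allI impI)
  fix ep :: real assume "ep > 0"
  then show "\<exists>dl>0. \<forall>I :: (real \<times> real) set. finite I & (\<forall>(a, b)\<in>I. 0 <= a & a <= b & b <= 1) &
  disjoint_family_on (%(a, b). {a<..<b}) I & (\<Sum>(a, b)\<in>I. b - a) < dl --> (\<Sum>(a, b)\<in>I. dist X X) < ep"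
   by (intro exI[of _ 1]) (simp add: case_prod_unfold)
 qed
 show ?thesis
 proof (rule absolutely_continuous_curve_transform[OF const, where \<tau> = "%t. t" and C = K])
  show "K > 0" unfolding K_def using norm_ge_zero[of u] norm_ge_zero[of v] by linarith
  have K1: "1 <= K" unfolding K_def by simp
  show "b - a <= K * (b - a)" if "a <= b" for a b using mult_right_mono[OF K1, of "b - a"] that by simp
  show "dist (bridge_path X u v a) (bridge_path X u v b) <= K * (dist X X + (b - a))"
   if ab: "0 <= a" "a <= b" "b <= 1" for a b
  proof -
   let ?A = "%t. min 1 (2 * t)" and ?B = "%t. max 0 (2 * t - 1 :: real)"
   have "dist (bridge_path X u v a) (bridge_path X u v b) <= norm ((?A a *\<^sub>R u - ?B a *\<^sub>R v) - (?A b *\<^sub>R u - ?B b *\<^sub>R v))"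
    using ab dist_torus_shift_le by (simp add: bridge_path_def)
   also have "... = norm ((?A a - ?A b) *\<^sub>R u - (?B a - ?B b) *\<^sub>R v)" by (simp add: algebra_simps)
   also have "... <= \<bar>?A a - ?A b\<bar> * norm u + \<bar>?B a - ?B b\<bar> * norm v"
    using norm_triangle_ineq4[of "(?A a - ?A b) *\<^sub>R u" "(?B a - ?B b) *\<^sub>R v"] by simp
   also have "... <= (2 * (b - a)) * norm u + (2 * (b - a)) * norm v"
    using ab by (intro add_mono mult_right_mono) auto
   also have "... <= K * (b - a)" using ab by (simp add: K_def algebra_simps)
   finally show ?thesis by simp
  qed
 qed auto
qed

lemma curve_action_bridge_path:
 assumes "norm u <= K" "norm v <= K"
 shows "curve_action (bridge_path X u v) <= ennreal (2 * K\<^sup>2)"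
proof -
 have K: "K >= 0" using assms(1) norm_ge_zero[of u] by linarith
 have "norm (velocity (bridge_path X u v) t) <= 2 * K" if t: "t \<in> {0<..<1}" "t ~= 1/2" for t
 proof (cases "t < 1/2")
  case True
  have "eventually (%s. s \<in> {0<..<1/2}) (nhds t)" using t True by (intro eventually_nhds_in_open) auto
  then have ev: "eventually (%s. bridge_path X u v s = X \<oplus> (s *\<^sub>R (2 *\<^sub>R u))) (nhds t)"
   by eventually_elim (simp add: bridge_path_def mult.commute)
  have "((%s. s *\<^sub>R (2 *\<^sub>R u)) has_vector_derivative (2 *\<^sub>R u)) (at t)"
   by (auto intro!: derivative_eq_intros)
  from velocity_shift_curve[OF t(1) ev this] show ?thesis using assms by simp
 next
  case False
  have "eventually (%s. s \<in> {1/2<..<1}) (nhds t)" using t False by (intro eventually_nhds_in_open) auto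
  then have ev: "eventually (%s. bridge_path X u v s = X \<oplus> (u - (2 * s - 1) *\<^sub>R v)) (nhds t)"
   by eventually_elim (simp add: bridge_path_def)
  have "((%s. u - (2 * s - 1) *\<^sub>R v) has_vector_derivative (- (2 *\<^sub>R v))) (at t)"
   by (auto intro!: derivative_eq_intros)
  from velocity_shift_curve[OF t(1) ev this] show ?thesis using assms by simp
 qed
 then have b: "ennreal (1 / 2 * (norm (velocity01 (bridge_path X u v) t))\<^sup>2) <= ennreal (2 * K\<^sup>2) * indicator {0..1} t"
  if "t ~= 1/2" for t
  using that power_mono[of "norm (velocity (bridge_path X u v) t)" "2 * K" 2]
  by (auto simp: velocity01_def power_mult_distrib split: split_indicator intro!: ennreal_leI)
 have "kinetic (bridge_path X u v) <= (\<integral>\<^sup>+t. ennreal (2 * K\<^sup>2) * indicator {0..1} (t::real) \<partial>lborel)"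
  unfolding kinetic_def
 proof (rule nn_integral_mono_AE)
  have "AE t in lborel. t ~= (1/2::real)" by (rule AE_lborel_singleton)
  then show "AE t in lborel. ennreal (1 / 2 * (norm (velocity01 (bridge_path X u v) t))\<^sup>2) <= ennreal (2 * K\<^sup>2) * indicator {0..1} t"
   by eventually_elim (rule b)
 qed
 also have "... = ennreal (2 * K\<^sup>2)" by (simp add: nn_integral_cmult)
 finally show ?thesis by (simp add: curve_action_alt absolutely_continuous_bridge_path)
qed

lemma nn_integral_torus_diff_uniform:
 fixes f :: "real ^ 'n::finite => ennreal"
 assumes [measurable]: "f : borel_measurable borel"
 shows "(\<integral>\<^sup>+Y. f (torus_diff Y X) \<partial>TM) = (\<integral>\<^sup>+Y. f (rep Y) \<partial>TM)"
proof -
 have "torus_diff Y X = rep (Y \<oplus> - rep X)" for Y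
  by (simp add: torus_diff_def torus_shift_rep)
 then show ?thesis using nn_integral_torus_shift[of "%Y. f (rep Y)" "- rep X"] by simp
qed

lemma nn_integral_random_shift:
 fixes f :: "'n::finite torus => ennreal" and P :: "(real => 'n torus) measure"
 assumes f[measurable]: "f : borel_measurable borel" and E: "E : borel_measurable P"
  and unif: "!!g :: 'n torus => ennreal. g : borel_measurable borel ==> (\<integral>\<^sup>+om. g (E om) \<partial>P) = (\<integral>\<^sup>+x. g x \<partial>TM)"
 shows "(\<integral>\<^sup>+om. \<integral>\<^sup>+y. f (E om \<oplus> r *\<^sub>R torus_diff y (E om)) \<partial>TM \<partial>P) = (\<integral>\<^sup>+x. f x \<partial>TM)"
proof -
 interpret pair_prob_space "TM :: 'n torus measure" "TM :: 'n torus measure" ..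
 have g: "(%X. \<integral>\<^sup>+y. f (X \<oplus> r *\<^sub>R rep y) \<partial>TM) : borel_measurable borel" by measurable
 have "(\<integral>\<^sup>+om. \<integral>\<^sup>+y. f (E om \<oplus> r *\<^sub>R torus_diff y (E om)) \<partial>TM \<partial>P)
  = (\<integral>\<^sup>+om. \<integral>\<^sup>+y. f (E om \<oplus> r *\<^sub>R rep y) \<partial>TM \<partial>P)"
  by (intro nn_integral_cong nn_integral_torus_diff_uniform[of "%v. f (_ \<oplus> r *\<^sub>R v)"]) measurable
 also have "... = (\<integral>\<^sup>+X. \<integral>\<^sup>+y. f (X \<oplus> r *\<^sub>R rep y) \<partial>TM \<partial>TM)" by (rule unif[OF g])
 also have "... = (\<integral>\<^sup>+y. \<integral>\<^sup>+X. f (X \<oplus> r *\<^sub>R rep y) \<partial>TM \<partial>TM)"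
  by (rule Fubini'[symmetric]) measurable
 also have "... = (\<integral>\<^sup>+y. \<integral>\<^sup>+X. f X \<partial>TM \<partial>(TM :: 'n torus measure))"
  by (intro nn_integral_cong nn_integral_torus_shift) measurable
 also have "... = (\<integral>\<^sup>+x. f x \<partial>TM)" using torus.emeasure_space_1[where ?'n = 'n] by simp
 finally show ?thesis .
qed

text \<open>Each path is led through an independent uniform midpoint. In either half it is an end point displaced by a multiple of an independent vector; the end point is uniform, and so is every translate.\<close>

lemma ex_incompressible_flow_finite_action:
 fixes \<nu> :: "'n::finite flow"
 assumes \<eta>: "\<eta> \<in> torus_plans" and gm: "gm \<in> torus_plans" and \<nu>: "generalized_flow \<eta> gm \<nu>"
 obtains \<nu>' where "generalized_flow \<eta> gm \<nu>'" "incompressible \<nu>'" "flow_action \<nu>' < \<infinity>"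
proof -
 define \<Phi> where "\<Phi> om y = bridge_path (om 0) (torus_diff y (om 0)) (torus_diff y (om 1))" for om :: "real => 'n torus" and y
 have m: "(%(om, y). \<Phi> om y) \<in> path_borel \<Otimes>\<^sub>M borel \<rightarrow>\<^sub>M path_borel"
 proof -
  have e: "(%z :: (real => 'n torus) \<times> 'n torus. fst z 0) : borel_measurable flow_borel"
   "(%z :: (real => 'n torus) \<times> 'n torus. fst z 1) : borel_measurable flow_borel"
   by (auto intro!: measurable_path_eval[OF measurable_fst])
  show ?thesis unfolding \<Phi>_def case_prod_unfold
   by (rule measurable_bridge_path[where f = "%z. fst z 0" and g = "%z. torus_diff (snd z) (fst z 0)" and h = "%z. torus_diff (snd z) (fst z 1)",
      OF e(1) measurable_torus_diff[OF measurable_snd e(1)] measurable_torus_diff[OF measurable_snd e(2)]])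
 qed
 have arrive: "X \<oplus> (torus_diff Y X - torus_diff Y Z) = Z" for X Y Z :: "'n torus"
 proof -
  have "X \<oplus> (torus_diff Y X - torus_diff Y Z) = X \<oplus> torus_diff Y X \<oplus> - torus_diff Y Z"
   unfolding torus_shift_assoc by simp
  also have "... = Z \<oplus> torus_diff Y Z \<oplus> - torus_diff Y Z" by (simp only: torus_shift_diff)
  finally show ?thesis by (simp only: torus_shift_minus)
 qed
 have "\<Phi> om y 0 = om 0" "\<Phi> om y 1 = om 1" for om y by (simp_all add: \<Phi>_def bridge_path_def arrive)
 from transport_flow[OF \<eta> gm \<nu> prob_space_torus_measure sets_torus_measure m this]
 obtain \<nu>' where \<nu>': "generalized_flow \<eta> gm \<nu>'" and law: "!!F :: _ => ennreal. F : borel_measurable path_borel ==>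
  (\<integral>\<^sup>+om. F om \<partial>path_law \<nu>') = (\<integral>\<^sup>+om. \<integral>\<^sup>+y. F (\<Phi> om y) \<partial>TM \<partial>path_law \<nu>)" by blast
 have "incompressible \<nu>'"
  unfolding incompressible_iff[OF \<nu>']
 proof (intro ballI allI impI)
  fix t :: real and f :: "'n torus => ennreal" assume t: "t \<in> {0..1}" and f[measurable]: "f : borel_measurable borel"
  have ev: "(%om. om s) : borel_measurable (path_law \<nu>)" if "s \<in> {0..1}" for s
   unfolding measurable_cong_sets[OF sets_path_law refl]
   by (rule measurable_path_eval[OF measurable_ident_sets[OF refl] that])
  have "(\<integral>\<^sup>+om. f (om t) \<partial>path_law \<nu>') = (\<integral>\<^sup>+om. \<integral>\<^sup>+y. f (\<Phi> om y t) \<partial>TM \<partial>path_law \<nu>)"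
   by (rule law) (rule measurable_compose[OF measurable_path_eval[OF measurable_ident_sets[OF refl] t] f])
  also have "... = (\<integral>\<^sup>+x. f x \<partial>TM)"
  proof (cases "t <= 1/2")
   case True
   then have "\<Phi> om y t = om 0 \<oplus> (2 * t) *\<^sub>R torus_diff y (om 0)" for om y
    using t by (simp add: \<Phi>_def bridge_path_def)
   then show ?thesis
    using nn_integral_random_shift[OF f ev[of 0] path_law_endpoint_uniform[OF \<eta> gm \<nu>], of "2 * t"] by simp
  next
   case False
   have "\<Phi> om y t = om 1 \<oplus> (2 - 2 * t) *\<^sub>R torus_diff y (om 1)" for om y
   proof -
    let ?u = "torus_diff y (om 0)" and ?v = "torus_diff y (om 1)"
    have "\<Phi> om y t = om 0 \<oplus> (?u - (2 * t - 1) *\<^sub>R ?v)" using t False by (simp add: \<Phi>_def bridge_path_def)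
    also have "... = om 0 \<oplus> (?u - ?v) \<oplus> ((2 - 2 * t) *\<^sub>R ?v)" by (simp add: torus_shift_assoc algebra_simps scaleR_2)
    finally show ?thesis by (simp add: arrive)
   qed
   then show ?thesis
    using nn_integral_random_shift[OF f ev[of 1] path_law_endpoint_uniform[OF \<eta> gm \<nu>], of "2 - 2 * t"] by simp
  qed
  finally show "(\<integral>\<^sup>+om. f (om t) \<partial>path_law \<nu>') = (\<integral>\<^sup>+x. f x \<partial>TM)" .
 qed
 moreover have "flow_action \<nu>' < \<infinity>"
 proof -
  interpret P: prob_space "path_law \<nu>" by (rule prob_space_path_law[OF \<nu>])
  let ?K = "2 * (real CARD('n))\<^sup>2"
  have n: "norm (torus_diff X Y) <= real CARD('n)" for X Y :: "'n torus"
   using dist_torus_bounded[of X Y] by (simp add: dist_torus_eq)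
  have "flow_action \<nu>' = (\<integral>\<^sup>+om. \<integral>\<^sup>+y. curve_action (\<Phi> om y) \<partial>TM \<partial>path_law \<nu>)"
   unfolding flow_action_eq[OF \<nu>'] by (rule law) measurable
  also have "... <= (\<integral>\<^sup>+om. \<integral>\<^sup>+y. ennreal ?K \<partial>(TM :: 'n torus measure) \<partial>path_law \<nu>)"
   unfolding \<Phi>_def by (intro nn_integral_mono curve_action_bridge_path n)
  also have "... = ennreal ?K"
   using P.emeasure_space_1 torus.emeasure_space_1[where ?'n = 'n] by simp
  finally show ?thesis by (rule le_less_trans) simp
 qed
 ultimately show ?thesis using that \<nu>' by blast
qed

section \<open>Shears of the torus\<close>

lemma nn_integral_periodic_interval:
 fixes G :: "real => ennreal"
 assumes [measurable]: "G : borel_measurable borel" and per: "!!x. G (x + 1) = G x"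
 shows "(\<integral>\<^sup>+x. G x * indicator {a..a + 1} x \<partial>lborel) = (\<integral>\<^sup>+x. G x * indicator {0..1} x \<partial>lborel)"
proof -
 have shift: "(\<integral>\<^sup>+x. H x \<partial>lborel) = (\<integral>\<^sup>+x. H (c + x) \<partial>lborel)" if [measurable]: "H : borel_measurable borel" for H :: "real => ennreal" and c
  using nn_integral_real_affine[of H 1 c] by simp
 have pern: "G (of_int n + x) = G x" for n x
 proof (induction n rule: int_induct[of _ 0])
  case (step1 i) then show ?case using per[of "of_int i + x"] by (simp add: ac_simps)
 next
  case (step2 i) then show ?case using per[of "of_int (i - 1) + x"] by (simp add: ac_simps)
 qed simp
 have half: "(\<integral>\<^sup>+x. G x * indicator {c..c + 1} x \<partial>lborel) = (\<integral>\<^sup>+x. G x * indicator {c..<c+1} x \<partial>lborel)" for c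
 proof (rule nn_integral_cong_AE)
  have "AE x in lborel. x ~= c + 1" by (rule AE_lborel_singleton)
  then show "AE x in lborel. G x * indicator {c..c + 1} x = G x * indicator {c..<c+1} x"
   by eventually_elim (auto split: split_indicator)
 qed
 define n where "n = \<lfloor>a\<rfloor>"
 have n: "of_int n <= a" "a < of_int n + 1" by (auto simp: n_def)
 have "(\<integral>\<^sup>+x. G x * indicator {a..<a+1} x \<partial>lborel)
   = (\<integral>\<^sup>+x. G x * indicator {a..<of_int n + 1} x + G x * indicator {of_int n + 1..<a + 1} x \<partial>lborel)"
  using n by (intro nn_integral_cong) (auto split: split_indicator)
 also have "... = (\<integral>\<^sup>+x. G x * indicator {a..<of_int n + 1} x \<partial>lborel) + (\<integral>\<^sup>+x. G x * indicator {of_int n + 1..<a + 1} x \<partial>lborel)"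
  by (rule nn_integral_add) auto
 also have "(\<integral>\<^sup>+x. G x * indicator {of_int n + 1..<a + 1} x \<partial>lborel) = (\<integral>\<^sup>+x. G x * indicator {of_int n..<a} x \<partial>lborel)"
  by (subst shift[of _ 1]) (auto intro!: nn_integral_cong simp: per add.commute[of 1] split: split_indicator)
 also have "(\<integral>\<^sup>+x. G x * indicator {a..<of_int n + 1} x \<partial>lborel) + (\<integral>\<^sup>+x. G x * indicator {of_int n..<a} x \<partial>lborel)
  = (\<integral>\<^sup>+x. G x * indicator {a..<of_int n + 1} x + G x * indicator {of_int n..<a} x \<partial>lborel)"
  by (rule nn_integral_add[symmetric]) auto
 also have "... = (\<integral>\<^sup>+x. G x * indicator {of_int n..<of_int n + 1} x \<partial>lborel)"
  using n by (intro nn_integral_cong) (auto split: split_indicator)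
 also have "... = (\<integral>\<^sup>+x. G x * indicator {0..<0+1} x \<partial>lborel)"
  by (subst shift[of _ "of_int n"]) (auto intro!: nn_integral_cong simp: pern split: split_indicator)
 finally show ?thesis using half[of a] half[of 0] by simp
qed

lemma nn_integral_torus_average:
 fixes H :: "'n::finite torus => ennreal"
 assumes [measurable]: "H : borel_measurable borel"
 shows "(\<integral>\<^sup>+X. H X \<partial>TM) = (\<integral>\<^sup>+X. \<integral>\<^sup>+s. H (X \<oplus> s *\<^sub>R axis i 1) * indicator {0..1::real} s \<partial>lborel \<partial>TM)"
proof -
 interpret pair_sigma_finite "TM :: 'n torus measure" "lborel :: real measure" ..
 have "(\<integral>\<^sup>+X. H X \<partial>TM) = (\<integral>\<^sup>+s. (\<integral>\<^sup>+X. H X \<partial>TM) * indicator {0..1::real} s \<partial>lborel)"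
  by (simp add: nn_integral_cmult)
 also have "... = (\<integral>\<^sup>+s. \<integral>\<^sup>+X. H (X \<oplus> s *\<^sub>R axis i 1) * indicator {0..1::real} s \<partial>TM \<partial>lborel)"
  by (intro nn_integral_cong) (simp add: nn_integral_multc nn_integral_torus_shift)
 also have "... = (\<integral>\<^sup>+X. \<integral>\<^sup>+s. H (X \<oplus> s *\<^sub>R axis i 1) * indicator {0..1::real} s \<partial>lborel \<partial>TM)"
  by (rule Fubini') measurable
 finally show ?thesis .
qed

text \<open>Fubini along one coordinate reduces this to a change of variables on a circle.\<close>

lemma nn_integral_shear:
 fixes F :: "'n::finite torus => ennreal" and g g' r2 :: "real ^ 'n => real"
 assumes F[measurable]: "F : borel_measurable borel"
  and per: "!!x y. lattice_rel x y ==> g x = g y" "!!x y. lattice_rel x y ==> g' x = g' y" "!!x y. lattice_rel x y ==> r2 x = r2 y"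
  and mg[measurable]: "g : borel_measurable borel" "g' : borel_measurable borel" "r2 : borel_measurable borel"
  and d: "!!x s. ((%s. g (x + s *\<^sub>R axis i 1)) has_real_derivative g' (x + s *\<^sub>R axis i 1)) (at s)"
  and c: "!!x. continuous_on UNIV (%s. g' (x + s *\<^sub>R axis i 1))"
  and pos: "!!x. 1 + g' x >= 0" "!!x. r2 x >= 0"
  and inv: "!!x s. r2 (x + s *\<^sub>R axis i 1) = r2 x"
 shows "(\<integral>\<^sup>+X. F (X \<oplus> g (rep X) *\<^sub>R axis i 1) * ennreal (r2 (rep X) * (1 + g' (rep X))) \<partial>TM)
  = (\<integral>\<^sup>+X. F X * ennreal (r2 (rep X)) \<partial>TM)"
proof -
 define H where "H X = F (X \<oplus> g (rep X) *\<^sub>R axis i 1) * ennreal (r2 (rep X) * (1 + g' (rep X)))" for X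
 have rel: "lattice_rel (rep (X \<oplus> v)) (rep X + v)" for X :: "'n torus" and v
  by (subst abs_torus_eq_iff[symmetric]) (simp add: torus_shift_rep)
 have "(\<integral>\<^sup>+s. H (X \<oplus> s *\<^sub>R axis i 1) * indicator {0..1::real} s \<partial>lborel)
   = (\<integral>\<^sup>+s. (F (X \<oplus> s *\<^sub>R axis i 1) * ennreal (r2 (rep (X \<oplus> s *\<^sub>R axis i 1)))) * indicator {0..1::real} s \<partial>lborel)" for X
 proof -
  define x where "x = rep X"
  define G where "G u = F (X \<oplus> u *\<^sub>R axis i 1)" for u
  define h where "h s = s + g (x + s *\<^sub>R axis i 1)" for s
  have [measurable]: "G : borel_measurable borel" unfolding G_def by measurable
  have perG: "G (u + 1) = G u" for u
  proof -
   have "X \<oplus> (u + 1) *\<^sub>R axis i 1 = X \<oplus> u *\<^sub>R axis i 1"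
    unfolding torus_shift_rep abs_torus_eq_iff lattice_rel_def by (auto simp: algebra_simps axis_def)
   then show ?thesis by (simp add: G_def)
  qed
  have "lattice_rel (x + 1 *\<^sub>R axis i 1) (x + 0 *\<^sub>R axis i 1)"
   by (auto simp: lattice_rel_def axis_def)
  from per(1)[OF this] have h1: "h 1 = h 0 + 1" by (simp add: h_def)
  have dh: "(h has_real_derivative 1 + g' (x + s *\<^sub>R axis i 1)) (at s)" for s
   unfolding h_def[abs_def] by (intro derivative_intros d)
  have "H (X \<oplus> s *\<^sub>R axis i 1) = ennreal (r2 x) * (G (h s) * ennreal (1 + g' (x + s *\<^sub>R axis i 1)))" for s
  proof -
   have "X \<oplus> s *\<^sub>R axis i 1 \<oplus> g (x + s *\<^sub>R axis i 1) *\<^sub>R axis i 1 = X \<oplus> h s *\<^sub>R axis i 1"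
    by (simp add: torus_shift_assoc h_def scaleR_left_distrib)
   moreover have "g (rep (X \<oplus> s *\<^sub>R axis i 1)) = g (x + s *\<^sub>R axis i 1)"
    "g' (rep (X \<oplus> s *\<^sub>R axis i 1)) = g' (x + s *\<^sub>R axis i 1)"
    "r2 (rep (X \<oplus> s *\<^sub>R axis i 1)) = r2 x"
    using per(1)[OF rel[of X "s *\<^sub>R axis i 1"]] per(2)[OF rel[of X "s *\<^sub>R axis i 1"]] per(3)[OF rel[of X "s *\<^sub>R axis i 1"]]
    unfolding x_def by (simp_all only: inv)
   ultimately have "H (X \<oplus> s *\<^sub>R axis i 1) = G (h s) * ennreal (r2 x * (1 + g' (x + s *\<^sub>R axis i 1)))"
    by (simp only: H_def G_def)
   also have "ennreal (r2 x * (1 + g' (x + s *\<^sub>R axis i 1))) = ennreal (r2 x) * ennreal (1 + g' (x + s *\<^sub>R axis i 1))"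
    by (rule ennreal_mult[OF pos(2) pos(1)])
   finally show ?thesis by (simp only: mult_ac)
  qed
  note Heq = this
  have "(\<integral>\<^sup>+s. H (X \<oplus> s *\<^sub>R axis i 1) * indicator {0..1::real} s \<partial>lborel)
   = (\<integral>\<^sup>+s. ennreal (r2 x) * (G (h s) * ennreal (1 + g' (x + s *\<^sub>R axis i 1)) * indicator {0..1::real} s) \<partial>lborel)"
   unfolding Heq by (simp only: mult.assoc)
  also have "... = ennreal (r2 x) * (\<integral>\<^sup>+s. G (h s) * ennreal (1 + g' (x + s *\<^sub>R axis i 1)) * indicator {0..1::real} s \<partial>lborel)"
   unfolding h_def by (rule nn_integral_cmult) measurable
  also have "(\<integral>\<^sup>+s. G (h s) * ennreal (1 + g' (x + s *\<^sub>R axis i 1)) * indicator {0..1::real} s \<partial>lborel)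
   = (\<integral>\<^sup>+u. G u * indicator {h 0..h 1} u \<partial>lborel)"
  proof (rule nn_integral_substitution_aux[symmetric])
   show "continuous_on {0..1} (%s. 1 + g' (x + s *\<^sub>R axis i 1))"
    by (intro continuous_on_add continuous_on_const continuous_on_subset[OF c]) simp
  qed (use dh pos in simp_all)
  also have "... = (\<integral>\<^sup>+u. G u * indicator {0..1} u \<partial>lborel)"
   unfolding h1 by (rule nn_integral_periodic_interval) (simp_all add: perG)
  also have "ennreal (r2 x) * ... = (\<integral>\<^sup>+s. ennreal (r2 x) * (G s * indicator {0..1} s) \<partial>lborel)"
   by (rule nn_integral_cmult[symmetric]) measurable
  also have "... = (\<integral>\<^sup>+s. (F (X \<oplus> s *\<^sub>R axis i 1) * ennreal (r2 (rep (X \<oplus> s *\<^sub>R axis i 1)))) * indicator {0..1::real} s \<partial>lborel)"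
  proof (rule nn_integral_cong)
   fix s
   have "r2 (rep (X \<oplus> s *\<^sub>R axis i 1)) = r2 x"
    using per(3)[OF rel[of X "s *\<^sub>R axis i 1"]] unfolding x_def by (simp only: inv)
   then show "ennreal (r2 x) * (G s * indicator {0..1} s) = (F (X \<oplus> s *\<^sub>R axis i 1) * ennreal (r2 (rep (X \<oplus> s *\<^sub>R axis i 1)))) * indicator {0..1} s"
    by (simp only: G_def mult_ac)
  qed
  finally show ?thesis .
 qed
 moreover have "H : borel_measurable borel" unfolding H_def by measurable
 ultimately show ?thesis
  unfolding H_def[symmetric]
  using nn_integral_torus_average[of H i] nn_integral_torus_average[of "%X. F X * ennreal (r2 (rep X))" i]
  by simp
qed

section \<open>Trigonometric modes\<close>

definition mode :: "complex => real ^ 'n => real ^ 'n => real" where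
 "mode c k x = Re c * cos (2 * pi * (k \<bullet> x)) - Im c * sin (2 * pi * (k \<bullet> x))"

lemma mode_eq_Re: "mode c k x = Re (c * cis (2 * pi * (k \<bullet> x)))"
 by (simp add: mode_def)

lemma abs_mode_le: "\<bar>mode c k x\<bar> <= cmod c"
 unfolding mode_eq_Re by (rule order_trans[OF abs_Re_le_cmod]) (simp add: norm_mult)

lemma lattice_inner_Ints:
 assumes "k \<in> lattice" "lattice_rel x y" shows "k \<bullet> x - k \<bullet> y \<in> \<int>"
proof -
 have "k \<bullet> x - k \<bullet> y = (\<Sum>i\<in>UNIV. k $ i * (x $ i - y $ i))"
  by (simp add: inner_vec_def algebra_simps sum_subtractf)
 also have "... \<in> \<int>" using assms by (intro Ints_sum Ints_mult) (auto simp: lattice_def lattice_rel_def)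
 finally show ?thesis .
qed

lemma cis_periodic: assumes "a - b \<in> \<int>" shows "cis (2 * pi * a) = cis (2 * pi * b)"
proof -
 have "cis (2 * pi * a) = cis (2 * pi * b) * cis (2 * pi * (a - b))"
  by (simp add: cis_mult algebra_simps)
 then show ?thesis using cis_multiple_2pi[OF assms] by simp
qed

lemma mode_periodic: assumes "k \<in> lattice" "lattice_rel x y" shows "mode c k x = mode c k y"
 unfolding mode_eq_Re using cis_periodic[OF lattice_inner_Ints[OF assms]] by simp

lemma has_derivative_mode:
 assumes "(c has_vector_derivative c') (at (fst z))"
 shows "((%z. mode (c (fst z)) k (snd z)) has_derivative
  (%h. mode (fst h *\<^sub>R c' + 2 * pi * (k \<bullet> snd h) * \<i> * c (fst z)) k (snd z))) (at z)"
proof -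
 have c: "((%z. c (fst z)) has_derivative (%h. fst h *\<^sub>R c')) (at z)"
  using has_derivative_compose[OF has_derivative_fst[OF has_derivative_ident] assms[unfolded has_vector_derivative_def]] by simp
 show ?thesis
  unfolding mode_def
  by (rule derivative_eq_intros c has_derivative_Re[OF c] has_derivative_Im[OF c] refl)+
   (auto simp: fun_eq_iff algebra_simps)
qed

lemma periodic_C1_mode:
 fixes c :: "real => complex"
 assumes k: "k \<in> lattice" and d: "!!t. (c has_vector_derivative c' t) (at t)"
  and B: "!!t. cmod (c t) <= B" "!!t. cmod (c' t) <= B"
 shows "periodic_C1 (%z. mode (c (fst z)) k (snd z))
  (%z h. mode (fst h *\<^sub>R c' (fst z) + 2 * pi * (k \<bullet> snd h) * \<i> * c (fst z)) k (snd z)) (B * (1 + 2 * pi * norm k))"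
 unfolding periodic_C1_def
proof (intro conjI allI impI)
 have B0: "B >= 0" using B(1)[of 0] norm_ge_zero[of "c 0"] by linarith
 fix z h :: "real \<times> (real ^ 'a)"
 show "((%z. mode (c (fst z)) k (snd z)) has_derivative
  (%h. mode (fst h *\<^sub>R c' (fst z) + 2 * pi * (k \<bullet> snd h) * \<i> * c (fst z)) k (snd z))) (at z)"
  by (rule has_derivative_mode[OF d])
 have "norm (mode (c (fst z)) k (snd z)) <= B" using abs_mode_le[of "c (fst z)" k "snd z"] B(1)[of "fst z"] by simp
 also have "... <= B * (1 + 2 * pi * norm k)" using B0 by (simp add: algebra_simps)
 finally show "norm (mode (c (fst z)) k (snd z)) <= B * (1 + 2 * pi * norm k)" .
 have "norm (mode (fst h *\<^sub>R c' (fst z) + 2 * pi * (k \<bullet> snd h) * \<i> * c (fst z)) k (snd z))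
   <= cmod (fst h *\<^sub>R c' (fst z) + 2 * pi * (k \<bullet> snd h) * \<i> * c (fst z))"
  using abs_mode_le by simp
 also have "... <= \<bar>fst h\<bar> * cmod (c' (fst z)) + 2 * pi * \<bar>k \<bullet> snd h\<bar> * cmod (c (fst z))"
  using norm_triangle_ineq[of "fst h *\<^sub>R c' (fst z)" "2 * pi * (k \<bullet> snd h) * \<i> * c (fst z)"]
  by (simp add: norm_mult)
 also have "... <= norm h * B + 2 * pi * (norm k * norm h) * B"
 proof (intro add_mono mult_mono B)
  show "\<bar>fst h\<bar> <= norm h" using norm_fst_le[of "fst h" "snd h"] by simp
  have "\<bar>k \<bullet> snd h\<bar> <= norm k * norm (snd h)" by (rule Cauchy_Schwarz_ineq2)
  also have "... <= norm k * norm h" using norm_snd_le[of "snd h" "fst h"] by (intro mult_left_mono) auto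
  finally show "\<bar>k \<bullet> snd h\<bar> <= norm k * norm h" .
 qed auto
 also have "... = B * (1 + 2 * pi * norm k) * norm h" by (simp add: algebra_simps)
 finally show "norm (mode (fst h *\<^sub>R c' (fst z) + 2 * pi * (k \<bullet> snd h) * \<i> * c (fst z)) k (snd z)) <= B * (1 + 2 * pi * norm k) * norm h" .
next
 fix t :: real and x y :: "real ^ 'a" assume "lattice_rel x y"
 then show "mode (c (fst (t, x))) k (snd (t, x)) = mode (c (fst (t, y))) k (snd (t, y))"
  by (simp add: mode_periodic[OF k])
qed

lemma periodic_C1_add:
 assumes "periodic_C1 U U' K" "periodic_C1 V V' L"
 shows "periodic_C1 (%z. U z + V z) (%z h. U' z h + V' z h) (K + L)"
proof -
 note u = periodic_C1D(1-4)[OF assms(1)] and v = periodic_C1D(1-4)[OF assms(2)]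
 show ?thesis
  unfolding periodic_C1_def
 proof (intro conjI allI impI)
  show "((%z. U z + V z) has_derivative (%h. U' z h + V' z h)) (at z)" for z
   by (intro has_derivative_add u v)
  show "norm (U z + V z) <= K + L" for z
   using norm_triangle_ineq[of "U z" "V z"] u(3)[of z] v(3)[of z] by linarith
  show "norm (U' z h + V' z h) <= (K + L) * norm h" for z h
   using norm_triangle_ineq[of "U' z h" "V' z h"] u(4)[of z h] v(4)[of z h] by (simp add: algebra_simps)
  show "U (t, x) + V (t, x) = U (t, y) + V (t, y)" if "lattice_rel x y" for t x y
   using u(2)[OF that] v(2)[OF that] by simp
 qed
qed

lemma periodic_C1_zero: "periodic_C1 (%z. 0) (%z h. 0) 0"
 by (simp add: periodic_C1_def)

lemma periodic_C1_sum:
 assumes "!!j. j \<in> J ==> periodic_C1 (U j) (U' j) (K j)"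
 shows "periodic_C1 (%z. \<Sum>j\<in>J. U j z) (%z h. \<Sum>j\<in>J. U' j z h) (\<Sum>j\<in>J. K j)"
 using assms
proof (induction J rule: infinite_finite_induct)
 case (insert j J)
 then show ?case using periodic_C1_add[of "U j" "U' j" "K j"] by simp
qed (simp_all add: periodic_C1_zero)

lemma periodic_C1_scaleR:
 assumes "periodic_C1 U U' K" "K * (\<bar>r\<bar> * norm v) <= L"
 shows "periodic_C1 (%z. (r * U z) *\<^sub>R v) (%z h. (r * U' z h) *\<^sub>R v) L"
proof -
 note u = periodic_C1D[OF assms(1)]
 show ?thesis
  unfolding periodic_C1_def
 proof (intro conjI allI impI)
  show "((%z. (r * U z) *\<^sub>R v) has_derivative (%h. (r * U' z h) *\<^sub>R v)) (at z)" for z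
   by (intro has_derivative_scaleR_left has_derivative_mult_right u(1))
  show "norm ((r * U z) *\<^sub>R v) <= L" for z
  proof -
   have "norm ((r * U z) *\<^sub>R v) = norm (U z) * (\<bar>r\<bar> * norm v)" by (simp add: abs_mult)
   also have "... <= K * (\<bar>r\<bar> * norm v)" by (intro mult_right_mono u) auto
   finally show ?thesis using assms(2) by linarith
  qed
  show "norm ((r * U' z h) *\<^sub>R v) <= L * norm h" for z h
  proof -
   have "norm ((r * U' z h) *\<^sub>R v) = norm (U' z h) * (\<bar>r\<bar> * norm v)" by (simp add: abs_mult)
   also have "... <= (K * norm h) * (\<bar>r\<bar> * norm v)" by (intro mult_right_mono u) auto
   also have "... = (K * (\<bar>r\<bar> * norm v)) * norm h" by simp
   also have "... <= L * norm h" by (intro mult_right_mono assms) auto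
   finally show ?thesis .
  qed
  show "(r * U (t, x)) *\<^sub>R v = (r * U (t, y)) *\<^sub>R v" if "lattice_rel x y" for t x y
   using u(2)[OF that] by simp
 qed
qed

lemma periodic_C1_weaken: "periodic_C1 U U' K ==> K <= L ==> periodic_C1 U U' L"
proof -
 assume U: "periodic_C1 U U' K" and KL: "K <= L"
 have "norm (U z) <= L" for z using periodic_C1D(3)[OF U, of z] KL by linarith
 moreover have "norm (U' z h) <= L * norm h" for z h
  using periodic_C1D(4)[OF U, of z h] mult_right_mono[OF KL, of "norm h"] by simp
 ultimately show ?thesis using U unfolding periodic_C1_def by simp
qed

text \<open>The second-order part of the quotient \<open>G / (1 + ep sg)\<close> is bounded uniformly in \<open>ep\<close>.\<close>

lemma periodic_C1_quotient_remainder: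
 fixes G sg :: "real \<times> (real ^ 'n) => real"
 assumes G: "periodic_C1 G G' K" and sg: "periodic_C1 sg sg' K" and e: "0 <= e" "e * K <= 1/2"
 shows "\<exists>Q'. periodic_C1 (%z. - (G z * sg z) / (1 + e * sg z)) Q' (8 * K\<^sup>2)"
proof -
 note g = periodic_C1D[OF G] and s = periodic_C1D[OF sg]
 have K: "K >= 0" by (rule g(6))
 have es: "\<bar>e * sg z\<bar> <= 1/2" for z
 proof -
  have "\<bar>e * sg z\<bar> <= e * K" using s(3)[of z] e by (simp add: abs_mult mult_left_mono)
  then show ?thesis using e by linarith
 qed
 then have p: "1 + e * sg z >= 1/2" for z using es[of z] by linarith
 then have pp: "1 + e * sg z > 0" for z using es[of z] by (meson less_le_trans half_gt_zero zero_less_one)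
 then have p0: "1 + e * sg z ~= 0" for z by (simp add: less_imp_neq[symmetric])
 define D where "D z = inverse (1 + e * sg z)" for z
 have D: "0 <= D z" "D z <= 2" for z
 proof -
  show "0 <= D z" using pp[of z] by (simp add: D_def)
  show "D z <= 2" using le_imp_inverse_le[OF p[of z]] by (simp add: D_def)
 qed
 define Q' where "Q' z h = G z * sg z * (D z * (e * sg' z h) * D z) - (G z * sg' z h + G' z h * sg z) * D z" for z h
 have "periodic_C1 (%z. - (G z * sg z) / (1 + e * sg z)) Q' (8 * K\<^sup>2)"
  unfolding periodic_C1_def
 proof (intro conjI allI impI)
  fix z h :: "real \<times> (real ^ 'n)"
  show "((%z. - (G z * sg z) / (1 + e * sg z)) has_derivative Q' z) (at z)"
   by (rule derivative_eq_intros g s p0 refl)+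
    (auto simp: fun_eq_iff Q'_def D_def divide_inverse algebra_simps)
  have gs: "\<bar>G z\<bar> <= K" "\<bar>sg z\<bar> <= K" "\<bar>G' z h\<bar> <= K * norm h" "\<bar>sg' z h\<bar> <= K * norm h"
   using g(3)[of z] s(3)[of z] g(4)[of z h] s(4)[of z h] by simp_all
  have GS: "\<bar>G z * sg z\<bar> <= K * K" unfolding abs_mult by (intro mult_mono gs K) auto
  have "norm (- (G z * sg z) / (1 + e * sg z)) = \<bar>G z * sg z\<bar> * D z"
   using D(1)[of z] by (simp add: D_def divide_inverse abs_mult)
  also have "... <= (K * K) * 2" using D[of z] K by (intro mult_mono GS) auto
  also have "... <= 8 * K\<^sup>2" using K by (simp add: power2_eq_square)
  finally show "norm (- (G z * sg z) / (1 + e * sg z)) <= 8 * K\<^sup>2" .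
  have eS: "\<bar>e * sg' z h\<bar> <= 1/2 * norm h"
  proof -
   have "\<bar>e * sg' z h\<bar> <= e * (K * norm h)" using gs(4) e(1) by (simp add: abs_mult mult_left_mono)
   also have "... = (e * K) * norm h" by simp
   also have "... <= 1/2 * norm h" by (intro mult_right_mono e) auto
   finally show ?thesis .
  qed
  have "\<bar>G z * sg z * (D z * (e * sg' z h) * D z)\<bar> <= (K * K) * (2 * (1/2 * norm h) * 2)"
   unfolding abs_mult[of "G z * sg z"] abs_mult[of "D z * _"] abs_mult[of "D z" "e * _"]
   using D[of z] K by (intro mult_mono GS eS) auto
  moreover have "\<bar>(G z * sg' z h + G' z h * sg z) * D z\<bar> <= (K * (K * norm h) + (K * norm h) * K) * 2"
  proof -
   have "\<bar>G z * sg' z h + G' z h * sg z\<bar> <= \<bar>G z\<bar> * \<bar>sg' z h\<bar> + \<bar>G' z h\<bar> * \<bar>sg z\<bar>"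
    using abs_triangle_ineq[of "G z * sg' z h" "G' z h * sg z"] by (simp add: abs_mult)
   also have "... <= K * (K * norm h) + (K * norm h) * K"
    using K by (intro add_mono mult_mono gs) auto
   finally show ?thesis unfolding abs_mult[of "_ + _"] using D[of z] K by (intro mult_mono) auto
  qed
  ultimately have "\<bar>Q' z h\<bar> <= (K * K) * (2 * (1/2 * norm h) * 2) + (K * (K * norm h) + (K * norm h) * K) * 2"
   unfolding Q'_def by linarith
  also have "... = 6 * K\<^sup>2 * norm h" by (simp add: power2_eq_square algebra_simps)
  also have "... <= 8 * K\<^sup>2 * norm h" by (intro mult_right_mono) auto
  finally show "norm (Q' z h) <= 8 * K\<^sup>2 * norm h" by simp
 next
  fix t :: real and x y :: "real ^ 'n" assume "lattice_rel x y"
  then show "- (G (t, x) * sg (t, x)) / (1 + e * sg (t, x)) = - (G (t, y) * sg (t, y)) / (1 + e * sg (t, y))"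
   using g(2)[of x y t] s(2)[of x y t] by simp
 qed
 then show ?thesis by blast
qed

section \<open>The triangular rectification\<close>

locale modes =
 fixes J :: "'j set" and c c' :: "'j => real => complex" and k :: "'j => real ^ 'n::finite"
  and pos :: "'n => nat" and B :: real
 assumes fin: "finite J"
  and k: "!!j. j \<in> J ==> k j \<in> lattice" "!!j. j \<in> J ==> k j ~= 0"
  and c: "!!j t. j \<in> J ==> (c j has_vector_derivative c' j t) (at t)"
  and B: "!!j t. j \<in> J ==> cmod (c j t) <= B" "!!j t. j \<in> J ==> cmod (c' j t) <= B" "B >= 0"
  and pos: "bij_betw pos UNIV {..<CARD('n)}"
begin

text \<open>Modes whose frequency vanishes in the first \<open>m\<close> coordinates. They make up the density averaged over these coordinates.\<close>

definition tail :: "nat => 'j set" where "tail m = {j\<in>J. \<forall>i. pos i < m --> k j $ i = 0}"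

text \<open>Every mode is charged to the first coordinate on which it depends; integrating in that coordinate gives its potential.\<close>

definition leads :: "'n => 'j set" where
 "leads i = {j\<in>J. k j $ i ~= 0 & (\<forall>i'. pos i' < pos i --> k j $ i' = 0)}"

definition dens :: "nat => real \<times> (real ^ 'n) => real" where
 "dens m z = (\<Sum>j\<in>tail m. mode (c j (fst z)) (k j) (snd z))"

definition pot_coeff :: "'n => 'j => complex" where
 "pot_coeff i j = 1 / (2 * pi * \<i> * (k j $ i))"

definition pot :: "'n => real \<times> (real ^ 'n) => real" where
 "pot i z = (\<Sum>j\<in>leads i. mode (pot_coeff i j * c j (fst z)) (k j) (snd z))"

lemma tail_0: "tail 0 = J" by (simp add: tail_def)

lemma pos_less: "pos i < CARD('n)" using pos by (auto simp: bij_betw_def)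

lemma pos_inj: "pos i = pos i' \<longleftrightarrow> i = i'" using pos by (auto simp: bij_betw_def inj_on_def)

lemma tail_CARD: "tail CARD('n) = {}"
 using k(2) pos_less by (auto simp: tail_def vec_eq_iff)

lemma tail_split: "tail (pos i) = tail (Suc (pos i)) \<union> leads i" "tail (Suc (pos i)) \<inter> leads i = {}"
 by (auto simp: tail_def leads_def less_Suc_eq pos_inj)

lemma fin_tail: "finite (tail m)" "finite (leads i)"
 using fin by (auto simp: tail_def leads_def)

lemma dens_split: "dens (pos i) z = dens (Suc (pos i)) z + (\<Sum>j\<in>leads i. mode (c j (fst z)) (k j) (snd z))"
 unfolding dens_def tail_split(1) using tail_split(2) fin_tail by (intro sum.union_disjoint) auto

lemma dens_CARD: "dens CARD('n) z = 0" by (simp add: dens_def tail_CARD)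

lemma ex_bounds:
 "\<exists>K. K >= 0 & (\<forall>m. \<exists>D. periodic_C1 (dens m) D K) & (\<forall>i. \<exists>D. periodic_C1 (pot i) D K)"
proof -
 have m: "\<exists>D. periodic_C1 (dens m) D (\<Sum>j\<in>J. B * (1 + 2 * pi * norm (k j)))" for m
 proof -
  have "periodic_C1 (%z. \<Sum>j\<in>tail m. mode (c j (fst z)) (k j) (snd z))
  (%z h. \<Sum>j\<in>tail m. mode (fst h *\<^sub>R c' j (fst z) + 2 * pi * (k j \<bullet> snd h) * \<i> * c j (fst z)) (k j) (snd z))
  (\<Sum>j\<in>tail m. B * (1 + 2 * pi * norm (k j)))"
   by (intro periodic_C1_sum periodic_C1_mode) (auto simp: tail_def k c B)
  moreover have "(\<Sum>j\<in>tail m. B * (1 + 2 * pi * norm (k j))) <= (\<Sum>j\<in>J. B * (1 + 2 * pi * norm (k j)))"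
   using fin B(3) by (intro sum_mono2) (auto simp: tail_def)
  ultimately show ?thesis unfolding dens_def[abs_def] using periodic_C1_weaken by blast
 qed
 define L where "L i = (\<Sum>j\<in>leads i. (cmod (pot_coeff i j) * B) * (1 + 2 * pi * norm (k j)))" for i
 have p: "\<exists>D. periodic_C1 (pot i) D (L i)" for i
 proof -
  have "periodic_C1 (%z. \<Sum>j\<in>leads i. mode (pot_coeff i j * c j (fst z)) (k j) (snd z))
  (%z h. \<Sum>j\<in>leads i. mode (fst h *\<^sub>R (pot_coeff i j * c' j (fst z)) + 2 * pi * (k j \<bullet> snd h) * \<i> * (pot_coeff i j * c j (fst z))) (k j) (snd z)) (L i)"
   unfolding L_def
  proof (intro periodic_C1_sum periodic_C1_mode)
   fix j t assume j: "j \<in> leads i"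
   then have jJ: "j \<in> J" by (simp add: leads_def)
   then show "k j \<in> lattice" by (rule k)
   show "((%t. pot_coeff i j * c j t) has_vector_derivative pot_coeff i j * c' j t) (at t)"
    by (intro has_vector_derivative_mult_right c jJ)
   show "cmod (pot_coeff i j * c j t) <= cmod (pot_coeff i j) * B" "cmod (pot_coeff i j * c' j t) <= cmod (pot_coeff i j) * B"
    using B(1,2)[OF jJ, of t] by (auto simp: norm_mult intro: mult_left_mono)
  qed
  then show ?thesis unfolding pot_def[abs_def] by blast
 qed
 define K where "K = max (\<Sum>j\<in>J. B * (1 + 2 * pi * norm (k j))) (Max (range L))"
 have "0 <= (\<Sum>j\<in>J. B * (1 + 2 * pi * norm (k j)))" using B(3) by (intro sum_nonneg) auto
 then have "K >= 0" by (simp add: K_def)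
 moreover have "\<exists>D. periodic_C1 (dens m) D K" for m 
 proof -
  have "(\<Sum>j\<in>J. B * (1 + 2 * pi * norm (k j))) <= K" by (simp add: K_def)
  then show ?thesis using m[of m] periodic_C1_weaken by blast
 qed
 moreover have "\<exists>D. periodic_C1 (pot i) D K" for i
 proof -
  have "L i <= K" unfolding K_def by (intro max.coboundedI2 Max_ge) auto
  then show ?thesis using p[of i] periodic_C1_weaken by blast
 qed
 ultimately show ?thesis by blast
qed

text \<open>The Knothe rearrangement: coordinate \<open>i\<close> is moved by the antiderivative of the part of the density charged to it, relative to the average over the earlier coordinates and this one.\<close>

definition rect_partial :: "real => nat => real \<times> (real ^ 'n) => real ^ 'n" where
 "rect_partial e m z = (\<Sum>i\<in>{i. pos i < m}. (e * pot i z / (1 + e * dens (Suc (pos i)) z)) *\<^sub>R axis i 1)"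

abbreviation "rect e \<equiv> rect_partial e CARD('n)"

lemma mode_shift: "(!!i. k j $ i * v $ i = 0) ==> mode d (k j) (x + v) = mode d (k j) x"
proof -
 assume z: "!!i. k j $ i * v $ i = 0"
 have "k j \<bullet> v = (\<Sum>i\<in>UNIV. k j $ i * v $ i)" by (simp add: inner_vec_def)
 also have "... = 0" by (rule sum.neutral) (rule ballI, rule z)
 finally show ?thesis by (simp add: mode_def inner_add_right)
qed

lemma rect_partial_component: "rect_partial e m z $ i = 0" if "\<not> pos i < m"
 using that unfolding rect_partial_def by (auto simp: axis_def intro!: sum.neutral)

lemma dens_shift: "dens m (t, x + v) = dens m (t, x)" if "!!i. \<not> pos i < m ==> v $ i = 0"
proof -
 have "mode (c j t) (k j) (x + v) = mode (c j t) (k j) x" if j: "j \<in> tail m" for j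
 proof (rule mode_shift)
  show "k j $ i * v $ i = 0" for i
   using j \<open>!!i. \<not> pos i < m ==> v $ i = 0\<close>[of i] by (cases "pos i < m") (simp_all add: tail_def)
 qed
 then show ?thesis by (simp add: dens_def)
qed

lemma pot_shift: "pot i (t, x + v) = pot i (t, x)" if "!!i'. \<not> pos i' < pos i ==> v $ i' = 0"
proof -
 have "mode d (k j) (x + v) = mode d (k j) x" if j: "j \<in> leads i" for j d
 proof (rule mode_shift)
  show "k j $ i' * v $ i' = 0" for i'
   using j \<open>!!i'. \<not> pos i' < pos i ==> v $ i' = 0\<close>[of i'] by (cases "pos i' < pos i") (simp_all add: leads_def)
 qed
 then show ?thesis by (simp add: pot_def)
qed

lemma dens_periodic: "lattice_rel x y ==> dens m (t, x) = dens m (t, y)"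
 unfolding dens_def by (intro sum.cong refl) (auto simp: tail_def intro!: mode_periodic k)

lemma pot_periodic: "lattice_rel x y ==> pot i (t, x) = pot i (t, y)"
 unfolding pot_def by (intro sum.cong refl) (auto simp: leads_def intro!: mode_periodic k)

lemma continuous_on_dens: "continuous_on S (%x. dens m (t, x))"
 unfolding dens_def mode_def by (auto intro!: continuous_intros)

lemma continuous_on_pot: "continuous_on S (%x. pot i (t, x))"
 unfolding pot_def mode_def by (auto intro!: continuous_intros)

lemma measurable_dens [measurable]: "(%x. dens m (t, x)) : borel_measurable borel"
 by (intro borel_measurable_continuous_onI continuous_on_dens)

lemma measurable_pot [measurable]: "(%x. pot i (t, x)) : borel_measurable borel"
 by (intro borel_measurable_continuous_onI continuous_on_pot)

lemma pot_derivative: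
 "((%s. pot i (t, x + s *\<^sub>R axis i 1)) has_real_derivative
   (dens (pos i) (t, x + s *\<^sub>R axis i 1) - dens (Suc (pos i)) (t, x + s *\<^sub>R axis i 1))) (at s)"
proof -
 have "((%s. mode (pot_coeff i j * c j t) (k j) (x + s *\<^sub>R axis i 1)) has_real_derivative
   mode (c j t) (k j) (x + s *\<^sub>R axis i 1)) (at s)" if "j \<in> leads i" for j
 proof -
  have ki: "k j $ i ~= 0" using that by (simp add: leads_def)
  have in1: "k j \<bullet> (x + s *\<^sub>R axis i 1) = k j \<bullet> x + s * k j $ i" for s
   by (simp add: inner_add_right inner_axis)
  define r where "r = k j $ i"
  define d where "d = pot_coeff i j * c j t"
  have "c j t = complex_of_real (2 * pi * r) * (\<i> * d)" using ki by (simp add: d_def pot_coeff_def r_def)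
  then have "Re (c j t) = - (2 * pi * r * Im d)" "Im (c j t) = 2 * pi * r * Re d" by simp_all
  then show ?thesis
   unfolding mode_def in1
   unfolding d_def[symmetric] r_def[symmetric]
   by (auto intro!: derivative_eq_intros simp: algebra_simps)
 qed
 then have "((%s. pot i (t, x + s *\<^sub>R axis i 1)) has_real_derivative
   (\<Sum>j\<in>leads i. mode (c j t) (k j) (x + s *\<^sub>R axis i 1))) (at s)"
  unfolding pot_def fst_conv snd_conv by (intro DERIV_sum) simp
 then show ?thesis using dens_split[of i "(t, x + s *\<^sub>R axis i 1)"] by simp
qed

text \<open>Induction over the coordinates. Each shear turns the density averaged over the earlier coordinates into the one averaged over one coordinate more, which no longer depends on the sheared coordinate.\<close>

lemma nn_integral_rect_partial:
 fixes F :: "'n torus => ennreal"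
 assumes small: "!!m x. \<bar>e * dens m (t, x)\<bar> <= 1/2" and m: "m <= CARD('n)"
  and F: "F : borel_measurable borel"
 shows "(\<integral>\<^sup>+X. F (X \<oplus> rect_partial e m (t, rep X)) * ennreal (1 + e * dens 0 (t, rep X)) \<partial>TM)
  = (\<integral>\<^sup>+X. F X * ennreal (1 + e * dens m (t, rep X)) \<partial>TM)"
 using m F
proof (induction m arbitrary: F)
 case 0
 then show ?case by (simp add: rect_partial_def)
next
 case (Suc m)
 have [measurable]: "F : borel_measurable borel" by fact
 have "m \<in> pos ` UNIV" using Suc.prems(1) pos by (simp add: bij_betw_def)
 then obtain i where i: "pos i = m" by blast
 have p: "1 + e * dens m' (t, x) > 0" for m' x using small[of m' x] by (auto simp: abs_le_iff)
 define g where "g x = e * pot i (t, x) / (1 + e * dens (Suc m) (t, x))" for x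
 define g' where "g' x = e * (dens m (t, x) - dens (Suc m) (t, x)) / (1 + e * dens (Suc m) (t, x))" for x
 have mg[measurable]: "g : borel_measurable borel" "g' : borel_measurable borel"
  unfolding g_def g'_def by measurable
 have perg: "g x = g y" "g' x = g' y" if "lattice_rel x y" for x y
  using dens_periodic[OF that] pot_periodic[OF that] by (auto simp: g_def g'_def)
 have gsh: "g (x + v) = g x" if "!!i'. \<not> pos i' < m ==> v $ i' = 0" for x v
 proof -
  have "dens (Suc m) (t, x + v) = dens (Suc m) (t, x)" using that by (intro dens_shift) (auto simp: less_Suc_eq)
  moreover have "pot i (t, x + v) = pot i (t, x)" using that i by (intro pot_shift) auto
  ultimately show ?thesis by (simp add: g_def)
 qed
 have inv: "dens (Suc m) (t, x + s *\<^sub>R axis i 1) = dens (Suc m) (t, x)" for x s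
  using i by (intro dens_shift) (auto simp: axis_def)
 define F' where "F' Y = F (Y \<oplus> g (rep Y) *\<^sub>R axis i 1)" for Y
 have F'[measurable]: "F' : borel_measurable borel" unfolding F'_def by measurable
 have set: "{i'. pos i' < Suc m} = insert i {i'. pos i' < m}" using i pos_inj by (auto simp: less_Suc_eq)
 have step: "F (X \<oplus> rect_partial e (Suc m) (t, rep X)) = F' (X \<oplus> rect_partial e m (t, rep X))" for X
 proof -
  let ?v = "rect_partial e m (t, rep X)"
  have "lattice_rel (rep (X \<oplus> ?v)) (rep X + ?v)"
   by (subst abs_torus_eq_iff[symmetric]) (simp add: torus_shift_rep)
  then have "g (rep (X \<oplus> ?v)) = g (rep X)"
   using perg(1) gsh rect_partial_component by simp
  moreover have "rect_partial e (Suc m) (t, rep X) = ?v + g (rep X) *\<^sub>R axis i 1"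
   unfolding rect_partial_def set by (subst sum.insert) (auto simp: i g_def add.commute)
  ultimately show ?thesis by (simp add: F'_def torus_shift_assoc)
 qed
 have "(\<integral>\<^sup>+X. F (X \<oplus> rect_partial e (Suc m) (t, rep X)) * ennreal (1 + e * dens 0 (t, rep X)) \<partial>TM)
  = (\<integral>\<^sup>+X. F' X * ennreal (1 + e * dens m (t, rep X)) \<partial>TM)"
  unfolding step using Suc.IH[OF _ F'] Suc.prems(1) by simp
 also have "... = (\<integral>\<^sup>+X. F (X \<oplus> g (rep X) *\<^sub>R axis i 1) * ennreal ((1 + e * dens (Suc m) (t, rep X)) * (1 + g' (rep X))) \<partial>TM)"
 proof (intro nn_integral_cong)
  fix X
  have "(1 + e * dens (Suc m) (t, rep X)) * (1 + g' (rep X)) = 1 + e * dens m (t, rep X)"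
   using p[of "Suc m" "rep X"] by (simp add: g'_def field_simps)
  then show "F' X * ennreal (1 + e * dens m (t, rep X)) = F (X \<oplus> g (rep X) *\<^sub>R axis i 1) * ennreal ((1 + e * dens (Suc m) (t, rep X)) * (1 + g' (rep X)))"
   by (simp add: F'_def)
 qed
 also have "... = (\<integral>\<^sup>+X. F X * ennreal (1 + e * dens (Suc m) (t, rep X)) \<partial>TM)"
 proof (rule nn_integral_shear)
  show "((%s. g (x + s *\<^sub>R axis i 1)) has_real_derivative g' (x + s *\<^sub>R axis i 1)) (at s)" for x s
  proof -
   have "1 + e * dens (Suc m) (t, x) ~= 0" using p[of "Suc m" x] by simp
   then show ?thesis
    unfolding g_def g'_def inv using pot_derivative[of i t x s] i inv
    by (auto intro!: derivative_eq_intros)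
  qed
  show "continuous_on UNIV (%s. g' (x + s *\<^sub>R axis i 1))" for x
  proof -
   have "continuous_on UNIV g'"
    unfolding g'_def using p by (intro continuous_intros continuous_on_dens) (auto simp: less_imp_neq[symmetric])
   then show ?thesis by (rule continuous_on_compose2) (auto intro!: continuous_intros)
  qed
  show "1 + g' x >= 0" for x
  proof -
   have "1 + g' x = (1 + e * dens m (t, x)) / (1 + e * dens (Suc m) (t, x))"
    using p[of "Suc m" x] by (simp add: g'_def field_simps)
   then show ?thesis using p[of m x] p[of "Suc m" x] by simp
  qed
  show "1 + e * dens (Suc m) (t, x) >= 0" for x using p[of "Suc m" x] by simp
 qed (auto simp: inv perg dens_periodic)
 finally show ?case .
qed

lemma nn_integral_rect:
 fixes F :: "'n torus => ennreal"
 assumes "!!m x. \<bar>e * dens m (t, x)\<bar> <= 1/2" "F : borel_measurable borel"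
 shows "(\<integral>\<^sup>+X. F (X \<oplus> rect e (t, rep X)) * ennreal (1 + e * dens 0 (t, rep X)) \<partial>TM)
  = (\<integral>\<^sup>+X. F X \<partial>TM)"
 using nn_integral_rect_partial[OF assms(1) order_refl assms(2)] by (simp add: dens_CARD)

definition field :: "real \<times> (real ^ 'n) => real ^ 'n" where
 "field z = (\<Sum>i\<in>UNIV. pot i z *\<^sub>R axis i 1)"

text \<open>The rectification is, up to a uniformly bounded second-order term, the displacement by \<open>ep\<close> times
 the vector field.\<close>

lemma rect_expansion:
 "\<exists>K W'. K >= 1 & periodic_C1 field W' K &
  (\<forall>e. 0 < e & e * K <= 1/2 --> (\<forall>m z. \<bar>e * dens m z\<bar> <= 1/2) &
    (\<exists>V V'. periodic_C1 V V' K & (\<forall>z. rect e z = e *\<^sub>R field z + e\<^sup>2 *\<^sub>R V z)))"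
proof -
 obtain K0 where K0: "K0 >= 0" "!!m. \<exists>D. periodic_C1 (dens m) D K0" "!!i. \<exists>D. periodic_C1 (pot i) D K0"
  using ex_bounds by blast
 obtain P' where P': "!!i. periodic_C1 (pot i) (P' i) K0" using K0(3) by metis
 define K where "K = 1 + K0 + CARD('n) * K0 + CARD('n) * (8 * K0\<^sup>2)"
 have K: "K >= 1" "K0 <= K" "CARD('n) * K0 <= K" "CARD('n) * (8 * K0\<^sup>2) <= K"
  using K0(1) mult_nonneg_nonneg[of "real CARD('n)" K0] mult_nonneg_nonneg[of "real CARD('n)" "8 * K0\<^sup>2"]
  unfolding K_def by (simp_all del: mult_nonneg_nonneg)
 define W' where "W' z h = (\<Sum>i\<in>UNIV. (1 * P' i z h) *\<^sub>R axis i (1::real))" for z h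
 have "periodic_C1 (%z. \<Sum>i\<in>UNIV. (1 * pot i z) *\<^sub>R axis i 1) W' (\<Sum>i\<in>(UNIV :: 'n set). K0)"
  unfolding W'_def by (intro periodic_C1_sum periodic_C1_scaleR[OF P']) simp
 then have W: "periodic_C1 field W' K"
  unfolding field_def[abs_def] using K(3) by (simp add: periodic_C1_weaken)
 have "(\<forall>m z. \<bar>e * dens m z\<bar> <= 1/2) &
    (\<exists>V V'. periodic_C1 V V' K & (\<forall>z. rect e z = e *\<^sub>R field z + e\<^sup>2 *\<^sub>R V z))" if e: "0 < e" "e * K <= 1/2" for e
 proof
  have eK0: "e * K0 <= 1/2" using mult_left_mono[OF K(2), of e] e by linarith
  show sm: "\<forall>m z. \<bar>e * dens m z\<bar> <= 1/2"
  proof (intro allI)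
   fix m z
   obtain D where "periodic_C1 (dens m) D K0" using K0(2) by blast
   from periodic_C1D(3)[OF this, of z] have "\<bar>e * dens m z\<bar> <= e * K0" using e by (simp add: abs_mult)
   then show "\<bar>e * dens m z\<bar> <= 1/2" using eK0 by linarith
  qed
  define Q where "Q i z = - (pot i z * dens (Suc (pos i)) z) / (1 + e * dens (Suc (pos i)) z)" for i z
  have "\<exists>Q'. periodic_C1 (Q i) Q' (8 * K0\<^sup>2)" for i
  proof -
   obtain D where D: "periodic_C1 (dens (Suc (pos i))) D K0" using K0(2) by blast
   show ?thesis unfolding Q_def[abs_def]
    by (rule periodic_C1_quotient_remainder[OF P' D]) (use e eK0 in auto)
  qed
  then obtain Q' where Q': "!!i. periodic_C1 (Q i) (Q' i) (8 * K0\<^sup>2)" by metis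
  have "periodic_C1 (%z. \<Sum>i\<in>UNIV. (1 * Q i z) *\<^sub>R axis i (1::real)) (%z h. \<Sum>i\<in>UNIV. (1 * Q' i z h) *\<^sub>R axis i (1::real)) (\<Sum>i\<in>(UNIV :: 'n set). 8 * K0\<^sup>2)"
   by (intro periodic_C1_sum periodic_C1_scaleR[OF Q']) (simp add: norm_axis_1)
  then have V: "periodic_C1 (%z. \<Sum>i\<in>UNIV. Q i z *\<^sub>R axis i 1) (%z h. \<Sum>i\<in>UNIV. (1 * Q' i z h) *\<^sub>R axis i (1::real)) K"
   using K(4) by (simp add: periodic_C1_weaken)
  have "rect e z = e *\<^sub>R field z + e\<^sup>2 *\<^sub>R (\<Sum>i\<in>UNIV. Q i z *\<^sub>R axis i 1)" for z
  proof -
   have "e * pot i z / (1 + e * dens (Suc (pos i)) z) = e * pot i z + e\<^sup>2 * Q i z" for i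
   proof -
    have "\<bar>e * dens (Suc (pos i)) z\<bar> <= 1/2" using sm by blast
    then have "1 + e * dens (Suc (pos i)) z ~= 0" by linarith
    then show ?thesis by (simp add: Q_def field_simps power2_eq_square)
   qed
   then show ?thesis
    unfolding rect_partial_def field_def
    by (simp add: pos_less scaleR_sum_right scaleR_left_distrib sum.distrib)
  qed
  with V show "\<exists>V V'. periodic_C1 V V' K & (\<forall>z. rect e z = e *\<^sub>R field z + e\<^sup>2 *\<^sub>R V z)" by blast
 qed
 with K(1) W show ?thesis by blast
qed

end

section \<open>Smoothness of trigonometric sums\<close>

text \<open>Smoothness given by the sequence of derivatives, which suits induction on the order.\<close>

definition smooth_curve :: "(real => complex) => bool" where
 "smooth_curve c \<longleftrightarrow> (\<exists>D. D 0 = c & (\<forall>n::nat. \<forall>t. (D n has_vector_derivative D (Suc n) t) (at t)))"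

lemma smooth_curve_derivative:
 assumes "smooth_curve c"
 obtains c' where "smooth_curve c'" "!!t. (c has_vector_derivative c' t) (at t)"
proof -
 obtain D where D: "D 0 = c" "!!n t. (D n has_vector_derivative D (Suc n) t) (at t)"
  using assms unfolding smooth_curve_def by blast
 have "smooth_curve (D 1)"
  unfolding smooth_curve_def using D(2) by (intro exI[of _ "%n. D (Suc n)"]) simp
 then show ?thesis using D(2)[of 0] by (intro that[of "D 1"]) (simp_all add: D(1))
qed

lemma smooth_curve_linear_combination:
 assumes "smooth_curve c" "smooth_curve d"
 shows "smooth_curve (%t. a * c t + b * d t)"
proof -
 obtain D where D: "D 0 = c" "!!n t. (D n has_vector_derivative D (Suc n) t) (at t)"
  using assms(1) unfolding smooth_curve_def by blast
 obtain E where E: "E 0 = d" "!!n t. (E n has_vector_derivative E (Suc n) t) (at t)"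
  using assms(2) unfolding smooth_curve_def by blast
 show ?thesis
  unfolding smooth_curve_def
 proof (intro exI[of _ "%n t. a * D n t + b * E n t"] conjI allI)
  show "((%t. a * D n t + b * E n t) has_vector_derivative a * D (Suc n) t + b * E (Suc n) t) (at t)" for n t
   by (intro has_vector_derivative_add has_vector_derivative_mult_right D(2) E(2))
 qed (simp add: D(1) E(1))
qed

lemma Ck_on_mode_sum:
 fixes c :: "'j => real => complex" and k :: "'j => real ^ 'n" and v :: "'j => 'b::real_normed_vector"
 assumes "!!j. j \<in> J ==> smooth_curve (c j)"
 shows "Ck_on S m (%z. \<Sum>j\<in>J. mode (c j (fst z)) (k j) (snd z) *\<^sub>R v j)"
 using assms
proof (induction m arbitrary: c)
 case 0
 have "continuous_on S (%z. mode (c j (fst z)) (k j) (snd z))" if j: "j \<in> J" for j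
 proof -
  obtain c' where c': "!!t. (c j has_vector_derivative c' t) (at t)"
   using smooth_curve_derivative[OF 0[OF j]] by metis
  show ?thesis
   by (rule has_derivative_continuous_on[OF has_derivative_at_withinI[OF has_derivative_mode[OF c']]])
 qed
 then show ?case by (auto intro!: continuous_on_sum continuous_on_scaleR continuous_on_const)
next
 case (Suc m)
 have "\<forall>j\<in>J. \<exists>c'. smooth_curve c' & (\<forall>t. (c j has_vector_derivative c' t) (at t))"
  using smooth_curve_derivative[OF Suc.prems] by metis
 then obtain c' where c': "!!j. j \<in> J ==> smooth_curve (c' j)"
   "!!j t. j \<in> J ==> (c j has_vector_derivative c' j t) (at t)"
  unfolding bchoice_iff by blast
 let ?f = "%z. \<Sum>j\<in>J. mode (c j (fst z)) (k j) (snd z) *\<^sub>R v j"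
 have d: "(?f has_derivative (%h. \<Sum>j\<in>J. mode (fst h *\<^sub>R c' j (fst z) + 2 * pi * (k j \<bullet> snd h) * \<i> * c j (fst z)) (k j) (snd z) *\<^sub>R v j)) (at z)" for z
  by (intro has_derivative_sum has_derivative_scaleR_left has_derivative_mode c'(2))
 have fr: "(%z. frechet_derivative ?f (at z) h) =
  (%z. \<Sum>j\<in>J. mode ((%t. complex_of_real (fst h) * c' j t + (2 * pi * (k j \<bullet> snd h) * \<i>) * c j t) (fst z)) (k j) (snd z) *\<^sub>R v j)" for h
  unfolding frechet_derivative_at[OF d, symmetric] by (simp add: scaleR_conv_of_real)
 show ?case
  unfolding Ck_on.simps
 proof (intro conjI ballI allI)
  show "?f differentiable at x" for x using d[of x] by (rule differentiableI)
  show "Ck_on S m (%z. frechet_derivative ?f (at z) h)" for h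
   unfolding fr by (rule Suc.IH) (intro smooth_curve_linear_combination c' Suc.prems)
 qed
qed

section \<open>The first variation of the action\<close>

lemma measurable_periodic_C1_derivative:
 fixes W :: "real \<times> (real ^ 'n::finite) => 'b::{banach, second_countable_topology}"
 assumes W: "periodic_C1 W W' K"
 shows "(%y. W' (fst y) (snd y)) : borel_measurable (borel \<Otimes>\<^sub>M borel)"
proof -
 have c: "continuous_on UNIV W"
  by (rule has_derivative_continuous_on[OF has_derivative_at_withinI[OF periodic_C1D(1)[OF W]]])
 then have [measurable]: "W : borel_measurable borel" by (rule borel_measurable_continuous_onI)
 have lim: "(%n. real (Suc n) *\<^sub>R (W (z + (1 / Suc n) *\<^sub>R h) - W z)) \<longlonglongrightarrow> W' z h" for z h
 proof -
  have "((%s. W (z + s *\<^sub>R h)) has_derivative (%s. W' z (s *\<^sub>R h))) (at 0)"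
  proof -
   have "((%s. z + s *\<^sub>R h) has_derivative (%s. s *\<^sub>R h)) (at 0)" by (auto intro!: derivative_eq_intros)
   from has_derivative_compose[OF this, of W "W' z"] periodic_C1D(1)[OF W, of z] show ?thesis by simp
  qed
  moreover have "W' z (s *\<^sub>R h) = s *\<^sub>R W' z h" for s
   by (rule linear_cmul[OF has_derivative_linear[OF periodic_C1D(1)[OF W]]])
  ultimately have "((%s. W (z + s *\<^sub>R h)) has_vector_derivative W' z h) (at 0)"
   by (simp add: has_vector_derivative_def)
  then have "((%s. (W (z + s *\<^sub>R h) - W z) /\<^sub>R s) \<longlongrightarrow> W' z h) (at 0)"
   by (simp add: has_vector_derivative_iff_quotient)
  moreover have "filterlim (%n. 1 / real (Suc n)) (at 0) sequentially"
   by (rule filterlim_atI[OF LIMSEQ_Suc[OF lim_inverse_n', unfolded]]) simp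
  ultimately have "(%n. (W (z + (1 / real (Suc n)) *\<^sub>R h) - W z) /\<^sub>R (1 / real (Suc n))) \<longlonglongrightarrow> W' z h"
   by (rule filterlim_compose)
  then show ?thesis by simp
 qed
 show ?thesis
  by (rule borel_measurable_LIMSEQ_metric[OF _ lim]) measurable
qed

definition first_variation_density ::
 "(real \<times> (real ^ 'n) => real \<times> (real ^ 'n) => real ^ 'n) => (real => 'n::finite torus) => real => real" where
 "first_variation_density W' om t =
  velocity01 om t \<bullet> W' (t, rep (path_at om t)) (1, velocity01 om t)"

definition energy :: "(real => 'n::finite torus) => real" where
 "energy om = (LINT t|lborel. 1 / 2 * (norm (velocity01 om t))\<^sup>2)"

definition first_variation ::
 "(real \<times> (real ^ 'n) => real \<times> (real ^ 'n) => real ^ 'n) => (real => 'n::finite torus) => real" where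
 "first_variation W' om = (LINT t|lborel. first_variation_density W' om t)"

lemma measurable_first_variation_density:
 assumes W: "periodic_C1 W W' K"
 shows "(%z. first_variation_density W' (fst z) (snd z)) : borel_measurable (path_borel \<Otimes>\<^sub>M borel)"
proof -
 have "(%z :: (real => 'a torus) \<times> real. ((snd z, rep (path_at (fst z) (snd z))), (1::real, velocity01 (fst z) (snd z))))
  \<in> path_borel \<Otimes>\<^sub>M borel \<rightarrow>\<^sub>M borel \<Otimes>\<^sub>M borel"
  unfolding borel_prod[symmetric] by measurable
 from measurable_compose[OF this measurable_periodic_C1_derivative[OF W]]
 have [measurable]: "(%z :: (real => 'a torus) \<times> real. W' (snd z, rep (path_at (fst z) (snd z))) (1, velocity01 (fst z) (snd z)))
  : borel_measurable (path_borel \<Otimes>\<^sub>M borel)" by simp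
 show ?thesis unfolding first_variation_density_def by measurable
qed

lemma measurable_first_variation:
 assumes W: "periodic_C1 W W' K"
 shows "first_variation W' : borel_measurable path_borel"
 unfolding first_variation_def
 by (rule lborel.borel_measurable_lebesgue_integral) (use measurable_first_variation_density[OF W] in "simp add: case_prod_unfold")

lemma measurable_energy [measurable]: "energy : borel_measurable path_borel"
 unfolding energy_def by (rule lborel.borel_measurable_lebesgue_integral) measurable

lemma measurable_section_path:
 "om \<in> paths ==> (%z. f (fst z) (snd z)) : borel_measurable (path_borel \<Otimes>\<^sub>M borel) ==> f om : borel_measurable borel"
 using measurable_Pair2[of "%z. f (fst z) (snd z)" path_borel borel borel om] by simp

lemma integrable_energy:
 assumes w: "om \<in> paths" and k: "kinetic om < \<infinity>"
 shows "integrable lborel (%t. 1 / 2 * (norm (velocity01 om t))\<^sup>2)" "kinetic om = ennreal (energy om)" "energy om >= 0"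
proof -
 have [measurable]: "velocity01 om : borel_measurable borel"
  by (rule measurable_section_path[OF w]) measurable
 show i: "integrable lborel (%t. 1 / 2 * (norm (velocity01 om t))\<^sup>2)"
  by (rule integrableI_nonneg) (use k in "auto simp: kinetic_def")
 show "kinetic om = ennreal (energy om)"
  unfolding kinetic_def energy_def by (rule nn_integral_eq_integral[OF i]) simp
 show "energy om >= 0" unfolding energy_def by (rule integral_nonneg_AE) simp
qed

lemma periodic_C1_perturbation:
 assumes W: "periodic_C1 W W' K" and V: "periodic_C1 V V' K" and K: "K >= 1" and e: "0 < e" "4 * (e * K) <= 1"
  and U: "!!z. U z = e *\<^sub>R W z + e\<^sup>2 *\<^sub>R V z"
 shows "periodic_C1 U (%z h. e *\<^sub>R W' z h + e\<^sup>2 *\<^sub>R V' z h) (1/2)"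
proof -
 have e1: "e <= 1/4" using e K mult_left_mono[of 1 K e] by linarith
 have scale: "periodic_C1 (%z. s *\<^sub>R F z) (%z h. s *\<^sub>R F' z h) (s * K)" if F: "periodic_C1 F F' K" and s: "s >= 0" for F F' s
  unfolding periodic_C1_def
 proof (intro conjI allI impI)
  show "((%z. s *\<^sub>R F z) has_derivative (%h. s *\<^sub>R F' z h)) (at z)" for z
   by (intro has_derivative_scaleR_right periodic_C1D(1)[OF F])
  show "s *\<^sub>R F (t, x) = s *\<^sub>R F (t, y)" if "lattice_rel x y" for t x y
   using periodic_C1D(2)[OF F that] by simp
  show "norm (s *\<^sub>R F z) <= s * K" for z using periodic_C1D(3)[OF F, of z] s by (simp add: mult_left_mono)
  show "norm (s *\<^sub>R F' z h) <= s * K * norm h" for z h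
   using mult_left_mono[OF periodic_C1D(4)[OF F, of z h] s] s by (simp add: mult.assoc)
 qed
 have Ueq: "U = (%z. e *\<^sub>R W z + e\<^sup>2 *\<^sub>R V z)" using U by (simp add: fun_eq_iff)
 have per: "periodic_C1 U (%z h. e *\<^sub>R W' z h + e\<^sup>2 *\<^sub>R V' z h) (e * K + e\<^sup>2 * K)"
  unfolding Ueq by (intro periodic_C1_add scale W V) (use e in auto)
 have "e\<^sup>2 * K <= e * K"
 proof (rule mult_right_mono)
  show "e\<^sup>2 <= e" using mult_left_mono[OF e1, of e] e by (simp add: power2_eq_square)
 qed (use K in simp)
 then show ?thesis using e(2) by (intro periodic_C1_weaken[OF per]) linarith
qed

lemma quadratic_bounds:
 fixes r :: real
 shows "r + r\<^sup>2 <= 2 * (1 + r\<^sup>2)" "(1 + r)\<^sup>2 <= 2 * (1 + r\<^sup>2)"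
proof -
 have "0 <= (r - 1) * (r - 1)" by simp
 then have *: "0 <= r * r - 2 * r + 1" by (simp add: algebra_simps)
 have "0 <= r * r" by simp
 note facts = * this
 have "r <= 2 + r * r" using facts by linarith
 then show "r + r\<^sup>2 <= 2 * (1 + r\<^sup>2)" by (simp add: power2_eq_square)
 have "2 * r <= 1 + r * r" using facts by linarith
 then show "(1 + r)\<^sup>2 <= 2 * (1 + r\<^sup>2)" by (simp add: power2_eq_square algebra_simps)
qed

text \<open>Expansion of the squared velocity along the moved path to second order. The remainder is controlled by the energy of the original path, with a constant that is the same for all paths.\<close>

lemma kinetic_move_path_le:
 fixes W :: "real \<times> (real ^ 'n::finite) => real ^ 'n"
 assumes W: "periodic_C1 W W' K" and V: "periodic_C1 V V' K" and K: "K >= 1" and e: "0 < e" "4 * (e * K) <= 1"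
  and U: "!!z. U z = e *\<^sub>R W z + e\<^sup>2 *\<^sub>R V z"
  and w: "om \<in> paths" and kin: "kinetic om < \<infinity>"
 shows "kinetic (move_path U om) <= ennreal (energy om + e * first_variation W' om + e\<^sup>2 * (8 * K\<^sup>2) * (1 + 2 * energy om))"
  and "\<bar>first_variation W' om\<bar> <= 2 * K * (1 + 2 * energy om)"
  and "0 <= energy om + e * first_variation W' om + e\<^sup>2 * (8 * K\<^sup>2) * (1 + 2 * energy om)"
proof -
 define v where "v = velocity01 om"
 define f where "f t = first_variation_density W' om t" for t
 define I :: "real => real" where "I t = indicator {0<..<1} t" for t
 have [measurable]: "v : borel_measurable borel" unfolding v_def
  by (rule measurable_section_path[OF w]) measurable
 have [measurable]: "f : borel_measurable borel" unfolding f_def[abs_def]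
  by (rule measurable_section_path[OF w measurable_first_variation_density[OF W]])
 have iv: "integrable lborel (%t. 1 / 2 * (norm (v t))\<^sup>2)" unfolding v_def by (rule integrable_energy[OF w kin])
 have iI: "integrable lborel I" unfolding I_def by simp
 have I1: "(LINT t|lborel. I t) = 1" unfolding I_def by simp
 have n1: "norm (1::real, x) <= 1 + norm x" for x :: "real ^ 'n"
  using norm_Pair_le[of "1::real" x] by simp
 have v0: "v t = 0" if "I t = 0" for t using that by (cases "t \<in> {0<..<1}") (auto simp: v_def I_def velocity01_def)
 have fb: "\<bar>f t\<bar> <= 2 * K * (I t + 2 * (1 / 2 * (norm (v t))\<^sup>2))" for t
 proof (cases "I t = 0")
  case True
  then show ?thesis using v0 by (simp add: f_def first_variation_density_def v_def)
 next
  case False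
  then have It: "I t = 1" by (auto simp: I_def indicator_def split: if_splits)
  have "\<bar>f t\<bar> <= norm (v t) * norm (W' (t, rep (path_at om t)) (1, v t))"
   unfolding f_def first_variation_density_def v_def by (rule Cauchy_Schwarz_ineq2)
  also have "... <= norm (v t) * (K * (1 + norm (v t)))"
  proof (rule mult_left_mono)
   have "K * norm (1::real, v t) <= K * (1 + norm (v t))" using K by (intro mult_left_mono n1) auto
   then show "norm (W' (t, rep (path_at om t)) (1, v t)) <= K * (1 + norm (v t))"
    using periodic_C1D(4)[OF W, of "(t, rep (path_at om t))" "(1, v t)"] by linarith
  qed simp
  also have "... = K * (norm (v t) + (norm (v t))\<^sup>2)" by (simp add: algebra_simps power2_eq_square)
  also have "... <= K * (2 * (1 + (norm (v t))\<^sup>2))"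
  proof (rule mult_left_mono)
   show "norm (v t) + (norm (v t))\<^sup>2 <= 2 * (1 + (norm (v t))\<^sup>2)"
    by (rule quadratic_bounds(1))
  qed (use K in simp)
  finally show ?thesis by (simp add: It algebra_simps)
 qed
 have "integrable lborel (%t. 2 * K * (I t + 2 * (1 / 2 * (norm (v t))\<^sup>2)))"
  by (intro integrable_mult_right Bochner_Integration.integrable_add iI iv)
 then have intf: "integrable lborel f"
 proof (rule Bochner_Integration.integrable_bound)
  show "AE t in lborel. norm (f t) <= norm (2 * K * (I t + 2 * (1 / 2 * (norm (v t))\<^sup>2)))"
  proof (rule AE_I2)
   fix t
   show "norm (f t) <= norm (2 * K * (I t + 2 * (1 / 2 * (norm (v t))\<^sup>2)))"
    unfolding real_norm_def by (rule order_trans[OF fb[of t] abs_ge_self])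
  qed
 qed measurable
 have bnd: "(LINT t|lborel. 2 * K * (I t + 2 * (1 / 2 * (norm (v t))\<^sup>2))) = 2 * K * (1 + 2 * energy om)"
 proof -
  have "(LINT t|lborel. 2 * K * (I t + 2 * (1 / 2 * (norm (v t))\<^sup>2)))
   = 2 * K * ((LINT t|lborel. I t) + 2 * (LINT t|lborel. 1 / 2 * (norm (v t))\<^sup>2))"
   using iI iv by (simp only: Bochner_Integration.integral_add integral_mult_right_zero Bochner_Integration.integrable_add integrable_mult_right)
  then show ?thesis by (simp only: I1 energy_def v_def)
 qed
 have "\<bar>LINT t|lborel. f t\<bar> <= (LINT t|lborel. 2 * K * (I t + 2 * (1 / 2 * (norm (v t))\<^sup>2)))"
  by (rule order_trans[OF integral_abs_bound]) (intro integral_mono integrable_abs intf fb integrable_mult_right Bochner_Integration.integrable_add iI iv)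
 then show "\<bar>first_variation W' om\<bar> <= 2 * K * (1 + 2 * energy om)"
  unfolding bnd first_variation_def f_def .
 define M where "M = 8 * K\<^sup>2"
 have K2: "K <= K\<^sup>2" using K by (simp add: power2_eq_square)
 have e1: "e <= 1/4" using e K mult_left_mono[of 1 K e] by linarith
 define U' where "U' z h = e *\<^sub>R W' z h + e\<^sup>2 *\<^sub>R V' z h" for z h
 have Uhalf: "periodic_C1 U U' (1/2)"
  unfolding U'_def by (rule periodic_C1_perturbation[OF W V K e U])
 have pt: "1 / 2 * (norm (velocity01 (move_path U om) t))\<^sup>2 <= 1 / 2 * (norm (v t))\<^sup>2 + e * f t + e\<^sup>2 * M * (I t + 2 * (1 / 2 * (norm (v t))\<^sup>2))" for t
 proof (cases "t \<in> {0<..<1}")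
  case False
  then have "velocity01 (move_path U om) t = 0" "v t = 0" "I t = 0"
   by (auto simp: v_def I_def velocity01_def)
  moreover have "f t = 0" using \<open>v t = 0\<close> by (simp add: f_def first_variation_density_def v_def)
  ultimately show ?thesis by simp
 next
  case t: True
  then have It: "I t = 1" by (simp add: I_def)
  have pa: "path_at om t = om t" using t by (simp add: path_at_eq)
  show ?thesis
  proof (cases "\<exists>u. has_velocity om u t")
   case False
   then have "v t = 0" "velocity01 (move_path U om) t = 0"
    using velocity_eq_0[of om t] velocity_move_path[OF Uhalf t, of om] by (auto simp: v_def velocity01_def)
   moreover have "f t = 0" using \<open>v t = 0\<close> by (simp add: f_def first_variation_density_def v_def)
   ultimately show ?thesis by (simp add: It M_def)
  next
   case True
   have vt: "v t = velocity om t" using t by (simp add: v_def velocity01_def)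
   define a where "a = W' (t, rep (om t)) (1, v t)"
   define r where "r = V' (t, rep (om t)) (1, v t)"
   define N where "N = norm (v t)"
   have N: "N >= 0" by (simp add: N_def)
   have new: "velocity01 (move_path U om) t = v t + e *\<^sub>R a + e\<^sup>2 *\<^sub>R r"
    using velocity_move_path[OF Uhalf t, of om] True t by (simp add: velocity01_def vt a_def r_def U'_def add.assoc)
   have ft: "f t = v t \<bullet> a" by (simp add: f_def first_variation_density_def a_def pa v_def)
   have a: "norm a <= K * (1 + N)" and r: "norm r <= K * (1 + N)"
   proof -
    have "K * norm (1::real, v t) <= K * (1 + N)" unfolding N_def using K by (intro mult_left_mono n1) auto
    then show "norm a <= K * (1 + N)" "norm r <= K * (1 + N)"
     unfolding a_def r_def
     using periodic_C1D(4)[OF W, of "(t, rep (om t))" "(1, v t)"]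
      periodic_C1D(4)[OF V, of "(t, rep (om t))" "(1, v t)"] by linarith+
   qed
   have N1: "N * (1 + N) <= 2 * (1 + N\<^sup>2)" "(1 + N)\<^sup>2 <= 2 * (1 + N\<^sup>2)"
    using quadratic_bounds[of N] by (simp_all add: power2_eq_square distrib_left)
   have ar: "norm (a + e *\<^sub>R r) <= 2 * K * (1 + N)"
   proof -
    have "norm (a + e *\<^sub>R r) <= norm a + e * norm r" using norm_triangle_ineq[of a "e *\<^sub>R r"] e by simp
    also have "... <= K * (1 + N) + 1 * (K * (1 + N))"
     using e e1 K N by (intro add_mono a mult_mono r) auto
    finally show ?thesis by simp
   qed
   have "1 / 2 * (norm (v t + e *\<^sub>R a + e\<^sup>2 *\<^sub>R r))\<^sup>2
    = 1 / 2 * N\<^sup>2 + e * (v t \<bullet> a) + e\<^sup>2 * (v t \<bullet> r + 1 / 2 * (norm (a + e *\<^sub>R r))\<^sup>2)"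
    unfolding N_def power2_norm_eq_inner
    by (simp add: inner_add_left inner_add_right inner_commute power2_eq_square algebra_simps)
   also have "v t \<bullet> r + 1 / 2 * (norm (a + e *\<^sub>R r))\<^sup>2 <= M * (1 + N\<^sup>2)"
   proof -
    have "v t \<bullet> r <= N * norm r" unfolding N_def by (rule norm_cauchy_schwarz)
    also have "... <= N * (K * (1 + N))" using N by (intro mult_left_mono r)
    also have "... = K * (N * (1 + N))" by simp
    also have "... <= K * (2 * (1 + N\<^sup>2))" using K by (intro mult_left_mono N1) auto
    also have "... <= K\<^sup>2 * (2 * (1 + N\<^sup>2))" using K2 by (intro mult_right_mono) auto
    finally have 1: "v t \<bullet> r <= K\<^sup>2 * (2 * (1 + N\<^sup>2))" .
    have "(norm (a + e *\<^sub>R r))\<^sup>2 <= (2 * K * (1 + N))\<^sup>2" by (intro power_mono ar) auto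
    also have "... = 4 * K\<^sup>2 * (1 + N)\<^sup>2" by (simp add: power2_eq_square)
    also have "... <= 4 * K\<^sup>2 * (2 * (1 + N\<^sup>2))" by (intro mult_left_mono N1) auto
    finally have 2: "(norm (a + e *\<^sub>R r))\<^sup>2 <= 8 * (K\<^sup>2 * (1 + N\<^sup>2))" by (simp add: algebra_simps)
    have "0 <= K\<^sup>2 * (1 + N\<^sup>2)" by simp
    moreover have "K\<^sup>2 * (2 * (1 + N\<^sup>2)) = 2 * (K\<^sup>2 * (1 + N\<^sup>2))" "8 * K\<^sup>2 * (1 + N\<^sup>2) = 8 * (K\<^sup>2 * (1 + N\<^sup>2))" by simp_all
    ultimately show ?thesis using 1 2 unfolding M_def by linarith
   qed
   finally show ?thesis using e unfolding new ft It by (simp add: N_def algebra_simps)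
  qed
 qed
 let ?R = "%t. 1 / 2 * (norm (v t))\<^sup>2 + e * f t + e\<^sup>2 * M * (I t + 2 * (1 / 2 * (norm (v t))\<^sup>2))"
 have iR: "integrable lborel ?R" by (intro Bochner_Integration.integrable_add integrable_mult_right iv iI intf)
 have "kinetic (move_path U om) <= (\<integral>\<^sup>+t. ennreal (?R t) \<partial>lborel)"
  unfolding kinetic_def by (intro nn_integral_mono ennreal_leI pt)
 also have "... = ennreal (LINT t|lborel. ?R t)"
  by (rule nn_integral_eq_integral[OF iR]) (intro AE_I2 order_trans[OF _ pt], simp)
 finally have k: "kinetic (move_path U om) <= ennreal (LINT t|lborel. ?R t)" .
 have eq: "(LINT t|lborel. ?R t) = energy om + e * first_variation W' om + e\<^sup>2 * (8 * K\<^sup>2) * (1 + 2 * energy om)"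
 proof -
  have "(LINT t|lborel. ?R t) = (LINT t|lborel. 1 / 2 * (norm (v t))\<^sup>2) + e * (LINT t|lborel. f t)
   + e\<^sup>2 * M * ((LINT t|lborel. I t) + 2 * (LINT t|lborel. 1 / 2 * (norm (v t))\<^sup>2))"
   using iv iI intf by (simp only: Bochner_Integration.integral_add integral_mult_right_zero Bochner_Integration.integrable_add integrable_mult_right)
  then show ?thesis by (simp only: I1 energy_def first_variation_def f_def v_def M_def)
 qed
 have "0 <= (LINT t|lborel. ?R t)"
  by (rule integral_nonneg_AE) (intro AE_I2 order_trans[OF _ pt], simp)
 with k show "kinetic (move_path U om) <= ennreal (energy om + e * first_variation W' om + e\<^sup>2 * (8 * K\<^sup>2) * (1 + 2 * energy om))"
  "0 <= energy om + e * first_variation W' om + e\<^sup>2 * (8 * K\<^sup>2) * (1 + 2 * energy om)"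
  unfolding eq by simp_all
qed

lemma flow_energy:
 fixes \<nu> :: "'n::finite flow"
 assumes \<nu>: "generalized_flow \<eta> gm \<nu>" and fin: "flow_action \<nu> < \<infinity>"
 shows "AE om in path_law \<nu>. om \<in> paths & absolutely_continuous_curve om & kinetic om < \<infinity> & curve_action om = ennreal (energy om)"
  and "integrable (path_law \<nu>) energy" "flow_action \<nu> = ennreal (\<integral>om. energy om \<partial>path_law \<nu>)"
  and "(\<integral>om. energy om \<partial>path_law \<nu>) >= 0"
proof -
 have mc: "curve_action : borel_measurable (path_law \<nu>)"
  unfolding measurable_cong_sets[OF sets_path_law refl] by (rule measurable_curve_action)
 have "AE om in path_law \<nu>. curve_action om ~= \<infinity>"
  using fin unfolding flow_action_eq[OF \<nu>] by (intro nn_integral_noteq_infinite[OF mc]) auto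
 moreover have "AE om in path_law \<nu>. om \<in> paths" using AE_space[of "path_law \<nu>"] by simp
 ultimately show ae: "AE om in path_law \<nu>. om \<in> paths & absolutely_continuous_curve om & kinetic om < \<infinity> & curve_action om = ennreal (energy om)"
 proof eventually_elim
  case (elim om)
  then have "absolutely_continuous_curve om" "kinetic om < \<infinity>"
   by (auto simp: curve_action_alt less_top split: if_splits)
  then show ?case using integrable_energy(2)[of om] elim by (simp add: curve_action_alt)
 qed
 have me: "energy : borel_measurable (path_law \<nu>)"
  unfolding measurable_cong_sets[OF sets_path_law refl] by (rule measurable_energy)
 have eq: "flow_action \<nu> = (\<integral>\<^sup>+om. ennreal (energy om) \<partial>path_law \<nu>)"
  unfolding flow_action_eq[OF \<nu>] using ae by (intro nn_integral_cong_AE) auto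
 have nn: "energy om >= 0" for om :: "real => 'n torus" unfolding energy_def by (rule integral_nonneg_AE) simp
 show i: "integrable (path_law \<nu>) energy"
  by (rule integrableI_nonneg[OF me]) (use fin eq nn in auto)
 show "flow_action \<nu> = ennreal (\<integral>om. energy om \<partial>path_law \<nu>)"
  unfolding eq by (rule nn_integral_eq_integral[OF i]) (use nn in auto)
 show "(\<integral>om. energy om \<partial>path_law \<nu>) >= 0" by (rule integral_nonneg_AE) (use nn in auto)
qed

text \<open>The expansion \<open>kinetic_move_path_le\<close> integrated over the flow; finite action makes every term integrable.\<close>

lemma flow_first_variation:
 fixes W :: "real \<times> (real ^ 'n::finite) => real ^ 'n"
 assumes \<nu>: "generalized_flow \<eta> gm \<nu>" and fin: "flow_action \<nu> < \<infinity>"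
  and W: "periodic_C1 W W' K" and V: "periodic_C1 V V' K" and K: "K >= 1" and e: "0 < e" "4 * (e * K) <= 1"
  and U: "!!z. U z = e *\<^sub>R W z + e\<^sup>2 *\<^sub>R V z"
 defines "A \<equiv> \<integral>om. energy om \<partial>path_law \<nu>" and "\<Lambda> \<equiv> \<integral>om. first_variation W' om \<partial>path_law \<nu>"
 shows "0 <= A + e * \<Lambda> + e\<^sup>2 * (8 * K\<^sup>2) * (1 + 2 * A)"
  and "(\<integral>\<^sup>+om. curve_action (move_path U om) \<partial>path_law \<nu>) <= ennreal (A + e * \<Lambda> + e\<^sup>2 * (8 * K\<^sup>2) * (1 + 2 * A))"
proof -
 interpret P: prob_space "path_law \<nu>" by (rule prob_space_path_law[OF \<nu>])
 note ae = flow_energy(1)[OF \<nu> fin] and iE = flow_energy(2)[OF \<nu> fin]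
 have mL: "first_variation W' : borel_measurable (path_law \<nu>)"
  unfolding measurable_cong_sets[OF sets_path_law refl] by (rule measurable_first_variation[OF W])
 have iB: "integrable (path_law \<nu>) (%om. 2 * K * (1 + 2 * energy om))"
  using iE by (intro integrable_mult_right Bochner_Integration.integrable_add P.integrable_const)
 have iL: "integrable (path_law \<nu>) (first_variation W')"
 proof (rule Bochner_Integration.integrable_bound[OF iB mL], use ae in eventually_elim)
  case (elim om)
  from kinetic_move_path_le(2)[OF W V K e refl] elim
  have "\<bar>first_variation W' om\<bar> <= 2 * K * (1 + 2 * energy om)" by blast
  then show ?case by simp
 qed
 let ?R = "%om. energy om + e * first_variation W' om + e\<^sup>2 * (8 * K\<^sup>2) * (1 + 2 * energy om)"
 have iR: "integrable (path_law \<nu>) ?R"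
  by (intro Bochner_Integration.integrable_add integrable_mult_right P.integrable_const iE iL)
 have R: "AE om in path_law \<nu>. 0 <= ?R om & curve_action (move_path U om) <= ennreal (?R om)"
  using ae
 proof eventually_elim
  case (elim om)
  then have w: "om \<in> paths" "kinetic om < \<infinity>" by auto
  have "absolutely_continuous_curve (move_path U om)"
   using elim absolutely_continuous_move_path[OF periodic_C1_perturbation[OF W V K e U]] by blast
  then show ?case
   using kinetic_move_path_le(1)[OF W V K e U w] kinetic_move_path_le(3)[OF W V K e U w] by (simp add: curve_action_alt)
 qed
 have eq: "(\<integral>om. ?R om \<partial>path_law \<nu>) = A + e * \<Lambda> + e\<^sup>2 * (8 * K\<^sup>2) * (1 + 2 * A)"
 proof -
  have "(\<integral>om. ?R om \<partial>path_law \<nu>) = A + e * \<Lambda> + e\<^sup>2 * (8 * K\<^sup>2) * ((\<integral>om. 1 \<partial>path_law \<nu>) + 2 * A)"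
   unfolding A_def \<Lambda>_def using iE iL
   by (simp only: Bochner_Integration.integral_add integral_mult_right_zero Bochner_Integration.integrable_add integrable_mult_right P.integrable_const)
  moreover have "(\<integral>om. (1::real) \<partial>path_law \<nu>) = 1" using P.prob_space by simp
  ultimately show ?thesis by simp
 qed
 have "0 <= (\<integral>om. ?R om \<partial>path_law \<nu>)"
  by (rule integral_nonneg_AE) (use R in eventually_elim, blast)
 then show "0 <= A + e * \<Lambda> + e\<^sup>2 * (8 * K\<^sup>2) * (1 + 2 * A)" unfolding eq .
 have "(\<integral>\<^sup>+om. curve_action (move_path U om) \<partial>path_law \<nu>) <= (\<integral>\<^sup>+om. ennreal (?R om) \<partial>path_law \<nu>)"
  by (rule nn_integral_mono_AE) (use R in eventually_elim, blast)
 also have "... = ennreal (\<integral>om. ?R om \<partial>path_law \<nu>)"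
  by (rule nn_integral_eq_integral[OF iR]) (use R in eventually_elim, blast)
 finally show "(\<integral>\<^sup>+om. curve_action (move_path U om) \<partial>path_law \<nu>) <= ennreal (A + e * \<Lambda> + e\<^sup>2 * (8 * K\<^sup>2) * (1 + 2 * A))"
  unfolding eq .
qed

context modes
begin

lemma field_periodic: "lattice_rel x y ==> field (t, x) = field (t, y)"
 unfolding field_def by (simp add: pot_periodic[of x y])

lemma lattice_rel_centre: "lattice_rel (centre x) x"
 by (metis abs_torus_centre abs_torus_eq_iff)

lemma field_rep_abs: "field (t, rep (abs_torus x)) = field (t, x)"
 using field_periodic[OF lattice_rel_centre] by simp

lemma field_eq_mode_sum:
 "field = (%z. \<Sum>(i, j)\<in>Sigma UNIV leads. mode (pot_coeff i j * c j (fst z)) (k j) (snd z) *\<^sub>R axis i (1::real))"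
proof
 fix z
 have "field z = (\<Sum>i\<in>UNIV. \<Sum>j\<in>leads i. mode (pot_coeff i j * c j (fst z)) (k j) (snd z) *\<^sub>R axis i (1::real))"
  unfolding field_def pot_def by (simp add: scaleR_sum_left)
 also have "... = (\<Sum>(i, j)\<in>Sigma UNIV leads. mode (pot_coeff i j * c j (fst z)) (k j) (snd z) *\<^sub>R axis i (1::real))"
  by (rule sum.Sigma) (simp_all add: fin_tail)
 finally show "field z = (\<Sum>(i, j)\<in>Sigma UNIV leads. mode (pot_coeff i j * c j (fst z)) (k j) (snd z) *\<^sub>R axis i (1::real))" .
qed

lemma pot_eq_0:
 assumes "!!j. j \<in> J ==> c j t = 0" shows "pot i (t, x) = 0"
 unfolding pot_def using assms by (intro sum.neutral) (simp add: leads_def mode_def)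

lemma test_field_field:
 assumes smooth: "!!j. j \<in> J ==> smooth_curve (c j)" and "dl > 0"
  and supp: "!!j t. j \<in> J ==> t < dl \<or> 1 - dl < t ==> c j t = 0"
 shows "test_field (%t X. field (t, rep X))"
 unfolding test_field_def
proof (intro conjI allI exI[of _ dl] ballI impI)
 have eq: "(%(t, x). field (t, rep (abs_torus x))) = field"
  using field_periodic[OF lattice_rel_centre] by (auto simp: fun_eq_iff)
 have sc: "smooth_curve (%t. a * c j t)" if "j \<in> J" for a j
  using smooth_curve_linear_combination[OF smooth[OF that] smooth[OF that], of a 0] by simp
 show "Ck_on ({0<..<1} \<times> UNIV) m (%(t, x). field (t, rep (abs_torus x)))" for m
  unfolding eq unfolding field_eq_mode_sum case_prod_unfold
  by (rule Ck_on_mode_sum[where c = "%p t. pot_coeff (fst p) (snd p) * c (snd p) t" and k = "%p. k (snd p)" and v = "%p. axis (fst p) 1"])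
   (auto simp: leads_def intro!: sc)
 show "field (t, rep x) = 0" if "t < dl \<or> 1 - dl < t" for t x
  using supp[OF _ that] pot_eq_0 by (simp add: field_def)
qed fact

lemma divergence_field:
 assumes W: "periodic_C1 field W' K"
 shows "divergence (%X. field (t, rep X)) X = dens 0 (t, rep X)"
proof -
 define x where "x = rep_torus X"
 have "((%y. (t, y)) has_derivative (%h. (0, h))) (at x)"
  by (intro has_derivative_Pair has_derivative_const has_derivative_ident)
 from has_derivative_compose[OF this periodic_C1D(1)[OF W]]
 have d: "((%y. field (t, y)) has_derivative (%h. W' (t, x) (0, h))) (at x)" .
 have comp: "W' (t, x) (0, axis i 1) $ i = dens (pos i) (t, x) - dens (Suc (pos i)) (t, x)" for i
 proof -
  have "((%s. x + s *\<^sub>R axis i 1) has_derivative (%s. s *\<^sub>R axis i 1)) (at 0)"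
   by (auto intro!: derivative_eq_intros)
  from has_derivative_compose[OF this, of "%y. field (t, y)"] d
  have "((%s. field (t, x + s *\<^sub>R axis i 1)) has_derivative (%s. W' (t, x) (0, s *\<^sub>R axis i 1))) (at 0)" by simp
  then have "((%s. field (t, x + s *\<^sub>R axis i 1) $ i) has_derivative (%s. W' (t, x) (0, s *\<^sub>R axis i 1) $ i)) (at 0)"
   by (rule bounded_linear.has_derivative[OF bounded_linear_vec_nth])
  moreover have "W' (t, x) (0, s *\<^sub>R axis i 1) $ i = s * (W' (t, x) (0, axis i 1) $ i)" for s
   using linear_cmul[OF has_derivative_linear[OF d], of s "axis i 1"] by simp
  moreover have "field (t, y) $ i = pot i (t, y)" for y
  proof -
   have "field (t, y) $ i = (\<Sum>i'\<in>UNIV. if i' = i then pot i' (t, y) else 0)"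
    unfolding field_def sum_component vector_scaleR_component
    by (rule sum.cong) (simp_all add: axis_def)
   then show ?thesis by simp
  qed
  ultimately have "((%s. pot i (t, x + s *\<^sub>R axis i 1)) has_real_derivative W' (t, x) (0, axis i 1) $ i) (at 0)"
   unfolding has_field_derivative_def by (simp add: mult_commute_abs)
  from DERIV_unique[OF this pot_derivative[of i t x 0]] show ?thesis by simp
 qed
 have "divergence (%X. field (t, rep X)) X = (\<Sum>i\<in>UNIV. W' (t, x) (0, axis i 1) $ i)"
  unfolding divergence_def field_rep_abs x_def[symmetric] by (simp add: frechet_derivative_at[OF d, symmetric])
 also have "... = (\<Sum>i\<in>UNIV. dens (pos i) (t, x) - dens (Suc (pos i)) (t, x))" by (simp add: comp)
 also have "... = (\<Sum>m<CARD('n). dens m (t, x) - dens (Suc m) (t, x))"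
  by (rule sum.reindex_bij_betw[OF pos])
 also have "... = dens 0 (t, x)"
  using sum_lessThan_telescope'[of "%m. dens m (t, x)" "CARD('n)"] by (simp only: dens_CARD diff_zero)
 also have "... = dens 0 (t, rep X)"
  by (intro dens_periodic) (simp add: x_def abs_torus_eq_iff[symmetric])
 finally show ?thesis .
qed

text \<open>The field has divergence \<open>dens 0\<close>, so the defining equation of the pressure evaluates the first variation.\<close>

lemma first_variation_eq_pressure:
 assumes W: "periodic_C1 field W' K" and \<nu>: "generalized_flow \<eta> gm \<nu>" and p: "pressure_field \<nu> p"
  and w: "test_field (%t X. field (t, rep X))"
 shows "(\<integral>om. first_variation W' om \<partial>path_law \<nu>) = - (\<integral>(t, x). p (t, x) * dens 0 (t, rep x) \<partial>spacetime)"
proof -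
 have pt: "(LINT t:{0<..<1}|lborel. velocity om t \<bullet> vector_derivative (%s. field (s, rep (om s))) (at t)) = first_variation W' om" for om
  unfolding set_lebesgue_integral_def first_variation_def
 proof (rule Bochner_Integration.integral_cong[OF refl])
  fix t :: real
  show "indicat_real {0<..<1} t *\<^sub>R (velocity om t \<bullet> vector_derivative (%s. field (s, rep (om s))) (at t)) = first_variation_density W' om t"
  proof (cases "t \<in> {0<..<1}")
   case t: True
   show ?thesis
   proof (cases "\<exists>v. has_velocity om v t")
    case True
    then obtain v where v: "has_velocity om v t" by blast
    then show ?thesis
     using vector_derivative_along_path[OF W t v] velocity_eq[OF t v] t
     by (simp add: first_variation_density_def velocity01_def path_at_eq)
   next
    case False
    then show ?thesis using velocity_eq_0[of om t] by (simp add: first_variation_density_def velocity01_def)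
   qed
  next
   case False
   then have "velocity01 om t = 0" unfolding velocity01_def by (rule if_not_P)
   moreover have "indicat_real {0<..<1} t = 0" using False by (rule indicator_simps(2))
   ultimately show ?thesis by (simp add: first_variation_density_def)
  qed
 qed
 have "(\<integral>om. first_variation W' om \<partial>path_law \<nu>) = (\<integral>z. first_variation W' (fst z) \<partial>\<nu>)"
  unfolding path_law_def by (rule integral_distr[OF measurable_fst_flow[OF \<nu>] measurable_first_variation[OF W]])
 also have "... = (\<integral>(om, a). (LINT t:{0<..<1}|lborel. velocity om t \<bullet> vector_derivative (%s. field (s, rep (om s))) (at t)) \<partial>\<nu>)"
  by (simp add: pt case_prod_unfold)
 also have "... = - (\<integral>(t, x). p (t, x) * divergence (%X. field (t, rep X)) x \<partial>spacetime)"
  using p[unfolded pressure_field_def, THEN conjunct2, THEN conjunct2, rule_format, OF w]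
  by (simp only: eq_neg_iff_add_eq_0)
 finally show ?thesis unfolding divergence_field[OF W] .
qed

text \<open>Mix with weight \<open>e\<close>, rectify the density to the uniform one, compare with the minimizer, divide by \<open>e\<close> and let \<open>e\<close> tend to 0.\<close>

lemma smooth_density_inequality:
 assumes plans: "\<eta> \<in> torus_plans" "gm \<in> torus_plans" and opt: "optimal_incompressible_flow \<eta> gm \<eta>\<eta>"
  and p: "pressure_field \<eta>\<eta> p" and \<nu>: "generalized_flow \<eta> gm \<nu>"
  and fin: "flow_action \<eta>\<eta> < \<infinity>" "flow_action \<nu> < \<infinity>"
  and smooth: "!!j. j \<in> J ==> smooth_curve (c j)" and dl: "dl > 0"
  and supp: "!!j t. j \<in> J ==> t < dl \<or> 1 - dl < t ==> c j t = 0"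
  and nonneg: "!!t x. 1 + dens 0 (t, x) >= 0"
  and law: "!!t (f :: 'n torus => ennreal). t \<in> {0..1} ==> f : borel_measurable borel ==>
   (\<integral>\<^sup>+om. f (om t) \<partial>path_law \<nu>) = (\<integral>\<^sup>+X. f X * ennreal (1 + dens 0 (t, rep X)) \<partial>TM)"
 shows "(\<integral>(t, x). p (t, x) * dens 0 (t, rep x) \<partial>spacetime) <= enn2real (flow_action \<nu>) - enn2real (flow_action \<eta>\<eta>)"
proof -
 have g: "generalized_flow \<eta> gm \<eta>\<eta>" and inc: "incompressible \<eta>\<eta>"
  and min: "!!\<nu>'. generalized_flow \<eta> gm \<nu>' ==> incompressible \<nu>' ==> flow_action \<eta>\<eta> <= flow_action \<nu>'"
  using opt by (auto simp: optimal_incompressible_flow_def)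
 obtain K W' where K: "K >= 1" and W: "periodic_C1 field W' K"
  and ex: "!!e. 0 < e ==> e * K <= 1/2 ==> (\<forall>m z. \<bar>e * dens m z\<bar> <= 1/2) &
    (\<exists>V V'. periodic_C1 V V' K & (\<forall>z. rect e z = e *\<^sub>R field z + e\<^sup>2 *\<^sub>R V z))"
  using rect_expansion by blast
 define A1 where "A1 = (\<integral>om. energy om \<partial>path_law \<eta>\<eta>)"
 define A2 where "A2 = (\<integral>om. energy om \<partial>path_law \<nu>)"
 define L1 where "L1 = (\<integral>om. first_variation W' om \<partial>path_law \<eta>\<eta>)"
 define L2 where "L2 = (\<integral>om. first_variation W' om \<partial>path_law \<nu>)"
 define M where "M = 8 * K\<^sup>2"
 have A: "flow_action \<eta>\<eta> = ennreal A1" "flow_action \<nu> = ennreal A2" "A1 >= 0" "A2 >= 0"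
  using flow_energy(3,4)[OF g fin(1)] flow_energy(3,4)[OF \<nu> fin(2)] by (simp_all add: A1_def A2_def)
 have M: "M >= 0" by (simp add: M_def)
 define C where "C = \<bar>L1\<bar> + \<bar>L2\<bar> + M * (1 + 2 * A1) + M * (1 + 2 * A2)"
 have main: "0 <= A2 - A1 + L1 + e * C" if e: "0 < e" "4 * (e * K) <= 1" for e
 proof -
  have e1: "e <= 1" using e K mult_left_mono[of 1 K e] by linarith
  obtain V V' where V: "periodic_C1 V V' K" and U: "!!z. rect e z = e *\<^sub>R field z + e\<^sup>2 *\<^sub>R V z"
   and small: "!!m z. \<bar>e * dens m z\<bar> <= 1/2" using ex[of e] e by auto
  note per = periodic_C1_perturbation[OF W V K e U]
  note b1 = flow_first_variation[OF g fin(1) W V K e U, folded A1_def L1_def M_def]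
  note b2 = flow_first_variation[OF \<nu> fin(2) W V K e U, folded A2_def L2_def M_def]
  let ?R1 = "A1 + e * L1 + e\<^sup>2 * M * (1 + 2 * A1)" and ?R2 = "A2 + e * L2 + e\<^sup>2 * M * (1 + 2 * A2)"
  obtain \<nu>1 where \<nu>1: "generalized_flow \<eta> gm \<nu>1" and mix: "!!F :: (real => 'n torus) => ennreal. F : borel_measurable path_borel ==>
   (\<integral>\<^sup>+om. F om \<partial>path_law \<nu>1) = (\<integral>\<^sup>+om. F om \<partial>path_law \<eta>\<eta>) * ennreal (1 - e) + (\<integral>\<^sup>+om. F om \<partial>path_law \<nu>) * ennreal e"
   using mix_flows[OF plans g \<nu>, of e] e e1 by auto
  let ?Q = "return borel (0::real)"
  have Q: "prob_space ?Q" by (rule prob_space_return) simp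
  have m: "(%(om, th :: real). move_path (rect e) om) \<in> path_borel \<Otimes>\<^sub>M borel \<rightarrow>\<^sub>M path_borel"
   using measurable_compose[OF measurable_fst measurable_move_path[OF per]] by (simp add: case_prod_unfold)
  have rect0: "rect e (t, x) = 0" if "t <= 0 \<or> 1 <= t" for t x
  proof -
   have "c j t = 0" if "j \<in> J" for j using that \<open>t <= 0 \<or> 1 <= t\<close> dl by (intro supp) auto
   then have "pot i (t, x) = 0" for i by (rule pot_eq_0)
   then show ?thesis by (simp add: rect_partial_def)
  qed
  have ends: "move_path (rect e) om 0 = om 0" "move_path (rect e) om 1 = om 1" for om :: "real => 'n torus"
   by (simp_all add: move_path_def rect0)
  obtain \<nu>2 where \<nu>2: "generalized_flow \<eta> gm \<nu>2" and tr: "!!F :: (real => 'n torus) => ennreal. F : borel_measurable path_borel ==>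
   (\<integral>\<^sup>+om. F om \<partial>path_law \<nu>2) = (\<integral>\<^sup>+om. \<integral>\<^sup>+th. F (move_path (rect e) om) \<partial>?Q \<partial>path_law \<nu>1)"
   using transport_flow[OF plans \<nu>1 Q _ m ends] by (metis sets_return)
  have tr': "(\<integral>\<^sup>+om. F om \<partial>path_law \<nu>2) = (\<integral>\<^sup>+om. F (move_path (rect e) om) \<partial>path_law \<nu>1)"
   if "F : borel_measurable path_borel" for F :: "(real => 'n torus) => ennreal"
   using tr[OF that] prob_space.emeasure_space_1[OF Q] by simp
  have "incompressible \<nu>2"
   unfolding incompressible_iff[OF \<nu>2]
  proof (intro ballI allI impI)
   fix t :: real and f :: "'n torus => ennreal" assume t: "t \<in> {0..1}" and f[measurable]: "f : borel_measurable borel"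
   define F where "F X = f (X \<oplus> rect e (t, rep X))" for X
   have [measurable]: "(%x. rect e (t, x)) : borel_measurable borel"
    unfolding rect_partial_def by measurable
   have F: "F : borel_measurable borel" unfolding F_def
    using measurable_compose[OF measurable_torus_rep \<open>(%x. rect e (t, x)) : borel_measurable borel\<close>] by measurable
   have ev: "(%om. G (om t)) : borel_measurable path_borel" if "G : borel_measurable borel" for G :: "'n torus => ennreal"
    by (rule measurable_compose[OF measurable_path_eval[OF measurable_ident_sets[OF refl] t] that])
   have "(\<integral>\<^sup>+om. f (om t) \<partial>path_law \<nu>2) = (\<integral>\<^sup>+om. F (om t) \<partial>path_law \<nu>1)"
    using tr'[OF ev[OF f]] t by (simp add: move_path_def F_def)
   also have "... = (\<integral>\<^sup>+om. F (om t) \<partial>path_law \<eta>\<eta>) * ennreal (1 - e) + (\<integral>\<^sup>+om. F (om t) \<partial>path_law \<nu>) * ennreal e"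
    by (rule mix[OF ev[OF F]])
   also have "(\<integral>\<^sup>+om. F (om t) \<partial>path_law \<eta>\<eta>) = (\<integral>\<^sup>+X. F X \<partial>TM)"
    using inc t F unfolding incompressible_iff[OF g] by blast
   also have "(\<integral>\<^sup>+om. F (om t) \<partial>path_law \<nu>) = (\<integral>\<^sup>+X. F X * ennreal (1 + dens 0 (t, rep X)) \<partial>TM)"
    by (rule law[OF t F])
   also have "(\<integral>\<^sup>+X. F X \<partial>TM) * ennreal (1 - e) + (\<integral>\<^sup>+X. F X * ennreal (1 + dens 0 (t, rep X)) \<partial>TM) * ennreal e
    = (\<integral>\<^sup>+X. F X * ennreal (1 - e) + F X * ennreal (1 + dens 0 (t, rep X)) * ennreal e \<partial>TM)"
   proof -
    have [measurable]: "(%X. dens 0 (t, rep X)) : borel_measurable borel"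
     using measurable_compose[OF measurable_torus_rep measurable_dens] .
    note [measurable] = F
    show ?thesis by (subst nn_integral_add) (simp_all add: nn_integral_multc)
   qed
   also have "... = (\<integral>\<^sup>+X. F X * ennreal (1 + e * dens 0 (t, rep X)) \<partial>TM)"
   proof (rule nn_integral_cong)
    fix X
    let ?d = "dens 0 (t, rep X)"
    have "F X * ennreal (1 - e) + F X * ennreal (1 + ?d) * ennreal e = F X * (ennreal (1 - e) + ennreal (1 + ?d) * ennreal e)"
     by (simp add: distrib_left mult.assoc)
    also have "ennreal (1 - e) + ennreal (1 + ?d) * ennreal e = ennreal ((1 - e) + (1 + ?d) * e)"
     using nonneg[of t "rep X"] e e1 by (simp add: ennreal_mult'[symmetric] ennreal_plus[symmetric] del: ennreal_plus)
    also have "(1 - e) + (1 + ?d) * e = 1 + e * ?d" by (simp add: algebra_simps)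
    finally show "F X * ennreal (1 - e) + F X * ennreal (1 + ?d) * ennreal e = F X * ennreal (1 + e * ?d)" .
   qed
   also have "... = (\<integral>\<^sup>+x. f x \<partial>TM)" unfolding F_def by (rule nn_integral_rect[OF small f])
   finally show "(\<integral>\<^sup>+om. f (om t) \<partial>path_law \<nu>2) = (\<integral>\<^sup>+x. f x \<partial>TM)" .
  qed
  from min[OF \<nu>2 this] have "ennreal A1 <= flow_action \<nu>2" by (simp add: A)
  also have "... = (\<integral>\<^sup>+om. curve_action (move_path (rect e) om) \<partial>path_law \<nu>1)"
   unfolding flow_action_eq[OF \<nu>2] by (rule tr'[OF measurable_curve_action])
  also have "... = (\<integral>\<^sup>+om. curve_action (move_path (rect e) om) \<partial>path_law \<eta>\<eta>) * ennreal (1 - e) + (\<integral>\<^sup>+om. curve_action (move_path (rect e) om) \<partial>path_law \<nu>) * ennreal e"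
   by (rule mix) (rule measurable_compose[OF measurable_move_path[OF per] measurable_curve_action])
  also have "... <= ennreal ?R1 * ennreal (1 - e) + ennreal ?R2 * ennreal e"
   by (intro add_mono mult_right_mono b1 b2) auto
  also have "... = ennreal (?R1 * (1 - e) + ?R2 * e)"
  proof -
   have "ennreal ?R1 * ennreal (1 - e) = ennreal (?R1 * (1 - e))" "ennreal ?R2 * ennreal e = ennreal (?R2 * e)"
    using b1(1) b2(1) e e1 by (simp_all only: ennreal_mult[symmetric] diff_ge_0_iff_ge less_imp_le)
   moreover have "0 <= ?R1 * (1 - e)" "0 <= ?R2 * e"
    by (rule mult_nonneg_nonneg[OF b1(1)], use e1 in simp) (rule mult_nonneg_nonneg[OF b2(1)], use e in simp)
   ultimately show ?thesis by (simp only: ennreal_plus[symmetric])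
  qed
  finally have "A1 <= ?R1 * (1 - e) + ?R2 * e"
  proof (rule ennreal_le_iff[THEN iffD1, rotated])
   show "0 <= ?R1 * (1 - e) + ?R2 * e"
    by (rule add_nonneg_nonneg[OF mult_nonneg_nonneg[OF b1(1)] mult_nonneg_nonneg[OF b2(1)]]) (use e e1 in simp_all)
  qed
  then have "0 <= e * (A2 - A1 + L1 + e * (L2 - L1 + (1 - e) * (M * (1 + 2 * A1)) + e * (M * (1 + 2 * A2))))"
   by (simp add: algebra_simps power2_eq_square)
  then have "0 <= A2 - A1 + L1 + e * (L2 - L1 + (1 - e) * (M * (1 + 2 * A1)) + e * (M * (1 + 2 * A2)))"
   using e by (simp add: zero_le_mult_iff)
  also have "e * (L2 - L1 + (1 - e) * (M * (1 + 2 * A1)) + e * (M * (1 + 2 * A2))) <= e * C"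
  proof (rule mult_left_mono)
   have n: "0 <= M * (1 + 2 * A1)" "0 <= M * (1 + 2 * A2)" using M A by (auto intro!: mult_nonneg_nonneg)
   have "(1 - e) * (M * (1 + 2 * A1)) <= M * (1 + 2 * A1)" "e * (M * (1 + 2 * A2)) <= M * (1 + 2 * A2)"
    using mult_right_mono[OF _ n(1), of "1 - e" 1] mult_right_mono[OF e1 n(2)] e by simp_all
   then show "L2 - L1 + (1 - e) * (M * (1 + 2 * A1)) + e * (M * (1 + 2 * A2)) <= C" unfolding C_def by linarith
  qed (use e in simp)
  finally show ?thesis by simp
 qed
 have "0 <= A2 - A1 + L1"
 proof (rule tendsto_lowerbound)
  show "((%e. A2 - A1 + L1 + e * C) \<longlongrightarrow> A2 - A1 + L1) (at_right 0)"
   by (auto intro!: tendsto_eq_intros)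
  have "eventually (%e. e \<in> {0<..<1 / (4 * K)}) (at_right 0)"
   using K by (intro eventually_at_right_real) simp
  then show "eventually (%e. 0 <= A2 - A1 + L1 + e * C) (at_right 0)"
   by eventually_elim (rule main, use K in "auto simp: field_simps")
 qed simp
 then show ?thesis
  using first_variation_eq_pressure[OF W g p test_field_field[OF smooth dl supp]] A by (simp add: L1_def)
qed

end

section \<open>A smooth bump function\<close>

primrec flat_poly :: "nat => real poly" where
 "flat_poly 0 = 1"
| "flat_poly (Suc n) = monom 1 2 * (flat_poly n - pderiv (flat_poly n))"

text \<open>The derivatives of \<open>exp (- 1 / x)\<close>, continued by 0.\<close>

definition flat :: "nat => real => real" where
 "flat n x = (if x > 0 then poly (flat_poly n) (1 / x) * exp (- (1 / x)) else 0)"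

lemma tendsto_poly_exp: "((%y. poly p y * exp (- y)) \<longlongrightarrow> (0::real)) at_top"
proof -
 have "((%y. \<Sum>i\<le>degree p. coeff p i * (y ^ i / exp y)) \<longlongrightarrow> (\<Sum>i\<le>degree p. coeff p i * 0)) at_top"
  by (intro tendsto_sum tendsto_mult tendsto_const tendsto_power_div_exp_0)
 then show ?thesis by (simp add: poly_altdef sum_distrib_right exp_minus divide_inverse mult.assoc)
qed

lemma has_derivative_flat: "(flat n has_real_derivative flat (Suc n) x) (at x)"
proof -
 consider "x > 0" | "x < 0" | "x = 0" by linarith
 then show ?thesis
 proof cases
  case 1
  have "((%x. poly (flat_poly n) (1 / x) * exp (- (1 / x))) has_real_derivative flat (Suc n) x) (at x)"
   using 1 by (auto intro!: derivative_eq_intros DERIV_chain2[OF poly_DERIV]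
     simp: flat_def poly_monom power2_eq_square field_simps)
  then show ?thesis
   by (rule has_field_derivative_transform_within_open[where S = "{0<..}"]) (use 1 in "auto simp: flat_def")
 next
  case 2
  have "((%x::real. 0) has_real_derivative flat (Suc n) x) (at x)" using 2 by (auto simp: flat_def)
  then show ?thesis
   by (rule has_field_derivative_transform_within_open[where S = "{..<0}"]) (use 2 in "auto simp: flat_def")
 next
  case 3
  have "((%h. poly (monom 1 1 * flat_poly n) (inverse h) * exp (- inverse h)) \<longlongrightarrow> 0) (at_right (0::real))"
   by (rule filterlim_compose[OF tendsto_poly_exp filterlim_inverse_at_top_right])
  then have "((%h. (flat n (0 + h) - flat n 0) / h) \<longlongrightarrow> 0) (at_right 0)"
  proof (rule Lim_transform_eventually)
   show "eventually (%h. poly (monom 1 1 * flat_poly n) (inverse h) * exp (- inverse h) = (flat n (0 + h) - flat n 0) / h) (at_right 0)"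
    unfolding eventually_at_filter by (rule always_eventually) (simp add: flat_def poly_monom divide_inverse)
  qed
  moreover have "((%h. (flat n (0 + h) - flat n 0) / h) \<longlongrightarrow> 0) (at_left 0)"
  proof (rule Lim_transform_eventually[OF tendsto_const])
   show "eventually (%h. 0 = (flat n (0 + h) - flat n 0) / h) (at_left 0)"
    unfolding eventually_at_filter by (rule always_eventually) (simp add: flat_def)
  qed
  ultimately have "((%h. (flat n (0 + h) - flat n 0) / h) \<longlongrightarrow> 0) (at 0)" by (rule filterlim_split_at[rotated])
  then show ?thesis using 3 by (simp add: DERIV_def flat_def)
 qed
qed

definition bump_term :: "(real \<times> nat \<times> nat) list => real => real" where
 "bump_term L x = (\<Sum>(a, m, n)\<leftarrow>L. a * flat m (1 + x) * flat n (1 - x))"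

definition bump_step :: "(real \<times> nat \<times> nat) list => (real \<times> nat \<times> nat) list" where
 "bump_step L = concat (map (%(a, m, n). [(a, Suc m, n), (- a, m, Suc n)]) L)"

lemma bump_Cons:
 "bump_term ((a, m, n) # L) x = a * flat m (1 + x) * flat n (1 - x) + bump_term L x"
 "bump_step ((a, m, n) # L) = (a, Suc m, n) # (- a, m, Suc n) # bump_step L"
 by (simp_all add: bump_term_def bump_step_def)

lemma has_derivative_bump_term: "(bump_term L has_real_derivative bump_term (bump_step L) x) (at x)"
proof (induction L)
 case (Cons p L)
 obtain a m n where p: "p = (a, m, n)" by (cases p)
 have d1: "((%x. flat m (1 + x)) has_real_derivative flat (Suc m) (1 + x)) (at x)"
  by (rule DERIV_chain2[OF has_derivative_flat, THEN DERIV_cong]) (auto intro!: derivative_eq_intros)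
 have d2: "((%x. flat n (1 - x)) has_real_derivative - flat (Suc n) (1 - x)) (at x)"
  by (rule DERIV_chain2[OF has_derivative_flat, THEN DERIV_cong]) (auto intro!: derivative_eq_intros)
 have d: "((%x. a * flat m (1 + x) * flat n (1 - x) + bump_term L x) has_real_derivative
  (a * flat (Suc m) (1 + x) * flat n (1 - x) + ((- a) * flat m (1 + x) * flat (Suc n) (1 - x) + bump_term (bump_step L) x))) (at x)"
  by (rule derivative_eq_intros d1 d2 Cons refl)+ (simp add: algebra_simps)
 have "bump_term (p # L) = (%x. a * flat m (1 + x) * flat n (1 - x) + bump_term L x)"
  by (simp only: fun_eq_iff p bump_Cons simp_thms)
 with d show ?case by (simp only: p bump_Cons)
qed (simp add: bump_term_def[abs_def] bump_step_def)

text \<open>The normalized product \<open>exp (- 1 / (1 + x)) exp (- 1 / (1 - x))\<close> on \<open>(-1, 1)\<close>.\<close>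

lemma ex_bump:
 obtains D :: "nat => real => real" where "!!x. D 0 x >= 0" "!!x. \<bar>x\<bar> >= 1 ==> D 0 x = 0"
  "!!n x. (D n has_real_derivative D (Suc n) x) (at x)" "(\<integral>\<^sup>+x. ennreal (D 0 x) \<partial>lborel) = 1"
proof -
 define E where "E n = bump_term ((bump_step ^^ n) [(1, 0, 0)])" for n
 have dE: "(E n has_real_derivative E (Suc n) x) (at x)" for n x
  unfolding E_def using has_derivative_bump_term by simp
 have E0: "E 0 x = flat 0 (1 + x) * flat 0 (1 - x)" for x by (simp add: E_def bump_term_def)
 have nonneg: "E 0 x >= 0" for x by (simp add: E0 flat_def)
 have le1: "E 0 x <= 1" for x unfolding E0 by (intro mult_le_one) (auto simp: flat_def)
 have supp: "E 0 x = 0" if "\<bar>x\<bar> >= 1" for x using that by (auto simp: E0 flat_def abs_if split: if_splits)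
 have cont: "continuous_on UNIV (E 0)" using dE by (intro DERIV_continuous_on) (auto intro: has_field_derivative_at_within)
 then have [measurable]: "E 0 : borel_measurable borel" by (rule borel_measurable_continuous_onI)
 define Z where "Z = (\<integral>\<^sup>+x. ennreal (E 0 x) \<partial>lborel)"
 have "Z <= (\<integral>\<^sup>+x. indicator {-1..1} (x::real) \<partial>lborel)"
  unfolding Z_def using le1 supp by (intro nn_integral_mono) (auto split: split_indicator simp: abs_le_iff)
 then have Zf: "Z < \<infinity>" by (auto intro: le_less_trans)
 have pos: "E 0 x > 0" if "\<bar>x\<bar> < 1" for x using that by (auto simp: E0 flat_def abs_less_iff)
 have "Z ~= 0"
 proof
  assume "Z = 0"
  then have "AE x in lborel. E 0 x = 0"
   unfolding Z_def using nonneg by (subst (asm) nn_integral_0_iff_AE) (auto elim!: eventually_mono simp: antisym)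
  then have "AE x in lborel. x \<notin> {-1<..<1::real}"
  proof eventually_elim
   case (elim x)
   then show ?case using pos[of x] by (auto simp: abs_less_iff)
  qed
  then have "(\<integral>\<^sup>+x. indicator {-1<..<1::real} x \<partial>lborel) = (\<integral>\<^sup>+x. 0 \<partial>(lborel :: real measure))"
   by (intro nn_integral_cong_AE) (auto elim!: eventually_mono split: split_indicator)
  then have "emeasure lborel {-1<..<1::real} = 0" by (subst (asm) nn_integral_indicator) simp_all
  then have "ennreal (1 - (-1)) = 0" by (subst (asm) emeasure_lborel_Ioo) simp_all
  then show False by simp
 qed
 define z where "z = enn2real Z"
 have z: "z > 0" "Z = ennreal z" using Zf \<open>Z ~= 0\<close> by (auto simp: z_def enn2real_positive_iff less_top zero_less_iff_neq_zero)
 show ?thesis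
 proof (rule that[of "%n x. E n x / z"])
  show "((%x. E n x / z) has_real_derivative E (Suc n) x / z) (at x)" for n x by (intro DERIV_cdivide dE)
  have "(\<integral>\<^sup>+x. ennreal (E 0 x / z) \<partial>lborel) = (\<integral>\<^sup>+x. ennreal (E 0 x) * ennreal (1 / z) \<partial>lborel)"
   using nonneg z by (intro nn_integral_cong) (simp add: ennreal_mult'[symmetric])
  also have "... = ennreal z * ennreal (1 / z)" by (simp add: nn_integral_multc Z_def[symmetric] z)
  also have "... = 1" using z by (simp add: ennreal_mult[symmetric])
  finally show "(\<integral>\<^sup>+x. ennreal (E 0 x / z) \<partial>lborel) = 1" .
 qed (use nonneg z supp in auto)
qed

section \<open>Nonnegative trigonometric kernels\<close>

definition trig_sum :: "(complex \<times> (real ^ 'n)) list => real ^ 'n => real" where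
 "trig_sum L x = (\<Sum>(a, k)\<leftarrow>L. mode a k x)"

definition trig_poly :: "(real ^ 'n => real) => bool" where
 "trig_poly f \<longleftrightarrow> (\<exists>L. snd ` set L \<subseteq> lattice & f = trig_sum L)"

lemma trig_poly_mode: "k \<in> lattice ==> trig_poly (mode a k)"
 unfolding trig_poly_def by (intro exI[of _ "[(a, k)]"]) (auto simp: trig_sum_def)

lemma trig_poly_const: "trig_poly (%_. r)"
proof -
 have "mode (complex_of_real r) (0 :: real ^ 'a) = (%_. r)" by (auto simp: mode_def)
 moreover have "trig_poly (mode (complex_of_real r) (0 :: real ^ 'a))" by (rule trig_poly_mode) (simp add: lattice_def)
 ultimately show ?thesis by simp
qed

lemma trig_poly_add:
 assumes "trig_poly f" "trig_poly g" shows "trig_poly (%x. f x + g x)"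
proof -
 obtain L M where "snd ` set L \<subseteq> lattice" "f = trig_sum L" "snd ` set M \<subseteq> lattice" "g = trig_sum M"
  using assms unfolding trig_poly_def by blast
 then show ?thesis unfolding trig_poly_def by (intro exI[of _ "L @ M"]) (auto simp: trig_sum_def)
qed

lemma mode_mult: "mode a k x * mode b l x = mode (a * b / 2) (k + l) x + mode (a * cnj b / 2) (k - l) x"
proof -
 have "cis (2 * pi * ((k + l) \<bullet> x)) = cis (2 * pi * (k \<bullet> x)) * cis (2 * pi * (l \<bullet> x))"
  "cis (2 * pi * ((k - l) \<bullet> x)) = cis (2 * pi * (k \<bullet> x)) * cnj (cis (2 * pi * (l \<bullet> x)))"
  by (simp_all add: cis_mult cis_cnj inner_add_left inner_diff_left algebra_simps)
 then show ?thesis unfolding mode_eq_Re by (simp add: field_simps)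
qed

lemma trig_poly_sum_list:
 assumes "!!p. p \<in> set L ==> trig_poly (F p)" shows "trig_poly (%x. \<Sum>p\<leftarrow>L. F p x)"
 using assms by (induction L) (auto intro: trig_poly_const[of 0] trig_poly_add)

lemma sum_list_product:
 fixes f :: "'a => real"
 shows "(\<Sum>p\<leftarrow>L. f p) * (\<Sum>q\<leftarrow>M. g q) = (\<Sum>p\<leftarrow>L. \<Sum>q\<leftarrow>M. f p * g q)"
 by (induction L) (simp_all add: distrib_right sum_list_const_mult)

lemma trig_poly_mult:
 assumes "trig_poly f" "trig_poly g" shows "trig_poly (%x. f x * g x)"
proof -
 obtain L M where L: "snd ` set L \<subseteq> lattice" "f = trig_sum L" and M: "snd ` set M \<subseteq> lattice" "g = trig_sum M"
  using assms unfolding trig_poly_def by blast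
 have eq: "(%x. f x * g x) = (%x. \<Sum>p\<leftarrow>L. \<Sum>q\<leftarrow>M. mode (fst p) (snd p) x * mode (fst q) (snd q) x)"
  unfolding L(2) M(2) trig_sum_def case_prod_unfold
  by (simp only: sum_list_product)
 show ?thesis
  unfolding eq mode_mult
  using L(1) M(1) by (intro trig_poly_sum_list trig_poly_add trig_poly_mode) (auto simp: lattice_def image_subset_iff intro!: Ints_add Ints_diff)
qed

lemma trig_poly_power: "trig_poly f ==> trig_poly (%x. f x ^ n)"
 by (induction n) (auto intro: trig_poly_const[of 1] trig_poly_mult)

lemma trig_poly_prod: "finite I ==> (!!i. i \<in> I ==> trig_poly (F i)) ==> trig_poly (%x. \<Prod>i\<in>I. F i x)"
 by (induction I rule: finite_induct) (auto intro: trig_poly_const[of 1] trig_poly_mult)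

lemma trig_poly_periodic: assumes "trig_poly f" "lattice_rel x y" shows "f x = f y"
proof -
 obtain L where L: "snd ` set L \<subseteq> lattice" "f = trig_sum L" using assms(1) unfolding trig_poly_def by blast
 have "map (%(a, k). mode a k x) L = map (%(a, k). mode a k y) L"
  using L(1) assms(2) by (auto intro!: mode_periodic)
 then show ?thesis by (simp only: L(2) trig_sum_def)
qed

lemma continuous_trig_poly: assumes "trig_poly f" shows "continuous_on S f"
proof -
 obtain L where L: "f = trig_sum L" using assms unfolding trig_poly_def by blast
 have "continuous_on S (trig_sum L)"
  unfolding trig_sum_def[abs_def] by (induction L) (auto simp: mode_def intro!: continuous_intros)
 then show ?thesis by (simp add: L)
qed

lemma measurable_vec_nth [measurable]: "(%x :: real ^ 'n. x $ i) : borel_measurable borel"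
 by (intro borel_measurable_continuous_onI continuous_intros)

lemma measurable_real_cos [measurable]: "(cos :: real => real) : borel_measurable borel"
 by (intro borel_measurable_continuous_onI continuous_intros)

text \<open>A power of \<open>1 + cos\<close> in each coordinate: a nonnegative trigonometric polynomial peaked at the lattice.\<close>

definition raw_kernel :: "nat => real ^ 'n => real" where
 "raw_kernel N x = (\<Prod>i\<in>UNIV. (1 + cos (2 * pi * x $ i)) ^ N)"

lemma trig_poly_raw_kernel: "trig_poly (raw_kernel N :: real ^ 'n::finite => real)"
proof -
 have "trig_poly (%x :: real ^ 'n. cos (2 * pi * x $ i))" for i
 proof -
  have "(%x :: real ^ 'n. cos (2 * pi * x $ i)) = mode 1 (axis i 1)" by (auto simp: mode_def inner_axis')
  then show ?thesis by (simp only:) (rule trig_poly_mode, auto simp: lattice_def axis_def)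
 qed
 then show ?thesis
  unfolding raw_kernel_def[abs_def] by (intro trig_poly_prod trig_poly_power trig_poly_add trig_poly_const) auto
qed

lemma raw_kernel_nonneg: "raw_kernel N x >= 0"
proof -
 have "0 <= 1 + cos r" for r :: real using cos_ge_minus_one[of r] by linarith
 then show ?thesis unfolding raw_kernel_def by (intro prod_nonneg) simp
qed

lemma raw_kernel_le: "raw_kernel N (x :: real ^ 'n::finite) <= (2 ^ N) ^ CARD('n)"
proof -
 have "0 <= 1 + cos r" "1 + cos r <= 2" for r :: real using cos_ge_minus_one[of r] cos_le_one[of r] by linarith+
 then have "raw_kernel N x <= (\<Prod>i\<in>(UNIV :: 'n set). 2 ^ N)"
  unfolding raw_kernel_def by (intro prod_mono conjI power_mono) auto
 then show ?thesis by simp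
qed

text \<open>The derivative of \<open>(1 + cos)\<^sup>N sin\<close> integrates to zero over a period, which compares the two integrals.\<close>

lemma cos_power_concentration:
 assumes "N >= 1"
 shows "(\<integral>\<^sup>+s. ennreal ((1 - cos (2 * pi * (a + s))) * (1 + cos (2 * pi * (a + s))) ^ N) * indicator {0..1} s \<partial>lborel)
  <= ennreal (1 / N) * (\<integral>\<^sup>+s. ennreal ((1 + cos (2 * pi * (a + s))) ^ N) * indicator {0..1} s \<partial>lborel)"
proof -
 define C where "C s = cos (2 * pi * (a + s))" for s
 define S where "S s = sin (2 * pi * (a + s))" for s
 have C1: "0 <= 1 + C s" "C s <= 1" "0 <= 1 - C s" for s
  using cos_ge_minus_one[of "2 * pi * (a + s)"] cos_le_one[of "2 * pi * (a + s)"] unfolding C_def by linarith+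
 have dC: "(C has_real_derivative - (2 * pi * S s)) (at s)" and dS: "(S has_real_derivative 2 * pi * C s) (at s)" for s
  unfolding C_def[abs_def] S_def[abs_def] by (auto intro!: derivative_eq_intros)
 have cC: "continuous_on X C" for X unfolding C_def[abs_def] by (intro continuous_intros)
 define I1 where "I1 = integral {0..1} (%s. (1 - C s) * (1 + C s) ^ N)"
 define I2 where "I2 = integral {0..1} (%s. (1 + C s) ^ N)"
 have i1: "((%s. (1 - C s) * (1 + C s) ^ N) has_integral I1) {0..1}"
  unfolding I1_def by (intro integrable_integral integrable_continuous_real continuous_intros cC)
 have i2: "((%s. (1 + C s) ^ N) has_integral I2) {0..1}"
  unfolding I2_def by (intro integrable_integral integrable_continuous_real continuous_intros cC)
 have ftc: "((%s. 2 * pi * ((1 + C s) ^ N - (N + 1) * ((1 - C s) * (1 + C s) ^ N))) has_integral (1 + C 1) ^ N * S 1 - (1 + C 0) ^ N * S 0) {0..1}"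
 proof (rule fundamental_theorem_of_calculus)
  fix s :: real
  obtain M where N: "N = Suc M" using assms by (cases N) auto
  have sq: "S s * S s = (1 - C s) * (1 + C s)"
   using sin_cos_squared_add3[of "2 * pi * (a + s)"] by (simp add: S_def C_def algebra_simps)
  have "((%s. (1 + C s) ^ N * S s) has_real_derivative
   (real N * (1 + C s) ^ M * (- (2 * pi * S s))) * S s + (2 * pi * C s) * (1 + C s) ^ N) (at s)"
   by (rule derivative_eq_intros dC dS refl)+ (simp add: N)
  also have "(real N * (1 + C s) ^ M * (- (2 * pi * S s))) * S s + (2 * pi * C s) * (1 + C s) ^ N
   = 2 * pi * (C s * (1 + C s) ^ N - real N * (1 + C s) ^ M * (S s * S s))" by (simp add: algebra_simps)
  also have "... = 2 * pi * ((1 + C s) ^ N - (N + 1) * ((1 - C s) * (1 + C s) ^ N))"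
   unfolding sq by (simp add: N algebra_simps)
  finally show "((%s. (1 + C s) ^ N * S s) has_vector_derivative 2 * pi * ((1 + C s) ^ N - (N + 1) * ((1 - C s) * (1 + C s) ^ N))) (at s within {0..1})"
   by (simp add: has_real_derivative_iff_has_vector_derivative has_vector_derivative_at_within)
 qed simp
 have CS: "C 1 = C 0" "S 1 = S 0"
  using cos_periodic[of "2 * pi * a"] sin_periodic[of "2 * pi * a"] by (simp_all add: C_def S_def algebra_simps)
 have lin: "((%s. 2 * pi * ((1 + C s) ^ N - (N + 1) * ((1 - C s) * (1 + C s) ^ N))) has_integral 2 * pi * (I2 - (N + 1) * I1)) {0..1}"
  by (intro has_integral_mult_right has_integral_diff i1 i2)
 have "2 * pi * (I2 - (N + 1) * I1) = 0" using has_integral_unique[OF lin ftc] by (simp add: CS)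
 then have eq: "I2 = (N + 1) * I1" by simp
 have I1: "I1 >= 0" using i1 by (rule has_integral_nonneg) (use C1 in auto)
 have "I1 <= 1 / N * I2" using assms I1 by (simp add: eq field_simps)
 have conv: "(\<integral>\<^sup>+s. ennreal (f s) * indicator {0..1} s \<partial>lborel) = ennreal I"
  if "(f has_integral I) {0..1}" "continuous_on UNIV f" "!!s. f s >= 0" for f :: "real => real" and I
 proof -
  have [measurable]: "f : borel_measurable borel" using that(2) by (rule borel_measurable_continuous_onI)
  have "((%s. if s \<in> {0..1} then f s else 0) has_integral I) UNIV"
   using that(1) unfolding has_integral_restrict_UNIV .
  then have "(\<integral>\<^sup>+s. ennreal (if s \<in> {0..1} then f s else 0) \<partial>lborel) = ennreal I"
   by (intro nn_integral_has_integral_lborel) (use that(3) in auto)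
  moreover have "(\<integral>\<^sup>+s. ennreal (if s \<in> {0..1} then f s else 0) \<partial>lborel) = (\<integral>\<^sup>+s. ennreal (f s) * indicator {0..1} s \<partial>lborel)"
   by (intro nn_integral_cong) (auto split: split_indicator)
  ultimately show ?thesis by simp
 qed
 have "(\<integral>\<^sup>+s. ennreal ((1 - C s) * (1 + C s) ^ N) * indicator {0..1} s \<partial>lborel) = ennreal I1"
  by (rule conv[OF i1]) (use C1 in "auto intro!: continuous_intros cC")
 moreover have "(\<integral>\<^sup>+s. ennreal ((1 + C s) ^ N) * indicator {0..1} s \<partial>lborel) = ennreal I2"
  by (rule conv[OF i2]) (use C1 in "auto intro!: continuous_intros cC")
 moreover have "ennreal I1 <= ennreal (1 / N) * ennreal I2"
  using \<open>I1 <= 1 / N * I2\<close> by (simp add: ennreal_mult'[symmetric] ennreal_leI)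
 ultimately show ?thesis unfolding C_def by simp
qed

lemma square_le_one_minus_cos:
 fixes u :: real assumes "\<bar>u\<bar> <= 1/2" shows "u\<^sup>2 <= 1 - cos (2 * pi * u)"
proof -
 define x where "x = pi * u"
 have x: "\<bar>x\<bar> <= 2"
 proof -
  have "\<bar>x\<bar> <= 4 * (1/2)" unfolding x_def abs_mult using assms pi_less_4 by (intro mult_mono) auto
  then show ?thesis by simp
 qed
 have "\<bar>sin x - (\<Sum>m<3. sin_coeff m * x ^ m)\<bar> <= inverse (fact 3) * \<bar>x\<bar> ^ 3" by (rule Maclaurin_sin_bound)
 also have "(\<Sum>m<3. sin_coeff m * x ^ m) = x" by (simp add: eval_nat_numeral sin_coeff_def)
 finally have "\<bar>sin x - x\<bar> <= \<bar>x\<bar> ^ 3 / 6" by (simp add: eval_nat_numeral)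
 also have "\<bar>x\<bar> ^ 3 / 6 <= 2 / 3 * \<bar>x\<bar>"
 proof -
  have "\<bar>x\<bar> * \<bar>x\<bar> <= 2 * 2" using x by (intro mult_mono) auto
  then have "(\<bar>x\<bar> * \<bar>x\<bar>) * \<bar>x\<bar> <= 4 * \<bar>x\<bar>" by (intro mult_right_mono) auto
  then show ?thesis by (simp add: eval_nat_numeral)
 qed
 finally have "\<bar>sin x\<bar> >= \<bar>x\<bar> / 3" by linarith
 moreover have "\<bar>x\<bar> >= 3 * \<bar>u\<bar>" unfolding x_def abs_mult using pi_gt3 by (intro mult_right_mono) auto
 ultimately have "\<bar>u\<bar> <= \<bar>sin x\<bar>" by linarith
 then have "u\<^sup>2 <= (sin x)\<^sup>2" by (rule abs_le_square_iff[THEN iffD1])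
 moreover have "cos (2 * x) = 1 - 2 * (sin x)\<^sup>2" by (rule cos_double_sin)
 then have "1 - cos (2 * pi * u) = 2 * (sin x)\<^sup>2" by (simp add: x_def mult.assoc)
 ultimately show ?thesis using zero_le_power2[of "sin x"] by linarith
qed

lemma raw_kernel_concentration:
 assumes "N >= 1"
 shows "(\<integral>\<^sup>+X. ennreal ((1 - cos (2 * pi * rep X $ i)) * raw_kernel N (rep X)) \<partial>(TM :: 'n::finite torus measure))
  <= ennreal (1 / N) * (\<integral>\<^sup>+X. ennreal (raw_kernel N (rep X)) \<partial>(TM :: 'n torus measure))"
proof -
 let ?\<mu> = "TM :: 'n torus measure"
 have [measurable]: "(raw_kernel N :: real ^ 'n => real) : borel_measurable borel"
  by (intro borel_measurable_continuous_onI continuous_trig_poly trig_poly_raw_kernel)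
 have rel: "lattice_rel (rep (X \<oplus> v)) (rep X + v)" for X :: "'n torus" and v
  by (subst abs_torus_eq_iff[symmetric]) (simp add: torus_shift_rep)
 have cosper: "cos (2 * pi * (x $ i)) = cos (2 * pi * (y $ i))" if "lattice_rel x y" for x y :: "real ^ 'n"
 proof -
  have "axis i 1 \<in> (lattice :: (real ^ 'n) set)" by (auto simp: lattice_def axis_def)
  from mode_periodic[OF this that, of 1] show ?thesis by (simp add: mode_def inner_axis')
 qed
 define R where "R x = (\<Prod>j\<in>UNIV - {i}. (1 + cos (2 * pi * x $ j)) ^ N)" for x :: "real ^ 'n"
 have R0: "R x >= 0" for x
 proof -
  have "0 <= 1 + cos r" for r :: real using cos_ge_minus_one[of r] by linarith
  then show ?thesis unfolding R_def by (intro prod_nonneg) simp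
 qed
 have split: "raw_kernel N (x + s *\<^sub>R axis i 1) = R x * (1 + cos (2 * pi * (x $ i + s))) ^ N" for x s
 proof -
  have "raw_kernel N (x + s *\<^sub>R axis i 1) = (1 + cos (2 * pi * (x $ i + s))) ^ N * R (x + s *\<^sub>R axis i 1)"
   unfolding raw_kernel_def R_def by (subst prod.remove[of UNIV i]) simp_all
  also have "R (x + s *\<^sub>R axis i 1) = R x" unfolding R_def by (intro prod.cong) (auto simp: axis_def)
  finally show ?thesis by simp
 qed
 have k1: "(\<integral>\<^sup>+s. ennreal (raw_kernel N (rep (X \<oplus> s *\<^sub>R axis i 1))) * indicator {0..1} s \<partial>lborel)
  = ennreal (R (rep X)) * (\<integral>\<^sup>+s. ennreal ((1 + cos (2 * pi * (rep X $ i + s))) ^ N) * indicator {0..1} s \<partial>lborel)" for X :: "'n torus"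
 proof -
  have "raw_kernel N (rep (X \<oplus> s *\<^sub>R axis i 1)) = R (rep X) * (1 + cos (2 * pi * (rep X $ i + s))) ^ N" for s
   unfolding trig_poly_periodic[OF trig_poly_raw_kernel rel] split ..
  then show ?thesis using R0 by (subst nn_integral_cmult[symmetric]) (simp_all add: ennreal_mult' mult.assoc)
 qed
 have k2: "(\<integral>\<^sup>+s. ennreal ((1 - cos (2 * pi * rep (X \<oplus> s *\<^sub>R axis i 1) $ i)) * raw_kernel N (rep (X \<oplus> s *\<^sub>R axis i 1))) * indicator {0..1} s \<partial>lborel)
  = ennreal (R (rep X)) * (\<integral>\<^sup>+s. ennreal ((1 - cos (2 * pi * (rep X $ i + s))) * (1 + cos (2 * pi * (rep X $ i + s))) ^ N) * indicator {0..1} s \<partial>lborel)" for X :: "'n torus"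
 proof -
  have "raw_kernel N (rep (X \<oplus> s *\<^sub>R axis i 1)) = R (rep X) * (1 + cos (2 * pi * (rep X $ i + s))) ^ N"
   "cos (2 * pi * rep (X \<oplus> s *\<^sub>R axis i 1) $ i) = cos (2 * pi * (rep X $ i + s))" for s
   unfolding trig_poly_periodic[OF trig_poly_raw_kernel rel] split cosper[OF rel] by simp_all
  note eqs = this
  have "ennreal ((1 - cos (2 * pi * rep (X \<oplus> s *\<^sub>R axis i 1) $ i)) * raw_kernel N (rep (X \<oplus> s *\<^sub>R axis i 1))) * indicator {0..1} s
   = ennreal (R (rep X)) * (ennreal ((1 - cos (2 * pi * (rep X $ i + s))) * (1 + cos (2 * pi * (rep X $ i + s))) ^ N) * indicator {0..1} s)" for s
   unfolding eqs mult.left_commute[of _ "R (rep X)"] by (simp only: ennreal_mult'[OF R0] mult.assoc)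
  then show ?thesis by (simp only:) (rule nn_integral_cmult, measurable)
 qed
 have "(\<integral>\<^sup>+X. ennreal ((1 - cos (2 * pi * rep X $ i)) * raw_kernel N (rep X)) \<partial>?\<mu>)
  = (\<integral>\<^sup>+X. ennreal (R (rep X)) * (\<integral>\<^sup>+s. ennreal ((1 - cos (2 * pi * (rep X $ i + s))) * (1 + cos (2 * pi * (rep X $ i + s))) ^ N) * indicator {0..1} s \<partial>lborel) \<partial>?\<mu>)"
  by (subst nn_integral_torus_average[of _ i]) (simp_all add: k2)
 also have "... <= (\<integral>\<^sup>+X. ennreal (R (rep X)) * (ennreal (1 / N) * (\<integral>\<^sup>+s. ennreal ((1 + cos (2 * pi * (rep X $ i + s))) ^ N) * indicator {0..1} s \<partial>lborel)) \<partial>?\<mu>)"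
  by (intro nn_integral_mono mult_left_mono cos_power_concentration assms) simp
 also have "... = (\<integral>\<^sup>+X. ennreal (1 / N) * (\<integral>\<^sup>+s. ennreal (raw_kernel N (rep (X \<oplus> s *\<^sub>R axis i 1))) * indicator {0..1} s \<partial>lborel) \<partial>?\<mu>)"
  by (rule nn_integral_cong) (simp only: k1 mult.left_commute[of "ennreal (1 / N)"])
 also have "... = ennreal (1 / N) * (\<integral>\<^sup>+X. ennreal (raw_kernel N (rep X)) \<partial>?\<mu>)"
  by (subst nn_integral_cmult) (simp_all add: nn_integral_torus_average[of "%X. ennreal (raw_kernel N (rep X))" i])
 finally show ?thesis .
qed

text \<open>The variance bound follows from \<open>u\<^sup>2 <= 1 - cos (2 \<pi> u)\<close> on half a period and \<open>cos_power_concentration\<close> in each coordinate.\<close>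

lemma ex_kernel:
 fixes N :: nat
 assumes "N >= 1"
 obtains ka :: "real ^ 'n::finite => real" where "trig_poly ka" "!!x. ka x >= 0"
  "(\<integral>\<^sup>+X. ennreal (ka (rep X)) \<partial>TM) = 1"
  "(\<integral>\<^sup>+X. ennreal ((norm (rep X))\<^sup>2 * ka (rep X)) \<partial>TM) <= ennreal (CARD('n) / N)"
proof -
 let ?\<mu> = "TM :: 'n torus measure"
 let ?k = "raw_kernel N :: real ^ 'n => real"
 have [measurable]: "?k : borel_measurable borel"
  by (intro borel_measurable_continuous_onI continuous_trig_poly trig_poly_raw_kernel)
 define Z where "Z = (\<integral>\<^sup>+X. ennreal (?k (rep X)) \<partial>?\<mu>)"
 have "Z <= (\<integral>\<^sup>+X. ennreal ((2 ^ N) ^ CARD('n)) \<partial>?\<mu>)"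
  unfolding Z_def by (intro nn_integral_mono ennreal_leI raw_kernel_le)
 also have "... < \<infinity>" using torus.emeasure_space_1[where ?'n = 'n] by simp
 finally have Zf: "Z < \<infinity>" .
 have "Z ~= 0"
 proof
  assume Z0: "Z = 0"
  have "(\<integral>\<^sup>+X. ennreal (1 - cos (2 * pi * rep X $ i)) * 0 \<partial>?\<mu>) = 0" for i by simp
  have "AE X in ?\<mu>. ?k (rep X) = 0"
  proof -
   have "AE X in ?\<mu>. ennreal (?k (rep X)) = 0"
    using Z0 unfolding Z_def by (subst (asm) nn_integral_0_iff_AE) simp_all
   then show ?thesis
   proof eventually_elim
    case (elim X)
    then have "?k (rep X) <= 0" by (simp only: ennreal_eq_0_iff)
    then show ?case using raw_kernel_nonneg[of N "rep X"] by (rule antisym)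
   qed
  qed
  then have AE0: "AE X in ?\<mu>. \<exists>i. rep X $ i = - (1/2)"
  proof eventually_elim
   case (elim X)
   then obtain i where "1 + cos (2 * pi * rep X $ i) = 0" by (auto simp: raw_kernel_def)
   have "rep X $ i = - (1/2)"
   proof (rule ccontr)
    assume ne: "rep X $ i ~= - (1/2)"
    define u where "u = rep X $ i"
    have u: "- (1/2) < u" "u < 1/2" using centre_bounds[of "rep_torus X" i] ne by (auto simp: u_def rep_def)
    have "\<bar>2 * pi * u\<bar> < pi" using u pi_gt_zero by (simp add: abs_mult abs_less_iff)
    then have "cos pi < cos \<bar>2 * pi * u\<bar>" by (intro cos_monotone_0_pi) auto
    then show False using \<open>1 + cos (2 * pi * rep X $ i) = 0\<close> by (simp add: u_def)
   qed
   then show ?case by blast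
  qed
  have "AE X in ?\<mu>. rep X $ i ~= - (1/2)" for i
  proof -
   have "(\<integral>\<^sup>+X. indicator {X. rep X $ i = - (1/2)} X \<partial>?\<mu>)
    = (\<integral>\<^sup>+X. \<integral>\<^sup>+s. indicator {X. rep X $ i = - (1/2)} (X \<oplus> s *\<^sub>R axis i 1) * indicator {0..1::real} s \<partial>lborel \<partial>?\<mu>)"
    by (rule nn_integral_torus_average) measurable
   also have "... = (\<integral>\<^sup>+X. 0 \<partial>?\<mu>)"
   proof (rule nn_integral_cong)
    fix X :: "'n torus"
    have "countable {s. rep (X \<oplus> s *\<^sub>R axis i 1) $ i = - (1/2)}"
    proof (rule countable_subset)
     show "{s. rep (X \<oplus> s *\<^sub>R axis i 1) $ i = - (1/2)} \<subseteq> (%m::int. - (1/2) - rep X $ i + m) ` UNIV"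
     proof
      fix s assume "s \<in> {s. rep (X \<oplus> s *\<^sub>R axis i 1) $ i = - (1/2)}"
      then have "centre (rep X + s *\<^sub>R axis i 1) $ i = - (1/2)" by (simp add: torus_shift_rep)
      then have "s = - (1/2) - rep X $ i + \<lfloor>rep X $ i + s + 1/2\<rfloor>" by (simp add: centre_def)
      then show "s \<in> (%m::int. - (1/2) - rep X $ i + m) ` UNIV" by blast
     qed
    qed simp
    then have "AE s in lborel. s \<notin> {s. rep (X \<oplus> s *\<^sub>R axis i 1) $ i = - (1/2)}"
     by (intro AE_not_in countable_imp_null_set_lborel)
    then show "(\<integral>\<^sup>+s. indicator {X. rep X $ i = - (1/2)} (X \<oplus> s *\<^sub>R axis i 1) * indicator {0..1::real} s \<partial>lborel) = 0"
     by (intro nn_integral_zero' ) (auto elim!: eventually_mono split: split_indicator)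
   qed
   finally have z: "(\<integral>\<^sup>+X. indicator {X. rep X $ i = - (1/2)} X \<partial>?\<mu>) = 0" by simp
   have "AE X in ?\<mu>. indicator {X. rep X $ i = - (1/2)} X = (0::ennreal)"
    by (rule nn_integral_0_iff_AE[THEN iffD1, OF _ z]) measurable
   then show ?thesis by eventually_elim (auto split: split_indicator_asm)
  qed
  then have "AE X in ?\<mu>. \<forall>i. rep X $ i ~= - (1/2)" by (simp add: AE_all_countable)
  with AE0 have "AE X in ?\<mu>. False" by eventually_elim auto
  then show False using torus.emeasure_space_1[where ?'n = 'n] by (simp add: AE_iff_null_sets null_sets_def)
 qed
 define z where "z = enn2real Z"
 have z: "z > 0" "Z = ennreal z" using Zf \<open>Z ~= 0\<close> by (auto simp: z_def enn2real_positive_iff less_top zero_less_iff_neq_zero)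
 have scale: "(\<integral>\<^sup>+X. ennreal (g X * (?k (rep X) / z)) \<partial>?\<mu>) = ennreal (1 / z) * (\<integral>\<^sup>+X. ennreal (g X * ?k (rep X)) \<partial>?\<mu>)"
  if [measurable]: "g : borel_measurable borel" for g
 proof -
  have "ennreal (g X * (?k (rep X) / z)) = ennreal (1 / z) * ennreal (g X * ?k (rep X))" for X
   using z by (simp add: ennreal_mult'[symmetric])
  then show ?thesis by (simp add: nn_integral_cmult)
 qed
 have zz: "ennreal (1 / z) * Z = 1" using z by (simp add: ennreal_mult'[symmetric])
 show ?thesis
 proof (rule that[of "%x. ?k x / z"])
  show "trig_poly (%x. ?k x / z)"
   using trig_poly_mult[OF trig_poly_raw_kernel trig_poly_const[of "1 / z"], of N] by simp
  show "?k x / z >= 0" for x using raw_kernel_nonneg z by (intro divide_nonneg_pos)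
  show "(\<integral>\<^sup>+X. ennreal (?k (rep X) / z) \<partial>?\<mu>) = 1"
   using scale[of "%_. 1"] zz by (simp add: Z_def)
  have "(\<integral>\<^sup>+X. ennreal ((norm (rep X))\<^sup>2 * ?k (rep X)) \<partial>?\<mu>)
   <= (\<integral>\<^sup>+X. (\<Sum>i\<in>UNIV. ennreal ((1 - cos (2 * pi * rep X $ i)) * ?k (rep X))) \<partial>?\<mu>)"
  proof (rule nn_integral_mono)
   fix X :: "'n torus"
   have "(norm (rep X))\<^sup>2 = (\<Sum>i\<in>UNIV. (rep X $ i)\<^sup>2)"
    unfolding power2_norm_eq_inner inner_vec_def by (simp add: power2_eq_square)
   also have "... <= (\<Sum>i\<in>UNIV. 1 - cos (2 * pi * rep X $ i))"
    by (intro sum_mono square_le_one_minus_cos) (simp only: rep_def abs_centre_le)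
   finally have "(norm (rep X))\<^sup>2 * ?k (rep X) <= (\<Sum>i\<in>UNIV. 1 - cos (2 * pi * rep X $ i)) * ?k (rep X)"
    by (rule mult_right_mono) (rule raw_kernel_nonneg)
   also have "... = (\<Sum>i\<in>UNIV. (1 - cos (2 * pi * rep X $ i)) * ?k (rep X))" by (simp add: sum_distrib_right)
   finally show "ennreal ((norm (rep X))\<^sup>2 * ?k (rep X)) <= (\<Sum>i\<in>UNIV. ennreal ((1 - cos (2 * pi * rep X $ i)) * ?k (rep X)))"
    using raw_kernel_nonneg[of N "rep X"] by (subst sum_ennreal) (auto intro!: ennreal_leI mult_nonneg_nonneg)
  qed
  also have "... = (\<Sum>i\<in>UNIV. \<integral>\<^sup>+X. ennreal ((1 - cos (2 * pi * rep X $ i)) * ?k (rep X)) \<partial>?\<mu>)"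
   by (rule nn_integral_sum) measurable
  also have "... <= (\<Sum>i\<in>(UNIV :: 'n set). ennreal (1 / N) * Z)"
   unfolding Z_def by (intro sum_mono raw_kernel_concentration assms)
  also have "... = ennreal (CARD('n) / N) * Z"
   by (simp add: ennreal_of_nat_eq_real_of_nat ennreal_mult'[symmetric] mult.assoc[symmetric])
  finally have "ennreal (1 / z) * (\<integral>\<^sup>+X. ennreal ((norm (rep X))\<^sup>2 * ?k (rep X)) \<partial>?\<mu>) <= ennreal (1 / z) * (ennreal (CARD('n) / N) * Z)"
   by (rule mult_left_mono) simp
  also have "... = ennreal (CARD('n) / N)" unfolding mult.left_commute[of "ennreal (1 / z)"] zz by simp
  finally show "(\<integral>\<^sup>+X. ennreal ((norm (rep X))\<^sup>2 * (?k (rep X) / z)) \<partial>?\<mu>) <= ennreal (CARD('n) / N)"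
   by (subst scale) simp_all
 qed
qed

section \<open>Mollified paths\<close>

text \<open>Equal to 1 on \<open>[dl, 1 - dl]\<close> and 0 at the end points.\<close>

definition cutoff :: "real => real => real" where
 "cutoff dl t = max 0 (min 1 (min (t / dl) ((1 - t) / dl)))"

text \<open>At least \<open>dl\<close> and at most \<open>3 dl\<close>, so the path is at rest at its end points whenever the cutoff differs from 1.\<close>

definition delay :: "real => real => real" where
 "delay dl s = dl * (2 + max (-1) (min 1 s))"

text \<open>The parameter \<open>th\<close> consists of the delay and of the displacement in space. The path is run in time \<open>1 - 4 dl\<close>, which leaves room for the delay at both ends.\<close>

definition mollify :: "real => (real => 'n::finite torus) => real \<times> (real ^ 'n) => real => 'n torus" where
 "mollify dl om th = (\<lambda>t\<in>{0..1}. path_at om ((t - delay dl (fst th)) / (1 - 4 * dl)) \<oplus> cutoff dl t *\<^sub>R snd th)"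

lemma cutoff_lipschitz: assumes "dl > 0" shows "\<bar>cutoff dl s - cutoff dl t\<bar> <= \<bar>s - t\<bar> / dl"
proof -
 define S T O' where "S = s / dl" and "T = t / dl" and "O' = 1 / dl"
 have 1: "\<bar>s - t\<bar> / dl = \<bar>S - T\<bar>" using assms by (simp add: S_def T_def diff_divide_distrib[symmetric])
 have "min x (O' - x) = O' / 2 - \<bar>x - O' / 2\<bar>" for x by (auto simp: min_def abs_if)
 then have 2: "\<bar>min S (O' - S) - min T (O' - T)\<bar> <= \<bar>S - T\<bar>"
  using abs_triangle_ineq3[of "T - O' / 2" "S - O' / 2"] by (simp add: abs_minus_commute)
 have 3: "cutoff dl s = clamp01 (min S (O' - S))" "cutoff dl t = clamp01 (min T (O' - T))"
  by (simp_all add: cutoff_def clamp01_def S_def T_def O'_def diff_divide_distrib)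
 show ?thesis unfolding 1 3 by (rule order_trans[OF clamp01_lipschitz 2])
qed

lemma cutoff_bounds: "0 <= cutoff dl t" "cutoff dl t <= 1" by (auto simp: cutoff_def)

lemma cutoff_values:
 assumes "0 < dl" "dl < 1/4"
 shows "t \<in> {dl..1-dl} ==> cutoff dl t = 1" "t \<in> {0..dl} ==> cutoff dl t = t / dl" "t \<in> {1-dl..1} ==> cutoff dl t = (1 - t) / dl"
proof -
 show "t \<in> {dl..1-dl} ==> cutoff dl t = 1" using assms by (auto simp: cutoff_def min_def max_def field_simps)
 show "cutoff dl t = t / dl" if "t \<in> {0..dl}"
 proof -
  have "0 <= t / dl" "t / dl <= 1" "t / dl <= (1 - t) / dl" using that assms by (auto simp: divide_right_mono)
  then show ?thesis by (simp add: cutoff_def)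
 qed
 show "cutoff dl t = (1 - t) / dl" if "t \<in> {1-dl..1}"
 proof -
  have "0 <= (1 - t) / dl" "(1 - t) / dl <= 1" "(1 - t) / dl <= t / dl" using that assms by (auto simp: divide_right_mono)
  then show ?thesis by (simp add: cutoff_def)
 qed
qed

lemma delay_bounds: assumes "0 < dl" shows "dl <= delay dl s" "delay dl s <= 3 * dl"
proof -
 have "dl * 1 <= delay dl s" "delay dl s <= dl * 3" unfolding delay_def using assms by (intro mult_left_mono; simp)+
 then show "dl <= delay dl s" "delay dl s <= 3 * dl" by simp_all
qed

lemma delay_lipschitz: assumes "0 < dl" shows "\<bar>delay dl s - delay dl s'\<bar> <= dl * \<bar>s - s'\<bar>"
proof -
 have "\<bar>delay dl s - delay dl s'\<bar> = dl * \<bar>max (-1) (min 1 s) - max (-1) (min 1 s')\<bar>"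
  using assms by (simp add: delay_def right_diff_distrib[symmetric] abs_mult)
 also have "... <= dl * \<bar>s - s'\<bar>" using assms by (intro mult_left_mono) auto
 finally show ?thesis .
qed

lemma measurable_delay [measurable]: "delay dl : borel_measurable borel"
 unfolding delay_def[abs_def] by measurable

lemma path_at_before: "u <= 0 ==> path_at om u = om 0" and path_at_after: "u >= 1 ==> path_at om u = om 1"
 by (simp_all add: path_at_def clamp01_def)

lemma path_at_delay:
 assumes dl: "0 < dl" "dl < 1/4"
 shows "t <= delay dl s ==> path_at om ((t - delay dl s) / (1 - 4 * dl)) = om 0"
  "t >= delay dl s + (1 - 4 * dl) ==> path_at om ((t - delay dl s) / (1 - 4 * dl)) = om 1"
 using dl by (auto intro!: path_at_before path_at_after divide_nonpos_pos simp: le_divide_eq)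

lemma mollify_endpoints:
 assumes dl: "0 < dl" "dl < 1/4"
 shows "mollify dl om th 0 = om 0" "mollify dl om th 1 = om 1"
 using delay_bounds[OF dl(1), of "fst th"] dl cutoff_values(2)[OF dl, of 0] cutoff_values(3)[OF dl, of 1]
  path_at_delay(1)[OF dl, of 0 "fst th" om] path_at_delay(2)[OF dl, of "fst th" 1 om]
 by (simp_all add: mollify_def)

lemma mollify_in_paths: assumes "om \<in> paths" "dl > 0" shows "mollify dl om th \<in> paths"
proof -
 have "continuous_on {0..1} (%t. path_at om ((t - delay dl (fst th)) / (1 - 4 * dl)) \<oplus> cutoff dl t *\<^sub>R snd th)"
 proof (intro continuous_intros)
  show "continuous_on {0..1} (%t. path_at om ((t - delay dl (fst th)) / (1 - 4 * dl)))"
   unfolding divide_inverse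
   by (rule continuous_on_compose2[OF continuous_path_at[OF assms(1)]]) (intro continuous_intros, simp)
  show "continuous_on {0..1} (cutoff dl)"
   unfolding cutoff_def[abs_def] divide_inverse by (intro continuous_intros)
 qed
 then have "continuous_on {0..1} (mollify dl om th)" by (rule continuous_on_eq) (simp add: mollify_def)
 then show ?thesis unfolding paths_def mollify_def by simp
qed

lemma measurable_mollify:
 assumes dl: "0 < dl" "dl < 1/4"
 shows "(%(om, th). mollify dl om th) \<in> (path_borel :: (real => 'n::finite torus) measure) \<Otimes>\<^sub>M borel \<rightarrow>\<^sub>M path_borel"
proof (rule measurable_into_paths)
 fix om :: "real => 'n torus" and th :: "real \<times> (real ^ 'n)" and e :: real assume w: "om \<in> paths" and e: "e > 0"
 obtain d0 where d0: "d0 > 0" "!!s t. s \<in> {0..1} ==> t \<in> {0..1} ==> \<bar>s - t\<bar> < d0 ==> dist (om s) (om t) < e / 4"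
  using path_uniformly_continuous[OF w, of "e / 4"] e by auto
 define d where "d = min (e / 4) (d0 * (1 - 4 * dl) / dl)"
 have dpos: "d > 0" using e d0 dl by (simp add: d_def)
 show "\<exists>d>0. \<forall>om'\<in>paths. \<forall>th'. paths_close d om om' & dist th th' < d --> paths_close e (mollify dl om th) (mollify dl om' th')"
 proof (intro exI[of _ d] conjI ballI allI impI)
  fix om' :: "real => 'n torus" and th' assume "paths_close d om om' & dist th th' < d"
  then have cl: "!!t. t \<in> {0..1} ==> dist (om t) (om' t) < d" "\<bar>fst th - fst th'\<bar> < d" "norm (snd th - snd th') < d"
   using dist_fst_le[of th th'] dist_snd_le[of th th'] by (auto simp: paths_close_def dist_real_def dist_norm)
  show "paths_close e (mollify dl om th) (mollify dl om' th')"
   unfolding paths_close_def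
  proof
   fix t :: real assume t: "t \<in> {0..1}"
   let ?u = "(t - delay dl (fst th)) / (1 - 4 * dl)" and ?v = "(t - delay dl (fst th')) / (1 - 4 * dl)"
   have "\<bar>?u - ?v\<bar> = \<bar>delay dl (fst th) - delay dl (fst th')\<bar> / (1 - 4 * dl)"
    using dl by (simp add: diff_divide_distrib[symmetric] abs_divide abs_minus_commute)
   also have "... <= dl * \<bar>fst th - fst th'\<bar> / (1 - 4 * dl)" using dl by (intro divide_right_mono delay_lipschitz) auto
   also have "... < d0"
   proof -
    have "\<bar>fst th - fst th'\<bar> < d0 * (1 - 4 * dl) / dl" using cl(2) by (simp add: d_def)
    then show ?thesis using dl by (simp add: field_simps)
   qed
   finally have "\<bar>clamp01 ?u - clamp01 ?v\<bar> < d0" using clamp01_lipschitz[of ?u ?v] by linarith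
   then have 1: "dist (path_at om ?u) (path_at om ?v) < e / 4" unfolding path_at_def by (intro d0(2)) auto
   have 2: "dist (path_at om ?v) (path_at om' ?v) < e / 4" unfolding path_at_def using cl(1)[OF clamp01_mem, of ?v] by (simp add: d_def)
   have "norm (cutoff dl t *\<^sub>R snd th - cutoff dl t *\<^sub>R snd th') = cutoff dl t * norm (snd th - snd th')"
    using cutoff_bounds[of dl t] by (simp add: scaleR_diff_right[symmetric])
   also have "... <= norm (snd th - snd th')" using cutoff_bounds[of dl t] by (intro mult_left_le_one_le) auto
   finally have 3: "norm (cutoff dl t *\<^sub>R snd th - cutoff dl t *\<^sub>R snd th') < e / 4" using cl(3) by (simp add: d_def)
   show "dist (mollify dl om th t) (mollify dl om' th' t) < e"
    using t dist_torus_shift_le2[of "path_at om ?u" "cutoff dl t *\<^sub>R snd th" "path_at om' ?v" "cutoff dl t *\<^sub>R snd th'"]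
     dist_triangle[of "path_at om ?u" "path_at om' ?v" "path_at om ?v"] 1 2 3 e by (simp add: mollify_def)
  qed
 qed fact
qed (rule mollify_in_paths[OF _ dl(1)])

lemma absolutely_continuous_mollify:
 assumes dl: "0 < dl" "dl < 1/4" and ac: "absolutely_continuous_curve om"
 shows "absolutely_continuous_curve (mollify dl om th)"
proof -
 define m where "m = 1 / (1 - 4 * dl)"
 define C where "C = 1 + m + norm (snd th) / dl"
 have m: "m > 0" and C: "C >= 1" "C >= m" "C >= norm (snd th) / dl" using dl by (simp_all add: m_def C_def)
 let ?\<tau> = "%t. clamp01 ((t - delay dl (fst th)) / (1 - 4 * dl))"
 show ?thesis
 proof (rule absolutely_continuous_curve_transform[OF ac, where \<tau> = ?\<tau> and C = C])
  fix a b :: real assume ab: "0 <= a" "a <= b" "b <= 1"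
  have le: "(a - delay dl (fst th)) / (1 - 4 * dl) <= (b - delay dl (fst th)) / (1 - 4 * dl)"
   using ab dl by (intro divide_right_mono) auto
  show "0 <= ?\<tau> a & ?\<tau> a <= ?\<tau> b & ?\<tau> b <= 1" using clamp01_mono[OF le] by simp
  have "?\<tau> b - ?\<tau> a <= (b - delay dl (fst th)) / (1 - 4 * dl) - (a - delay dl (fst th)) / (1 - 4 * dl)"
   using clamp01_lipschitz[of "(b - delay dl (fst th)) / (1 - 4 * dl)" "(a - delay dl (fst th)) / (1 - 4 * dl)"] le by linarith
  also have "... = m * (b - a)" by (simp add: m_def diff_divide_distrib[symmetric])
  also have "... <= C * (b - a)" using ab C by (intro mult_right_mono) auto
  finally show "?\<tau> b - ?\<tau> a <= C * (b - a)" .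
  have "norm (cutoff dl a *\<^sub>R snd th - cutoff dl b *\<^sub>R snd th) = \<bar>cutoff dl a - cutoff dl b\<bar> * norm (snd th)"
   by (simp add: scaleR_diff_left[symmetric])
  also have "... <= \<bar>a - b\<bar> / dl * norm (snd th)" using dl by (intro mult_right_mono cutoff_lipschitz) auto
  also have "... = norm (snd th) / dl * (b - a)" using ab by simp
  also have "... <= C * (b - a)" using C ab by (intro mult_right_mono) auto
  finally have n: "norm (cutoff dl a *\<^sub>R snd th - cutoff dl b *\<^sub>R snd th) <= C * (b - a)" .
  have "dist (om (?\<tau> a)) (om (?\<tau> b)) <= C * dist (om (?\<tau> a)) (om (?\<tau> b))"
   using mult_right_mono[OF C(1) zero_le_dist] by simp
  then show "dist (mollify dl om th a) (mollify dl om th b) <= C * (dist (om (?\<tau> a)) (om (?\<tau> b)) + (b - a))"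
   using ab n dist_torus_shift_le2[of "om (?\<tau> a)" "cutoff dl a *\<^sub>R snd th" "om (?\<tau> b)" "cutoff dl b *\<^sub>R snd th"]
   by (simp add: mollify_def path_at_def distrib_left)
 qed (use C in simp)
qed

text \<open>Running the path faster multiplies its energy by \<open>1 / (1 - 4 dl)\<close>; the displacement contributes only while it is switched on and off, twice for a time \<open>dl\<close> with speed \<open>norm (snd th) / dl\<close>. The velocity is unknown only at the four times where these regimes meet.\<close>

lemma kinetic_mollify_le:
 fixes om :: "real => 'n::finite torus"
 assumes dl: "0 < dl" "dl < 1/4" and w: "om \<in> paths"
 shows "kinetic (mollify dl om th) <= ennreal (1 / (1 - 4 * dl)) * kinetic om + ennreal ((norm (snd th))\<^sup>2 / dl)"
proof -
 define m where "m = 1 / (1 - 4 * dl)"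
 define a where "a = delay dl (fst th)"
 define y where "y = snd th"
 define b where "b = a + (1 - 4 * dl)"
 have m: "m > 0" using dl by (simp add: m_def)
 have a: "dl <= a" "a <= 3 * dl" using delay_bounds[OF dl(1)] by (simp_all add: a_def)
 have b: "a < b" "b <= 1 - dl" using a dl by (simp_all add: b_def)
 let ?W = "mollify dl om th"
 have W: "?W s = path_at om (m * (s - a)) \<oplus> cutoff dl s *\<^sub>R y" if "s \<in> {0..1}" for s
  using that by (simp add: mollify_def a_def y_def m_def)
 have W0: "?W s = om 0 \<oplus> cutoff dl s *\<^sub>R y" if "s \<in> {0..a}" for s
  using that a dl path_at_delay(1)[OF dl, of s "fst th" om] by (simp add: mollify_def a_def y_def)
 have W1: "?W s = om 1 \<oplus> cutoff dl s *\<^sub>R y" if "s \<in> {b..1}" for s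
  using that a b dl path_at_delay(2)[OF dl, of "fst th" s om] by (simp add: mollify_def a_def b_def y_def)
 let ?e = "%t. ennreal (1 / 2 * (norm (velocity01 om (m * (t - a))))\<^sup>2)"
 let ?I = "%t. indicator {0..dl} t + indicator {1-dl..1} t :: ennreal"
 have pt: "ennreal (1 / 2 * (norm (velocity01 ?W t))\<^sup>2) <= ennreal (m\<^sup>2) * ?e t + ennreal ((norm y / dl)\<^sup>2 / 2) * ?I t"
  if ne: "t ~= dl" "t ~= 1 - dl" "t ~= a" "t ~= b" for t
 proof (cases "t \<in> {0<..<1}")
  case t: True
  consider "t < dl" | "dl < t" "t < a" | "a < t" "t < b" | "b < t" "t < 1 - dl" | "1 - dl < t"
   using ne by linarith
  then show ?thesis
  proof cases
   case 1
   have "eventually (%s. s \<in> {0<..<dl}) (nhds t)" using t 1 by (intro eventually_nhds_in_open) auto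
   then have ev: "eventually (%s. ?W s = om 0 \<oplus> (s / dl) *\<^sub>R y) (nhds t)"
    by eventually_elim (use a in "simp add: W0 cutoff_values(2)[OF dl]")
   have "((%s. (s / dl) *\<^sub>R y) has_vector_derivative (1 / dl) *\<^sub>R y) (at t)"
    using dl by (auto intro!: derivative_eq_intros)
   from velocity_shift_curve[OF t ev this] have "velocity01 ?W t = (1 / dl) *\<^sub>R y" using t by (simp add: velocity01_def)
   then show ?thesis using t 1 dl by (intro order_trans[OF _ add_increasing]) (auto simp: power_divide)
  next
   case 2
   have "eventually (%s. s \<in> {dl<..<a}) (nhds t)" using 2 by (intro eventually_nhds_in_open) auto
   then have ev: "eventually (%s. ?W s = om 0 \<oplus> y) (nhds t)"
    by eventually_elim (use a b dl in "simp add: W0 cutoff_values(1)[OF dl]")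
   from velocity_shift_curve[OF t ev has_vector_derivative_const] show ?thesis using t by (simp add: velocity01_def)
  next
   case 3
   have "m * (t - a) > 0" "m * (t - a) < m * (b - a)" using 3 m by simp_all
   moreover have "m * (b - a) = 1" using dl by (simp add: m_def b_def)
   ultimately have mt: "m * (t - a) \<in> {0<..<1}" by simp
   have "eventually (%s. s \<in> {a<..<b}) (nhds t)" using 3 by (intro eventually_nhds_in_open) auto
   then have ev: "eventually (%s. ?W s = path_at om (m * (s - a)) \<oplus> y) (nhds t)"
    by eventually_elim (use a b dl in "simp add: W cutoff_values(1)[OF dl]")
   have "eventually (%s. s \<in> (%s. m * (s - a)) -` {0<..<1}) (nhds t)"
    using mt by (intro eventually_nhds_in_open open_vimage continuous_intros) auto
   with ev have "eventually (%s. ?W s = om (m * (s - a)) \<oplus> y) (nhds t)"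
    by eventually_elim (simp add: path_at_eq)
   from velocity_affine[OF t mt m this] have "velocity01 ?W t = m *\<^sub>R velocity01 om (m * (t - a))"
    using t mt by (simp add: velocity01_def)
   then have "ennreal (1 / 2 * (norm (velocity01 ?W t))\<^sup>2) = ennreal (m\<^sup>2) * ?e t"
    using m by (simp add: power_mult_distrib ennreal_mult'[symmetric])
   then show ?thesis by simp
  next
   case 4
   have "eventually (%s. s \<in> {b<..<1 - dl}) (nhds t)" using 4 by (intro eventually_nhds_in_open) auto
   then have ev: "eventually (%s. ?W s = om 1 \<oplus> y) (nhds t)"
    by eventually_elim (use a b dl in "simp add: W1 cutoff_values(1)[OF dl]")
   from velocity_shift_curve[OF t ev has_vector_derivative_const] show ?thesis using t by (simp add: velocity01_def)
  next
   case 5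
   have "eventually (%s. s \<in> {1 - dl<..<1}) (nhds t)" using t 5 by (intro eventually_nhds_in_open) auto
   then have ev: "eventually (%s. ?W s = om 1 \<oplus> ((1 - s) / dl) *\<^sub>R y) (nhds t)"
    by eventually_elim (use b in "simp add: W1 cutoff_values(3)[OF dl]")
   have "((%s. ((1 - s) / dl) *\<^sub>R y) has_vector_derivative (- 1 / dl) *\<^sub>R y) (at t)"
    using dl by (auto intro!: derivative_eq_intros)
   from velocity_shift_curve[OF t ev this] have "velocity01 ?W t = (- 1 / dl) *\<^sub>R y" using t by (simp add: velocity01_def)
   then show ?thesis using t 5 dl by (intro order_trans[OF _ add_increasing]) (auto simp: power_divide)
  qed
 next
  case False
  then have "velocity01 ?W t = 0" by (auto simp: velocity01_def)
  then show ?thesis by simp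
 qed
 have meas: "(%s. velocity01 om (f s)) : borel_measurable borel" if "f : borel_measurable borel" for f :: "real => real"
  using that w by (intro measurable_velocity01) simp_all
 note [measurable] = meas
 have "kinetic om = ennreal \<bar>m\<bar> * (\<integral>\<^sup>+t. ?e t \<partial>lborel)"
  unfolding kinetic_def by (subst nn_integral_real_affine[of _ m "- (m * a)"]) (use m in "auto simp: algebra_simps")
 then have k: "ennreal (m\<^sup>2) * (\<integral>\<^sup>+t. ?e t \<partial>lborel) = ennreal m * kinetic om"
  using m by (simp add: power2_eq_square ennreal_mult mult.assoc)
 have "kinetic ?W <= (\<integral>\<^sup>+t. ennreal (m\<^sup>2) * ?e t + ennreal ((norm y / dl)\<^sup>2 / 2) * ?I t \<partial>lborel)"
  unfolding kinetic_def
 proof (rule nn_integral_mono_AE)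
  have "AE t in lborel. t \<notin> {dl, 1 - dl, a, b}" by (rule AE_not_in, rule countable_imp_null_set_lborel) auto
  then show "AE t in lborel. ennreal (1 / 2 * (norm (velocity01 ?W t))\<^sup>2) <= ennreal (m\<^sup>2) * ?e t + ennreal ((norm y / dl)\<^sup>2 / 2) * ?I t"
   by eventually_elim (rule pt, auto)
 qed
 also have "... = ennreal (m\<^sup>2) * (\<integral>\<^sup>+t. ?e t \<partial>lborel) + ennreal ((norm y / dl)\<^sup>2 / 2) * (ennreal dl + ennreal dl)"
  using dl by (simp add: nn_integral_add nn_integral_cmult)
 also have "ennreal ((norm y / dl)\<^sup>2 / 2) * (ennreal dl + ennreal dl) = ennreal ((norm y)\<^sup>2 / dl)"
  using dl by (simp add: ennreal_plus[symmetric] ennreal_mult'[symmetric] power2_eq_square del: ennreal_plus)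
 finally show ?thesis unfolding k unfolding m_def y_def .
qed

lemma curve_action_mollify_le:
 assumes dl: "0 < dl" "dl < 1/4" and w: "om \<in> paths"
 shows "curve_action (mollify dl om th) <= ennreal (1 / (1 - 4 * dl)) * curve_action om + ennreal ((norm (snd th))\<^sup>2 / dl)"
proof (cases "absolutely_continuous_curve om")
 case True
 then show ?thesis using kinetic_mollify_le[OF assms] absolutely_continuous_mollify[OF dl True]
  by (simp add: curve_action_alt)
next
 case False
 then show ?thesis using dl by (simp add: curve_action_alt ennreal_mult_top)
qed

section \<open>Fourier coefficients\<close>

text \<open>Characters of the torus; their means over a law are its Fourier coefficients.\<close>

definition wave :: "real ^ 'n => 'n::finite torus => complex" where
 "wave k X = cis (- (2 * pi * (k \<bullet> rep X)))"

lemma norm_wave [simp]: "norm (wave k X) = 1" by (simp add: wave_def)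

lemma wave_shift:
 assumes "k \<in> lattice" shows "wave k (X \<oplus> v) = wave k X * cis (- (2 * pi * (k \<bullet> v)))"
proof -
 have "lattice_rel (rep (X \<oplus> v)) (rep X + v)"
  by (metis abs_torus_eq_iff abs_torus_rep torus_shift_rep)
 from Ints_minus[OF lattice_inner_Ints[OF assms this]]
 have "- (k \<bullet> rep (X \<oplus> v)) - - (k \<bullet> (rep X + v)) \<in> \<int>" by simp
 from cis_periodic[OF this] show ?thesis
  by (simp add: wave_def cis_mult inner_add_right algebra_simps)
qed

lemma continuous_wave: assumes k: "k \<in> lattice" shows "continuous_on UNIV (wave k)"
 unfolding continuous_on_iff
proof (intro ballI allI impI)
 fix X :: "'a torus" and e :: real assume e: "e > 0"
 have K: "1 + 2 * pi * norm k > 0" by (intro add_pos_nonneg) auto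
 show "\<exists>d>0. \<forall>Y\<in>UNIV. dist Y X < d --> dist (wave k Y) (wave k X) < e"
 proof (intro exI[of _ "e / (1 + 2 * pi * norm k)"] conjI ballI impI)
  fix Y assume d: "dist Y X < e / (1 + 2 * pi * norm k)"
  define v where "v = torus_diff Y X"
  have "wave k Y - wave k X = wave k X * (cis (- (2 * pi * (k \<bullet> v))) - 1)"
   using wave_shift[OF k, of X v] by (simp add: v_def algebra_simps)
  then have "dist (wave k Y) (wave k X) = 2 * \<bar>sin (- (2 * pi * (k \<bullet> v)) / 2)\<bar>"
   using dist_exp_i_1[of "- (2 * pi * (k \<bullet> v))"] by (simp add: dist_norm norm_mult cis_conv_exp)
  also have "... <= 2 * \<bar>- (2 * pi * (k \<bullet> v)) / 2\<bar>" by (intro mult_left_mono abs_sin_x_le_abs_x) simp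
  also have "... = 2 * pi * \<bar>k \<bullet> v\<bar>" by (simp add: abs_mult)
  also have "... <= 2 * pi * (norm k * norm v)" by (intro mult_left_mono Cauchy_Schwarz_ineq2) simp
  also have "... <= (1 + 2 * pi * norm k) * dist Y X" by (simp add: v_def dist_torus_eq algebra_simps)
  also have "... < e" using d K by (simp add: field_simps)
  finally show "dist (wave k Y) (wave k X) < e" .
 qed (use e K in simp)
qed

lemma measurable_wave: "k \<in> lattice ==> wave k : borel_measurable borel"
 by (rule borel_measurable_continuous_onI[OF continuous_wave])

text \<open>A translation by half a wavelength changes the sign.\<close>

lemma integral_wave:
 fixes k :: "real ^ 'n::finite"
 assumes k: "k \<in> lattice" "k ~= 0" shows "(\<integral>X. wave k X \<partial>TM) = 0"
proof -
 define v where "v = (1 / (2 * (norm k)\<^sup>2)) *\<^sub>R k"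
 have "k \<bullet> v = 1/2" using k(2) by (simp add: v_def power2_norm_eq_inner)
 then have pi: "2 * pi * (k \<bullet> v) = pi" by simp
 have s: "wave k (X \<oplus> v) = - wave k X" for X unfolding wave_shift[OF k(1)] pi by (simp add: complex_eq_iff)
 have "(\<integral>X. wave k X \<partial>TM) = (\<integral>X. wave k X \<partial>distr TM borel (%X. X \<oplus> v))"
  by (simp only: distr_torus_shift)
 also have "... = (\<integral>X. wave k (X \<oplus> v) \<partial>TM)"
  using measurable_wave[OF k(1)] by (intro integral_distr) measurable
 also have "... = - (\<integral>X. wave k X \<partial>TM)" by (simp add: s)
 finally show ?thesis by (metis add.inverse_unique eq_neg_iff_add_eq_0 mult_2 mult_eq_0_iff zero_neq_numeral)
qed

lemma mode_diff: "mode a k (x - rep X) = mode (a * wave k X) k x"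
 by (simp add: mode_eq_Re wave_def inner_diff_right cis_mult algebra_simps)

lemma mode_torus_rep: "mode a k (rep X) = Re (a * wave (- k) X)"
 by (simp add: mode_eq_Re wave_def)

lemma integral_mode:
 assumes "integrable M g"
 shows "integrable M (%w. mode (a * g w) k x)" "(\<integral>w. mode (a * g w) k x \<partial>M) = mode (a * (\<integral>w. g w \<partial>M)) k x"
 using assms by (simp_all add: mode_eq_Re integral_Re mult.assoc)

text \<open>Convolution with a smooth bump turns continuous coefficients into smooth ones.\<close>

lemma smooth_curve_convolution:
 fixes H :: "real => complex"
 assumes D: "!!n x. (D n has_real_derivative D (Suc n) x) (at x)" and H: "continuous_on UNIV H" and dl: "dl > 0"
 shows "smooth_curve (%t. integral {0..1} (%u. D 0 ((t - u) / dl) *\<^sub>R H u))"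
 unfolding smooth_curve_def
proof (intro exI[of _ "%n t. integral {0..1} (%u. (D n ((t - u) / dl) / dl ^ n) *\<^sub>R H u)"] conjI allI)
 fix n t
 have cD: "continuous_on UNIV (D m)" for m using DERIV_continuous_on[OF D] .
 have c: "continuous_on S (%z. (D m ((fst z - snd z) / dl) / dl ^ m) *\<^sub>R H (snd z))" for m S
  unfolding divide_inverse
  by (intro continuous_intros continuous_on_compose2[OF cD] continuous_on_compose2[OF H]) auto
 have c1: "continuous_on S (%u. (D m ((t - u) / dl) / dl ^ m) *\<^sub>R H u)" for m S t
  unfolding divide_inverse
  by (intro continuous_intros continuous_on_compose2[OF cD] continuous_on_subset[OF H]) auto
 have "((%x. integral (cbox 0 1) (%u. (D n ((x - u) / dl) / dl ^ n) *\<^sub>R H u)) has_vector_derivative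
  integral (cbox 0 1) (%u. (D (Suc n) ((t - u) / dl) / dl ^ Suc n) *\<^sub>R H u)) (at t within UNIV)"
 proof (rule leibniz_rule_vector_derivative)
  fix x u :: real
  have "((%x. D n ((x - u) / dl)) has_real_derivative D (Suc n) ((x - u) / dl) * (1 / dl)) (at x)"
   by (rule DERIV_chain2[OF D]) (use dl in "auto intro!: derivative_eq_intros")
  from DERIV_cdivide[OF this, of "dl ^ n"]
  have "((%x. D n ((x - u) / dl) / dl ^ n) has_vector_derivative D (Suc n) ((x - u) / dl) / dl ^ Suc n) (at x)"
   by (simp add: has_real_derivative_iff_has_vector_derivative[symmetric] mult.commute)
  from bounded_linear.has_vector_derivative[OF bounded_linear_scaleR_left this, of "H u"]
  show "((%x. (D n ((x - u) / dl) / dl ^ n) *\<^sub>R H u) has_vector_derivative (D (Suc n) ((x - u) / dl) / dl ^ Suc n) *\<^sub>R H u) (at x within UNIV)" .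
  show "(%u. (D n ((x - u) / dl) / dl ^ n) *\<^sub>R H u) integrable_on cbox 0 1"
   by (rule integrable_continuous) (rule c1)
 next
  show "continuous_on (UNIV \<times> cbox 0 1) (%(x, u). (D (Suc n) ((x - u) / dl) / dl ^ Suc n) *\<^sub>R H u)"
   using c[of _ "Suc n"] by (simp add: case_prod_unfold)
 qed auto
 then show "((%t. integral {0..1} (%u. (D n ((t - u) / dl) / dl ^ n) *\<^sub>R H u)) has_vector_derivative
  integral {0..1} (%u. (D (Suc n) ((t - u) / dl) / dl ^ Suc n) *\<^sub>R H u)) (at t)"
  by (simp only: cbox_interval)
qed simp

lemma smooth_curve_bounded_derivative:
 assumes c: "smooth_curve c" and dl: "dl > 0" and supp: "!!t. t < dl \<or> 1 - dl < t ==> c t = 0"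
 shows "\<exists>c' B. B >= 0 & (\<forall>t. (c has_vector_derivative c' t) (at t) & cmod (c t) <= B & cmod (c' t) <= B)"
proof -
 obtain c' where c': "smooth_curve c'" "!!t. (c has_vector_derivative c' t) (at t)" using smooth_curve_derivative[OF c] by metis
 obtain c'' where c'': "!!t. (c' has_vector_derivative c'' t) (at t)" using smooth_curve_derivative[OF c'(1)] by metis
 have cont: "continuous_on {0..1} c" "continuous_on {0..1} c'"
  using c'(2) c'' by (auto intro!: has_vector_derivative_continuous continuous_at_imp_continuous_on)
 obtain B1 where B1: "!!t. t \<in> {0..1} ==> cmod (c t) <= B1"
  using compact_imp_bounded[OF compact_continuous_image[OF cont(1) compact_Icc]] unfolding bounded_iff by blast
 obtain B2 where B2: "!!t. t \<in> {0..1} ==> cmod (c' t) <= B2"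
  using compact_imp_bounded[OF compact_continuous_image[OF cont(2) compact_Icc]] unfolding bounded_iff by blast
 have out: "c t = 0 & c' t = 0" if "t \<notin> {0..1}" for t
 proof -
  have "open ({..<dl} \<union> {1 - dl<..})" "t \<in> {..<dl} \<union> {1 - dl<..}" using that dl by auto
  from eventually_nhds_in_open[OF this] have ev: "eventually (%s. c s = (%_. 0) s) (nhds t)"
   by eventually_elim (auto intro: supp)
  have "((%_. 0 :: complex) has_vector_derivative c' t) (at t)"
   using has_vector_derivative_eventually_eq[OF c'(2) ev] .
  then have "c' t = 0" using vector_derivative_unique_at has_vector_derivative_const by metis
  then show ?thesis using that dl supp[of t] by auto
 qed
 show ?thesis
 proof (intro exI[of _ c'] exI[of _ "max 0 (max B1 B2)"] conjI allI)
  fix t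
  show "cmod (c t) <= max 0 (max B1 B2)" "cmod (c' t) <= max 0 (max B1 B2)"
   using B1[of t] B2[of t] out[of t] by (cases "t \<in> {0..1}"; force)+
 qed (use c'(2) in auto)
qed

section \<open>The density of a mollified flow\<close>

text \<open>The spatial kernel is \<open>trig_sum L\<close> and the delays have density \<open>D 0\<close>, whose derivatives are the \<open>D n\<close>.\<close>

locale mollification =
 fixes \<eta> gm :: "('n::finite torus \<times> 'n torus) measure" and \<nu> :: "'n flow" and dl :: real
  and L :: "(complex \<times> (real ^ 'n)) list" and D :: "nat => real => real"
 assumes plans: "\<eta> \<in> torus_plans" "gm \<in> torus_plans" and flow: "generalized_flow \<eta> gm \<nu>"
  and dl: "0 < dl" "dl < 1/4"
  and L: "snd ` set L \<subseteq> lattice" and nonneg: "!!x. trig_sum L x >= 0"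
  and mass: "(\<integral>\<^sup>+X. ennreal (trig_sum L (rep X)) \<partial>TM) = 1"
  and D: "!!x. D 0 x >= 0" "!!x. \<bar>x\<bar> >= 1 ==> D 0 x = 0" "!!n x. (D n has_real_derivative D (Suc n) x) (at x)"
   "(\<integral>\<^sup>+x. ennreal (D 0 x) \<partial>lborel) = 1"
begin

abbreviation "P \<equiv> path_law \<nu>"

sublocale P: prob_space P by (rule prob_space_path_law[OF flow])

lemma prob_paths [simp]: "measure P paths = 1" "measure (TM :: 'n torus measure) UNIV = 1"
 using P.prob_space torus.prob_space by (simp_all add: torus_measure_def)

abbreviation "ka \<equiv> trig_sum L"
abbreviation "amplitude l \<equiv> fst (L ! l)"
abbreviation "freq l \<equiv> snd (L ! l)"

definition index :: "nat set" where "index = {l. l < length L & freq l ~= 0}"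

lemma trig_poly_kernel: "trig_poly ka" unfolding trig_poly_def using L by blast

lemma measurable_kernel [measurable]: "ka : borel_measurable borel"
 by (intro borel_measurable_continuous_onI continuous_trig_poly trig_poly_kernel)

lemma freq_lattice: "l < length L ==> freq l \<in> lattice" using L by (metis image_subset_iff nth_mem)

lemma finite_index: "finite index" unfolding index_def by (rule finite_subset[of _ "{..<length L}"]) auto

lemma kernel_sum: "ka x = (\<Sum>l<length L. mode (amplitude l) (freq l) x)"
 by (simp add: trig_sum_def case_prod_unfold sum_list_sum_nth atLeast0LessThan)

definition coeff :: "nat => real => complex" where
 "coeff l u = (\<integral>om. wave (freq l) (path_at om u) \<partial>P)"

lemma measurable_wave_path:
 "l < length L ==> (%om. wave (freq l) (path_at om u)) : borel_measurable P"
 by (rule measurable_compose[OF _ measurable_wave[OF freq_lattice]]) measurable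

lemma integrable_wave_path: "l < length L ==> integrable P (%om. wave (freq l) (path_at om u))"
 by (rule P.integrable_const_bound[where B = 1]) (simp_all add: measurable_wave_path)

lemma continuous_coeff: assumes l: "l < length L" shows "continuous_on UNIV (coeff l)"
proof (rule continuous_on_sequentiallyI)
 fix u :: "nat => real" and a assume "u \<longlonglongrightarrow> a"
 have cw: "isCont (%t. wave (freq l) (path_at om t)) a" if "om \<in> paths" for om
  using continuous_on_compose2[OF continuous_wave[OF freq_lattice[OF l]] continuous_path_at[OF that]]
  by (simp add: continuous_on_eq_continuous_at)
 show "(%n. coeff l (u n)) \<longlonglongrightarrow> coeff l a"
  unfolding coeff_def
  by (rule integral_dominated_convergence[where w = "%_. 1"])
   (auto simp: measurable_wave_path[OF l] intro!: isCont_tendsto_compose[OF cw] \<open>u \<longlonglongrightarrow> a\<close>)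
qed

lemma distr_endpoint: assumes t: "t = 0 \<or> t = 1" shows "distr P borel (%om. om t) = TM"
proof (rule measure_eqI)
 have m: "(%om. om t) : borel_measurable P" by (rule measurable_path_eval) (use t in auto)
 show "sets (distr P borel (%om. om t)) = sets TM" by (simp add: torus_measure_def)
 fix A assume "A \<in> sets (distr P borel (%om. om t))"
 then have [measurable]: "A \<in> sets borel" by simp
 have "emeasure (distr P borel (%om. om t)) A = (\<integral>\<^sup>+x. indicator A x \<partial>distr P borel (%om. om t))" by simp
 also have "... = (\<integral>\<^sup>+om. indicator A (om t) \<partial>P)" by (rule nn_integral_distr[OF m]) simp
 also have "... = (\<integral>\<^sup>+x. indicator A x \<partial>TM)" using t by (intro path_law_endpoint_uniform[OF plans flow]) auto
 finally show "emeasure (distr P borel (%om. om t)) A = emeasure TM A" by (simp add: torus_measure_def)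
qed

lemma coeff_endpoint: assumes l: "l \<in> index" and u: "u <= 0 \<or> 1 <= u" shows "coeff l u = 0"
proof -
 define t where "t = clamp01 u"
 have t: "t = 0 \<or> t = 1" using u by (auto simp: t_def clamp01_def)
 have k: "freq l \<in> lattice" "freq l ~= 0" using l freq_lattice by (auto simp: index_def)
 have "coeff l u = (\<integral>om. wave (freq l) (om t) \<partial>P)" by (simp add: coeff_def path_at_def t_def)
 also have "... = (\<integral>X. wave (freq l) X \<partial>distr P borel (%om. om t))"
  using t measurable_wave[OF k(1)] by (intro integral_distr[symmetric] measurable_path_eval) auto
 also have "... = 0" unfolding distr_endpoint[OF t] by (rule integral_wave[OF k])
 finally show ?thesis .
qed

text \<open>Only constant modes contribute to the mass of the kernel, which is 1.\<close>

lemma constant_modes: "(\<Sum>l\<in>{..<length L} - index. mode (amplitude l) (freq l) x) = 1"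
proof -
 have int: "integrable TM (%X. mode (amplitude l) (freq l) (rep X))" if "l < length L" for l
 proof (rule torus.integrable_const_bound[where B = "cmod (amplitude l)"])
  show "(%X. mode (amplitude l) (freq l) (rep X)) : borel_measurable TM"
   unfolding mode_def by measurable
 qed (simp add: abs_mode_le)
 have "(\<integral>X. ka (rep X) \<partial>TM) = 1"
  using mass nonneg by (subst integral_eq_nn_integral) auto
 then have "1 = (\<Sum>l<length L. \<integral>X. mode (amplitude l) (freq l) (rep X) \<partial>TM)"
  unfolding kernel_sum by (subst Bochner_Integration.integral_sum[symmetric]) (auto intro: int)
 also have "... = (\<Sum>l\<in>{..<length L} - index. \<integral>X. mode (amplitude l) (freq l) (rep X) \<partial>TM)"
 proof (rule sum.mono_neutral_right)
  show "\<forall>l\<in>{..<length L} - ({..<length L} - index). (\<integral>X. mode (amplitude l) (freq l) (rep X) \<partial>TM) = 0"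
  proof
   fix l assume "l \<in> {..<length L} - ({..<length L} - index)"
   then have k: "- freq l \<in> lattice" "- freq l ~= 0" using freq_lattice[of l] by (auto simp: index_def lattice_def)
   have "integrable TM (wave (- freq l))"
    by (rule torus.integrable_const_bound[where B = 1]) (use measurable_wave[OF k(1)] in "auto simp: torus_measure_def")
   then show "(\<integral>X. mode (amplitude l) (freq l) (rep X) \<partial>TM) = 0"
    using integral_wave[OF k] unfolding mode_torus_rep by (subst integral_Re) auto
  qed
 qed auto
 also have "... = (\<Sum>l\<in>{..<length L} - index. mode (amplitude l) (freq l) x)"
  by (intro sum.cong refl) (auto simp: index_def mode_def torus.prob_space)
 finally show ?thesis by simp
qed

text \<open>The density of the law at time \<open>u\<close> convolved with the kernel.\<close>

definition smoothed :: "real => real ^ 'n => real" where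
 "smoothed u x = (\<integral>om. ka (x - rep (path_at om u)) \<partial>P)"

lemma kernel_diff: "ka (x - rep X) = (\<Sum>l<length L. mode (amplitude l * wave (freq l) X) (freq l) x)"
 by (simp add: kernel_sum mode_diff)

lemma smoothed_eq: "smoothed u x = 1 + (\<Sum>l\<in>index. mode (amplitude l * coeff l u) (freq l) x)"
proof -
 have "smoothed u x = (\<Sum>l<length L. \<integral>om. mode (amplitude l * wave (freq l) (path_at om u)) (freq l) x \<partial>P)"
  unfolding smoothed_def kernel_diff by (intro Bochner_Integration.integral_sum integral_mode integrable_wave_path) auto
 also have "... = (\<Sum>l<length L. mode (amplitude l * coeff l u) (freq l) x)"
  unfolding coeff_def by (intro sum.cong refl integral_mode integrable_wave_path) auto
 also have "... = (\<Sum>l\<in>{..<length L} - index. mode (amplitude l * coeff l u) (freq l) x) + (\<Sum>l\<in>index. mode (amplitude l * coeff l u) (freq l) x)"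
  by (rule sum.subset_diff) (auto simp: index_def)
 also have "(\<Sum>l\<in>{..<length L} - index. mode (amplitude l * coeff l u) (freq l) x) = (\<Sum>l\<in>{..<length L} - index. mode (amplitude l) (freq l) x)"
  by (intro sum.cong refl) (auto simp: index_def coeff_def wave_def P.prob_space)
 finally show ?thesis by (simp add: constant_modes)
qed

lemma smoothed_nonneg: "smoothed u x >= 0" unfolding smoothed_def by (intro Bochner_Integration.integral_nonneg nonneg)

lemma nn_integral_smoothed: "(\<integral>\<^sup>+om. ennreal (ka (x - rep (path_at om u))) \<partial>P) = ennreal (smoothed u x)"
 unfolding smoothed_def
proof (rule nn_integral_eq_integral)
 show "integrable P (%om. ka (x - rep (path_at om u)))"
  unfolding kernel_diff by (intro Bochner_Integration.integrable_sum integral_mode integrable_wave_path) auto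
qed (simp add: nonneg)

lemma smoothed_endpoint: "u <= 0 \<or> 1 <= u ==> smoothed u x = 1"
 by (simp add: smoothed_eq coeff_endpoint mode_def)

lemma continuous_smoothed: "continuous_on UNIV (%u. smoothed u x)"
 unfolding smoothed_eq mode_def
 by (intro continuous_intros continuous_coeff) (auto simp: index_def)

text \<open>The bound on the density passes to the convolution at almost every time, and by continuity to every time.\<close>

lemma smoothed_le:
 assumes M: "M >= 1"
  and ae: "AE u in lborel. u \<in> {0<..<1} --> (\<forall>f :: 'n torus => ennreal. f : borel_measurable borel -->
   (\<integral>\<^sup>+om. f (om u) \<partial>P) <= ennreal M * (\<integral>\<^sup>+X. f X \<partial>TM))"
 shows "smoothed u x <= M"
proof (cases "u \<in> {0<..<1}")
 case True
 have [measurable]: "(%X. ennreal (ka (x - rep X))) : borel_measurable borel" by measurable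
 have one: "(\<integral>\<^sup>+X. ennreal (ka (x - rep X)) \<partial>TM) = 1"
 proof -
  have "(\<integral>\<^sup>+X. ennreal (ka (x - rep X)) \<partial>TM) = (\<integral>\<^sup>+om. ennreal (ka (x - rep (om 0))) \<partial>P)"
   by (rule path_law_endpoint_uniform[OF plans flow, symmetric]) auto
  also have "... = ennreal (smoothed 0 x)" using nn_integral_smoothed[of x 0] by (simp add: path_at_eq)
  finally show ?thesis by (simp add: smoothed_endpoint)
 qed
 have le: "AE u in lborel. u \<in> {0<..<1} --> smoothed u x <= M"
  using ae
 proof eventually_elim
  case (elim v)
  show ?case
  proof
   assume v: "v \<in> {0<..<1}"
   have "ennreal (smoothed v x) = (\<integral>\<^sup>+om. ennreal (ka (x - rep (om v))) \<partial>P)"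
    using v nn_integral_smoothed[of x v] by (simp add: path_at_eq)
   also have "... <= ennreal M * 1"
    using elim[rule_format, OF v, of "%X. ennreal (ka (x - rep X))"] unfolding one by simp
   finally show "smoothed v x <= M" using M by simp
  qed
 qed
 show ?thesis
 proof (rule ccontr)
  assume "\<not> smoothed u x <= M"
  define S where "S = (%u. smoothed u x) -` {M<..} \<inter> {0<..<1}"
  have S: "S ~= {}" "open S"
   unfolding S_def using True \<open>\<not> smoothed u x <= M\<close>
   by (force, intro open_Int open_vimage continuous_smoothed) auto
  have "AE u in lborel. u \<notin> S" using le by eventually_elim (auto simp: S_def)
  then have "S \<in> null_sets lborel" using S(2) by (subst AE_iff_null_sets) auto
  then have "negligible S" by (simp add: negligible_iff_null_sets null_sets_completionI)
  then show False using open_not_negligible[OF S(2,1)] by simp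
 qed
qed (use M smoothed_endpoint[of u x] in auto)

definition rescale :: "real => real" where "rescale u = (u - 2 * dl) / (1 - 4 * dl)"

definition Q1 :: "real measure" where "Q1 = density lborel (%s. ennreal (D 0 s))"
definition Q2 :: "(real ^ 'n) measure" where
 "Q2 = distr (density TM (%X. ennreal (ka (rep X)))) borel rep"

lemma measurable_bump [measurable]: "D n : borel_measurable borel"
 by (rule borel_measurable_continuous_onI[OF DERIV_continuous_on[OF D(3)]])

lemma sets_Q [simp, measurable_cong]: "sets Q1 = sets borel" "sets Q2 = sets borel" by (simp_all add: Q1_def Q2_def)

lemma nn_integral_Q2:
 assumes [measurable]: "g : borel_measurable borel"
 shows "(\<integral>\<^sup>+y. g y \<partial>Q2) = (\<integral>\<^sup>+X. ennreal (ka (rep X)) * g (rep X) \<partial>TM)"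
proof -
 have [measurable]: "rep \<in> TM \<rightarrow>\<^sub>M borel" using measurable_torus_rep by (simp add: torus_measure_def)
 show ?thesis unfolding Q2_def by (subst nn_integral_distr) (auto simp: nn_integral_density)
qed

sublocale Q1: prob_space Q1
 by (rule prob_spaceI) (simp add: Q1_def emeasure_density D(4))

sublocale Q2: prob_space Q2
proof (rule prob_spaceI)
 show "emeasure Q2 (space Q2) = 1" using nn_integral_Q2[of "%_. 1"] mass by simp
qed

lemma AE_Q1: "AE s in Q1. \<bar>s\<bar> < 1"
proof -
 have "AE s in lborel. 0 < ennreal (D 0 s) --> \<bar>s\<bar> < 1"
  using D(2) by (intro AE_I2) (metis ennreal_0 less_irrefl not_less)
 then show ?thesis unfolding Q1_def by (subst AE_density) auto
qed

definition amp :: "nat => real => complex" where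
 "amp l t = amplitude l * (\<integral>s. coeff l (rescale (t - dl * s)) \<partial>Q1)"

text \<open>The density of the mollified flow: \<open>smoothed\<close> averaged over the delay. Expanded in modes, it is 1 plus a trigonometric polynomial without constant term.\<close>

definition ratio :: "real => real ^ 'n => real" where
 "ratio t x = 1 + (\<Sum>l\<in>index. mode (amp l t) (freq l) x)"

lemma measurable_coeff: "l < length L ==> coeff l : borel_measurable borel"
 by (rule borel_measurable_continuous_onI[OF continuous_coeff])

lemma norm_coeff_le: "norm (coeff l u) <= 1"
proof -
 have "norm (coeff l u) <= (\<integral>om. norm (wave (freq l) (path_at om u)) \<partial>P)" unfolding coeff_def by (rule integral_norm_bound)
 then show ?thesis by (simp add: P.prob_space)
qed

lemma integrable_coeff: "l < length L ==> integrable Q1 (%s. coeff l (rescale (t - dl * s)))"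
 unfolding rescale_def
 by (rule Q1.integrable_const_bound[where B = 1])
  (auto simp: norm_coeff_le intro!: measurable_compose[OF _ measurable_coeff])

lemma ratio_eq: "ratio t x = (\<integral>s. smoothed (rescale (t - dl * s)) x \<partial>Q1)" (is ?A)
 and integrable_smoothed: "integrable Q1 (%s. smoothed (rescale (t - dl * s)) x)" (is ?B)
proof -
 have i: "integrable Q1 (%s. mode (amplitude l * coeff l (rescale (t - dl * s))) (freq l) x)" if "l \<in> index" for l
  using that by (intro integral_mode integrable_coeff) (simp add: index_def)
 show ?B unfolding smoothed_eq using i by simp
 have "(\<integral>s. smoothed (rescale (t - dl * s)) x \<partial>Q1) = 1 + (\<Sum>l\<in>index. \<integral>s. mode (amplitude l * coeff l (rescale (t - dl * s))) (freq l) x \<partial>Q1)"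
  unfolding smoothed_eq using i by (simp add: Q1.prob_space)
 also have "... = ratio t x"
  unfolding ratio_def amp_def
  by (intro arg_cong[where f = "(+) 1"] sum.cong refl integral_mode integrable_coeff) (simp add: index_def)
 finally show ?A by simp
qed

lemma ratio_nonneg: "ratio t x >= 0" unfolding ratio_eq by (intro Bochner_Integration.integral_nonneg smoothed_nonneg)

lemma nn_integral_ratio: "(\<integral>\<^sup>+s. ennreal (smoothed (rescale (t - dl * s)) x) \<partial>Q1) = ennreal (ratio t x)"
 unfolding ratio_eq by (rule nn_integral_eq_integral[OF integrable_smoothed]) (simp add: smoothed_nonneg)

lemma ratio_le: assumes "!!u. smoothed u x <= M" shows "ratio t x <= M"
proof -
 have "ratio t x <= (\<integral>s. M \<partial>Q1)" unfolding ratio_eq by (intro integral_mono integrable_smoothed assms) simp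
 then show ?thesis by (simp add: Q1.prob_space)
qed

lemma amp_support: assumes l: "l \<in> index" and t: "t < dl \<or> 1 - dl < t" shows "amp l t = 0"
proof -
 have "AE s in Q1. coeff l (rescale (t - dl * s)) = 0"
  using AE_Q1
 proof eventually_elim
  case (elim s)
  define z where "z = dl * s"
  have "\<bar>z\<bar> <= dl" using elim dl by (simp add: z_def abs_mult mult_left_le)
  then have "t - z <= 2 * dl \<or> 1 - 2 * dl <= t - z" using t by linarith
  then have "rescale (t - dl * s) <= 0 \<or> 1 <= rescale (t - dl * s)"
   using dl unfolding rescale_def z_def[symmetric] by (auto simp: le_divide_eq intro!: divide_nonpos_pos)
  then show ?case by (rule coeff_endpoint[OF l])
 qed
 then show ?thesis unfolding amp_def by (simp add: integral_eq_zero_AE)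
qed

text \<open>Averaging over the delay is a convolution in time. The coefficients vanish before time 0 and after time 1 since the end points are uniform, so the integral runs over \<open>[0, 1]\<close> only.\<close>

lemma smooth_amp: assumes l: "l \<in> index" shows "smooth_curve (amp l)"
proof -
 have ll: "l < length L" using l by (simp add: index_def)
 define H where "H u = coeff l (rescale u)" for u
 have cH: "continuous_on UNIV H"
  unfolding H_def rescale_def divide_inverse
  by (intro continuous_on_compose2[OF continuous_coeff[OF ll]] continuous_intros) auto
 have [measurable]: "H : borel_measurable borel" by (rule borel_measurable_continuous_onI[OF cH])
 have H0: "H u = 0" if "u \<notin> {0..1}" for u
  unfolding H_def using that dl by (intro coeff_endpoint[OF l]) (auto simp: rescale_def le_divide_eq intro!: divide_nonpos_pos)
 have "amp l t = (amplitude l / dl) * integral {0..1} (%u. D 0 ((t - u) / dl) *\<^sub>R H u)" for t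
 proof -
  let ?g = "%u. D 0 ((t - u) / dl) *\<^sub>R H u"
  have cg: "continuous_on {0..1} ?g"
   unfolding divide_inverse
   by (intro continuous_intros continuous_on_compose2[OF DERIV_continuous_on[OF D(3)]] continuous_on_subset[OF cH]) auto
  have "(\<integral>s. H (t - dl * s) \<partial>Q1) = (\<integral>s. D 0 s *\<^sub>R H (t - dl * s) \<partial>lborel)"
   unfolding Q1_def by (rule integral_density) (auto simp: D(1))
  also have "... = (1 / dl) *\<^sub>R (\<bar>- dl\<bar> *\<^sub>R (\<integral>s. ?g (t + (- dl) * s) \<partial>lborel))" using dl by simp
  also have "\<bar>- dl\<bar> *\<^sub>R (\<integral>s. ?g (t + (- dl) * s) \<partial>lborel) = (\<integral>u. ?g u \<partial>lborel)"
   by (rule lborel_integral_real_affine[symmetric]) (use dl in simp)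
  also have "(\<integral>u. ?g u \<partial>lborel) = (LINT u:{0..1}|lborel. ?g u)"
   unfolding set_lebesgue_integral_def by (intro Bochner_Integration.integral_cong refl) (auto simp: H0 split: split_indicator)
  also have "... = integral {0..1} ?g"
   by (rule set_borel_integral_eq_integral(2)) (rule borel_integrable_atLeastAtMost'[OF cg])
  finally show ?thesis by (simp add: amp_def H_def scaleR_conv_of_real)
 qed
 then have "amp l = (%t. (amplitude l / dl) * integral {0..1} (%u. D 0 ((t - u) / dl) *\<^sub>R H u) + 0 * integral {0..1} (%u. D 0 ((t - u) / dl) *\<^sub>R H u))"
  by auto
 then show ?thesis
  using smooth_curve_convolution[where D = D and H = H and dl = dl, OF D(3) cH dl(1)]
  by (simp only:) (intro smooth_curve_linear_combination)
qed

end

context mollification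
begin

abbreviation "Q \<equiv> Q1 \<Otimes>\<^sub>M Q2"

lemma sets_pair_Q: "sets Q = sets borel"
 unfolding borel_prod[symmetric] by (rule sets_pair_measure_cong[OF sets_Q])

sublocale PQ: pair_sigma_finite P Q1 ..
sublocale QQ: pair_prob_space Q1 Q2 ..

lemma prob_space_Q: "prob_space Q" by (rule QQ.prob_space_axioms)

sublocale PQQ: pair_sigma_finite P Q ..

lemma nn_integral_Q: "f : borel_measurable borel ==> (\<integral>\<^sup>+th. f th \<partial>Q) = (\<integral>\<^sup>+s. \<integral>\<^sup>+y. f (s, y) \<partial>Q2 \<partial>Q1)"
 using measurable_cong_sets[OF sets_pair_Q refl, of "borel :: ennreal measure"] by (intro Q2.nn_integral_fst[symmetric]) simp

text \<open>Substitute the target point for the displacement; translations preserve the measure and the kernel is periodic.\<close>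

lemma nn_integral_kernel_shift:
 assumes [measurable]: "f : borel_measurable borel"
 shows "(\<integral>\<^sup>+y. f (X \<oplus> y) \<partial>Q2) = (\<integral>\<^sup>+Z. f Z * ennreal (ka (rep Z - rep X)) \<partial>TM)"
proof -
 define g where "g Y = ennreal (ka (rep Y)) * f (X \<oplus> rep Y)" for Y
 have [measurable]: "g : borel_measurable borel" unfolding g_def by measurable
 have "(\<integral>\<^sup>+y. f (X \<oplus> y) \<partial>Q2) = (\<integral>\<^sup>+Y. g Y \<partial>TM)"
  unfolding g_def by (rule nn_integral_Q2) measurable
 also have "... = (\<integral>\<^sup>+Z. g (Z \<oplus> - rep X) \<partial>TM)" by (rule nn_integral_torus_shift[symmetric]) measurable
 also have "... = (\<integral>\<^sup>+Z. f Z * ennreal (ka (rep Z - rep X)) \<partial>TM)"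
 proof (rule nn_integral_cong)
  fix Z :: "'n torus"
  let ?W = "Z \<oplus> - rep X"
  have "X \<oplus> rep ?W = ?W \<oplus> rep X" by (simp only: torus_shift_rep[of X] torus_shift_rep[of ?W] add.commute)
  also have "... = Z" by (simp add: torus_shift_assoc)
  finally have 1: "X \<oplus> rep ?W = Z" .
  have "lattice_rel (rep ?W) (rep Z - rep X)"
   using abs_torus_eq_iff[of "rep ?W" "rep Z - rep X"] by (simp add: torus_shift_rep)
  from trig_poly_periodic[OF trig_poly_kernel this] 1
  show "g ?W = f Z * ennreal (ka (rep Z - rep X))" by (simp add: g_def mult.commute)
 qed
 finally show ?thesis .
qed

definition slow :: "real => real => real" where "slow t s = (t - delay dl s) / (1 - 4 * dl)"

lemma measurable_slow [measurable]: "slow t : borel_measurable borel"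
 unfolding slow_def[abs_def] by measurable

lemma mollify_mid: "t \<in> {dl..1-dl} ==> mollify dl om th t = path_at om (slow t (fst th)) \<oplus> snd th"
 using dl by (simp add: mollify_def slow_def cutoff_values(1)[OF dl])

lemma measurable_path_at_const: assumes "om \<in> paths" shows "path_at om : borel_measurable borel"
 by (rule borel_measurable_continuous_onI[OF continuous_path_at[OF assms]])

lemma law_middle:
 fixes f :: "'n torus => ennreal"
 assumes t: "t \<in> {dl..1-dl}" and f [measurable]: "f : borel_measurable borel"
 shows "(\<integral>\<^sup>+om. \<integral>\<^sup>+th. f (mollify dl om th t) \<partial>Q \<partial>P) = (\<integral>\<^sup>+Z. f Z * ennreal (ratio t (rep Z)) \<partial>TM)"
proof -
 have [measurable_cong]: "sets TM = sets (borel :: 'n torus measure)" by (simp add: torus_measure_def)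
 interpret PT: pair_sigma_finite P TM ..
 interpret QT: pair_sigma_finite Q1 TM ..
 let ?h = "%om s Z. f Z * ennreal (ka (rep Z - rep (path_at om (slow t s))))"
 have "(\<integral>\<^sup>+om. \<integral>\<^sup>+th. f (mollify dl om th t) \<partial>Q \<partial>P) = (\<integral>\<^sup>+om. \<integral>\<^sup>+s. \<integral>\<^sup>+Z. ?h om s Z \<partial>TM \<partial>Q1 \<partial>P)"
 proof (rule nn_integral_cong)
  fix om assume "om \<in> space P"
  then have [measurable]: "path_at om : borel_measurable borel" by (intro measurable_path_at_const) simp
  have "(\<integral>\<^sup>+th. f (mollify dl om th t) \<partial>Q) = (\<integral>\<^sup>+s. \<integral>\<^sup>+y. f (path_at om (slow t s) \<oplus> y) \<partial>Q2 \<partial>Q1)"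
   unfolding mollify_mid[OF t] by (subst nn_integral_Q) (simp_all add: borel_prod[symmetric])
  then show "(\<integral>\<^sup>+th. f (mollify dl om th t) \<partial>Q) = (\<integral>\<^sup>+s. \<integral>\<^sup>+Z. ?h om s Z \<partial>TM \<partial>Q1)"
   by (simp only: nn_integral_kernel_shift[OF f])
 qed
 also have "... = (\<integral>\<^sup>+s. \<integral>\<^sup>+om. \<integral>\<^sup>+Z. ?h om s Z \<partial>TM \<partial>P \<partial>Q1)"
  by (rule PQ.Fubini'[symmetric]) measurable
 also have "... = (\<integral>\<^sup>+s. \<integral>\<^sup>+Z. \<integral>\<^sup>+om. ?h om s Z \<partial>P \<partial>TM \<partial>Q1)"
  by (intro nn_integral_cong PT.Fubini'[symmetric]) measurable
 also have "... = (\<integral>\<^sup>+Z. \<integral>\<^sup>+s. \<integral>\<^sup>+om. ?h om s Z \<partial>P \<partial>Q1 \<partial>TM)"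
  by (rule QT.Fubini'[symmetric]) measurable
 also have "... = (\<integral>\<^sup>+Z. f Z * ennreal (ratio t (rep Z)) \<partial>TM)"
 proof (rule nn_integral_cong)
  fix Z :: "'n torus"
  have eq: "(\<integral>\<^sup>+om. ?h om s Z \<partial>P) = f Z * ennreal (smoothed (slow t s) (rep Z))" for s
   by (subst nn_integral_cmult) (simp_all add: nn_integral_smoothed)
  have [measurable]: "(%u. smoothed u (rep Z)) : borel_measurable borel"
   by (rule borel_measurable_continuous_onI[OF continuous_smoothed])
  have "(\<integral>\<^sup>+s. \<integral>\<^sup>+om. ?h om s Z \<partial>P \<partial>Q1) = f Z * (\<integral>\<^sup>+s. ennreal (smoothed (slow t s) (rep Z)) \<partial>Q1)"
   unfolding eq by (rule nn_integral_cmult) measurable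
  also have "(\<integral>\<^sup>+s. ennreal (smoothed (slow t s) (rep Z)) \<partial>Q1) = (\<integral>\<^sup>+s. ennreal (smoothed (rescale (t - dl * s)) (rep Z)) \<partial>Q1)"
  proof (rule nn_integral_cong_AE)
   show "AE s in Q1. ennreal (smoothed (slow t s) (rep Z)) = ennreal (smoothed (rescale (t - dl * s)) (rep Z))"
    using AE_Q1 by eventually_elim (simp add: slow_def rescale_def delay_def algebra_simps)
  qed
  finally show "(\<integral>\<^sup>+s. \<integral>\<^sup>+om. ?h om s Z \<partial>P \<partial>Q1) = f Z * ennreal (ratio t (rep Z))" by (simp add: nn_integral_ratio)
 qed
 finally show ?thesis .
qed

text \<open>While the displacement is being switched the path rests at an end point, which is uniform, and translations preserve uniformity.\<close>

lemma law_outer: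
 fixes f :: "'n torus => ennreal"
 assumes t: "t \<in> {0..1}" "t < dl \<or> 1 - dl < t" and f [measurable]: "f : borel_measurable borel"
 shows "(\<integral>\<^sup>+om. \<integral>\<^sup>+th. f (mollify dl om th t) \<partial>Q \<partial>P) = (\<integral>\<^sup>+Z. f Z \<partial>TM)"
proof -
 define e :: real where "e = (if t < dl then 0 else 1)"
 have e: "e = 0 \<or> e = 1" by (simp add: e_def)
 have eq: "mollify dl om th t = path_at om e \<oplus> cutoff dl t *\<^sub>R snd th" for om th
  using t dl delay_bounds[OF dl(1), of "fst th"] path_at_delay[OF dl, of t "fst th" om] path_at_delay[OF dl, of "fst th" t om]
  by (auto simp: mollify_def e_def path_at_eq)
 have "(\<integral>\<^sup>+om. \<integral>\<^sup>+th. f (mollify dl om th t) \<partial>Q \<partial>P) = (\<integral>\<^sup>+th. \<integral>\<^sup>+om. f (path_at om e \<oplus> cutoff dl t *\<^sub>R snd th) \<partial>P \<partial>Q)"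
  unfolding eq by (rule PQQ.Fubini'[symmetric]) measurable
 also have "... = (\<integral>\<^sup>+th. \<integral>\<^sup>+Z. f Z \<partial>TM \<partial>Q)"
 proof (rule nn_integral_cong)
  fix th :: "real \<times> (real ^ 'n)"
  have "(\<integral>\<^sup>+om. f (path_at om e \<oplus> cutoff dl t *\<^sub>R snd th) \<partial>P) = (\<integral>\<^sup>+om. f (om e \<oplus> cutoff dl t *\<^sub>R snd th) \<partial>P)"
   using e by (simp add: path_at_eq disj_ac) (auto simp: path_at_eq)
  also have "... = (\<integral>\<^sup>+Z. f (Z \<oplus> cutoff dl t *\<^sub>R snd th) \<partial>TM)"
   by (rule path_law_endpoint_uniform[OF plans flow _ e]) measurable
  also have "... = (\<integral>\<^sup>+Z. f Z \<partial>TM)" by (rule nn_integral_torus_shift) measurable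
  finally show "(\<integral>\<^sup>+om. f (path_at om e \<oplus> cutoff dl t *\<^sub>R snd th) \<partial>P) = (\<integral>\<^sup>+Z. f Z \<partial>TM)" .
 qed
 also have "... = (\<integral>\<^sup>+Z. f Z \<partial>TM)" by (simp add: QQ.emeasure_space_1)
 finally show ?thesis .
qed

lemma ratio_outer: "t < dl \<or> 1 - dl < t ==> ratio t x = 1"
 by (simp add: ratio_def amp_support mode_def)

lemma law:
 fixes f :: "'n torus => ennreal"
 assumes "t \<in> {0..1}" "f : borel_measurable borel"
 shows "(\<integral>\<^sup>+om. \<integral>\<^sup>+th. f (mollify dl om th t) \<partial>Q \<partial>P) = (\<integral>\<^sup>+Z. f Z * ennreal (ratio t (rep Z)) \<partial>TM)"
 using law_middle[of t f] law_outer[of t f] assms by (cases "t \<in> {dl..1-dl}") (auto simp: ratio_outer)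

lemma ex_mollified_flow:
 obtains \<nu>' where "generalized_flow \<eta> gm \<nu>'"
  "!!t (f :: 'n torus => ennreal). t \<in> {0..1} ==> f : borel_measurable borel ==>
   (\<integral>\<^sup>+om. f (om t) \<partial>path_law \<nu>') = (\<integral>\<^sup>+Z. f Z * ennreal (ratio t (rep Z)) \<partial>TM)"
  "flow_action \<nu>' <= ennreal (1 / (1 - 4 * dl)) * flow_action \<nu> + ennreal (1 / dl) * (\<integral>\<^sup>+y. ennreal ((norm y)\<^sup>2) \<partial>Q2)"
proof -
 obtain \<nu>' where g: "generalized_flow \<eta> gm \<nu>'" and F: "!!F :: _ => ennreal. F : borel_measurable path_borel ==>
   (\<integral>\<^sup>+om. F om \<partial>path_law \<nu>') = (\<integral>\<^sup>+om. \<integral>\<^sup>+th. F (mollify dl om th) \<partial>Q \<partial>P)"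
  by (rule transport_flow[OF plans flow prob_space_Q sets_pair_Q measurable_mollify[OF dl]])
   (simp_all add: mollify_endpoints[OF dl])
 show ?thesis
 proof (rule that[OF g])
  fix t :: real and f :: "'n torus => ennreal" assume t: "t \<in> {0..1}" and f: "f : borel_measurable borel"
  have "(%om. f (om t)) : borel_measurable path_borel"
   by (rule measurable_compose[OF measurable_path_eval[OF measurable_ident_sets[OF refl] t] f])
  from F[OF this] show "(\<integral>\<^sup>+om. f (om t) \<partial>path_law \<nu>') = (\<integral>\<^sup>+Z. f Z * ennreal (ratio t (rep Z)) \<partial>TM)"
   using law[OF t f] by simp
 next
  let ?m = "ennreal (1 / (1 - 4 * dl))"
  have "flow_action \<nu>' = (\<integral>\<^sup>+om. \<integral>\<^sup>+th. curve_action (mollify dl om th) \<partial>Q \<partial>P)"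
   by (simp add: flow_action_eq[OF g] F measurable_curve_action)
  also have "... <= (\<integral>\<^sup>+om. \<integral>\<^sup>+th. ?m * curve_action om + ennreal (1 / dl) * ennreal ((norm (snd th))\<^sup>2) \<partial>Q \<partial>P)"
  proof (intro nn_integral_mono)
   fix om and th :: "real \<times> (real ^ 'n)" assume "om \<in> space P"
   then have "curve_action (mollify dl om th) <= ?m * curve_action om + ennreal ((norm (snd th))\<^sup>2 / dl)"
    by (intro curve_action_mollify_le[OF dl]) simp
   then show "curve_action (mollify dl om th) <= ?m * curve_action om + ennreal (1 / dl) * ennreal ((norm (snd th))\<^sup>2)"
    using dl by (simp add: ennreal_mult'[symmetric])
  qed
  also have "... = (\<integral>\<^sup>+om. ?m * curve_action om + ennreal (1 / dl) * (\<integral>\<^sup>+y. ennreal ((norm y)\<^sup>2) \<partial>Q2) \<partial>P)"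
  proof (rule nn_integral_cong)
   fix om
   have "(\<integral>\<^sup>+th. ennreal (1 / dl) * ennreal ((norm (snd th))\<^sup>2) \<partial>Q) = ennreal (1 / dl) * (\<integral>\<^sup>+y. ennreal ((norm y)\<^sup>2) \<partial>Q2)"
    by (subst nn_integral_cmult, measurable, subst nn_integral_Q) (simp_all add: borel_prod[symmetric] Q1.emeasure_space_1)
   then show "(\<integral>\<^sup>+th. ?m * curve_action om + ennreal (1 / dl) * ennreal ((norm (snd th))\<^sup>2) \<partial>Q) = ?m * curve_action om + ennreal (1 / dl) * (\<integral>\<^sup>+y. ennreal ((norm y)\<^sup>2) \<partial>Q2)"
    by (subst nn_integral_add) (simp_all add: QQ.emeasure_space_1)
  qed
  also have "... = ?m * flow_action \<nu> + ennreal (1 / dl) * (\<integral>\<^sup>+y. ennreal ((norm y)\<^sup>2) \<partial>Q2)"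
   by (subst nn_integral_add) (simp_all add: nn_integral_cmult flow_action_eq[OF flow] P.emeasure_space_1 del: space_path_law)
  finally show "flow_action \<nu>' <= ..." .
 qed
qed

lemma slow_error: assumes "t \<in> {0..1}" shows "\<bar>slow t s - t\<bar> <= 7 * dl / (1 - 4 * dl)"
proof -
 have "slow t s - t = (4 * dl * t - delay dl s) / (1 - 4 * dl)" using dl by (simp add: slow_def field_simps)
 moreover have "0 <= dl * t" "dl * t <= dl" using assms dl by (auto simp: mult_left_le)
 then have "\<bar>4 * dl * t - delay dl s\<bar> <= 7 * dl" using delay_bounds[OF dl(1), of s] dl by linarith
 ultimately show ?thesis using dl by (simp add: abs_divide divide_right_mono)
qed

text \<open>A Lipschitz test function sees at most the distance between the moved and the original position, which is due to the change of time and to the displacement.\<close>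

lemma weak_error:
 fixes f :: "'n torus => real"
 assumes t: "t \<in> {dl..1-dl}" and f: "!!X Y. \<bar>f X - f Y\<bar> <= dist X Y"
  and e: "!!u. \<bar>u - t\<bar> <= 7 * dl / (1 - 4 * dl) ==> (\<integral>\<^sup>+om. ennreal (dist (path_at om u) (path_at om t)) \<partial>P) <= e"
 shows "(\<integral>\<^sup>+Z. ennreal (f Z) * ennreal (ratio t (rep Z)) \<partial>TM) <= (\<integral>\<^sup>+om. ennreal (f (om t)) \<partial>P) + (e + (\<integral>\<^sup>+y. ennreal (norm y) \<partial>Q2))" (is ?A)
  "(\<integral>\<^sup>+om. ennreal (f (om t)) \<partial>P) <= (\<integral>\<^sup>+Z. ennreal (f Z) * ennreal (ratio t (rep Z)) \<partial>TM) + (e + (\<integral>\<^sup>+y. ennreal (norm y) \<partial>Q2))" (is ?B)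
proof -
 have t01: "t \<in> {0..1}" using t dl by auto
 have "continuous_on UNIV f"
  unfolding continuous_on_iff dist_real_def using f by (meson le_less_trans)
 then have [measurable]: "f : borel_measurable borel" by (rule borel_measurable_continuous_onI)
 let ?d = "%om th. ennreal (dist (path_at om (slow t (fst th))) (path_at om t)) + ennreal (norm (snd th))"
 have err: "(\<integral>\<^sup>+om. \<integral>\<^sup>+th. ?d om th \<partial>Q \<partial>P) <= e + (\<integral>\<^sup>+y. ennreal (norm y) \<partial>Q2)"
 proof -
  have "(\<integral>\<^sup>+om. \<integral>\<^sup>+th. ?d om th \<partial>Q \<partial>P) = (\<integral>\<^sup>+th. \<integral>\<^sup>+om. ?d om th \<partial>P \<partial>Q)"
   by (rule PQQ.Fubini'[symmetric]) measurable
  also have "... <= (\<integral>\<^sup>+th. e + ennreal (norm (snd th)) \<partial>Q)"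
  proof (rule nn_integral_mono)
   fix th :: "real \<times> (real ^ 'n)"
   have "(\<integral>\<^sup>+om. ?d om th \<partial>P) = (\<integral>\<^sup>+om. ennreal (dist (path_at om (slow t (fst th))) (path_at om t)) \<partial>P) + ennreal (norm (snd th))"
    by (subst nn_integral_add) (simp_all add: P.emeasure_space_1 del: space_path_law)
   then show "(\<integral>\<^sup>+om. ?d om th \<partial>P) <= e + ennreal (norm (snd th))"
    using e[OF slow_error[OF t01, of "fst th"]] by (simp add: add_right_mono)
  qed
  also have "... = e + (\<integral>\<^sup>+th. ennreal (norm (snd th)) \<partial>Q)"
   by (subst nn_integral_add) (simp_all add: QQ.emeasure_space_1)
  also have "(\<integral>\<^sup>+th. ennreal (norm (snd th)) \<partial>Q) = (\<integral>\<^sup>+y. ennreal (norm y) \<partial>Q2)"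
   by (subst nn_integral_Q) (simp_all add: borel_prod[symmetric] Q1.emeasure_space_1)
  finally show ?thesis .
 qed
 have compare: "(\<integral>\<^sup>+om. \<integral>\<^sup>+th. F om th \<partial>Q \<partial>P) <= (\<integral>\<^sup>+om. \<integral>\<^sup>+th. G om th \<partial>Q \<partial>P) + (e + (\<integral>\<^sup>+y. ennreal (norm y) \<partial>Q2))"
  if m: "(%(om, th). G om th) : borel_measurable (P \<Otimes>\<^sub>M Q)" and le: "!!om th. F om th <= G om th + ?d om th" for F G :: "_ => _ => ennreal"
 proof -
  note [measurable] = m
  have "(\<integral>\<^sup>+om. \<integral>\<^sup>+th. F om th \<partial>Q \<partial>P) <= (\<integral>\<^sup>+om. \<integral>\<^sup>+th. G om th + ?d om th \<partial>Q \<partial>P)" by (intro nn_integral_mono le)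
  also have "... = (\<integral>\<^sup>+om. (\<integral>\<^sup>+th. G om th \<partial>Q) + (\<integral>\<^sup>+th. ?d om th \<partial>Q) \<partial>P)" by (intro nn_integral_cong nn_integral_add) measurable
  also have "... = (\<integral>\<^sup>+om. \<integral>\<^sup>+th. G om th \<partial>Q \<partial>P) + (\<integral>\<^sup>+om. \<integral>\<^sup>+th. ?d om th \<partial>Q \<partial>P)" by (rule nn_integral_add) measurable
  also have "... <= (\<integral>\<^sup>+om. \<integral>\<^sup>+th. G om th \<partial>Q \<partial>P) + (e + (\<integral>\<^sup>+y. ennreal (norm y) \<partial>Q2))" by (rule add_left_mono[OF err])
  finally show ?thesis .
 qed
 let ?F = "%om th. ennreal (f (path_at om (slow t (fst th)) \<oplus> snd th))" and ?G = "%om th :: real \<times> (real ^ 'n). ennreal (f (path_at om t))"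
 have near: "\<bar>f (path_at om (slow t (fst th)) \<oplus> snd th) - f (path_at om t)\<bar> <= dist (path_at om (slow t (fst th))) (path_at om t) + norm (snd th)" for om and th :: "real \<times> (real ^ 'n)"
  using f[of "path_at om (slow t (fst th)) \<oplus> snd th" "path_at om t \<oplus> 0"]
   dist_torus_shift_le2[of "path_at om (slow t (fst th))" "snd th" "path_at om t" 0] by simp
 have le: "ennreal a <= ennreal b + (ennreal x + ennreal y)" if "\<bar>a - b\<bar> <= x + y" "0 <= x" "0 <= y" for a b x y
 proof -
  have "ennreal a <= ennreal (max 0 b + (x + y))" using that by (intro ennreal_leI) linarith
  also have "... = ennreal b + (ennreal x + ennreal y)" using that by (simp add: ennreal_max_0)
  finally show ?thesis .
 qed
 have F: "(\<integral>\<^sup>+om. \<integral>\<^sup>+th. ?F om th \<partial>Q \<partial>P) = (\<integral>\<^sup>+Z. ennreal (f Z) * ennreal (ratio t (rep Z)) \<partial>TM)"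
  using law_middle[OF t, of "%X. ennreal (f X)"] unfolding mollify_mid[OF t] by simp
 have G: "(\<integral>\<^sup>+om. \<integral>\<^sup>+th. ?G om th \<partial>Q \<partial>P) = (\<integral>\<^sup>+om. ennreal (f (om t)) \<partial>P)"
  using t01 by (simp add: QQ.emeasure_space_1 path_at_eq)
 show ?A using compare[of ?G ?F] near unfolding F G by (simp add: le)
 show ?B using compare[of ?F ?G] near unfolding F G by (simp add: le abs_minus_commute)
qed

lemma pressure_mollified_le:
 assumes opt: "optimal_incompressible_flow \<eta> gm \<eta>\<eta>" and p: "pressure_field \<eta>\<eta> p"
  and finite_action: "flow_action \<eta>\<eta> < \<infinity>" "flow_action \<nu> < \<infinity>"
  and var: "(\<integral>\<^sup>+y. ennreal ((norm y)\<^sup>2) \<partial>Q2) <= ennreal (dl\<^sup>2)"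
 shows "(\<integral>(t, x). p (t, x) * (ratio t (rep x) - 1) \<partial>spacetime) <= enn2real (flow_action \<nu>) / (1 - 4 * dl) + dl - enn2real (flow_action \<eta>\<eta>)"
proof -
 obtain \<nu>' where \<nu>': "generalized_flow \<eta> gm \<nu>'"
  and law': "!!t (f :: 'n torus => ennreal). t \<in> {0..1} ==> f : borel_measurable borel ==>
   (\<integral>\<^sup>+om. f (om t) \<partial>path_law \<nu>') = (\<integral>\<^sup>+Z. f Z * ennreal (ratio t (rep Z)) \<partial>TM)"
  and act: "flow_action \<nu>' <= ennreal (1 / (1 - 4 * dl)) * flow_action \<nu> + ennreal (1 / dl) * (\<integral>\<^sup>+y. ennreal ((norm y)\<^sup>2) \<partial>Q2)"
  using ex_mollified_flow by blast
 obtain A where A: "flow_action \<nu> = ennreal A" "A >= 0" using finite_action(2) by (cases "flow_action \<nu>") auto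
 note act
 also have "ennreal (1 / dl) * (\<integral>\<^sup>+y. ennreal ((norm y)\<^sup>2) \<partial>Q2) <= ennreal (1 / dl) * ennreal (dl\<^sup>2)"
  by (rule mult_left_mono[OF var]) simp
 also have "ennreal (1 / (1 - 4 * dl)) * flow_action \<nu> + ennreal (1 / dl) * ennreal (dl\<^sup>2) = ennreal (A / (1 - 4 * dl) + dl)"
  using dl A by (simp add: ennreal_mult'[symmetric] power2_eq_square)
 finally have act': "flow_action \<nu>' <= ennreal (A / (1 - 4 * dl) + dl)" by (simp add: add_left_mono)
 have "\<forall>l\<in>index. \<exists>c' B. B >= 0 & (\<forall>t. (amp l has_vector_derivative c' t) (at t) & cmod (amp l t) <= B & cmod (c' t) <= B)"
  using smooth_curve_bounded_derivative[OF smooth_amp dl(1) amp_support] by blast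
 then obtain c' B where c': "!!l. l \<in> index ==> B l >= 0 & (\<forall>t. (amp l has_vector_derivative c' l t) (at t) & cmod (amp l t) <= B l & cmod (c' l t) <= B l)"
  by metis
 have B: "B l <= (\<Sum>l\<in>index. B l)" if "l \<in> index" for l using c' finite_index that by (intro member_le_sum) auto
 obtain pos :: "'n => nat" where pos: "bij_betw pos UNIV {..<CARD('n)}"
  using ex_bij_betw_finite_nat[of "UNIV :: 'n set"] by (auto simp: atLeast0LessThan)
 interpret modes index amp c' freq pos "\<Sum>l\<in>index. B l"
 proof
  fix l t assume l: "l \<in> index"
  show "freq l \<in> lattice" "freq l ~= 0" using l freq_lattice by (auto simp: index_def)
  show "(amp l has_vector_derivative c' l t) (at t)" using c'[OF l] by blast
  show "cmod (amp l t) <= (\<Sum>l\<in>index. B l)" "cmod (c' l t) <= (\<Sum>l\<in>index. B l)" using c'[OF l] B[OF l] order_trans by blast+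
 qed (use c' in "auto intro: sum_nonneg finite_index pos")
 have dens: "1 + dens 0 (t, x) = ratio t x" for t x by (simp add: dens_def tail_0 ratio_def)
 have "(\<integral>(t, x). p (t, x) * dens 0 (t, rep x) \<partial>spacetime) <= enn2real (flow_action \<nu>') - enn2real (flow_action \<eta>\<eta>)"
 proof (rule smooth_density_inequality[OF plans opt p \<nu>' finite_action(1)])
  show "flow_action \<nu>' < \<infinity>" using act' by (rule order_le_less_trans) simp
 qed (auto simp: dens ratio_nonneg law' smooth_amp intro!: dl(1) amp_support)
 moreover have "enn2real (flow_action \<nu>') <= A / (1 - 4 * dl) + dl"
  using act' A dl by (intro enn2real_leI) auto
 moreover have "dens 0 (t, x) = ratio t x - 1" for t x using dens[of t x] by simp
 ultimately show ?thesis using A by simp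
qed

end

context mollification
begin

text \<open>The density at time \<open>t\<close> only depends on the laws at the delayed times.\<close>

lemma ratio_eq_1:
 assumes t: "t \<in> {0..1}"
  and unif: "!!u (f :: 'n torus => ennreal). \<bar>u - t\<bar> <= 7 * dl / (1 - 4 * dl) ==> u \<in> {0<..<1} ==> f : borel_measurable borel ==>
   (\<integral>\<^sup>+om. f (om u) \<partial>P) = (\<integral>\<^sup>+X. f X \<partial>TM)"
 shows "ratio t x = 1"
proof -
 have "smoothed u x = 1" if u: "\<bar>u - t\<bar> <= 7 * dl / (1 - 4 * dl)" for u
 proof (cases "u \<in> {0<..<1}")
  case True
  have m: "(%X. ennreal (ka (x - rep X))) : borel_measurable borel" by measurable
  have "ennreal (smoothed u x) = (\<integral>\<^sup>+om. ennreal (ka (x - rep (om u))) \<partial>P)"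
   using True nn_integral_smoothed[of x u] by (simp add: path_at_eq)
  also have "... = (\<integral>\<^sup>+om. ennreal (ka (x - rep (om 0))) \<partial>P)"
   using unif[OF u True m] path_law_endpoint_uniform[OF plans flow m, of 0] by simp
  also have "... = ennreal (smoothed 0 x)" using nn_integral_smoothed[of x 0] by (simp add: path_at_eq)
  finally show ?thesis by (simp add: smoothed_endpoint smoothed_nonneg)
 qed (use smoothed_endpoint[of u x] in auto)
 note one = this
 have "AE s in Q1. smoothed (rescale (t - dl * s)) x = 1"
  using AE_Q1
 proof eventually_elim
  case (elim s)
  have "rescale (t - dl * s) = slow t s"
   using elim by (simp add: slow_def rescale_def delay_def algebra_simps)
  then show ?case using one[OF slow_error[OF t, of s]] by simp
 qed
 then have "(\<integral>s. smoothed (rescale (t - dl * s)) x \<partial>Q1) = (\<integral>s. 1 \<partial>Q1)"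
  using borel_measurable_integrable[OF integrable_smoothed] by (intro integral_cong_AE) auto
 then show ?thesis by (simp add: ratio_eq Q1.prob_space)
qed

lemma measurable_ratio: "(%z. ratio (fst z) (rep (snd z))) : borel_measurable (borel \<Otimes>\<^sub>M borel)"
proof -
 have "amp l : borel_measurable borel" if l: "l \<in> index" for l
 proof -
  obtain c' where "!!t. (amp l has_vector_derivative c' t) (at t)"
   using smooth_curve_derivative[OF smooth_amp[OF l]] by metis
  then have "continuous_on UNIV (amp l)" by (auto intro!: has_vector_derivative_continuous continuous_at_imp_continuous_on)
  then show ?thesis by (rule borel_measurable_continuous_onI)
 qed
 then have "(%z. mode (amp l (fst z)) (freq l) (rep (snd z))) : borel_measurable (borel \<Otimes>\<^sub>M borel)" if "l \<in> index" for l
  using that unfolding mode_def by measurable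
 then show ?thesis unfolding ratio_def by measurable
qed

end

lemma ex_mollification:
 fixes \<nu> :: "'n::finite flow"
 assumes plans: "\<eta> \<in> torus_plans" "gm \<in> torus_plans" and flow: "generalized_flow \<eta> gm \<nu>" and dl: "0 < dl" "dl < 1/4"
 obtains L D where "mollification \<eta> gm \<nu> dl L D"
  "(\<integral>\<^sup>+y. ennreal ((norm y)\<^sup>2) \<partial>mollification.Q2 L) <= ennreal (dl\<^sup>2)"
proof -
 define N where "N = Suc (nat \<lceil>CARD('n) / dl\<^sup>2\<rceil>)"
 have "CARD('n) / dl\<^sup>2 <= N" unfolding N_def by linarith
 moreover have N: "N >= 1" by (simp add: N_def)
 ultimately have N2: "CARD('n) / N <= dl\<^sup>2" using dl by (simp add: field_simps)
 obtain ka :: "real ^ 'n => real" where k: "trig_poly ka" "!!x. ka x >= 0"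
  "(\<integral>\<^sup>+X. ennreal (ka (rep X)) \<partial>TM) = 1"
  "(\<integral>\<^sup>+X. ennreal ((norm (rep X))\<^sup>2 * ka (rep X)) \<partial>TM) <= ennreal (CARD('n) / N)"
  by (rule ex_kernel[OF N, where 'n = 'n]) (rule that)
 obtain L where L: "snd ` set L \<subseteq> lattice" "ka = trig_sum L" using k(1) unfolding trig_poly_def by blast
 obtain D :: "nat => real => real" where D: "!!x. D 0 x >= 0" "!!x. \<bar>x\<bar> >= 1 ==> D 0 x = 0"
  "!!n x. (D n has_real_derivative D (Suc n) x) (at x)" "(\<integral>\<^sup>+x. ennreal (D 0 x) \<partial>lborel) = 1"
  by (rule ex_bump) (rule that)
 have m: "mollification \<eta> gm \<nu> dl L D"
  by (rule mollification.intro[where D = D and L = L, OF plans flow dl L(1) k(2,3)[unfolded L(2)] D])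
 have "(\<integral>\<^sup>+y. ennreal ((norm y)\<^sup>2) \<partial>mollification.Q2 L) = (\<integral>\<^sup>+X. ennreal ((norm (rep X))\<^sup>2 * ka (rep X)) \<partial>TM)"
  using k(2) by (subst mollification.nn_integral_Q2[OF m]) (simp_all add: L(2) ennreal_mult'[symmetric] mult.commute)
 also have "... <= ennreal (dl\<^sup>2)" using k(4) N2 by (meson ennreal_leI order_trans)
 finally show ?thesis using that[OF m] by blast
qed

section \<open>Approximation of flows of bounded compression\<close>

definition uniform_at :: "'n::finite flow => real => bool" where
 "uniform_at \<nu> u \<longleftrightarrow> (\<forall>f :: 'n torus => ennreal. f : borel_measurable borel -->
  (\<integral>\<^sup>+om. f (om u) \<partial>path_law \<nu>) = (\<integral>\<^sup>+X. f X \<partial>TM))"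

definition compressed_at :: "'n::finite flow => real => real => bool" where
 "compressed_at \<nu> M u \<longleftrightarrow> (\<forall>f :: 'n torus => ennreal. f : borel_measurable borel -->
  (\<integral>\<^sup>+om. f (om u) \<partial>path_law \<nu>) <= ennreal M * (\<integral>\<^sup>+X. f X \<partial>TM))"

text \<open>All that the limit needs to know about the density \<open>r\<close> of a mollified flow; \<open>7 dl / (1 - 4 dl)\<close> bounds the change of time.\<close>

definition approximates :: "'n::finite flow => real => (real \<times> 'n torus => real) => bool" where
 "approximates \<nu> dl r \<longleftrightarrow> r : borel_measurable (borel \<Otimes>\<^sub>M borel) & (\<forall>z. 0 <= r z) &
  (\<forall>M\<ge>1. (AE u in lborel. u \<in> {0<..<1} --> compressed_at \<nu> M u) --> (\<forall>z. r z <= M)) &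
  (\<forall>t\<in>{0..1}. (\<forall>u. \<bar>u - t\<bar> <= 7 * dl / (1 - 4 * dl) --> u \<in> {0<..<1} --> uniform_at \<nu> u) --> (\<forall>X. r (t, X) = 1)) &
  (\<forall>t\<in>{dl..1-dl}. \<forall>f :: 'n torus => real. \<forall>e. (\<forall>X Y. \<bar>f X - f Y\<bar> <= dist X Y) -->
   (\<forall>u. \<bar>u - t\<bar> <= 7 * dl / (1 - 4 * dl) --> (\<integral>\<^sup>+om. ennreal (dist (path_at om u) (path_at om t)) \<partial>path_law \<nu>) <= e) -->
   (\<integral>\<^sup>+Z. ennreal (f Z) * ennreal (r (t, Z)) \<partial>TM) <= (\<integral>\<^sup>+om. ennreal (f (om t)) \<partial>path_law \<nu>) + (e + ennreal (2 * dl)) &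
   (\<integral>\<^sup>+om. ennreal (f (om t)) \<partial>path_law \<nu>) <= (\<integral>\<^sup>+Z. ennreal (f Z) * ennreal (r (t, Z)) \<partial>TM) + (e + ennreal (2 * dl)))"

lemma mollified_density:
 fixes \<nu> \<eta>\<eta> :: "'n::finite flow"
 assumes plans: "\<eta> \<in> torus_plans" "gm \<in> torus_plans" and flow: "generalized_flow \<eta> gm \<nu>" and dl: "0 < dl" "dl < 1/4"
  and opt: "optimal_incompressible_flow \<eta> gm \<eta>\<eta>" and p: "pressure_field \<eta>\<eta> p"
  and finite_action: "flow_action \<eta>\<eta> < \<infinity>" "flow_action \<nu> < \<infinity>"
 obtains r :: "real \<times> 'n torus => real" where "approximates \<nu> dl r"
  "(\<integral>z. p z * (r z - 1) \<partial>spacetime) <= enn2real (flow_action \<nu>) / (1 - 4 * dl) + dl - enn2real (flow_action \<eta>\<eta>)"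
proof -
 obtain L D where m: "mollification \<eta> gm \<nu> dl L D"
  and var: "(\<integral>\<^sup>+y. ennreal ((norm y)\<^sup>2) \<partial>mollification.Q2 L) <= ennreal (dl\<^sup>2)"
  using ex_mollification[OF plans flow dl] by blast
 interpret mollification \<eta> gm \<nu> dl L D by (rule m)
 have dev: "(\<integral>\<^sup>+y. ennreal (norm y) \<partial>Q2) <= ennreal (2 * dl)"
 proof -
  have "norm y <= dl + (norm y)\<^sup>2 / dl" for y :: "real ^ 'n"
  proof (cases "norm y <= dl")
   case False
   then have "norm y * dl <= norm y * norm y" by (intro mult_left_mono) auto
   then have "norm y <= (norm y)\<^sup>2 / dl" using dl by (simp add: field_simps power2_eq_square)
   then show ?thesis using dl by simp
  qed (use dl in "simp add: add_increasing2")
  then have "(\<integral>\<^sup>+y. ennreal (norm y) \<partial>Q2) <= (\<integral>\<^sup>+y. ennreal dl + ennreal (1 / dl) * ennreal ((norm y)\<^sup>2) \<partial>Q2)"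
   using dl by (intro nn_integral_mono) (simp add: ennreal_mult'[symmetric] ennreal_plus[symmetric] ennreal_leI del: ennreal_plus)
  also have "... = ennreal dl + ennreal (1 / dl) * (\<integral>\<^sup>+y. ennreal ((norm y)\<^sup>2) \<partial>Q2)"
   by (subst nn_integral_add) (simp_all add: nn_integral_cmult Q2.emeasure_space_1)
  also have "... <= ennreal dl + ennreal (1 / dl) * ennreal (dl\<^sup>2)" by (intro add_left_mono mult_left_mono var) simp
  also have "... = ennreal (2 * dl)" using dl by (simp add: ennreal_mult'[symmetric] ennreal_plus[symmetric] power2_eq_square del: ennreal_plus)
  finally show ?thesis .
 qed
 show ?thesis
 proof (rule that[of "%z. ratio (fst z) (rep (snd z))"])
  show "(\<integral>z. p z * (ratio (fst z) (rep (snd z)) - 1) \<partial>spacetime) <= enn2real (flow_action \<nu>) / (1 - 4 * dl) + dl - enn2real (flow_action \<eta>\<eta>)"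
   using pressure_mollified_le[OF opt p finite_action var] by (simp add: case_prod_unfold)
  show "approximates \<nu> dl (%z. ratio (fst z) (rep (snd z)))"
   unfolding approximates_def fst_conv snd_conv
  proof (intro conjI allI impI ballI)
   show "(%z. ratio (fst z) (rep (snd z))) : borel_measurable (borel \<Otimes>\<^sub>M borel)" by (rule measurable_ratio)
   show "0 <= ratio (fst z) (rep (snd z))" for z :: "real \<times> 'n torus" by (rule ratio_nonneg)
   show "ratio (fst z) (rep (snd z)) <= M"
    if "M >= 1" "AE u in lborel. u \<in> {0<..<1} --> compressed_at \<nu> M u" for M and z :: "real \<times> 'n torus"
    by (rule ratio_le, rule smoothed_le) (rule that[unfolded compressed_at_def])+
   show "ratio t (rep X) = 1"
    if "t \<in> {0..1}" "\<forall>u. \<bar>u - t\<bar> <= 7 * dl / (1 - 4 * dl) --> u \<in> {0<..<1} --> uniform_at \<nu> u" for t and X :: "'n torus"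
    by (rule ratio_eq_1[OF that(1)]) (rule that(2)[unfolded uniform_at_def, rule_format])
   fix t :: real and f :: "'n torus => real" and e :: ennreal
   assume *: "t \<in> {dl..1-dl}" "\<forall>X Y. \<bar>f X - f Y\<bar> <= dist X Y"
    "\<forall>u. \<bar>u - t\<bar> <= 7 * dl / (1 - 4 * dl) --> (\<integral>\<^sup>+om. ennreal (dist (path_at om u) (path_at om t)) \<partial>P) <= e"
   have le: "e + (\<integral>\<^sup>+y. ennreal (norm y) \<partial>Q2) <= e + ennreal (2 * dl)" by (rule add_left_mono[OF dev])
   show "(\<integral>\<^sup>+Z. ennreal (f Z) * ennreal (ratio t (rep Z)) \<partial>TM) <= (\<integral>\<^sup>+om. ennreal (f (om t)) \<partial>P) + (e + ennreal (2 * dl))"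
    by (rule order_trans[OF weak_error(1)[OF *(1) *(2)[rule_format] *(3)[rule_format]] add_left_mono[OF le]])
   show "(\<integral>\<^sup>+om. ennreal (f (om t)) \<partial>P) <= (\<integral>\<^sup>+Z. ennreal (f Z) * ennreal (ratio t (rep Z)) \<partial>TM) + (e + ennreal (2 * dl))"
    by (rule order_trans[OF weak_error(2)[OF *(1) *(2)[rule_format] *(3)[rule_format]] add_left_mono[OF le]])
  qed
 qed
qed

text \<open>Functions for which convergence holds are closed under \<open>L\<^sup>1\<close> limits since the \<open>d n\<close> are bounded. Distances to the complement reach the indicators of open sets, Dynkin's lemma those of Borel sets, and simple functions all integrable functions.\<close>

lemma weak_limit_extends_to_integrable:
 fixes M :: "'a::metric_space measure" and d :: "nat => 'a => real"
 assumes fin: "finite_measure M" and sets: "sets M = sets borel"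
  and d: "!!n. d n : borel_measurable borel" "!!n x. \<bar>d n x\<bar> <= C"
  and lip: "!!f b. (!!x y. \<bar>f x - f y\<bar> <= dist x y) ==> (!!x. 0 <= f x & f x <= b) ==> (%n. \<integral>x. f x * d n x \<partial>M) \<longlonglongrightarrow> 0"
  and f: "integrable M f"
 shows "(%n. \<integral>x. f x * d n x \<partial>M) \<longlonglongrightarrow> 0"
proof -
 interpret finite_measure M by fact
 note [measurable_cong] = sets and [measurable] = d(1)
 have C: "C >= 0" using d(2)[of 0 undefined] by linarith
 define P where "P f \<longleftrightarrow> (%n. \<integral>x. f x * d n x \<partial>M) \<longlonglongrightarrow> 0" for f
 have int: "integrable M (%x. f x * d n x)" if "integrable M f" for f n
 proof (rule Bochner_Integration.integrable_bound[OF integrable_mult_right[OF that, of C]])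
  show "(%x. f x * d n x) : borel_measurable M" using borel_measurable_integrable[OF that] by measurable
  show "AE x in M. norm (f x * d n x) <= norm (C * f x)"
   using C mult_left_mono[OF d(2), of "\<bar>f x\<bar>" n x for x] by (intro AE_I2) (simp add: abs_mult mult.commute)
 qed
 have approx: "P f" if f: "integrable M f" and g: "!!n. integrable M (g n)" "!!n. P (g n)"
   and lim: "(%n. \<integral>x. \<bar>f x - g n x\<bar> \<partial>M) \<longlonglongrightarrow> 0" for f and g :: "nat => 'a => real"
  unfolding P_def tendsto_iff
 proof (intro allI impI)
  fix e :: real assume e: "e > 0"
  have "e / (2 * (C + 1)) > 0" using e C by simp
  from tendstoD[OF lim this]
  have "eventually (%m. dist (\<integral>x. \<bar>f x - g m x\<bar> \<partial>M) 0 < e / (2 * (C + 1))) sequentially" .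
  then obtain m where "\<bar>\<integral>x. \<bar>f x - g m x\<bar> \<partial>M\<bar> < e / (2 * (C + 1))"
   unfolding eventually_sequentially by auto
  then have m: "(C + 1) * (\<integral>x. \<bar>f x - g m x\<bar> \<partial>M) < e / 2" using C by (simp add: field_simps)
  have "\<bar>(\<integral>x. f x * d n x \<partial>M) - (\<integral>x. g m x * d n x \<partial>M)\<bar> <= e / 2" for n
  proof -
   have "\<bar>(\<integral>x. f x * d n x \<partial>M) - (\<integral>x. g m x * d n x \<partial>M)\<bar> = \<bar>\<integral>x. (f x - g m x) * d n x \<partial>M\<bar>"
    using int[OF f] int[OF g(1)] by (simp add: left_diff_distrib)
   also have "... <= (\<integral>x. \<bar>(f x - g m x) * d n x\<bar> \<partial>M)" by (rule integral_abs_bound)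
   also have "... <= (\<integral>x. (C + 1) * \<bar>f x - g m x\<bar> \<partial>M)"
   proof (rule integral_mono)
    show "\<bar>(f x - g m x) * d n x\<bar> <= (C + 1) * \<bar>f x - g m x\<bar>" for x
     using d(2)[of n x] mult_right_mono[of "\<bar>d n x\<bar>" "C + 1" "\<bar>f x - g m x\<bar>"] by (simp add: abs_mult mult.commute)
   qed (use f g int in auto)
   also have "... = (C + 1) * (\<integral>x. \<bar>f x - g m x\<bar> \<partial>M)" by simp
   finally show ?thesis using m by simp
  qed
  note b = this
  have "eventually (%n. \<bar>\<integral>x. g m x * d n x \<partial>M\<bar> < e / 2) sequentially"
   using tendstoD[OF g(2)[unfolded P_def], of "e / 2" m] e by simp
  then show "eventually (%n. dist (\<integral>x. f x * d n x \<partial>M) 0 < e) sequentially"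
   by eventually_elim (use b in "smt (verit) dist_real_def diff_0_right field_sum_of_halves")
 qed
 have scale: "P (%x. c * f x)" if "P f" for c f
  using tendsto_mult_right_zero[OF that[unfolded P_def], of c] by (simp add: P_def mult.assoc)
 have add: "P (%x. f x + g x)" if "P f" "P g" "integrable M f" "integrable M g" for f g
  using tendsto_add_zero[OF that(1,2)[unfolded P_def]] int[OF that(3)] int[OF that(4)] by (simp add: P_def distrib_right)
 have const: "P (%_. 1)" unfolding P_def by (rule lip[of _ 1]) auto
 have opn: "P (indicator U)" if U: "open U" for U
 proof (cases "U = UNIV")
  case False
  define g where "g n x = real (Suc n) * min (1 / Suc n) (infdist x (- U))" for n x
  have inf: "\<bar>min c (infdist x (- U)) - min c (infdist y (- U))\<bar> <= dist x y" for c x y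
   using infdist_triangle_abs[of x "- U" y] by (auto simp: min_def abs_if split: if_splits)
  have gb: "0 <= g n x" "g n x <= 1" for n x
   unfolding g_def using mult_left_mono[of "min (1 / Suc n) (infdist x (- U))" "1 / Suc n" "real (Suc n)"]
   by (auto simp: infdist_nonneg)
  have [measurable]: "g n : borel_measurable borel" for n
   unfolding g_def by (intro borel_measurable_continuous_onI continuous_intros)
  have Pg: "P (g n)" for n
   unfolding g_def
  proof (rule scale)
   show "P (%x. min (1 / Suc n) (infdist x (- U)))"
    unfolding P_def by (rule lip[of _ "1 / Suc n"]) (auto simp: inf infdist_nonneg)
  qed
  have lim: "(%n. g n x) \<longlonglongrightarrow> indicator U x" for x
  proof (cases "x \<in> U")
   case True
   have "infdist x (- U) ~= 0"
    using in_closed_iff_infdist_zero[of "- U" x] True False U by (auto simp: closed_Compl)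
   then have pos: "infdist x (- U) > 0" using infdist_nonneg[of x "- U"] by simp
   have "eventually (%n. 1 / real (Suc n) < infdist x (- U)) sequentially"
    using order_tendstoD(2)[OF LIMSEQ_inverse_real_of_nat pos] by (simp add: inverse_eq_divide)
   then have "eventually (%n. g n x = 1) sequentially" by eventually_elim (simp add: g_def)
   then show ?thesis using True by (simp add: tendsto_eventually)
  next
   case False
   then show ?thesis by (simp add: g_def)
  qed
  have [measurable]: "U \<in> sets borel" using U by simp
  show ?thesis
  proof (rule approx[of _ g])
   have "(%n. \<integral>x. \<bar>indicator U x - g n x\<bar> \<partial>M) \<longlonglongrightarrow> (\<integral>x. 0 \<partial>M)"
   proof (rule integral_dominated_convergence[where w = "%_. 1"])
    show "AE x in M. (%n. \<bar>indicator U x - g n x\<bar>) \<longlonglongrightarrow> 0"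
    proof (rule AE_I2)
     fix x
     have "(%n. indicator U x - g n x) \<longlonglongrightarrow> indicator U x - indicator U x"
      by (intro tendsto_diff tendsto_const lim)
     then show "(%n. \<bar>indicator U x - g n x\<bar>) \<longlonglongrightarrow> 0" by (intro tendsto_rabs_zero) simp
    qed
    show "AE x in M. norm \<bar>indicator U x - g n x\<bar> <= 1" for n
     using gb[of n] by (auto split: split_indicator)
   qed auto
   then show "(%n. \<integral>x. \<bar>indicator U x - g n x\<bar> \<partial>M) \<longlonglongrightarrow> 0" by simp
   show "integrable M (g n)" for n
    by (rule integrable_const_bound[where B = 1]) (use gb in auto)
  qed (use Pg in "auto simp: integrable_indicator_iff emeasure_finite less_top[symmetric] sets")
 qed (use const in simp)
 have ind: "integrable M (indicator A :: 'a => real)" if "A \<in> sets borel" for A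
  using that by (simp add: integrable_indicator_iff less_top[symmetric] sets)
 have borel: "P (indicator A)" if A: "A \<in> sets borel" for A
 proof -
  have *: "Int_stable {S :: 'a set. open S}" "{S :: 'a set. open S} \<subseteq> Pow UNIV" "A \<in> sigma_sets UNIV {S. open S}"
   using A by (auto simp: Int_stable_def borel_def)
  have sb: "B \<in> sets borel" if "B \<in> sigma_sets UNIV {S. open S}" for B :: "'a set" using that by (simp add: borel_def)
  show ?thesis
  proof (rule sigma_sets_induct_disjoint[OF *, where P = "%A. P (indicator A)"])
   show "P (indicator {})" by (simp add: P_def indicator_def)
   show "P (indicator (UNIV - B))" if "B \<in> sigma_sets UNIV {S. open S}" "P (indicator B)" for B
   proof -
    have "P (%x. 1 + (- 1) * indicator B x)"
     using ind[OF sb[OF that(1)]] that(2) by (intro add scale const) auto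
    also have "(%x. 1 + (- 1) * indicator B x) = (indicator (UNIV - B) :: 'a => real)" by (auto split: split_indicator)
    finally show ?thesis .
   qed
   show "P (indicator (\<Union>i. B i))"
    if "disjoint_family B" "range B \<subseteq> sigma_sets UNIV {S. open S}" "!!i. P (indicator (B i))" for B :: "nat => 'a set"
   proof -
    have B: "B i \<in> sets borel" for i using that(2) sb by blast
    have U: "(\<Union>i<n. B i) \<in> sets borel" for n using B by auto
    have Pn: "P (indicator (\<Union>i<n. B i))" for n
    proof (induction n)
     case 0
     show ?case by (simp add: P_def indicator_def)
    next
     case (Suc n)
     have "P (%x. indicator (\<Union>i<n. B i) x + indicator (B n) x)"
      by (intro add Suc that(3) ind U B)
     also have "(%x. indicator (\<Union>i<n. B i) x + indicator (B n) x) = (indicator (\<Union>i<Suc n. B i) :: 'a => real)"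
     proof
      fix x
      have "B i \<inter> B n = {}" if "i < n" for i
       using \<open>disjoint_family B\<close> that by (simp add: disjoint_family_on_def)
      then have "\<not> (x \<in> B n & x \<in> (\<Union>i<n. B i))" by blast
      then show "indicator (\<Union>i<n. B i) x + indicator (B n) x = (indicator (\<Union>i<Suc n. B i) x :: real)"
       by (auto simp: lessThan_Suc split: split_indicator)
     qed
     finally show ?case .
    qed
    have [measurable]: "B i \<in> sets borel" for i by (rule B)
    show ?thesis
    proof (rule approx[of _ "%n. indicator (\<Union>i<n. B i)"])
     have "(%n. \<integral>x. \<bar>indicator (\<Union>i. B i) x - indicator (\<Union>i<n. B i) x\<bar> \<partial>M) \<longlonglongrightarrow> (\<integral>x. (0 :: real) \<partial>M)"
     proof (rule integral_dominated_convergence[where w = "%_. 1"])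
      have "(%n. \<bar>indicator (\<Union>i. B i) x - indicator (\<Union>i<n. B i) x\<bar>) \<longlonglongrightarrow> (0 :: real)" for x
      proof (cases "x \<in> (\<Union>i. B i)")
       case True
       then obtain i where "x \<in> B i" by blast
       then have "eventually (%n. \<bar>indicator (\<Union>i. B i) x - indicator (\<Union>i<n. B i) x\<bar> = (0 :: real)) sequentially"
        unfolding eventually_sequentially by (intro exI[of _ "Suc i"]) (auto split: split_indicator)
       then show ?thesis by (rule tendsto_eventually)
      qed (auto simp: indicator_def)
      then show "AE x in M. (%n. \<bar>indicator (\<Union>i. B i) x - indicator (\<Union>i<n. B i) x\<bar>) \<longlonglongrightarrow> (0 :: real)" by simp
     qed (auto split: split_indicator)
     then show "(%n. \<integral>x. \<bar>indicator (\<Union>i. B i) x - indicator (\<Union>i<n. B i) x\<bar> \<partial>M) \<longlonglongrightarrow> (0 :: real)" by simp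
    qed (auto intro!: ind Pn)
   qed
  qed (auto intro: opn)
 qed
 have "P f"
  using f
 proof (induction f rule: integrable_induct)
  case (base A c)
  have "P (%x. c * indicator A x)" using base(1) sets by (intro scale borel) auto
  then show ?case by (simp add: mult.commute)
 next
  case (add f g)
  then show ?case by (intro \<open>!!f g. P f ==> P g ==> integrable M f ==> integrable M g ==> P (%x. f x + g x)\<close>)
 next
  case (lim f s)
  have [measurable]: "f : borel_measurable M" "s n : borel_measurable M" for n using lim by auto
  show ?case
  proof (rule approx[of _ s])
   have "(%n. \<integral>x. \<bar>f x - s n x\<bar> \<partial>M) \<longlonglongrightarrow> (\<integral>x. 0 \<partial>M)"
   proof (rule integral_dominated_convergence[where w = "%x. 3 * \<bar>f x\<bar>"])
    show "AE x in M. (%n. \<bar>f x - s n x\<bar>) \<longlonglongrightarrow> 0"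
    proof (rule AE_I2)
     fix x assume "x \<in> space M"
     then have "(%n. f x - s n x) \<longlonglongrightarrow> f x - f x" by (intro tendsto_diff tendsto_const lim)
     then show "(%n. \<bar>f x - s n x\<bar>) \<longlonglongrightarrow> 0" by (intro tendsto_rabs_zero) simp
    qed
    show "AE x in M. norm \<bar>f x - s n x\<bar> <= 3 * \<bar>f x\<bar>" for n
    proof (rule AE_I2)
     fix x assume "x \<in> space M"
     then have "\<bar>s n x\<bar> <= 2 * \<bar>f x\<bar>" using lim by simp
     then show "norm \<bar>f x - s n x\<bar> <= 3 * \<bar>f x\<bar>" by simp
    qed
   qed (use lim in auto)
   then show "(%n. \<integral>x. \<bar>f x - s n x\<bar> \<partial>M) \<longlonglongrightarrow> 0" by simp
  qed (use lim in auto)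
 qed
 then show ?thesis by (simp add: P_def)
qed

section \<open>Passage to the limit\<close>

abbreviation "unit_time \<equiv> restrict_space lborel {0<..<1::real}"

lemma prob_space_unit_time: "prob_space unit_time"
 by (rule prob_spaceI) (simp add: emeasure_restrict_space space_restrict_space)

interpretation unit_time: prob_space unit_time by (rule prob_space_unit_time)
interpretation spacetime: pair_prob_space unit_time "TM :: 'n::finite torus measure" ..

lemma pressure_pairing_eq: "pressure_pairing p f = (\<integral>t. \<integral>x. p (t, x) * f (t, x) \<partial>TM \<partial>unit_time)"
 unfolding pressure_pairing_def set_lebesgue_integral_def by (subst integral_restrict_space) auto

lemma borel_measurable_spacetime:
 assumes "r : borel_measurable (borel \<Otimes>\<^sub>M borel)" shows "r : borel_measurable (spacetime :: (real \<times> 'n::finite torus) measure)"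
proof -
 have "(%z. (fst z, snd z)) \<in> (spacetime :: (real \<times> 'n torus) measure) \<rightarrow>\<^sub>M borel \<Otimes>\<^sub>M borel"
  unfolding spacetime_def
  by (intro measurable_Pair measurable_compose[OF measurable_fst] measurable_compose[OF measurable_snd])
   (auto simp: torus_measure_def intro!: measurable_restrict_space1)
 from measurable_compose[OF this assms] show ?thesis by simp
qed

text \<open>Dominated convergence in time; the bound on the densities makes the spatial norm of \<open>p\<close> a dominating function.\<close>

lemma limit_pairing:
 fixes p \<rho> :: "real \<times> 'n::finite torus => real" and r :: "nat => real \<times> 'n torus => real"
 assumes p: "integrable spacetime p" and \<rho>: "\<rho> : borel_measurable spacetime"
  and r: "!!n. r n : borel_measurable (borel \<Otimes>\<^sub>M borel)" "!!n z. 0 <= r n z" "!!n z. r n z <= M"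
  and conv: "AE t in unit_time. \<forall>f. integrable TM f -->
   (%n. \<integral>x. f x * (r n (t, x) - 1) \<partial>TM) \<longlonglongrightarrow> (\<integral>x. f x * (\<rho> (t, x) - 1) \<partial>TM)"
 shows "(%n. \<integral>z. p z * (r n z - 1) \<partial>spacetime) \<longlonglongrightarrow> pressure_pairing p (%z. \<rho> z - 1)"
proof -
 have [measurable]: "r n : borel_measurable (unit_time \<Otimes>\<^sub>M TM)" "\<rho> : borel_measurable (unit_time \<Otimes>\<^sub>M TM)" for n
  using borel_measurable_spacetime[OF r(1)] \<rho> unfolding spacetime_def by blast+
 note p = p[unfolded spacetime_def]
 note [measurable] = borel_measurable_integrable[OF p]
 have M: "M >= 0" using r(2,3)[of 0 undefined] by linarith
 have b: "\<bar>r n z - 1\<bar> <= M + 1" for n z using r(2,3)[of n z] by linarith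
 have bp: "\<bar>p z * (r n z - 1)\<bar> <= (M + 1) * \<bar>p z\<bar>" for n z
  using mult_right_mono[OF b[of n z], of "\<bar>p z\<bar>"] by (simp add: abs_mult mult.commute)
 have i: "integrable (unit_time \<Otimes>\<^sub>M TM) (%z. p z * (r n z - 1))" for n
  by (rule Bochner_Integration.integrable_bound[OF integrable_mult_right[OF integrable_abs[OF p], of "M + 1"]])
   (use bp M in "auto intro!: AE_I2")
 have eq: "(\<integral>z. p z * (r n z - 1) \<partial>spacetime) = (\<integral>t. \<integral>x. p (t, x) * (r n (t, x) - 1) \<partial>TM \<partial>unit_time)" for n
  unfolding spacetime_def using spacetime.integral_fst'[OF i[of n]] by simp
 show ?thesis
  unfolding eq pressure_pairing_eq
 proof (rule integral_dominated_convergence[where w = "%t. (M + 1) * (\<integral>x. \<bar>p (t, x)\<bar> \<partial>TM)"])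
  show "integrable unit_time (%t. (M + 1) * (\<integral>x. \<bar>p (t, x)\<bar> \<partial>TM))"
   using spacetime.integrable_fst'[OF integrable_abs[OF p]] by simp
  show "AE t in unit_time. (%n. \<integral>x. p (t, x) * (r n (t, x) - 1) \<partial>TM) \<longlonglongrightarrow> (\<integral>x. p (t, x) * (\<rho> (t, x) - 1) \<partial>TM)"
   using conv spacetime.AE_integrable_fst'[OF p] by eventually_elim blast
  show "AE t in unit_time. norm (\<integral>x. p (t, x) * (r n (t, x) - 1) \<partial>TM) <= (M + 1) * (\<integral>x. \<bar>p (t, x)\<bar> \<partial>TM)" for n
   using spacetime.AE_integrable_fst'[OF p] spacetime.AE_integrable_fst'[OF i[of n]]
  proof eventually_elim
   case (elim t)
   have "norm (\<integral>x. p (t, x) * (r n (t, x) - 1) \<partial>TM) <= (\<integral>x. (M + 1) * \<bar>p (t, x)\<bar> \<partial>TM)"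
    by (rule order_trans[OF integral_norm_bound integral_mono]) (use elim bp in auto)
   then show ?case by simp
  qed
 qed measurable
qed

text \<open>The exponent \<open>q = d / (d - 1)\<close> is at most 2 for \<open>d >= 2\<close>, so \<open>\<bar>f\<bar> <= 1 + \<bar>f\<bar>\<^sup>q\<close> and \<open>j <= 1 + j\<^bsup>2/q\<^esup>\<close> suffice; it is infinite for \<open>d = 1\<close>.\<close>

lemma nn_integral_abs_le_Lp_norm:
 fixes f :: "'a => real"
 assumes "prob_space M" and f [measurable]: "f : borel_measurable M" and d: "d >= 1"
 shows "(\<integral>\<^sup>+x. ennreal \<bar>f x\<bar> \<partial>M) <= 2 + (Lp_norm (of_nat d / of_nat (d - 1)) M f)\<^sup>2"
proof -
 interpret prob_space M by fact
 have square: "x <= 1 + x\<^sup>2" for x :: ennreal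
 proof (cases x)
  case (real a)
  have "a <= 1 + a\<^sup>2" using sum_squares_ge_zero[of "a - 1/2" 0] by (simp add: power2_eq_square algebra_simps)
  then show ?thesis using real by (simp add: ennreal_power ennreal_leI flip: ennreal_1 ennreal_plus)
 qed simp
 let ?q = "of_nat d / of_nat (d - 1) :: ennreal"
 show ?thesis
 proof (cases "d = 1")
  case True
  have q: "?q = \<infinity>" using True by (simp add: ennreal_divide_zero)
  have "AE x in M. ennreal \<bar>f x\<bar> <= esssup M (%x. ennreal \<bar>f x\<bar>)" by (rule esssup_AE)
  then have "(\<integral>\<^sup>+x. ennreal \<bar>f x\<bar> \<partial>M) <= (\<integral>\<^sup>+x. esssup M (%x. ennreal \<bar>f x\<bar>) \<partial>M)" by (rule nn_integral_mono_AE)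
  also have "... = Lp_norm ?q M f" unfolding q Lp_norm_def by (simp add: emeasure_space_1)
  also have "... <= 1 + (Lp_norm ?q M f)\<^sup>2" by (rule square)
  also have "... <= 2 + (Lp_norm ?q M f)\<^sup>2" by (intro add_right_mono) simp
  finally show ?thesis .
 next
  case False
  then have d2: "d >= 2" using d by simp
  define Q where "Q = real d / real (d - 1)"
  have Q: "1 <= Q" "Q <= 2" using d2 by (auto simp: Q_def field_simps of_nat_diff)
  have qQ: "?q = ennreal Q" using d2 by (simp add: Q_def ennreal_of_nat_eq_real_of_nat divide_ennreal)
  define J where "J = (\<integral>\<^sup>+x. ennreal (\<bar>f x\<bar> powr Q) \<partial>M)"
  have Lp: "Lp_norm ?q M f = (if J = \<infinity> then \<infinity> else ennreal (enn2real J powr (1 / Q)))"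
   unfolding qQ Lp_norm_def J_def Let_def using Q by simp
  show ?thesis
  proof (cases "J = \<infinity>")
   case True
   then show ?thesis unfolding Lp by simp
  next
   case False
   then obtain j where j: "J = ennreal j" "j >= 0" by (cases J) auto
   have le: "y <= 1 + y powr Q" if "y >= 0" for y :: real
   proof (cases "y <= 1")
    case False
    then show ?thesis using powr_mono[of 1 Q y] Q by simp
   qed (simp add: add_increasing2)
   have "(\<integral>\<^sup>+x. ennreal \<bar>f x\<bar> \<partial>M) <= (\<integral>\<^sup>+x. 1 + ennreal (\<bar>f x\<bar> powr Q) \<partial>M)"
    by (intro nn_integral_mono) (use le in "simp add: ennreal_leI flip: ennreal_1 ennreal_plus")
   also have "... = 1 + J" unfolding J_def by (subst nn_integral_add) (simp_all add: emeasure_space_1)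
   also have "... <= ennreal (2 + (j powr (1 / Q))\<^sup>2)"
   proof -
    have "j <= 1 + (j powr (1 / Q))\<^sup>2"
    proof (cases "j <= 1")
     case False
     have "j powr 1 <= j powr (2 / Q)" using False Q by (intro powr_mono) (auto simp: field_simps)
     also have "j powr (2 / Q) = (j powr (1 / Q))\<^sup>2" using False by (simp add: power2_eq_square flip: powr_add)
     finally show ?thesis using False by simp
    qed (simp add: add_increasing2)
    then show ?thesis using j by (simp add: ennreal_leI flip: ennreal_1 ennreal_plus)
   qed
   also have "... = 2 + (Lp_norm ?q M f)\<^sup>2" unfolding Lp using False j by (simp add: ennreal_power)
   finally show ?thesis .
  qed
 qed
qed

lemma pressure_locally_integrable:
 fixes p :: "real \<times> 'n::finite torus => real"
 assumes p: "L2_loc (of_nat CARD('n) / of_nat (CARD('n) - 1)) p" and a: "0 < a" "a < 1/2"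
 shows "integrable spacetime (%z. indicator {a..1-a} (fst z) * p z)"
proof -
 have [measurable]: "p : borel_measurable (unit_time \<Otimes>\<^sub>M TM)"
  using p by (simp add: L2_loc_def spacetime_def)
 have [measurable]: "{a..1-a} \<in> sets unit_time" using a by (subst sets_restrict_space_iff) auto
 let ?q = "of_nat CARD('n) / of_nat (CARD('n) - 1) :: ennreal"
 define \<phi> where "\<phi> t = (\<integral>\<^sup>+x. ennreal \<bar>p (t, x)\<bar> \<partial>TM)" for t
 have [measurable]: "\<phi> : borel_measurable unit_time" unfolding \<phi>_def by measurable
 have bound: "\<phi> t - 2 <= (Lp_norm ?q TM (%x. p (t, x)))\<^sup>2" if "t \<in> {0<..<1}" for t
 proof -
  have "(%x. p (t, x)) : borel_measurable TM"
   by (rule measurable_Pair2[of p unit_time]) (use that in "auto simp: space_restrict_space")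
  from nn_integral_abs_le_Lp_norm[OF prob_space_torus_measure this, of "CARD('n)"]
  have "\<phi> t <= 2 + (Lp_norm ?q TM (%x. p (t, x)))\<^sup>2" by (simp add: \<phi>_def Suc_le_eq)
  then have "\<phi> t - 2 <= 2 + (Lp_norm ?q TM (%x. p (t, x)))\<^sup>2 - 2" by (rule ennreal_minus_mono) simp
  then show ?thesis by simp
 qed
 have "(\<integral>\<^sup>+z. ennreal (norm (indicator {a..1-a} (fst z) * p z)) \<partial>(unit_time \<Otimes>\<^sub>M TM))
  = (\<integral>\<^sup>+t. \<integral>\<^sup>+x. ennreal (norm (indicator {a..1-a} t * p (t, x))) \<partial>TM \<partial>unit_time)"
  using torus.nn_integral_fst[of "%z. ennreal (norm (indicator {a..1-a} (fst z) * p z))" unit_time] by simp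
 also have "... = (\<integral>\<^sup>+t. \<phi> t * indicator {a..1-a} t \<partial>unit_time)"
  by (intro nn_integral_cong) (auto simp: \<phi>_def split: split_indicator)
 also have "... <= (\<integral>\<^sup>+t. 2 + (\<phi> t - 2) * indicator {a..1-a} t \<partial>unit_time)"
 proof (rule nn_integral_mono)
  fix t
  have "\<phi> t <= 2 + (\<phi> t - 2)"
  proof (cases "2 <= \<phi> t")
   case False
   then have "\<phi> t <= 2" by simp
   also have "2 <= 2 + (\<phi> t - 2)" by simp
   finally show ?thesis .
  qed (simp add: diff_add_cancel_ennreal add.commute[of 2])
  then show "\<phi> t * indicator {a..1-a} t <= 2 + (\<phi> t - 2) * indicator {a..1-a} t" by (auto split: split_indicator)
 qed
 also have "... = 2 + (\<integral>\<^sup>+t. (\<phi> t - 2) * indicator {a..1-a} t \<partial>unit_time)"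
  by (subst nn_integral_add) (simp_all add: emeasure_restrict_space space_restrict_space)
 also have "(\<integral>\<^sup>+t. (\<phi> t - 2) * indicator {a..1-a} t \<partial>unit_time) = (\<integral>\<^sup>+t. (\<phi> t - 2) * indicator {a..1-a} t * indicator {0<..<1} t \<partial>lborel)"
  by (rule nn_integral_restrict_space) simp
 also have "... <= (\<integral>\<^sup>+t\<in>{a..1-a}. (Lp_norm ?q TM (%x. p (t, x)))\<^sup>2 \<partial>lborel)"
  using bound by (intro nn_integral_mono) (auto split: split_indicator)
 also have "2 + ... < \<infinity>"
  using p a unfolding L2_loc_def by (auto simp: ennreal_add_less_top)
 finally have "(\<integral>\<^sup>+z. ennreal (norm (indicator {a..1-a} (fst z) * p z)) \<partial>(unit_time \<Otimes>\<^sub>M TM)) < \<infinity>"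
  by (simp add: add_left_mono)
 then show ?thesis unfolding spacetime_def by (intro integrableI_bounded) auto
qed

text \<open>Paths are continuous and distances bounded, so the mean displacement is continuous in time.\<close>

lemma path_modulus:
 fixes \<nu> :: "'n::finite flow"
 assumes "generalized_flow \<eta> gm \<nu>" and e: "e > 0"
 obtains h where "h > 0" "!!u. \<bar>u - t\<bar> <= h ==> (\<integral>\<^sup>+om. ennreal (dist (path_at om u) (path_at om t)) \<partial>path_law \<nu>) <= ennreal e"
proof -
 interpret P: prob_space "path_law \<nu>" by (rule prob_space_path_law[OF assms(1)])
 define ps where "ps u = (\<integral>om. dist (path_at om u) (path_at om t) \<partial>path_law \<nu>)" for u
 have m: "(%om. dist (path_at om u) (path_at om t)) : borel_measurable (path_law \<nu>)" for u by measurable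
 have "continuous_on UNIV ps"
 proof (rule continuous_on_sequentiallyI)
  fix u :: "nat => real" and a assume u: "u \<longlonglongrightarrow> a"
  have ic: "isCont (%s. dist (path_at om s) (path_at om t)) a" if "om \<in> paths" for om :: "real => 'n torus"
   using continuous_on_dist[OF continuous_path_at[OF that] continuous_on_const] by (simp add: continuous_on_eq_continuous_at)
  have c: "(%n. dist (path_at om (u n)) (path_at om t)) \<longlonglongrightarrow> dist (path_at om a) (path_at om t)" if "om \<in> paths" for om :: "real => 'n torus"
   by (rule isCont_tendsto_compose[OF ic[OF that] u])
  show "(%n. ps (u n)) \<longlonglongrightarrow> ps a"
   unfolding ps_def
   by (rule integral_dominated_convergence[where w = "%_. real CARD('n)"])
    (use c m dist_torus_bounded in auto)
 qed
 then have "isCont ps t" by (simp add: continuous_on_eq_continuous_at)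
 moreover have "ps t = 0" by (simp add: ps_def)
 ultimately obtain h where h: "h > 0" "!!u. \<bar>u - t\<bar> < h ==> \<bar>ps u\<bar> < e"
  using e unfolding continuous_at_eps_delta dist_real_def by force
 show ?thesis
 proof (rule that[of "h / 2"])
  fix u assume "\<bar>u - t\<bar> <= h / 2"
  then have "ps u <= e" using h(2)[of u] h(1) by linarith
  moreover have "(\<integral>\<^sup>+om. ennreal (dist (path_at om u) (path_at om t)) \<partial>path_law \<nu>) = ennreal (ps u)"
   unfolding ps_def
  proof (rule nn_integral_eq_integral)
   show "integrable (path_law \<nu>) (%om. dist (path_at om u) (path_at om t))"
    by (rule P.integrable_const_bound[OF _ m, where B = "real CARD('n)"]) (simp add: dist_torus_bounded)
  qed simp
  ultimately show "(\<integral>\<^sup>+om. ennreal (dist (path_at om u) (path_at om t)) \<partial>path_law \<nu>) <= ennreal e" by (simp add: ennreal_leI)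
 qed (use h in simp)
qed

text \<open>The density is replaced by its truncation \<open>sg\<close> to \<open>[0, M]\<close>, which is bounded everywhere and not only almost everywhere.\<close>

lemma approximates_converges:
 fixes \<nu> :: "'n::finite flow" and r :: "nat => real \<times> 'n torus => real"
 assumes \<nu>: "generalized_flow \<eta> gm \<nu>" and r: "!!n. approximates \<nu> (dl n) (r n)" and M: "!!n z. r n z <= M"
  and dl: "dl \<longlonglongrightarrow> 0" and t: "t \<in> {0<..<1}"
  and dens: "flow_at \<nu> t = density TM (%x. ennreal (\<rho> x))" and \<rho>: "\<rho> : borel_measurable TM" "AE x in TM. 0 <= \<rho> x & \<rho> x <= M"
  and f: "integrable TM f"
 shows "(%n. \<integral>x. f x * (r n (t, x) - 1) \<partial>TM) \<longlonglongrightarrow> (\<integral>x. f x * (\<rho> x - 1) \<partial>TM)"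
proof -
 let ?\<mu> = "TM :: 'n torus measure"
 have sets [measurable_cong]: "sets ?\<mu> = sets borel" by (simp add: torus_measure_def)
 define sg where "sg x = max 0 (min M (\<rho> x))" for x
 have r0: "0 <= r n z" for n z using r[of n] unfolding approximates_def by blast
 have M0: "M >= 0" using r0 M order_trans by blast
 have [measurable]: "\<rho> : borel_measurable borel" "sg : borel_measurable borel"
  using \<rho>(1) unfolding sg_def[abs_def] measurable_cong_sets[OF sets refl] by measurable
 have sg: "0 <= sg x" "sg x <= M" for x using M0 by (auto simp: sg_def)
 have ae: "AE x in ?\<mu>. \<rho> x = sg x" using \<rho>(2) by eventually_elim (simp add: sg_def)
 have [measurable]: "(%x. r n (t, x)) : borel_measurable borel" for n
  using r[of n] measurable_Pair2[of "r n" borel borel borel t] by (simp add: approximates_def)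
 have law: "(\<integral>\<^sup>+om. ennreal (g (om t)) \<partial>path_law \<nu>) = (\<integral>\<^sup>+x. ennreal (g x) * ennreal (sg x) \<partial>?\<mu>)" if [measurable]: "g : borel_measurable borel" for g
 proof -
  have "(\<integral>\<^sup>+om. ennreal (g (om t)) \<partial>path_law \<nu>) = (\<integral>\<^sup>+x. ennreal (g x) \<partial>flow_at \<nu> t)"
   using t by (intro nn_integral_flow_at[OF \<nu>, symmetric]) auto
  also have "... = (\<integral>\<^sup>+x. ennreal (\<rho> x) * ennreal (g x) \<partial>?\<mu>)" unfolding dens by (rule nn_integral_density) measurable
  also have "... = (\<integral>\<^sup>+x. ennreal (g x) * ennreal (sg x) \<partial>?\<mu>)"
   using ae by (intro nn_integral_cong_AE) (auto simp: mult.commute)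
  finally show ?thesis .
 qed
 have tested: "integrable ?\<mu> (%x. g x * h x)" if "!!x. \<bar>h x\<bar> <= M + 1" "integrable ?\<mu> g" and [measurable]: "h : borel_measurable borel" for g h :: "'n torus => real"
 proof (rule Bochner_Integration.integrable_bound[OF integrable_mult_right[OF that(2), of "M + 1"]])
  show "(%x. g x * h x) : borel_measurable ?\<mu>" using borel_measurable_integrable[OF that(2)] by measurable
  show "AE x in ?\<mu>. norm (g x * h x) <= norm ((M + 1) * g x)"
   using M0 mult_left_mono[OF that(1), of "\<bar>g x\<bar>" x for x] by (intro AE_I2) (simp add: abs_mult mult.commute)
 qed
 have "(%n. \<integral>x. f x * (r n (t, x) - sg x) \<partial>?\<mu>) \<longlonglongrightarrow> 0"
 proof (rule weak_limit_extends_to_integrable[where C = M, OF torus.finite_measure_axioms sets _ _ _ f])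
  show "\<bar>r n (t, x) - sg x\<bar> <= M" for n x using r0[of n "(t, x)"] M[of n "(t, x)"] sg[of x] by linarith
  show "(%x. r n (t, x) - sg x) : borel_measurable borel" for n by measurable
  fix g :: "'n torus => real" and b assume lip: "!!x y. \<bar>g x - g y\<bar> <= dist x y" and gb: "!!x. 0 <= g x & g x <= b"
  have "continuous_on UNIV g" unfolding continuous_on_iff dist_real_def using lip by (meson le_less_trans)
  then have g [measurable]: "g : borel_measurable borel" by (rule borel_measurable_continuous_onI)
  have gi: "integrable ?\<mu> g" by (rule torus.integrable_const_bound[where B = b]) (use gb in auto)
  have nn: "(\<integral>\<^sup>+x. ennreal (g x) * ennreal (h x) \<partial>?\<mu>) = ennreal (\<integral>x. g x * h x \<partial>?\<mu>)"
   if h: "!!x. 0 <= h x" "!!x. h x <= M" "h : borel_measurable borel" for h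
  proof -
   have "integrable ?\<mu> (%x. g x * h x)" using h(1,2) by (intro tested gi h(3)) (simp add: add_increasing2)
   moreover have "0 <= g x * h x" for x using gb h(1) by simp
   ultimately show ?thesis using gb h(1) by (subst nn_integral_eq_integral[symmetric]) (auto simp: ennreal_mult')
  qed
  show "(%n. \<integral>x. g x * (r n (t, x) - sg x) \<partial>?\<mu>) \<longlonglongrightarrow> 0"
   unfolding tendsto_iff
  proof (intro allI impI)
   fix e :: real assume e: "e > 0"
   obtain h where h: "h > 0" "!!u. \<bar>u - t\<bar> <= h ==> (\<integral>\<^sup>+om. ennreal (dist (path_at om u) (path_at om t)) \<partial>path_law \<nu>) <= ennreal (e / 4)"
    by (rule path_modulus[OF \<nu>, of "e / 4" t]) (use e in auto)
   have "(%n. 7 * dl n / (1 - 4 * dl n)) \<longlonglongrightarrow> 7 * 0 / (1 - 4 * 0)" by (intro tendsto_intros dl) simp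
   then have "eventually (%n. 7 * dl n / (1 - 4 * dl n) < h) sequentially" using h(1) by (intro order_tendstoD) auto
   moreover have "eventually (%n. dl n < min (e / 8) (min t (1 - t))) sequentially" using t e dl by (intro order_tendstoD) auto
   ultimately show "eventually (%n. dist (\<integral>x. g x * (r n (t, x) - sg x) \<partial>?\<mu>) 0 < e) sequentially"
   proof eventually_elim
    case (elim n)
    define A where "A = (\<integral>x. g x * r n (t, x) \<partial>?\<mu>)"
    define B where "B = (\<integral>x. g x * sg x \<partial>?\<mu>)"
    have A: "(\<integral>\<^sup>+x. ennreal (g x) * ennreal (r n (t, x)) \<partial>?\<mu>) = ennreal A" unfolding A_def by (rule nn) (use r0 M in auto)
    have B: "(\<integral>\<^sup>+om. ennreal (g (om t)) \<partial>path_law \<nu>) = ennreal B" unfolding B_def law[OF g] by (rule nn) (use sg in auto)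
    have AB: "A >= 0" "B >= 0" unfolding A_def B_def by (intro Bochner_Integration.integral_nonneg mult_nonneg_nonneg; use gb r0 sg in simp)+
    have tn: "t \<in> {dl n..1 - dl n}" using elim by auto
    have mod: "\<bar>u - t\<bar> <= 7 * dl n / (1 - 4 * dl n) ==> (\<integral>\<^sup>+om. ennreal (dist (path_at om u) (path_at om t)) \<partial>path_law \<nu>) <= ennreal (e / 4)" for u
     using h(2)[of u] elim by linarith
    have "ennreal A <= ennreal B + (ennreal (e / 4) + ennreal (2 * dl n)) & ennreal B <= ennreal A + (ennreal (e / 4) + ennreal (2 * dl n))"
     using r[of n] tn lip mod unfolding approximates_def A[symmetric] B[symmetric] by blast
    moreover have "ennreal (2 * dl n) <= ennreal (e / 4)" using elim by (intro ennreal_leI) auto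
    ultimately have "ennreal A <= ennreal B + (ennreal (e / 4) + ennreal (e / 4))" "ennreal B <= ennreal A + (ennreal (e / 4) + ennreal (e / 4))"
     using add_left_mono order_trans by meson+
    then have "A <= B + e / 2" "B <= A + e / 2" using AB e by (simp_all flip: ennreal_plus)
    moreover have "(\<integral>x. g x * (r n (t, x) - sg x) \<partial>?\<mu>) = A - B"
     unfolding A_def B_def right_diff_distrib
     by (rule Bochner_Integration.integral_diff; rule tested[OF _ gi]) (use r0 M sg in "auto simp: add_increasing2")
    ultimately show ?case using e by (simp add: dist_real_def)
   qed
  qed
 qed
 then have "(%n. (\<integral>x. f x * (r n (t, x) - sg x) \<partial>?\<mu>) + (\<integral>x. f x * (sg x - 1) \<partial>?\<mu>)) \<longlonglongrightarrow> 0 + (\<integral>x. f x * (sg x - 1) \<partial>?\<mu>)"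
  by (intro tendsto_intros)
 moreover have "(\<integral>x. f x * (r n (t, x) - sg x) \<partial>?\<mu>) + (\<integral>x. f x * (sg x - 1) \<partial>?\<mu>) = (\<integral>x. f x * (r n (t, x) - 1) \<partial>?\<mu>)" for n
 proof -
  have "\<bar>r n (t, x) - sg x\<bar> <= M + 1" "\<bar>sg x - 1\<bar> <= M + 1" for x
   using r0[of n "(t, x)"] M[of n "(t, x)"] sg[of x] by linarith+
  then have "integrable ?\<mu> (%x. f x * (r n (t, x) - sg x))" "integrable ?\<mu> (%x. f x * (sg x - 1))"
   by (intro tested f; measurable)+
  then show ?thesis by (subst Bochner_Integration.integral_add[symmetric]) (auto simp: algebra_simps)
 qed
 moreover have "(\<integral>x. f x * (sg x - 1) \<partial>?\<mu>) = (\<integral>x. f x * (\<rho> x - 1) \<partial>?\<mu>)"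
  using ae borel_measurable_integrable[OF f] by (intro integral_cong_AE) (auto simp: measurable_cong_sets[OF sets refl])
 ultimately show ?thesis by simp
qed

text \<open>If \<open>p\<close> is not integrable it is cut off to times in \<open>[a, 1 - a]\<close>; outside of them the densities are 1 and the pairing vanishes.\<close>

lemma pairing_le_action_difference:
 fixes \<eta>\<eta> \<nu> :: "'n::finite flow"
 assumes plans: "\<eta> \<in> torus_plans" "gm \<in> torus_plans" and opt: "optimal_incompressible_flow \<eta> gm \<eta>\<eta>"
  and p: "pressure_field \<eta>\<eta> p" and \<nu>: "generalized_flow \<eta> gm \<nu>" and \<rho>: "bounded_compression_density \<nu> \<rho>"
  and finite_action: "flow_action \<eta>\<eta> < \<infinity>" "flow_action \<nu> < \<infinity>"
  and cases: "unit_density_near_endpoints \<rho> \<or> integrable spacetime p"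
 shows "pressure_pairing p (%z. \<rho> z - 1) <= enn2real (flow_action \<nu>) - enn2real (flow_action \<eta>\<eta>)"
proof -
 define dl :: "nat => real" where "dl n = 1 / real (n + 5)" for n
 have dl: "0 < dl n" "dl n < 1/4" for n by (simp_all add: dl_def field_simps)
 have dl_0: "dl \<longlonglongrightarrow> 0" unfolding dl_def using LIMSEQ_ignore_initial_segment[OF lim_1_over_n, of 5] by simp
 have "\<exists>r. approximates \<nu> (dl n) r & (\<integral>z. p z * (r z - 1) \<partial>spacetime) <= enn2real (flow_action \<nu>) / (1 - 4 * dl n) + dl n - enn2real (flow_action \<eta>\<eta>)" for n
 proof -
  obtain r where "approximates \<nu> (dl n) r"
   "(\<integral>z. p z * (r z - 1) \<partial>spacetime) <= enn2real (flow_action \<nu>) / (1 - 4 * dl n) + dl n - enn2real (flow_action \<eta>\<eta>)"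
   by (rule mollified_density[OF plans \<nu> dl opt p finite_action])
  then show ?thesis by (intro exI conjI)
 qed
 then have "\<exists>r. \<forall>n. approximates \<nu> (dl n) (r n) & (\<integral>z. p z * (r n z - 1) \<partial>spacetime) <= enn2real (flow_action \<nu>) / (1 - 4 * dl n) + dl n - enn2real (flow_action \<eta>\<eta>)"
  by (intro choice allI)
 then obtain r where r: "!!n. approximates \<nu> (dl n) (r n)"
  and act: "!!n. (\<integral>z. p z * (r n z - 1) \<partial>spacetime) <= enn2real (flow_action \<nu>) / (1 - 4 * dl n) + dl n - enn2real (flow_action \<eta>\<eta>)"
  by (elim exE) (blast dest: spec)
 have mr: "r n : borel_measurable (borel \<Otimes>\<^sub>M borel)" "0 <= r n z" for n z using r[of n] unfolding approximates_def by blast+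
 have \<rho>m: "\<rho> : borel_measurable spacetime" and \<rho>d: "!!t. t \<in> {0<..<1} ==> (AE x in TM. 0 <= \<rho> (t, x)) & flow_at \<nu> t = density TM (%x. ennreal (\<rho> (t, x)))"
  using \<rho> unfolding bounded_compression_density_def flow_density_def by blast+
 have \<rho>t: "(%x. \<rho> (t, x)) : borel_measurable TM" if "t \<in> {0<..<1}" for t
  by (rule measurable_Pair2[OF \<rho>m[unfolded spacetime_def]]) (use that in "simp add: space_restrict_space")
 define S where "S = esssup spacetime (%z. ennreal \<bar>\<rho> z\<bar>)"
 have S: "S < \<infinity>" using \<rho> unfolding bounded_compression_density_def Lp_norm_def S_def by simp
 define M where "M = max 1 (enn2real S)"
 have M1: "M >= 1" by (simp add: M_def)
 have "AE z in spacetime. ennreal \<bar>\<rho> z\<bar> <= S" unfolding S_def by (rule esssup_AE)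
 then have "AE z in unit_time \<Otimes>\<^sub>M TM. \<rho> z <= M"
  unfolding spacetime_def
 proof eventually_elim
  case (elim z)
  have "ennreal \<bar>\<rho> z\<bar> <= ennreal (enn2real S)" using elim S by simp
  then show ?case by (simp add: M_def)
 qed
 from spacetime.AE_pair[OF this] have bd: "AE t in unit_time. AE x in TM. \<rho> (t, x) <= M" .
 have law: "(\<integral>\<^sup>+om. f (om t) \<partial>path_law \<nu>) = (\<integral>\<^sup>+x. ennreal (\<rho> (t, x)) * f x \<partial>TM)"
  if t: "t \<in> {0<..<1}" and f: "f : borel_measurable borel" for t and f :: "'n torus => ennreal"
 proof -
  have fm: "f : borel_measurable TM" using f by (simp add: torus_measure_def)
  have "(\<integral>\<^sup>+om. f (om t) \<partial>path_law \<nu>) = (\<integral>\<^sup>+x. f x \<partial>flow_at \<nu> t)"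
   using t by (intro nn_integral_flow_at[OF \<nu> _ f, symmetric]) auto
  then show ?thesis using \<rho>d[OF t] \<rho>t[OF t] fm by (simp add: nn_integral_density)
 qed
 have "AE u in lborel. u \<in> {0<..<1} --> compressed_at \<nu> M u"
 proof -
  have "AE u in unit_time. compressed_at \<nu> M u"
   using bd AE_space
  proof eventually_elim
   case (elim u)
   then have u: "u \<in> {0<..<1}" by (simp add: space_restrict_space)
   show ?case
    unfolding compressed_at_def
   proof (intro allI impI)
    fix f :: "'n torus => ennreal" assume f: "f : borel_measurable borel"
    then have fm: "f : borel_measurable TM" by (simp add: torus_measure_def)
    have "(\<integral>\<^sup>+om. f (om u) \<partial>path_law \<nu>) <= (\<integral>\<^sup>+x. ennreal M * f x \<partial>TM)"
     unfolding law[OF u f] using elim(1) by (intro nn_integral_mono_AE) (auto elim!: eventually_mono intro!: mult_right_mono ennreal_leI)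
    also have "... = ennreal M * (\<integral>\<^sup>+X. f X \<partial>TM)" by (rule nn_integral_cmult[OF fm])
    finally show "(\<integral>\<^sup>+om. f (om u) \<partial>path_law \<nu>) <= ennreal M * (\<integral>\<^sup>+X. f X \<partial>TM)" .
   qed
  qed
  then show ?thesis by (subst (asm) AE_restrict_space_iff) auto
 qed
 then have rM: "r n z <= M" for n z using r[of n] M1 unfolding approximates_def by blast
 have conv: "AE t in unit_time. \<forall>f. integrable TM f -->
   (%n. \<integral>x. f x * (r n (t, x) - 1) \<partial>TM) \<longlonglongrightarrow> (\<integral>x. f x * (\<rho> (t, x) - 1) \<partial>TM)"
  using bd AE_space
 proof eventually_elim
  case (elim t)
  then have t: "t \<in> {0<..<1}" by (simp add: space_restrict_space)
  have "AE x in TM. 0 <= \<rho> (t, x) & \<rho> (t, x) <= M" using elim(1) \<rho>d[OF t] by auto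
  then show ?case using approximates_converges[OF \<nu> r rM dl_0 t _ \<rho>t[OF t]] \<rho>d[OF t] by blast
 qed
 have "\<exists>X. X \<longlonglongrightarrow> pressure_pairing p (%z. \<rho> z - 1) & eventually (%n. X n = (\<integral>z. p z * (r n z - 1) \<partial>spacetime)) sequentially"
 proof (cases "integrable spacetime p")
  case True
  show ?thesis using limit_pairing[OF True \<rho>m mr rM conv] by (intro exI conjI) auto
 next
  case False
  then obtain d where d: "d > 0" and one: "!!t. t \<in> {0<..<1} ==> t < d \<or> 1 - d < t ==> AE x in TM. \<rho> (t, x) = 1"
   using cases unfolding unit_density_near_endpoints_def by blast
  define a where "a = min d (1/2) / 2"
  have a: "0 < a" "a < 1/2" "2 * a <= d" using d by (auto simp: a_def)
  define q where "q z = indicator {a..1-a} (fst z) * p z" for z :: "real \<times> 'n torus"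
  have qi: "integrable spacetime q"
   unfolding q_def using p a(1,2) by (intro pressure_locally_integrable) (auto simp: pressure_field_def)
  have unif: "uniform_at \<nu> u" if u: "u \<in> {0<..<1}" "u < d \<or> 1 - d < u" for u
   unfolding uniform_at_def
  proof (intro allI impI)
   fix f :: "'n torus => ennreal" assume f: "f : borel_measurable borel"
   show "(\<integral>\<^sup>+om. f (om u) \<partial>path_law \<nu>) = (\<integral>\<^sup>+X. f X \<partial>TM)"
    unfolding law[OF u(1) f] using one[OF u] by (intro nn_integral_cong_AE) auto
  qed
  have "(%n. 7 * dl n / (1 - 4 * dl n)) \<longlonglongrightarrow> 7 * 0 / (1 - 4 * 0)" by (intro tendsto_intros dl_0) simp
  then have "eventually (%n. 7 * dl n / (1 - 4 * dl n) < a) sequentially" using a(1) by (intro order_tendstoD) auto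
  then have ev: "eventually (%n. (\<integral>z. q z * (r n z - 1) \<partial>spacetime) = (\<integral>z. p z * (r n z - 1) \<partial>spacetime)) sequentially"
  proof eventually_elim
   case (elim n)
   have "r n (t, X) = 1" if t: "t \<in> {0<..<1}" "t \<notin> {a..1-a}" for t X
   proof -
    have "uniform_at \<nu> u" if "\<bar>u - t\<bar> <= 7 * dl n / (1 - 4 * dl n)" "u \<in> {0<..<1}" for u
    proof (rule unif[OF that(2)])
     have "\<bar>u - t\<bar> < a" using that(1) elim by linarith
     then show "u < d \<or> 1 - d < u" using t a by auto
    qed
    moreover have "t \<in> {0..1}" using t by auto
    ultimately show ?thesis using r[of n] unfolding approximates_def by blast
   qed
   then show ?case
    by (intro Bochner_Integration.integral_cong refl)
     (auto simp: q_def spacetime_def space_pair_measure space_restrict_space split: split_indicator)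
  qed
  have eq: "pressure_pairing q (%z. \<rho> z - 1) = pressure_pairing p (%z. \<rho> z - 1)"
   unfolding pressure_pairing_eq
  proof (rule Bochner_Integration.integral_cong[OF refl])
   fix t :: real assume "t \<in> space unit_time"
   then have t: "t \<in> {0<..<1}" by (simp add: space_restrict_space)
   show "(\<integral>x. q (t, x) * (\<rho> (t, x) - 1) \<partial>TM) = (\<integral>x. p (t, x) * (\<rho> (t, x) - 1) \<partial>TM)"
   proof (cases "t \<in> {a..1-a}")
    case False
    then have "t < d \<or> 1 - d < t" using a by auto
    from one[OF t this] have "(\<integral>x. p (t, x) * (\<rho> (t, x) - 1) \<partial>TM) = 0" by (intro integral_eq_zero_AE) auto
    then show ?thesis using False by (simp add: q_def)
   qed (simp add: q_def)
  qed
  from limit_pairing[OF qi \<rho>m mr rM conv] ev show ?thesis unfolding eq by (intro exI conjI)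
 qed
 then obtain X where X: "X \<longlonglongrightarrow> pressure_pairing p (%z. \<rho> z - 1)" "eventually (%n. X n = (\<integral>z. p z * (r n z - 1) \<partial>spacetime)) sequentially"
  by blast
 have up: "(%n. enn2real (flow_action \<nu>) / (1 - 4 * dl n) + dl n - enn2real (flow_action \<eta>\<eta>)) \<longlonglongrightarrow> enn2real (flow_action \<nu>) / (1 - 4 * 0) + 0 - enn2real (flow_action \<eta>\<eta>)"
  by (intro tendsto_intros dl_0) simp
 have "eventually (%n. X n <= enn2real (flow_action \<nu>) / (1 - 4 * dl n) + dl n - enn2real (flow_action \<eta>\<eta>)) sequentially"
  using X(2) by eventually_elim (simp only: act)
 from tendsto_le[OF _ up X(1) this] show ?thesis by simp
qed

theorem theorem6p4:
 fixes \<eta> \<gamma> :: "('n::finite torus \<times> 'n torus) measure"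
  and \<eta>\<eta> \<nu> :: "'n flow"
  and p \<rho> :: "real \<times> 'n torus => real"
 assumes "\<eta> \<in> torus_plans" and "\<gamma> \<in> torus_plans"
  and "optimal_incompressible_flow \<eta> \<gamma> \<eta>\<eta>"
  and "pressure_field \<eta>\<eta> p"
  and "generalized_flow \<eta> \<gamma> \<nu>"
  and "bounded_compression_density \<nu> \<rho>"
 shows "(unit_density_near_endpoints \<rho> -->
      ereal (pressure_pairing p (%z. \<rho> z - 1))
       <= enn2ereal (flow_action \<nu>) - enn2ereal (flow_action \<eta>\<eta>)) \<and>
    (integrable spacetime p -->
      ereal (pressure_pairing p (%z. \<rho> z - 1))
       <= enn2ereal (flow_action \<nu>) - enn2ereal (flow_action \<eta>\<eta>))"
proof -
 obtain \<nu>' where "generalized_flow \<eta> \<gamma> \<nu>'" "incompressible \<nu>'" "flow_action \<nu>' < \<infinity>"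
  by (rule ex_incompressible_flow_finite_action[OF assms(1,2,5)])
 then have fin: "flow_action \<eta>\<eta> < \<infinity>"
  using assms(3) unfolding optimal_incompressible_flow_def by (meson order_le_less_trans)
 then obtain A where A: "flow_action \<eta>\<eta> = ennreal A" "A >= 0" by (cases "flow_action \<eta>\<eta>") auto
 have "ereal (pressure_pairing p (%z. \<rho> z - 1)) <= enn2ereal (flow_action \<nu>) - enn2ereal (flow_action \<eta>\<eta>)"
  if "unit_density_near_endpoints \<rho> \<or> integrable spacetime p"
 proof (cases "flow_action \<nu>")
  case (real B)
  then show ?thesis
   using pairing_le_action_difference[OF assms fin _ that] A by simp
 qed (simp add: A)
 then show ?thesis by blast
qed

end
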